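(* Let $\mathcal{I}'\subseteq\mathcal{I}$ and $\mathcal{J}'\subseteq\mathcal{J}$ be ideals of $R$ such that each of the pairs $\{\mathcal{I},\mathcal{J}\}$, $\{\mathcal{I}',\mathcal{J}\}$, $\{\mathcal{I},\mathcal{J}'\}$ is Tor-independent. Let $\mathcal{X},\mathcal{Y},\mathscr{S},\mathscr{T}$ be free resolutions over $R$ of $R/\mathcal{I}$, $R/\mathcal{J}$, $R/\mathcal{I}'$, $R/\mathcal{J}'$, respectively, each with $R$ in degree $0$. Let $\phi:\mathscr{S}\to\mathcal{X}$ and $\psi:\mathscr{T}\to\mathcal{Y}$ be chain maps with $\phi_0=1$, $\psi_0=1$ lifting the natural surjections $R/\mathcal{I}'\to R/\mathcal{I}$ and $R/\mathcal{J}'\to R/\mathcal{J}$, let $\Phi$ and $\Psi$ be the chain maps defined from them in the context, and set \[\Omega=\begin{pmatrix}\Phi&\Psi\end{pmatrix}:\Sigma^{-1}\left(\mathscr{S}_{\geq1}\otimes_R\mathcal{Y}\right)\oplus\Sigma^{-1}\left(\mathcal{X}\otimes_R\mathscr{T}_{\geq1}\right)\longrightarrow\mathcal{X}*_R\mathcal{Y}.\] Then $\operatorname{Cone}(\Omega)$ is a free resolution of $R/\langle\mathcal{I}',\mathcal{I}\mathcal{J},\mathcal{J}'\rangle$ over $R$.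
   Context: $R$ is a commutative noetherian ring that is local or standard graded. Ideals $\mathcal{A},\mathcal{B}$ are Tor-independent if $\operatorname{Tor}_i^R(R/\mathcal{A},R/\mathcal{B})=0$ for all $i\ge1$. For a complex $\mathcal C$, $\mathcal C_{\ge1}$ is the hard truncation: $(\mathcal C_{\ge1})_q=\mathcal C_q$ for $q\ge1$ and $0$ otherwise, with $\partial_q^{\mathcal C_{\ge1}}=\partial_q^{\mathcal C}$ for $q>1$ and $0$ for $q\le1$. The shift is $(\Sigma^{\ell}\mathcal C)_i=\mathcal C_{i-\ell}$ with $\partial^{\Sigma^\ell\mathcal C}=(-1)^\ell\partial^{\mathcal C}$. Tensor products carry the differential $\partial(a\otimes b)=\partial(a)\otimes b+(-1)^{|a|}a\otimes\partial(b)$, where $|\cdot|$ is homological degree. Star product: $\mathcal{X}*_R\mathcal{Y}$ is the complex with $(\mathcal{X}*_R\mathcal{Y})_n=(\mathcal{X}_{\ge1}\otimes_R\mathcal{Y}_{\ge1})_{n+1}$ for $n\ge1$, $\mathcal{X}_0\otimes_R\mathcal{Y}_0$ for $n=0$, and $0$ for $n<0$; its differential is $\partial_{n+1}^{\mathcal{X}_{\ge1}\otimes\mathcal{Y}_{\ge1}}$ for $n\ge2$, $\partial_1^{\mathcal{X}}\otimes\partial_1^{\mathcal{Y}}$ for $n=1$, and $0$ for $n\le0$. Write $a*b$ for the element given by $a\otimes b$. Define $\Phi:\Sigma^{-1}(\mathscr{S}_{\ge1}\otimes_R\mathcal{Y})\to\mathcal{X}*_R\mathcal{Y}$ by $\Phi(\alpha\otimes\beta)=(-1)^{|\alpha|+|\beta|}\phi(\alpha)*\beta$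 if $|\beta|>0$; $\partial_1^{\mathscr{S}}(\alpha)*\beta$ if $|\beta|=0,|\alpha|=1$; $0$ if $|\beta|=0,|\alpha|>1$. Define $\Psi:\Sigma^{-1}(\mathcal{X}\otimes_R\mathscr{T}_{\ge1})\to\mathcal{X}*_R\mathcal{Y}$ by $\Psi(\alpha\otimes\beta)=(-1)^{|\alpha|+|\beta|-1}\alpha*\psi(\beta)$ if $|\alpha|>0$; $\alpha*\partial_1^{\mathscr{T}}(\beta)$ if $|\alpha|=0,|\beta|=1$; $0$ if $|\alpha|=0,|\beta|>1$. Here $|\alpha|,|\beta|$ are the degrees in the original (unshifted) complexes, and $\mathscr{S}_0=\mathcal{X}_0=\mathscr{T}_0=\mathcal{Y}_0=R$. These are chain maps. For a chain map $f:\mathcal C\to\mathcal D$, $\operatorname{Cone}(f)_i=\mathcal D_i\oplus\mathcal C_{i-1}$ with differential $(d,c)\mapsto(\partial^{\mathcal D}(d)+f(c),-\partial^{\mathcal C}(c))$. *)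

theory Defs
  imports "HOL-Algebra.Module" "HOL-Algebra.Ideal_Product" "HOL-Algebra.Generated_Rings"
    "HOL-Algebra.Ring_Divisibility" "HOL-Algebra.Free_Abelian_Groups"
begin

section \<open>The ground ring\<close>

definition local_ring :: "('a, 'r) ring_scheme \<Rightarrow> bool" where
  "local_ring R \<longleftrightarrow> cring R \<and> (\<exists>!m. maximalideal m R)"

(* The ring is the internal direct sum of the G n, with G 0 a field, and is generated as a
   G 0 - algebra by G 1.  For noetherian R the G 0 - dimension of G 1 is automatically finite. *)
definition standard_graded :: "('a, 'r) ring_scheme \<Rightarrow> bool" where
  "standard_graded R \<longleftrightarrow> cring R \<and> (\<exists>G :: nat \<Rightarrow> 'a set.
     (\<forall>n. additive_subgroup (G n) R) \<and>
     (\<forall>m n. \<forall>x\<in>G m. \<forall>y\<in>G n. x \<otimes>\<^bsub>R\<^esub> y \<in> G (m + n)) \<and>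
     (\<forall>x\<in>carrier R. \<exists>!c. (\<forall>n. c n \<in> G n) \<and> finite {n. c n \<noteq> \<zero>\<^bsub>R\<^esub>} \<and>
        x = (\<Oplus>\<^bsub>R\<^esub>n\<in>{n. c n \<noteq> \<zero>\<^bsub>R\<^esub>}. c n)) \<and>
     field (R\<lparr>carrier := G 0\<rparr>) \<and>
     generate_ring R (G 0 \<union> G 1) = carrier R)"

section \<open>Modules\<close>

(* The multiplicative fields of a module record are irrelevant and left undefined throughout. *)

definition module_hom ::
  "('a, 'r) ring_scheme \<Rightarrow> ('a, 'm) module \<Rightarrow> ('a, 'n) module \<Rightarrow> ('m \<Rightarrow> 'n) set" where
  "module_hom R M N = {h \<in> carrier M \<rightarrow> carrier N.
     (\<forall>x\<in>carrier M. \<forall>y\<in>carrier M. h (x \<oplus>\<^bsub>M\<^esub> y) = h x \<oplus>\<^bsub>N\<^esub> h y) \<and>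
     (\<forall>r\<in>carrier R. \<forall>x\<in>carrier M. h (r \<odot>\<^bsub>M\<^esub> x) = r \<odot>\<^bsub>N\<^esub> h x)}"

definition module_iso ::
  "('a, 'r) ring_scheme \<Rightarrow> ('a, 'm) module \<Rightarrow> ('a, 'n) module \<Rightarrow> ('m \<Rightarrow> 'n) set" where
  "module_iso R M N = {h \<in> module_hom R M N. bij_betw h (carrier M) (carrier N)}"

definition free_module :: "('a, 'r) ring_scheme \<Rightarrow> ('a, 'm) module \<Rightarrow> bool" where
  "free_module R M \<longleftrightarrow> module R M \<and> (\<exists>B \<subseteq> carrier M. \<forall>x\<in>carrier M.
     \<exists>!c. (\<forall>b. c b \<in> carrier R) \<and> (\<forall>b. b \<notin> B \<longrightarrow> c b = \<zero>\<^bsub>R\<^esub>) \<and> finite {b. c b \<noteq> \<zero>\<^bsub>R\<^esub>} \<and>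
       x = (\<Oplus>\<^bsub>M\<^esub>b\<in>{b. c b \<noteq> \<zero>\<^bsub>R\<^esub>}. c b \<odot>\<^bsub>M\<^esub> b))"

definition regular_module :: "('a, 'r) ring_scheme \<Rightarrow> ('a, 'a) module" where
  "regular_module R = \<lparr>carrier = carrier R, monoid.mult = undefined, monoid.one = undefined,
     ring.zero = \<zero>\<^bsub>R\<^esub>, ring.add = (\<oplus>\<^bsub>R\<^esub>), module.smult = (\<otimes>\<^bsub>R\<^esub>)\<rparr>"

definition restrict_module :: "('a, 'm) module \<Rightarrow> 'm set \<Rightarrow> ('a, 'm) module" where
  "restrict_module M K = M\<lparr>carrier := K\<rparr>"

abbreviation zero_submodule :: "('a, 'm) module \<Rightarrow> ('a, 'm) module" where
  "zero_submodule M \<equiv> restrict_module M {\<zero>\<^bsub>M\<^esub>}"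

(* For a submodule N all cosets in the union defining the scalar multiplication coincide. *)
definition quot_module :: "('a, 'm) module \<Rightarrow> 'm set \<Rightarrow> ('a, 'm set) module" where
  "quot_module M N = \<lparr>carrier = a_rcosets\<^bsub>M\<^esub> N, monoid.mult = undefined, monoid.one = undefined,
     ring.zero = N, ring.add = (<+>\<^bsub>M\<^esub>), module.smult = (\<lambda>r A. \<Union>x\<in>A. N +>\<^bsub>M\<^esub> (r \<odot>\<^bsub>M\<^esub> x))\<rparr>"

definition cyclic_module :: "('a, 'r) ring_scheme \<Rightarrow> 'a set \<Rightarrow> ('a, 'a set) module" where
  "cyclic_module R I = quot_module (regular_module R) I"

definition sign_smult :: "('a, 'm) module \<Rightarrow> int \<Rightarrow> 'm \<Rightarrow> 'm" where
  "sign_smult M k x = (if even k then x else \<ominus>\<^bsub>M\<^esub> x)"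

definition prod_module :: "('a, 'm) module \<Rightarrow> ('a, 'n) module \<Rightarrow> ('a, 'm \<times> 'n) module" where
  "prod_module M N = \<lparr>carrier = carrier M \<times> carrier N, monoid.mult = undefined, monoid.one = undefined,
     ring.zero = (\<zero>\<^bsub>M\<^esub>, \<zero>\<^bsub>N\<^esub>),
     ring.add = (\<lambda>(x, y) (x', y'). (x \<oplus>\<^bsub>M\<^esub> x', y \<oplus>\<^bsub>N\<^esub> y')),
     module.smult = (\<lambda>r (x, y). (r \<odot>\<^bsub>M\<^esub> x, r \<odot>\<^bsub>N\<^esub> y))\<rparr>"

(* The direct sum of the M k over k in K; its elements are families indexed by the whole index
   type that vanish outside K. *)
definition dsum_module :: "'k set \<Rightarrow> ('k \<Rightarrow> ('a, 'm) module) \<Rightarrow> ('a, 'k \<Rightarrow> 'm) module" where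
  "dsum_module K M = \<lparr>carrier = {f. (\<forall>k. f k \<in> carrier (M k)) \<and>
        finite {k. f k \<noteq> \<zero>\<^bsub>M k\<^esub>} \<and> (\<forall>k. k \<notin> K \<longrightarrow> f k = \<zero>\<^bsub>M k\<^esub>)},
     monoid.mult = undefined, monoid.one = undefined,
     ring.zero = (\<lambda>k. \<zero>\<^bsub>M k\<^esub>),
     ring.add = (\<lambda>f g k. f k \<oplus>\<^bsub>M k\<^esub> g k),
     module.smult = (\<lambda>r f k. r \<odot>\<^bsub>M k\<^esub> f k)\<rparr>"

definition dsum_inj :: "('k \<Rightarrow> ('a, 'm) module) \<Rightarrow> 'k \<Rightarrow> 'm \<Rightarrow> 'k \<Rightarrow> 'm" where
  "dsum_inj M k x = (\<lambda>l. if l = k then x else \<zero>\<^bsub>M l\<^esub>)"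

section \<open>Tensor products\<close>

(* The tensor product is the free abelian group on carrier M x carrier N modulo the subgroup
   generated by the bilinearity and balancing relations; tensors are cosets of this subgroup. *)

definition tensor_rels ::
  "('a, 'r) ring_scheme \<Rightarrow> ('a, 'm) module \<Rightarrow> ('a, 'n) module \<Rightarrow> ('m \<times> 'n \<Rightarrow>\<^sub>0 int) set" where
  "tensor_rels R M N =
     {frag_of (x \<oplus>\<^bsub>M\<^esub> x', y) - frag_of (x, y) - frag_of (x', y) | x x' y.
        x \<in> carrier M \<and> x' \<in> carrier M \<and> y \<in> carrier N} \<union>
     {frag_of (x, y \<oplus>\<^bsub>N\<^esub> y') - frag_of (x, y) - frag_of (x, y') | x y y'.
        x \<in> carrier M \<and> y \<in> carrier N \<and> y' \<in> carrier N} \<union>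
     {frag_of (r \<odot>\<^bsub>M\<^esub> x, y) - frag_of (x, r \<odot>\<^bsub>N\<^esub> y) | r x y.
        r \<in> carrier R \<and> x \<in> carrier M \<and> y \<in> carrier N}"

abbreviation tensor_free ::
  "('a, 'm) module \<Rightarrow> ('a, 'n) module \<Rightarrow> ('m \<times> 'n \<Rightarrow>\<^sub>0 int) monoid" where
  "tensor_free M N \<equiv> free_Abelian_group (carrier M \<times> carrier N)"

definition tensor_null ::
  "('a, 'r) ring_scheme \<Rightarrow> ('a, 'm) module \<Rightarrow> ('a, 'n) module \<Rightarrow> ('m \<times> 'n \<Rightarrow>\<^sub>0 int) set" where
  "tensor_null R M N = generate (tensor_free M N) (tensor_rels R M N)"

definition tensor_module ::
  "('a, 'r) ring_scheme \<Rightarrow> ('a, 'm) module \<Rightarrow> ('a, 'n) module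
    \<Rightarrow> ('a, ('m \<times> 'n \<Rightarrow>\<^sub>0 int) set) module" where
  "tensor_module R M N = \<lparr>carrier = rcosets\<^bsub>tensor_free M N\<^esub> (tensor_null R M N),
     monoid.mult = undefined, monoid.one = undefined,
     ring.zero = tensor_null R M N,
     ring.add = (<#>\<^bsub>tensor_free M N\<^esub>),
     module.smult = (\<lambda>r A. \<Union>u\<in>A. tensor_null R M N #>\<^bsub>tensor_free M N\<^esub>
                 frag_extend (\<lambda>(x, y). frag_of (r \<odot>\<^bsub>M\<^esub> x, y)) u)\<rparr>"

definition pure_tensor ::
  "('a, 'r) ring_scheme \<Rightarrow> ('a, 'm) module \<Rightarrow> ('a, 'n) module \<Rightarrow> 'm \<Rightarrow> 'n
    \<Rightarrow> ('m \<times> 'n \<Rightarrow>\<^sub>0 int) set" where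
  "pure_tensor R M N x y = tensor_null R M N #>\<^bsub>tensor_free M N\<^esub> frag_of (x, y)"

(* For b bilinear and balanced with values in P, this is the homomorphism out of the tensor
   product taking the pure tensor of x and y to b x y: the value at a coset is computed from any
   representing formal sum. *)
definition tensor_lift ::
  "('a, 'p) module \<Rightarrow> ('m \<Rightarrow> 'n \<Rightarrow> 'p) \<Rightarrow> ('m \<times> 'n \<Rightarrow>\<^sub>0 int) set \<Rightarrow> 'p" where
  "tensor_lift P b A = (let u = (SOME u. u \<in> A) in
     \<Oplus>\<^bsub>P\<^esub>z\<in>Poly_Mapping.keys u. [Poly_Mapping.lookup u z] \<cdot>\<^bsub>P\<^esub> b (fst z) (snd z))"

section \<open>Complexes\<close>

(* bd C n is the differential from degree n to degree n - 1. *)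
record ('a, 'm) cplx =
  Md :: "int \<Rightarrow> ('a, 'm) module"
  bd :: "int \<Rightarrow> 'm \<Rightarrow> 'm"

definition chain_complex :: "('a, 'r) ring_scheme \<Rightarrow> ('a, 'm) cplx \<Rightarrow> bool" where
  "chain_complex R C \<longleftrightarrow> (\<forall>n. module R (Md C n) \<and>
     bd C n \<in> module_hom R (Md C n) (Md C (n - 1)) \<and>
     (\<forall>x\<in>carrier (Md C n). bd C (n - 1) (bd C n x) = \<zero>\<^bsub>Md C (n - 2)\<^esub>))"

definition chain_map ::
  "('a, 'r) ring_scheme \<Rightarrow> ('a, 'm) cplx \<Rightarrow> ('a, 'n) cplx \<Rightarrow> (int \<Rightarrow> 'm \<Rightarrow> 'n) \<Rightarrow> bool" where
  "chain_map R C D f \<longleftrightarrow> (\<forall>n. f n \<in> module_hom R (Md C n) (Md D n) \<and>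
     (\<forall>x\<in>carrier (Md C n). bd D n (f n x) = f (n - 1) (bd C n x)))"

definition cycles :: "('a, 'm) cplx \<Rightarrow> int \<Rightarrow> 'm set" where
  "cycles C n = {x \<in> carrier (Md C n). bd C n x = \<zero>\<^bsub>Md C (n - 1)\<^esub>}"

definition boundaries :: "('a, 'm) cplx \<Rightarrow> int \<Rightarrow> 'm set" where
  "boundaries C n = bd C (n + 1) ` carrier (Md C (n + 1))"

definition homology :: "('a, 'm) cplx \<Rightarrow> int \<Rightarrow> ('a, 'm set) module" where
  "homology C n = quot_module (restrict_module (Md C n) (cycles C n)) (boundaries C n)"

definition augmented_free_resolution ::
  "('a, 'r) ring_scheme \<Rightarrow> ('a, 'm) cplx \<Rightarrow> ('m \<Rightarrow> 'n) \<Rightarrow> ('a, 'n) module \<Rightarrow> bool" where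
  "augmented_free_resolution R C \<epsilon> M \<longleftrightarrow> chain_complex R C \<and>
     (\<forall>n. free_module R (Md C n)) \<and>
     (\<forall>n<0. carrier (Md C n) = {\<zero>\<^bsub>Md C n\<^esub>}) \<and>
     (\<forall>n\<ge>1. cycles C n = boundaries C n) \<and>
     \<epsilon> \<in> module_hom R (Md C 0) M \<and> \<epsilon> ` carrier (Md C 0) = carrier M \<and>
     {x \<in> carrier (Md C 0). \<epsilon> x = \<zero>\<^bsub>M\<^esub>} = boundaries C 0"

definition free_resolution ::
  "('a, 'r) ring_scheme \<Rightarrow> ('a, 'm) cplx \<Rightarrow> ('a, 'n) module \<Rightarrow> bool" where
  "free_resolution R C M \<longleftrightarrow> (\<exists>\<epsilon>. augmented_free_resolution R C \<epsilon> M)"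

(* A free resolution of R/I with R in degree 0: the isomorphism e identifies R with C_0, and
   under this identification the augmentation is the natural surjection from R to R/I. *)
definition cyclic_resolution ::
  "('a, 'r) ring_scheme \<Rightarrow> 'a set \<Rightarrow> ('a, 'm) cplx \<Rightarrow> ('a \<Rightarrow> 'm) \<Rightarrow> bool" where
  "cyclic_resolution R I C e \<longleftrightarrow> e \<in> module_iso R (regular_module R) (Md C 0) \<and>
     augmented_free_resolution R C (\<lambda>x. I +>\<^bsub>R\<^esub> inv_into (carrier R) e x) (cyclic_module R I)"

section \<open>Tor\<close>

definition tensor_cplx_module ::
  "('a, 'r) ring_scheme \<Rightarrow> ('a, 'm) cplx \<Rightarrow> ('a, 'n) module
    \<Rightarrow> ('a, ('m \<times> 'n \<Rightarrow>\<^sub>0 int) set) cplx" where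
  "tensor_cplx_module R C N = \<lparr>Md = (\<lambda>n. tensor_module R (Md C n) N),
     bd = (\<lambda>n. tensor_lift (tensor_module R (Md C (n - 1)) N)
                 (\<lambda>x y. pure_tensor R (Md C (n - 1)) N (bd C n x) y))\<rparr>"

(* Over a noetherian ring a finitely generated module has a resolution by finitely generated free
   modules, which can be realised inside the type nat => 'a.  Tor is only used in this setting,
   and is then independent, up to isomorphism, of the resolution chosen. *)
definition chosen_resolution ::
  "('a, 'r) ring_scheme \<Rightarrow> ('a, 'm) module \<Rightarrow> ('a, nat \<Rightarrow> 'a) cplx" where
  "chosen_resolution R M = (SOME F. free_resolution R F M)"

definition Tor ::
  "('a, 'r) ring_scheme \<Rightarrow> int \<Rightarrow> ('a, 'm) module \<Rightarrow> ('a, 'n) module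
    \<Rightarrow> ('a, ((nat \<Rightarrow> 'a) \<times> 'n \<Rightarrow>\<^sub>0 int) set set) module" where
  "Tor R i M N = homology (tensor_cplx_module R (chosen_resolution R M) N) i"

definition Tor_independent :: "('a, 'r) ring_scheme \<Rightarrow> 'a set \<Rightarrow> 'a set \<Rightarrow> bool" where
  "Tor_independent R A B \<longleftrightarrow> (\<forall>i\<ge>1.
     carrier (Tor R i (cyclic_module R A) (cyclic_module R B)) =
       {\<zero>\<^bsub>Tor R i (cyclic_module R A) (cyclic_module R B)\<^esub>})"

section \<open>Operations on complexes\<close>

definition trunc1 :: "('a, 'm) cplx \<Rightarrow> ('a, 'm) cplx" where
  "trunc1 C = \<lparr>Md = (\<lambda>q. if q \<ge> 1 then Md C q else zero_submodule (Md C q)),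
     bd = (\<lambda>q. if q > 1 then bd C q else (\<lambda>_. \<zero>\<^bsub>Md C (q - 1)\<^esub>))\<rparr>"

definition shift :: "int \<Rightarrow> ('a, 'm) cplx \<Rightarrow> ('a, 'm) cplx" where
  "shift l C = \<lparr>Md = (\<lambda>i. Md C (i - l)),
     bd = (\<lambda>i x. sign_smult (Md C (i - l - 1)) l (bd C (i - l) x))\<rparr>"

definition dsum_cplx :: "('a, 'm) cplx \<Rightarrow> ('a, 'n) cplx \<Rightarrow> ('a, 'm \<times> 'n) cplx" where
  "dsum_cplx C D = \<lparr>Md = (\<lambda>n. prod_module (Md C n) (Md D n)),
     bd = (\<lambda>n (x, y). (bd C n x, bd D n y))\<rparr>"

definition mapping_cone ::
  "('a, 'm) cplx \<Rightarrow> ('a, 'n) cplx \<Rightarrow> (int \<Rightarrow> 'm \<Rightarrow> 'n) \<Rightarrow> ('a, 'n \<times> 'm) cplx" where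
  "mapping_cone C D f = \<lparr>Md = (\<lambda>i. prod_module (Md D i) (Md C (i - 1))),
     bd = (\<lambda>i (d, c). (bd D i d \<oplus>\<^bsub>Md D (i - 1)\<^esub> f (i - 1) c, \<ominus>\<^bsub>Md C (i - 2)\<^esub> bd C (i - 1) c))\<rparr>"

type_synonym ('m, 'n) bitensor = "int \<times> int \<Rightarrow> ('m \<times> 'n \<Rightarrow>\<^sub>0 int) set"

definition bigraded_tensor ::
  "('a, 'r) ring_scheme \<Rightarrow> ('a, 'm) cplx \<Rightarrow> ('a, 'n) cplx \<Rightarrow> int \<times> int
    \<Rightarrow> ('a, ('m \<times> 'n \<Rightarrow>\<^sub>0 int) set) module" where
  "bigraded_tensor R X Y = (\<lambda>(i, j). tensor_module R (Md X i) (Md Y j))"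

definition homog_tensor ::
  "('a, 'r) ring_scheme \<Rightarrow> ('a, 'm) cplx \<Rightarrow> ('a, 'n) cplx \<Rightarrow> int \<times> int \<Rightarrow> 'm \<Rightarrow> 'n
    \<Rightarrow> ('m, 'n) bitensor" where
  "homog_tensor R X Y = (\<lambda>(i, j) x y.
     dsum_inj (bigraded_tensor R X Y) (i, j) (pure_tensor R (Md X i) (Md Y j) x y))"

(* The additive extension to a map into P of a rule given on the tensors of homogeneous elements:
   the tensor of x in X_i and y in Y_j is sent to b (i, j) x y. *)
definition bitensor_lift ::
  "('a, 'r) ring_scheme \<Rightarrow> ('a, 'm) cplx \<Rightarrow> ('a, 'n) cplx \<Rightarrow> ('a, 'p) module
    \<Rightarrow> (int \<times> int \<Rightarrow> 'm \<Rightarrow> 'n \<Rightarrow> 'p) \<Rightarrow> ('m, 'n) bitensor \<Rightarrow> 'p" where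
  "bitensor_lift R X Y P b f =
     (\<Oplus>\<^bsub>P\<^esub>k\<in>{k. f k \<noteq> \<zero>\<^bsub>bigraded_tensor R X Y k\<^esub>}. tensor_lift P (b k) (f k))"

definition tensor_cplx_Md ::
  "('a, 'r) ring_scheme \<Rightarrow> ('a, 'm) cplx \<Rightarrow> ('a, 'n) cplx \<Rightarrow> int
    \<Rightarrow> ('a, ('m, 'n) bitensor) module" where
  "tensor_cplx_Md R X Y n = dsum_module {(i, j). i + j = n} (bigraded_tensor R X Y)"

definition tensor_cplx ::
  "('a, 'r) ring_scheme \<Rightarrow> ('a, 'm) cplx \<Rightarrow> ('a, 'n) cplx \<Rightarrow> ('a, ('m, 'n) bitensor) cplx" where
  "tensor_cplx R X Y = \<lparr>Md = tensor_cplx_Md R X Y,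
     bd = (\<lambda>n. let P = tensor_cplx_Md R X Y (n - 1) in
       bitensor_lift R X Y P (\<lambda>(i, j) x y.
         homog_tensor R X Y (i - 1, j) (bd X i x) y \<oplus>\<^bsub>P\<^esub>
         sign_smult P i (homog_tensor R X Y (i, j - 1) x (bd Y j y))))\<rparr>"

section \<open>The star product\<close>

definition star_Md ::
  "('a, 'r) ring_scheme \<Rightarrow> ('a, 'm) cplx \<Rightarrow> ('a, 'n) cplx \<Rightarrow> int
    \<Rightarrow> ('a, ('m, 'n) bitensor) module" where
  "star_Md R X Y n =
     (if n \<ge> 1 then Md (tensor_cplx R (trunc1 X) (trunc1 Y)) (n + 1)
      else if n = 0 then dsum_module {(0, 0)} (bigraded_tensor R X Y)
      else dsum_module {} (bigraded_tensor R X Y))"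

(* star_elem R X Y (i, j) x y is the element x * y for x in X_i and y in Y_j; it is meaningful for
   i, j >= 1, where it has degree i + j - 1, and for i = j = 0, where it has degree 0. *)
definition star_elem ::
  "('a, 'r) ring_scheme \<Rightarrow> ('a, 'm) cplx \<Rightarrow> ('a, 'n) cplx \<Rightarrow> int \<times> int \<Rightarrow> 'm \<Rightarrow> 'n
    \<Rightarrow> ('m, 'n) bitensor" where
  "star_elem R X Y k = (if k = (0, 0) then homog_tensor R X Y k
                        else homog_tensor R (trunc1 X) (trunc1 Y) k)"

definition star_product ::
  "('a, 'r) ring_scheme \<Rightarrow> ('a, 'm) cplx \<Rightarrow> ('a, 'n) cplx \<Rightarrow> ('a, ('m, 'n) bitensor) cplx" where
  "star_product R X Y = \<lparr>Md = star_Md R X Y,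
     bd = (\<lambda>n.
       if n \<ge> 2 then bd (tensor_cplx R (trunc1 X) (trunc1 Y)) (n + 1)
       else if n = 1 then bitensor_lift R (trunc1 X) (trunc1 Y) (star_Md R X Y 0)
         (\<lambda>k x y. star_elem R X Y (0, 0) (bd X 1 x) (bd Y 1 y))
       else (\<lambda>_. \<zero>\<^bsub>star_Md R X Y (n - 1)\<^esub>))\<rparr>"

section \<open>The maps Phi, Psi and Omega\<close>

(* In Phi the argument e is the identification of S_0 = R with X_0 = R, and in Psi it is the
   identification of T_0 = R with Y_0 = R. *)

definition Phi ::
  "('a, 'r) ring_scheme \<Rightarrow> ('a, 's) cplx \<Rightarrow> ('a, 'x) cplx \<Rightarrow> ('a, 'y) cplx
    \<Rightarrow> (int \<Rightarrow> 's \<Rightarrow> 'x) \<Rightarrow> ('s \<Rightarrow> 'x) \<Rightarrow> int \<Rightarrow> ('s, 'y) bitensor \<Rightarrow> ('x, 'y) bitensor" where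
  "Phi R S X Y \<phi> e n = (let P = star_Md R X Y n in
     bitensor_lift R (trunc1 S) Y P (\<lambda>(i, j) \<alpha> \<beta>.
       if j > 0 then sign_smult P (i + j) (star_elem R X Y (i, j) (\<phi> i \<alpha>) \<beta>)
       else if j = 0 \<and> i = 1 then star_elem R X Y (0, 0) (e (bd S 1 \<alpha>)) \<beta>
       else \<zero>\<^bsub>P\<^esub>))"

definition Psi ::
  "('a, 'r) ring_scheme \<Rightarrow> ('a, 't) cplx \<Rightarrow> ('a, 'x) cplx \<Rightarrow> ('a, 'y) cplx
    \<Rightarrow> (int \<Rightarrow> 't \<Rightarrow> 'y) \<Rightarrow> ('t \<Rightarrow> 'y) \<Rightarrow> int \<Rightarrow> ('x, 't) bitensor \<Rightarrow> ('x, 'y) bitensor" where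
  "Psi R T X Y \<psi> e n = (let P = star_Md R X Y n in
     bitensor_lift R X (trunc1 T) P (\<lambda>(i, j) \<alpha> \<beta>.
       if i > 0 then sign_smult P (i + j - 1) (star_elem R X Y (i, j) \<alpha> (\<psi> j \<beta>))
       else if i = 0 \<and> j = 1 then star_elem R X Y (0, 0) \<alpha> (e (bd T 1 \<beta>))
       else \<zero>\<^bsub>P\<^esub>))"

definition Omega_source ::
  "('a, 'r) ring_scheme \<Rightarrow> ('a, 's) cplx \<Rightarrow> ('a, 't) cplx \<Rightarrow> ('a, 'x) cplx \<Rightarrow> ('a, 'y) cplx
    \<Rightarrow> ('a, ('s, 'y) bitensor \<times> ('x, 't) bitensor) cplx" where
  "Omega_source R S T X Y = dsum_cplx
     (shift (- 1) (tensor_cplx R (trunc1 S) Y)) (shift (- 1) (tensor_cplx R X (trunc1 T)))"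

definition Omega ::
  "('a, 'r) ring_scheme \<Rightarrow> ('a, 'x) cplx \<Rightarrow> ('a, 'y) cplx
    \<Rightarrow> (int \<Rightarrow> ('s, 'y) bitensor \<Rightarrow> ('x, 'y) bitensor)
    \<Rightarrow> (int \<Rightarrow> ('x, 't) bitensor \<Rightarrow> ('x, 'y) bitensor)
    \<Rightarrow> int \<Rightarrow> ('s, 'y) bitensor \<times> ('x, 't) bitensor \<Rightarrow> ('x, 'y) bitensor" where
  "Omega R X Y F G n = (\<lambda>(u, v). F n u \<oplus>\<^bsub>star_Md R X Y n\<^esub> G n v)"

end

theory Submission
  imports Defs
begin

text \<open>Hard truncation turns a free resolution of \<open>R/I\<close> into a free resolution of \<open>I\<close>, placed in
  degree one.  Hence the three complexes from which the cone is built have the homology of derived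
  tensor products: in degree \<open>n \<ge> 1\<close> the complexes \<open>\<Sigma>\<^sup>-\<^sup>1(S\<^sub>\<ge>\<^sub>1 \<otimes> Y)\<close> and
  \<open>\<Sigma>\<^sup>-\<^sup>1(X \<otimes> T\<^sub>\<ge>\<^sub>1)\<close> compute \<open>Tor\<^sub>n\<^sub>+\<^sub>1(R/I', R/J)\<close> and \<open>Tor\<^sub>n\<^sub>+\<^sub>1(R/I, R/J')\<close>, so they are exact
  there, and their homology in degree zero is \<open>I'/I'J\<close> and \<open>J'/IJ'\<close>.  The complex
  \<open>X\<^sub>\<ge>\<^sub>1 \<otimes> Y\<^sub>\<ge>\<^sub>1\<close> resolves \<open>I \<otimes> J \<cong> IJ\<close>, and the star product splices it to \<open>X\<^sub>0 \<otimes> Y\<^sub>0 \<cong> R\<close>,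
  so that the star product is exact in positive degrees.

  The long exact homology sequence of the cone now gives exactness in degrees at least two.  In
  degree one the homology is the kernel of \<open>I'/I'J \<oplus> J'/IJ' \<rightarrow> R/IJ\<close>.  If \<open>a + b \<in> IJ\<close> with
  \<open>a \<in> I'\<close> and \<open>b \<in> J'\<close>, then \<open>a\<close> lies in \<open>J\<close>, because \<open>IJ\<close> and \<open>J'\<close> do, hence in
  \<open>I' \<inter> J = I'J\<close> by the vanishing of \<open>Tor\<^sub>1(R/I', R/J)\<close>; symmetrically \<open>b \<in> I \<inter> J' = IJ'\<close>.  So the
  kernel is zero.  In degree zero the homology is \<open>R/(I' + IJ + J')\<close>.

  All of this is carried out with elements of double complexes.  Tor-independence enters as an edge
  condition: for a resolution \<open>G\<close> of \<open>N\<close>, the complex \<open>F \<otimes> N\<close> is exact in degree \<open>n\<close> if and only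
  if every element of \<open>F\<^sub>n \<otimes> G\<^sub>0\<close> whose horizontal differential is a vertical one is the sum of a
  horizontal and a vertical differential (one half is \<open>tensor_acyclic_edge\<close>).  If the columns of a
  double complex are exact above its bottom row and the edge condition holds there, then the total
  complex is exact (\<open>columns_exact_imp_boundary\<close>), and this yields the edge condition along the left
  column when the rows are exact (\<open>left_edge_condition\<close>).  That is the symmetry of Tor
  (\<open>tensor_acyclic_swap\<close>), and used twice it carries the vanishing of Tor from one resolution of
  \<open>R/I\<close> to any other (\<open>Tor_independent_imp_tensor_acyclic\<close>).  Over a noetherian ring a first
  resolution with terms \<open>R\<^sup>k\<close> exists (\<open>cyclic_free_resolution_exists\<close>).

  The exactness of the star product is \<open>star_exact\<close>, that of the two summands of the source is
  \<open>SY_boundary\<close> and \<open>XT_boundary\<close>, the argument in degree one is \<open>degree_1_boundaries\<close>, and the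
  homology in degree zero is identified in \<open>cone_augmentation\<close>.\<close>


section \<open>Modules, homomorphisms and generation\<close>

lemma module_cring: "module R M \<Longrightarrow> cring R"
  by (simp add: module_def)

lemma module_abelian_group: "module R M \<Longrightarrow> abelian_group M"
  by (simp add: module_def)

lemma module_homI:
  assumes "\<And>x. x \<in> carrier M \<Longrightarrow> h x \<in> carrier N"
    and "\<And>x y. x \<in> carrier M \<Longrightarrow> y \<in> carrier M \<Longrightarrow> h (x \<oplus>\<^bsub>M\<^esub> y) = h x \<oplus>\<^bsub>N\<^esub> h y"
    and "\<And>r x. r \<in> carrier R \<Longrightarrow> x \<in> carrier M \<Longrightarrow> h (r \<odot>\<^bsub>M\<^esub> x) = r \<odot>\<^bsub>N\<^esub> h x"
  shows "h \<in> module_hom R M N"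
  using assms by (auto simp: module_hom_def)

lemma module_hom_closed: "h \<in> module_hom R M N \<Longrightarrow> x \<in> carrier M \<Longrightarrow> h x \<in> carrier N"
  by (auto simp: module_hom_def)

lemma module_hom_add:
  "h \<in> module_hom R M N \<Longrightarrow> x \<in> carrier M \<Longrightarrow> y \<in> carrier M \<Longrightarrow> h (x \<oplus>\<^bsub>M\<^esub> y) = h x \<oplus>\<^bsub>N\<^esub> h y"
  by (auto simp: module_hom_def)

lemma module_hom_smult:
  "h \<in> module_hom R M N \<Longrightarrow> r \<in> carrier R \<Longrightarrow> x \<in> carrier M \<Longrightarrow> h (r \<odot>\<^bsub>M\<^esub> x) = r \<odot>\<^bsub>N\<^esub> h x"
  by (auto simp: module_hom_def)

lemma module_hom_zero:
  assumes "h \<in> module_hom R M N" "module R M" "module R N"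
  shows "h \<zero>\<^bsub>M\<^esub> = \<zero>\<^bsub>N\<^esub>"
proof -
  interpret M: module R M by fact
  interpret N: module R N by fact
  have "h (\<zero>\<^bsub>R\<^esub> \<odot>\<^bsub>M\<^esub> \<zero>\<^bsub>M\<^esub>) = \<zero>\<^bsub>R\<^esub> \<odot>\<^bsub>N\<^esub> h \<zero>\<^bsub>M\<^esub>"
    by (intro module_hom_smult[OF assms(1)]) auto
  then show ?thesis using module_hom_closed[OF assms(1) M.M.zero_closed] by simp
qed

lemma module_minus_eq_smult:
  assumes "module R M" "x \<in> carrier M"
  shows "\<ominus>\<^bsub>M\<^esub> x = (\<ominus>\<^bsub>R\<^esub> \<one>\<^bsub>R\<^esub>) \<odot>\<^bsub>M\<^esub> x"
proof -
  interpret M: module R M by fact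
  show ?thesis using assms(2) by (simp add: M.smult_l_minus)
qed

lemma module_hom_minus:
  assumes "h \<in> module_hom R M N" "module R M" "module R N" "x \<in> carrier M"
  shows "h (\<ominus>\<^bsub>M\<^esub> x) = \<ominus>\<^bsub>N\<^esub> h x"
proof -
  interpret M: module R M by fact
  show ?thesis
    using assms module_hom_closed[OF assms(1,4)]
    by (simp add: module_minus_eq_smult module_hom_smult[OF assms(1)])
qed

lemma module_minus_zero: "module R M \<Longrightarrow> \<ominus>\<^bsub>M\<^esub> \<zero>\<^bsub>M\<^esub> = \<zero>\<^bsub>M\<^esub>"
  using abelian_groupE(3)[of M] abelian_group.minus_equality[of M "\<zero>\<^bsub>M\<^esub>" "\<zero>\<^bsub>M\<^esub>"]
  by (auto simp: module_def abelian_group_def abelian_monoid.zero_closed abelian_monoid.l_zero)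

lemma module_hom_comp:
  assumes "f \<in> module_hom R M N" "g \<in> module_hom R N P"
  shows "(\<lambda>x. g (f x)) \<in> module_hom R M P"
  using assms by (intro module_homI) (auto simp: module_hom_closed module_hom_add module_hom_smult)

lemma module_hom_const_zero:
  assumes "module R N"
  shows "(\<lambda>_. \<zero>\<^bsub>N\<^esub>) \<in> module_hom R M N"
proof -
  interpret N: module R N by fact
  show ?thesis by (auto simp: module_hom_def)
qed

lemma module_hom_plus:
  assumes "f \<in> module_hom R M N" "g \<in> module_hom R M N" "module R N"
  shows "(\<lambda>x. f x \<oplus>\<^bsub>N\<^esub> g x) \<in> module_hom R M N"
proof -
  interpret N: module R N by fact
  show ?thesis using assms(1,2)
    by (intro module_homI)
      (auto simp: module_hom_closed module_hom_add module_hom_smult N.smult_r_distr N.a_ac)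
qed

lemma module_hom_uminus:
  assumes "f \<in> module_hom R M N" "module R N"
  shows "(\<lambda>x. \<ominus>\<^bsub>N\<^esub> f x) \<in> module_hom R M N"
proof -
  interpret N: module R N by fact
  show ?thesis using assms(1)
    by (intro module_homI)
      (auto simp: module_hom_closed module_hom_add module_hom_smult N.smult_r_minus N.minus_add)
qed

lemma sign_smult_closed: "module R M \<Longrightarrow> x \<in> carrier M \<Longrightarrow> sign_smult M k x \<in> carrier M"
  by (auto simp: sign_smult_def module_def abelian_group.a_inv_closed)

lemma sign_smult_zero: "module R M \<Longrightarrow> sign_smult M k \<zero>\<^bsub>M\<^esub> = \<zero>\<^bsub>M\<^esub>"
  by (simp add: sign_smult_def module_minus_zero)

lemma module_hom_sign:
  assumes "f \<in> module_hom R M N" "module R N"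
  shows "(\<lambda>x. sign_smult N k (f x)) \<in> module_hom R M N"
  using assms module_hom_uminus[OF assms] by (cases "even k") (simp_all add: sign_smult_def)

lemma module_hom_sign_smult:
  assumes "h \<in> module_hom R M N" "module R M" "module R N" "x \<in> carrier M"
  shows "h (sign_smult M k x) = sign_smult N k (h x)"
  using assms by (auto simp: sign_smult_def module_hom_minus)

lemma module_hom_cong:
  assumes "f \<in> module_hom R M N" "module R M" "\<And>x. x \<in> carrier M \<Longrightarrow> f x = g x"
  shows "g \<in> module_hom R M N"
proof -
  interpret M: module R M by fact
  show ?thesis using assms(1)
    by (intro module_homI)
      (auto simp: module_hom_closed module_hom_add module_hom_smult simp flip: assms(3))
qed

lemma module_hom_finsum:
  assumes "h \<in> module_hom R M N" "module R M" "module R N"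
    and "\<And>a. a \<in> A \<Longrightarrow> f a \<in> carrier M"
  shows "h (\<Oplus>\<^bsub>M\<^esub>a\<in>A. f a) = (\<Oplus>\<^bsub>N\<^esub>a\<in>A. h (f a))"
proof -
  interpret M: module R M by fact
  interpret N: module R N by fact
  show ?thesis using assms(4)
  proof (induction A rule: infinite_finite_induct)
    case (infinite A)
    then show ?case by (simp add: module_hom_zero[OF assms(1-3)])
  next
    case empty
    then show ?case by (simp add: module_hom_zero[OF assms(1-3)])
  next
    case (insert a A)
    then show ?case
      by (simp add: Pi_def module_hom_add[OF assms(1)] module_hom_closed[OF assms(1)])
  qed
qed

lemma module_eq_iff_minus:
  assumes "module R M" "x \<in> carrier M" "y \<in> carrier M"
  shows "x \<oplus>\<^bsub>M\<^esub> \<ominus>\<^bsub>M\<^esub> y = \<zero>\<^bsub>M\<^esub> \<longleftrightarrow> x = y"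
proof -
  interpret M: module R M by fact
  show ?thesis using assms(2,3)
    by (metis M.M.minus_equality M.M.minus_minus M.M.r_neg M.a_inv_closed)
qed

lemma module_add_eq_zeroD:
  assumes "module R M" "x \<in> carrier M" "y \<in> carrier M" "x \<oplus>\<^bsub>M\<^esub> y = \<zero>\<^bsub>M\<^esub>"
  shows "x = \<ominus>\<^bsub>M\<^esub> y"
proof -
  interpret M: module R M by fact
  show ?thesis using assms(2-) by (simp add: M.M.minus_equality)
qed

text \<open>Closure under negation is automatic, because a negative is a scalar multiple.\<close>

lemma submodule_closedI:
  assumes "module R M" "L \<subseteq> carrier M" "\<zero>\<^bsub>M\<^esub> \<in> L"
    and "\<And>x y. x \<in> L \<Longrightarrow> y \<in> L \<Longrightarrow> x \<oplus>\<^bsub>M\<^esub> y \<in> L"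
    and "\<And>r x. r \<in> carrier R \<Longrightarrow> x \<in> L \<Longrightarrow> r \<odot>\<^bsub>M\<^esub> x \<in> L"
  shows "submodule L R M"
proof -
  interpret M: module R M by fact
  show ?thesis
  proof (intro M.submoduleI)
    fix a assume "a \<in> L"
    then show "\<ominus>\<^bsub>M\<^esub> a \<in> L"
      using assms(2) assms(5)[of "\<ominus>\<^bsub>R\<^esub> \<one>\<^bsub>R\<^esub>" a] module_minus_eq_smult[OF assms(1), of a] by auto
  qed (use assms in auto)
qed

lemma submodule_zero: "submodule L R M \<Longrightarrow> \<zero>\<^bsub>M\<^esub> \<in> L"
  using subgroup.one_closed[of L "add_monoid M"] by (simp add: submodule_def)

lemma submodule_subset: "submodule L R M \<Longrightarrow> x \<in> L \<Longrightarrow> x \<in> carrier M"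
  using subgroup.subset[of L "add_monoid M"] by (auto simp: submodule_def)

lemma submodule_add: "submodule L R M \<Longrightarrow> x \<in> L \<Longrightarrow> y \<in> L \<Longrightarrow> x \<oplus>\<^bsub>M\<^esub> y \<in> L"
  using subgroup.m_closed[of L "add_monoid M"] by (auto simp: submodule_def)

lemma submodule_smult: "submodule L R M \<Longrightarrow> r \<in> carrier R \<Longrightarrow> x \<in> L \<Longrightarrow> r \<odot>\<^bsub>M\<^esub> x \<in> L"
  by (rule submodule.smult_closed)

lemma submodule_minus:
  assumes "module R M" "submodule L R M" "x \<in> L"
  shows "\<ominus>\<^bsub>M\<^esub> x \<in> L"
  using module.submoduleE(3)[OF assms(1,2)] assms(3) by blast

lemma submodule_finsum:
  assumes "module R M" "submodule L R M" "\<And>a. a \<in> A \<Longrightarrow> f a \<in> L"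
  shows "(\<Oplus>\<^bsub>M\<^esub>a\<in>A. f a) \<in> L"
proof -
  interpret M: module R M by fact
  show ?thesis using assms(3)
  proof (induction A rule: infinite_finite_induct)
    case (insert a A)
    then show ?case
      using submodule_subset[OF assms(2)] by (simp add: Pi_def submodule_add[OF assms(2)])
  qed (auto simp: submodule_zero[OF assms(2)])
qed

lemma submodule_image:
  assumes "h \<in> module_hom R M N" "module R M" "module R N" "submodule L R M"
  shows "submodule (h ` L) R N"
proof (rule submodule_closedI)
  show "h ` L \<subseteq> carrier N"
    using submodule_subset[OF assms(4)] module_hom_closed[OF assms(1)] by auto
  show "\<zero>\<^bsub>N\<^esub> \<in> h ` L"
    using submodule_zero[OF assms(4)] module_hom_zero[OF assms(1-3)] by (metis imageI)
  show "x \<oplus>\<^bsub>N\<^esub> y \<in> h ` L" if "x \<in> h ` L" "y \<in> h ` L" for x y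
    using that submodule_subset[OF assms(4)] submodule_add[OF assms(4)]
    by (auto simp flip: module_hom_add[OF assms(1)])
  show "r \<odot>\<^bsub>N\<^esub> x \<in> h ` L" if "r \<in> carrier R" "x \<in> h ` L" for r x
    using that submodule_subset[OF assms(4)] submodule_smult[OF assms(4)]
    by (auto simp flip: module_hom_smult[OF assms(1)])
qed fact

lemma submodule_carrier: "module R M \<Longrightarrow> submodule (carrier M) R M"
  by (rule module.carrier_is_submodule)

lemma submodule_preimage:
  assumes "h \<in> module_hom R M N" "module R M" "module R N" "submodule L R N"
  shows "submodule {x \<in> carrier M. h x \<in> L} R M"
proof -
  interpret M: module R M by fact
  show ?thesis
    by (rule submodule_closedI)
      (use assms in \<open>auto simp: module_hom_zero submodule_zero module_hom_add submodule_add
        module_hom_smult submodule_smult\<close>)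
qed

text \<open>Generation refers to submodules rather than to linear combinations: a property then holds for the
  whole module as soon as the elements with this property form a submodule that contains the
  generators.\<close>

definition spans :: "('a, 'r) ring_scheme \<Rightarrow> ('a, 'm) module \<Rightarrow> 'm set \<Rightarrow> bool" where
  "spans R M G \<longleftrightarrow> G \<subseteq> carrier M \<and> (\<forall>L. submodule L R M \<and> G \<subseteq> L \<longrightarrow> carrier M \<subseteq> L)"

lemma spansD: "spans R M G \<Longrightarrow> submodule L R M \<Longrightarrow> G \<subseteq> L \<Longrightarrow> x \<in> carrier M \<Longrightarrow> x \<in> L"
  by (auto simp: spans_def)

lemma spans_hom_eq:
  assumes "spans R M G" "module R M" "module R N" "f \<in> module_hom R M N" "g \<in> module_hom R M N"
    and "\<And>x. x \<in> G \<Longrightarrow> f x = g x" and "x \<in> carrier M"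
  shows "f x = g x"
proof -
  interpret M: module R M by fact
  interpret N: module R N by fact
  have "submodule {x \<in> carrier M. f x = g x} R M"
    by (rule submodule_closedI)
      (use assms in \<open>auto simp: module_hom_zero module_hom_add module_hom_smult\<close>)
  moreover have "G \<subseteq> {x \<in> carrier M. f x = g x}"
    using assms by (auto simp: spans_def)
  ultimately show ?thesis using spansD[OF assms(1)] assms(7) by blast
qed

lemma spans_image_subset:
  assumes "spans R M G" "module R M" "module R N" "h \<in> module_hom R M N" "submodule L R N"
    and "\<And>x. x \<in> G \<Longrightarrow> h x \<in> L" and "x \<in> carrier M"
  shows "h x \<in> L"
  using spansD[OF assms(1) submodule_preimage[OF assms(4,2,3,5)], of x] assms(1,6,7)
  by (auto simp: spans_def)

section \<open>Elementary modules\<close>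

lemma regular_module_simps [simp]:
  "carrier (regular_module R) = carrier R"
  "\<zero>\<^bsub>regular_module R\<^esub> = \<zero>\<^bsub>R\<^esub>"
  "x \<oplus>\<^bsub>regular_module R\<^esub> y = x \<oplus>\<^bsub>R\<^esub> y"
  "r \<odot>\<^bsub>regular_module R\<^esub> x = r \<otimes>\<^bsub>R\<^esub> x"
  by (simp_all add: regular_module_def)

text \<open>The group laws are checked with the additive inverse supplied as a witness.\<close>

lemma module_of_inverses:
  fixes R (structure) and M (structure)
  assumes "cring R"
    and "\<And>x y. x \<in> carrier M \<Longrightarrow> y \<in> carrier M \<Longrightarrow> x \<oplus>\<^bsub>M\<^esub> y \<in> carrier M"
    and "\<zero>\<^bsub>M\<^esub> \<in> carrier M"
    and "\<And>x y z. x \<in> carrier M \<Longrightarrow> y \<in> carrier M \<Longrightarrow> z \<in> carrier M \<Longrightarrow>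
           (x \<oplus>\<^bsub>M\<^esub> y) \<oplus>\<^bsub>M\<^esub> z = x \<oplus>\<^bsub>M\<^esub> (y \<oplus>\<^bsub>M\<^esub> z)"
    and "\<And>x y. x \<in> carrier M \<Longrightarrow> y \<in> carrier M \<Longrightarrow> x \<oplus>\<^bsub>M\<^esub> y = y \<oplus>\<^bsub>M\<^esub> x"
    and "\<And>x. x \<in> carrier M \<Longrightarrow> \<zero>\<^bsub>M\<^esub> \<oplus>\<^bsub>M\<^esub> x = x"
    and "\<And>x. x \<in> carrier M \<Longrightarrow> \<exists>y\<in>carrier M. y \<oplus>\<^bsub>M\<^esub> x = \<zero>\<^bsub>M\<^esub>"
    and "\<And>a x. a \<in> carrier R \<Longrightarrow> x \<in> carrier M \<Longrightarrow> a \<odot>\<^bsub>M\<^esub> x \<in> carrier M"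
    and "\<And>a b x. a \<in> carrier R \<Longrightarrow> b \<in> carrier R \<Longrightarrow> x \<in> carrier M \<Longrightarrow>
           (a \<oplus>\<^bsub>R\<^esub> b) \<odot>\<^bsub>M\<^esub> x = (a \<odot>\<^bsub>M\<^esub> x) \<oplus>\<^bsub>M\<^esub> (b \<odot>\<^bsub>M\<^esub> x)"
    and "\<And>a x y. a \<in> carrier R \<Longrightarrow> x \<in> carrier M \<Longrightarrow> y \<in> carrier M \<Longrightarrow>
           a \<odot>\<^bsub>M\<^esub> (x \<oplus>\<^bsub>M\<^esub> y) = (a \<odot>\<^bsub>M\<^esub> x) \<oplus>\<^bsub>M\<^esub> (a \<odot>\<^bsub>M\<^esub> y)"
    and "\<And>a b x. a \<in> carrier R \<Longrightarrow> b \<in> carrier R \<Longrightarrow> x \<in> carrier M \<Longrightarrow>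
           (a \<otimes>\<^bsub>R\<^esub> b) \<odot>\<^bsub>M\<^esub> x = a \<odot>\<^bsub>M\<^esub> (b \<odot>\<^bsub>M\<^esub> x)"
    and "\<And>x. x \<in> carrier M \<Longrightarrow> \<one>\<^bsub>R\<^esub> \<odot>\<^bsub>M\<^esub> x = x"
  shows "module R M"
  by (intro moduleI abelian_groupI) (use assms in auto)

lemma module_regular:
  assumes "cring R" shows "module R (regular_module R)"
proof -
  interpret cring R by fact
  show ?thesis
    by (rule module_of_inverses)
      (auto simp: a_ac m_ac l_distr r_distr assms intro!: bexI[of _ "\<ominus>\<^bsub>R\<^esub> _"] l_neg)
qed

lemma restrict_module_simps [simp]:
  "carrier (restrict_module M K) = K"
  "\<zero>\<^bsub>restrict_module M K\<^esub> = \<zero>\<^bsub>M\<^esub>"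
  "x \<oplus>\<^bsub>restrict_module M K\<^esub> y = x \<oplus>\<^bsub>M\<^esub> y"
  "r \<odot>\<^bsub>restrict_module M K\<^esub> x = r \<odot>\<^bsub>M\<^esub> x"
  by (simp_all add: restrict_module_def)

lemma module_restrict:
  assumes "module R M" "submodule K R M" shows "module R (restrict_module M K)"
  using submodule.submodule_is_module[OF assms(2,1)] by (simp add: restrict_module_def)

lemma submodule_zero_singleton:
  assumes "module R M" shows "submodule {\<zero>\<^bsub>M\<^esub>} R M"
proof -
  interpret M: module R M by fact
  show ?thesis by (rule submodule_closedI) (use assms in auto)
qed

lemma prod_module_simps [simp]:
  "carrier (prod_module M N) = carrier M \<times> carrier N"
  "\<zero>\<^bsub>prod_module M N\<^esub> = (\<zero>\<^bsub>M\<^esub>, \<zero>\<^bsub>N\<^esub>)"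
  "(x, y) \<oplus>\<^bsub>prod_module M N\<^esub> (x', y') = (x \<oplus>\<^bsub>M\<^esub> x', y \<oplus>\<^bsub>N\<^esub> y')"
  "r \<odot>\<^bsub>prod_module M N\<^esub> (x, y) = (r \<odot>\<^bsub>M\<^esub> x, r \<odot>\<^bsub>N\<^esub> y)"
  by (simp_all add: prod_module_def)

lemma module_prod:
  assumes "module R M" "module R N" shows "module R (prod_module M N)"
proof -
  interpret M: module R M by fact
  interpret N: module R N by fact
  show ?thesis
  proof (rule module_of_inverses)
    fix x assume "x \<in> carrier (prod_module M N)"
    then show "\<exists>y\<in>carrier (prod_module M N). y \<oplus>\<^bsub>prod_module M N\<^esub> x = \<zero>\<^bsub>prod_module M N\<^esub>"
      by (intro bexI[of _ "(\<ominus>\<^bsub>M\<^esub> fst x, \<ominus>\<^bsub>N\<^esub> snd x)"]) (auto simp: M.M.l_neg N.M.l_neg)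
  qed (use module_cring[OF assms(1)] in \<open>auto simp: M.M.a_ac N.M.a_ac M.smult_l_distr N.smult_l_distr
      M.smult_r_distr N.smult_r_distr M.smult_assoc1 N.smult_assoc1\<close>)
qed

lemma dsum_module_simps [simp]:
  "\<zero>\<^bsub>dsum_module K M\<^esub> = (\<lambda>k. \<zero>\<^bsub>M k\<^esub>)"
  "f \<oplus>\<^bsub>dsum_module K M\<^esub> g = (\<lambda>k. f k \<oplus>\<^bsub>M k\<^esub> g k)"
  "r \<odot>\<^bsub>dsum_module K M\<^esub> f = (\<lambda>k. r \<odot>\<^bsub>M k\<^esub> f k)"
  by (simp_all add: dsum_module_def)

lemma dsum_carrier_iff:
  "f \<in> carrier (dsum_module K M) \<longleftrightarrow> (\<forall>k. f k \<in> carrier (M k)) \<and>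
     finite {k. f k \<noteq> \<zero>\<^bsub>M k\<^esub>} \<and> (\<forall>k. k \<notin> K \<longrightarrow> f k = \<zero>\<^bsub>M k\<^esub>)"
  by (simp add: dsum_module_def)

lemma dsum_closed: "f \<in> carrier (dsum_module K M) \<Longrightarrow> f k \<in> carrier (M k)"
  by (simp add: dsum_carrier_iff)

lemma dsum_outside: "f \<in> carrier (dsum_module K M) \<Longrightarrow> k \<notin> K \<Longrightarrow> f k = \<zero>\<^bsub>M k\<^esub>"
  by (simp add: dsum_carrier_iff)

lemma module_dsum:
  assumes "cring R" "\<And>k. module R (M k)" shows "module R (dsum_module K M)"
proof -
  have ag: "abelian_group (M k)" for k
    using assms(2) by (rule module_abelian_group)
  have mon: "abelian_monoid (M k)" for k
    using ag by (simp add: abelian_group_def)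
  note [simp] = abelian_monoid.a_closed[OF mon] abelian_monoid.zero_closed[OF mon]
    abelian_monoid.l_zero[OF mon] abelian_monoid.r_zero[OF mon] module.smult_r_null[OF assms(2)]
    module.smult_closed[OF assms(2)] abelian_group.a_inv_closed[OF ag] abelian_group.l_neg[OF ag]
    module_minus_zero[OF assms(2)]
  show ?thesis
  proof (rule module_of_inverses)
    fix f g assume "f \<in> carrier (dsum_module K M)" "g \<in> carrier (dsum_module K M)"
    moreover have "{k. f k \<oplus>\<^bsub>M k\<^esub> g k \<noteq> \<zero>\<^bsub>M k\<^esub>} \<subseteq> {k. f k \<noteq> \<zero>\<^bsub>M k\<^esub>} \<union> {k. g k \<noteq> \<zero>\<^bsub>M k\<^esub>}"
      by auto
    ultimately show "f \<oplus>\<^bsub>dsum_module K M\<^esub> g \<in> carrier (dsum_module K M)"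
      by (auto simp: dsum_carrier_iff intro: finite_subset)
  next
    fix f assume f: "f \<in> carrier (dsum_module K M)"
    have "{k. \<ominus>\<^bsub>M k\<^esub> f k \<noteq> \<zero>\<^bsub>M k\<^esub>} \<subseteq> {k. f k \<noteq> \<zero>\<^bsub>M k\<^esub>}" by auto
    with f show "\<exists>g\<in>carrier (dsum_module K M). g \<oplus>\<^bsub>dsum_module K M\<^esub> f = \<zero>\<^bsub>dsum_module K M\<^esub>"
      by (intro bexI[of _ "\<lambda>k. \<ominus>\<^bsub>M k\<^esub> f k"])
        (auto simp: dsum_carrier_iff intro: finite_subset)
  next
    fix r f assume "r \<in> carrier R" and f: "f \<in> carrier (dsum_module K M)"
    then have "{k. r \<odot>\<^bsub>M k\<^esub> f k \<noteq> \<zero>\<^bsub>M k\<^esub>} \<subseteq> {k. f k \<noteq> \<zero>\<^bsub>M k\<^esub>}" by auto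
    with f \<open>r \<in> carrier R\<close> show "r \<odot>\<^bsub>dsum_module K M\<^esub> f \<in> carrier (dsum_module K M)"
      by (auto simp: dsum_carrier_iff intro: finite_subset)
  qed (auto simp: assms(1) dsum_carrier_iff fun_eq_iff abelian_monoid.a_assoc[OF mon]
      intro: abelian_monoid.a_comm[OF mon] simp: module.smult_l_distr[OF assms(2)]
      module.smult_r_distr[OF assms(2)] module.smult_assoc1[OF assms(2)]
      module.smult_one[OF assms(2)])
qed

lemma dsum_minus:
  assumes "cring R" "\<And>k. module R (M k)" "f \<in> carrier (dsum_module K M)"
  shows "\<ominus>\<^bsub>dsum_module K M\<^esub> f = (\<lambda>k. \<ominus>\<^bsub>M k\<^esub> f k)"
  using assms dsum_closed[OF assms(3)]
  by (simp add: module_minus_eq_smult[OF module_dsum[OF assms(1,2)]] fun_eq_iff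
      module_minus_eq_smult[OF assms(2)])

lemma dsum_inj_self [simp]: "dsum_inj M k x k = x"
  by (simp add: dsum_inj_def)

lemma dsum_inj_other [simp]: "l \<noteq> k \<Longrightarrow> dsum_inj M k x l = \<zero>\<^bsub>M l\<^esub>"
  by (simp add: dsum_inj_def)

lemma dsum_inj_hom:
  assumes "cring R" "\<And>k. module R (M k)" "k \<in> K"
  shows "dsum_inj M k \<in> module_hom R (M k) (dsum_module K M)"
proof -
  have mon: "abelian_monoid (M k)" for k
    using module_abelian_group[OF assms(2)] by (simp add: abelian_group_def)
  note [simp] = abelian_monoid.a_closed[OF mon] abelian_monoid.zero_closed[OF mon]
    abelian_monoid.l_zero[OF mon] abelian_monoid.r_zero[OF mon] module.smult_r_null[OF assms(2)]
    module.smult_closed[OF assms(2)]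
  show ?thesis
  proof (rule module_homI)
    fix x assume "x \<in> carrier (M k)"
    moreover have "{l. dsum_inj M k x l \<noteq> \<zero>\<^bsub>M l\<^esub>} \<subseteq> {k}" by (auto simp: dsum_inj_def)
    ultimately show "dsum_inj M k x \<in> carrier (dsum_module K M)"
      using assms(3) by (auto simp: dsum_carrier_iff dsum_inj_def intro: finite_subset)
  qed (auto simp: dsum_inj_def fun_eq_iff)
qed

lemma dsum_spans:
  assumes "cring R" "\<And>k. module R (M k)"
  shows "spans R (dsum_module K M) (\<Union>k\<in>K. dsum_inj M k ` carrier (M k))"
  unfolding spans_def
proof (intro conjI allI impI)
  show "(\<Union>k\<in>K. dsum_inj M k ` carrier (M k)) \<subseteq> carrier (dsum_module K M)"
    using module_hom_closed[OF dsum_inj_hom[OF assms]] by auto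
  fix L assume "submodule L R (dsum_module K M) \<and> (\<Union>k\<in>K. dsum_inj M k ` carrier (M k)) \<subseteq> L"
  then have L: "submodule L R (dsum_module K M)" and inj: "\<And>k x. k \<in> K \<Longrightarrow> x \<in> carrier (M k) \<Longrightarrow> dsum_inj M k x \<in> L"
    by auto
  have mon: "abelian_monoid (M k)" for k
    using module_abelian_group[OF assms(2)] by (simp add: abelian_group_def)
  note [simp] = abelian_monoid.zero_closed[OF mon]
    abelian_monoid.l_zero[OF mon] abelian_monoid.r_zero[OF mon]
  have "f \<in> L" if "finite S" "f \<in> carrier (dsum_module K M)" "{k. f k \<noteq> \<zero>\<^bsub>M k\<^esub>} \<subseteq> S" for f S
    using that
  proof (induction S arbitrary: f rule: finite_induct)
    case empty
    then have "f = \<zero>\<^bsub>dsum_module K M\<^esub>" by (auto simp: fun_eq_iff)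
    then show ?case using submodule_zero[OF L] by simp
  next
    case (insert a S)
    show ?case
    proof (cases "a \<in> K")
      case True
      have fa: "f a \<in> carrier (M a)" using insert.prems by (simp add: dsum_closed)
      let ?g = "f(a := \<zero>\<^bsub>M a\<^esub>)"
      have "?g \<in> carrier (dsum_module K M)"
        using insert.prems(1) by (auto simp: dsum_carrier_iff intro: finite_subset[rotated])
      moreover have "{k. ?g k \<noteq> \<zero>\<^bsub>M k\<^esub>} \<subseteq> S" using insert.prems(2) by auto
      ultimately have "?g \<in> L" by (rule insert.IH)
      moreover have "f = ?g \<oplus>\<^bsub>dsum_module K M\<^esub> dsum_inj M a (f a)"
        using insert.prems fa by (auto simp: fun_eq_iff dsum_inj_def dsum_closed)
      ultimately show ?thesis using inj[OF True fa] submodule_add[OF L] by metis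
    next
      case False
      then show ?thesis using insert.prems dsum_outside[OF insert.prems(1) False]
        by (intro insert.IH) auto
    qed
  qed
  then show "carrier (dsum_module K M) \<subseteq> L" by (auto simp: dsum_carrier_iff)
qed

section \<open>Dual bases\<close>

text \<open>A module is free exactly if it has a generating family with a biorthogonal family of linear
  functionals.  In this form freeness passes easily to tensor products and direct sums.\<close>

definition dual_basis ::
  "('a, 'r) ring_scheme \<Rightarrow> ('a, 'm) module \<Rightarrow> 'k set \<Rightarrow> ('k \<Rightarrow> 'm) \<Rightarrow> ('k \<Rightarrow> 'm \<Rightarrow> 'a) \<Rightarrow> bool" where
  "dual_basis R M K b \<kappa> \<longleftrightarrow> module R M \<and> spans R M (b ` K) \<and>
     (\<forall>k\<in>K. \<kappa> k \<in> module_hom R M (regular_module R)) \<and>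
     (\<forall>k\<in>K. \<forall>l\<in>K. \<kappa> k (b l) = (if k = l then \<one>\<^bsub>R\<^esub> else \<zero>\<^bsub>R\<^esub>))"

lemma dual_basis_mem: "dual_basis R M K b \<kappa> \<Longrightarrow> k \<in> K \<Longrightarrow> b k \<in> carrier M"
  by (auto simp: dual_basis_def spans_def)

lemma finsum_superset:
  assumes "abelian_monoid M" "finite B" "A \<subseteq> B" "\<And>x. x \<in> B \<Longrightarrow> f x \<in> carrier M"
    and "\<And>x. x \<in> B \<Longrightarrow> x \<notin> A \<Longrightarrow> f x = \<zero>\<^bsub>M\<^esub>"
  shows "(\<Oplus>\<^bsub>M\<^esub>x\<in>A. f x) = (\<Oplus>\<^bsub>M\<^esub>x\<in>B. f x)"
proof -
  interpret M: abelian_monoid M by fact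
  show ?thesis by (rule M.add.finprod_mono_neutral_cong_left) (use assms in auto)
qed

text \<open>The elements that have such an expansion form a submodule containing all \<open>b k\<close>.  The index set
  \<open>A\<close> may be enlarged, which is how expansions of two elements are added.\<close>

lemma dual_basis_expansion:
  assumes "dual_basis R M K b \<kappa>" "x \<in> carrier M"
  shows "\<exists>A\<subseteq>K. finite A \<and> (\<forall>k\<in>K - A. \<kappa> k x = \<zero>\<^bsub>R\<^esub>) \<and> x = (\<Oplus>\<^bsub>M\<^esub>k\<in>A. \<kappa> k x \<odot>\<^bsub>M\<^esub> b k)"
proof -
  have M: "module R M" and sp: "spans R M (b ` K)"
    and hom: "\<And>k. k \<in> K \<Longrightarrow> \<kappa> k \<in> module_hom R M (regular_module R)"
    and delta: "\<And>k l. k \<in> K \<Longrightarrow> l \<in> K \<Longrightarrow> \<kappa> k (b l) = (if k = l then \<one>\<^bsub>R\<^esub> else \<zero>\<^bsub>R\<^esub>)"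
    using assms(1) by (auto simp: dual_basis_def)
  have bM: "k \<in> K \<Longrightarrow> b k \<in> carrier M" for k using dual_basis_mem[OF assms(1)] .
  interpret M: module R M by fact
  have RR: "module R (regular_module R)" by (rule module_regular) (rule M.is_cring)
  have kc: "\<kappa> k x \<in> carrier R" if "k \<in> K" "x \<in> carrier M" for k x
    using module_hom_closed[OF hom[OF that(1)] that(2)] by simp
  define Q where "Q x A \<longleftrightarrow> A \<subseteq> K \<and> finite A \<and> (\<forall>k\<in>K - A. \<kappa> k x = \<zero>\<^bsub>R\<^esub>) \<and> x = (\<Oplus>\<^bsub>M\<^esub>k\<in>A. \<kappa> k x \<odot>\<^bsub>M\<^esub> b k)" for x A
  have Qmono: "Q x B" if "Q x A" "A \<subseteq> B" "finite B" "B \<subseteq> K" "x \<in> carrier M" for x A B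
  proof -
    have "(\<Oplus>\<^bsub>M\<^esub>k\<in>A. \<kappa> k x \<odot>\<^bsub>M\<^esub> b k) = (\<Oplus>\<^bsub>M\<^esub>k\<in>B. \<kappa> k x \<odot>\<^bsub>M\<^esub> b k)"
      using that by (intro finsum_superset) (auto simp: Q_def subset_iff bM kc intro: M.abelian_monoid_axioms)
    then show ?thesis using that by (auto simp: Q_def)
  qed
  have "submodule {x \<in> carrier M. \<exists>A. Q x A} R M"
  proof (rule submodule_closedI[OF M])
    have "Q \<zero>\<^bsub>M\<^esub> {}" using module_hom_zero[OF hom M RR] by (auto simp: Q_def)
    then show "\<zero>\<^bsub>M\<^esub> \<in> {x \<in> carrier M. \<exists>A. Q x A}" by auto
  next
    fix x y assume x: "x \<in> {x \<in> carrier M. \<exists>A. Q x A}" and y: "y \<in> {x \<in> carrier M. \<exists>A. Q x A}"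
    then obtain A B where QA: "Q x A" and QB: "Q y B" by auto
    have "finite (A \<union> B)" "A \<union> B \<subseteq> K" using QA QB by (auto simp: Q_def)
    then have AB: "Q x (A \<union> B)" "Q y (A \<union> B)"
      using x y Qmono[OF QA, of "A \<union> B"] Qmono[OF QB, of "A \<union> B"] by auto
    have "A \<union> B \<subseteq> K" using QA QB by (auto simp: Q_def)
    have "x \<oplus>\<^bsub>M\<^esub> y = (\<Oplus>\<^bsub>M\<^esub>k\<in>A \<union> B. \<kappa> k x \<odot>\<^bsub>M\<^esub> b k) \<oplus>\<^bsub>M\<^esub> (\<Oplus>\<^bsub>M\<^esub>k\<in>A \<union> B. \<kappa> k y \<odot>\<^bsub>M\<^esub> b k)"
      using AB by (simp add: Q_def)
    also have "\<dots> = (\<Oplus>\<^bsub>M\<^esub>k\<in>A \<union> B. \<kappa> k x \<odot>\<^bsub>M\<^esub> b k \<oplus>\<^bsub>M\<^esub> \<kappa> k y \<odot>\<^bsub>M\<^esub> b k)"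
      using x y \<open>A \<union> B \<subseteq> K\<close> by (intro M.finsum_addf[symmetric]) (auto simp: bM kc)
    also have "\<dots> = (\<Oplus>\<^bsub>M\<^esub>k\<in>A \<union> B. \<kappa> k (x \<oplus>\<^bsub>M\<^esub> y) \<odot>\<^bsub>M\<^esub> b k)"
      using x y \<open>A \<union> B \<subseteq> K\<close>
      by (intro M.finsum_cong') (auto simp: bM kc subset_iff module_hom_add[OF hom] M.smult_l_distr)
    finally have "Q (x \<oplus>\<^bsub>M\<^esub> y) (A \<union> B)"
      using AB x y by (auto simp: Q_def module_hom_add[OF hom])
    then show "x \<oplus>\<^bsub>M\<^esub> y \<in> {x \<in> carrier M. \<exists>A. Q x A}" using x y by auto
  next
    fix r x assume r: "r \<in> carrier R" and x: "x \<in> {x \<in> carrier M. \<exists>A. Q x A}"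
    then obtain A where A: "Q x A" by auto
    then have "A \<subseteq> K" "finite A" by (auto simp: Q_def)
    have "r \<odot>\<^bsub>M\<^esub> x = r \<odot>\<^bsub>M\<^esub> (\<Oplus>\<^bsub>M\<^esub>k\<in>A. \<kappa> k x \<odot>\<^bsub>M\<^esub> b k)" using A by (simp add: Q_def)
    also have "\<dots> = (\<Oplus>\<^bsub>M\<^esub>k\<in>A. r \<odot>\<^bsub>M\<^esub> (\<kappa> k x \<odot>\<^bsub>M\<^esub> b k))"
      using r x \<open>A \<subseteq> K\<close> \<open>finite A\<close> by (intro M.finsum_smult_ldistr) (auto simp: bM kc subset_iff)
    also have "\<dots> = (\<Oplus>\<^bsub>M\<^esub>k\<in>A. \<kappa> k (r \<odot>\<^bsub>M\<^esub> x) \<odot>\<^bsub>M\<^esub> b k)"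
      using r x \<open>A \<subseteq> K\<close>
      by (intro M.finsum_cong') (auto simp: bM kc subset_iff module_hom_smult[OF hom] M.smult_assoc1)
    finally have "Q (r \<odot>\<^bsub>M\<^esub> x) A"
      using A r x by (auto simp: Q_def module_hom_smult[OF hom])
    then show "r \<odot>\<^bsub>M\<^esub> x \<in> {x \<in> carrier M. \<exists>A. Q x A}" using r x by auto
  qed auto
  moreover have "b ` K \<subseteq> {x \<in> carrier M. \<exists>A. Q x A}"
  proof clarify
    fix k assume "k \<in> K"
    then have "Q (b k) {k}" by (auto simp: Q_def delta bM)
    then show "b k \<in> carrier M \<and> (\<exists>A. Q (b k) A)" using \<open>k \<in> K\<close> bM by blast
  qed
  ultimately show ?thesis using spansD[OF sp, of _ x] assms(2) unfolding Q_def by blast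
qed

text \<open>The coordinates with respect to a basis are linear because they are unique.\<close>

lemma free_module_imp_dual_basis:
  assumes "free_module R M"
  obtains B \<kappa> where "dual_basis R M B (\<lambda>b. b) \<kappa>"
proof -
  have M: "module R M" using assms by (simp add: free_module_def)
  interpret M: module R M by fact
  define co where "co B x c \<longleftrightarrow> (\<forall>b. c b \<in> carrier R) \<and> (\<forall>b. b \<notin> B \<longrightarrow> c b = \<zero>\<^bsub>R\<^esub>) \<and>
       finite {b. c b \<noteq> \<zero>\<^bsub>R\<^esub>} \<and> x = (\<Oplus>\<^bsub>M\<^esub>b\<in>{b. c b \<noteq> \<zero>\<^bsub>R\<^esub>}. c b \<odot>\<^bsub>M\<^esub> b)" for B x c
  obtain B where B: "B \<subseteq> carrier M" and ex: "\<And>x. x \<in> carrier M \<Longrightarrow> \<exists>!c. co B x c"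
    using assms unfolding free_module_def co_def by auto
  define c where "c x = (THE c. co B x c)" for x
  have cx: "co B x (c x)" if "x \<in> carrier M" for x
    unfolding c_def using ex[OF that] by (rule theI')
  have cuniq: "c x = d" if "x \<in> carrier M" "co B x d" for x d
    unfolding c_def by (rule the1_equality[where P = "co B x", OF ex[OF that(1)] that(2)])
  have sup: "co B x d \<Longrightarrow> finite A \<Longrightarrow> {b. d b \<noteq> \<zero>\<^bsub>R\<^esub>} \<subseteq> A \<Longrightarrow> A \<subseteq> carrier M \<Longrightarrow> x = (\<Oplus>\<^bsub>M\<^esub>b\<in>A. d b \<odot>\<^bsub>M\<^esub> b)" for x d A
    unfolding co_def
    by (elim conjE, erule trans, rule finsum_superset) (auto intro: M.abelian_monoid_axioms)
  have subc: "co B x d \<Longrightarrow> {b. d b \<noteq> \<zero>\<^bsub>R\<^esub>} \<subseteq> carrier M" for x d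
    using B by (auto simp: co_def)
  have ccl: "x \<in> carrier M \<Longrightarrow> c x b \<in> carrier R" for x b
    using cx by (auto simp: co_def)
  have add: "c (x \<oplus>\<^bsub>M\<^esub> y) = (\<lambda>b. c x b \<oplus>\<^bsub>R\<^esub> c y b)" if xy: "x \<in> carrier M" "y \<in> carrier M" for x y
  proof (rule cuniq)
    let ?A = "{b. c x b \<noteq> \<zero>\<^bsub>R\<^esub>} \<union> {b. c y b \<noteq> \<zero>\<^bsub>R\<^esub>}"
    have fin: "finite ?A" using cx xy by (auto simp: co_def)
    have A: "?A \<subseteq> carrier M" using subc[OF cx] xy by auto
    have sub: "{b. c x b \<oplus>\<^bsub>R\<^esub> c y b \<noteq> \<zero>\<^bsub>R\<^esub>} \<subseteq> ?A" by auto
    have "x \<oplus>\<^bsub>M\<^esub> y = (\<Oplus>\<^bsub>M\<^esub>b\<in>?A. c x b \<odot>\<^bsub>M\<^esub> b) \<oplus>\<^bsub>M\<^esub> (\<Oplus>\<^bsub>M\<^esub>b\<in>?A. c y b \<odot>\<^bsub>M\<^esub> b)"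
      using sup[OF cx[OF xy(1)] fin _ A] sup[OF cx[OF xy(2)] fin _ A] by auto
    also have "\<dots> = (\<Oplus>\<^bsub>M\<^esub>b\<in>?A. c x b \<odot>\<^bsub>M\<^esub> b \<oplus>\<^bsub>M\<^esub> c y b \<odot>\<^bsub>M\<^esub> b)"
      using A xy by (intro M.finsum_addf[symmetric]) (auto simp: ccl)
    also have "\<dots> = (\<Oplus>\<^bsub>M\<^esub>b\<in>?A. (c x b \<oplus>\<^bsub>R\<^esub> c y b) \<odot>\<^bsub>M\<^esub> b)"
      using A xy by (intro M.finsum_cong') (auto simp: ccl M.smult_l_distr)
    also have "\<dots> = (\<Oplus>\<^bsub>M\<^esub>b\<in>{b. c x b \<oplus>\<^bsub>R\<^esub> c y b \<noteq> \<zero>\<^bsub>R\<^esub>}. (c x b \<oplus>\<^bsub>R\<^esub> c y b) \<odot>\<^bsub>M\<^esub> b)"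
      using A sub xy fin by (intro finsum_superset[symmetric]) (auto simp: ccl intro: M.abelian_monoid_axioms)
    finally show "co B (x \<oplus>\<^bsub>M\<^esub> y) (\<lambda>b. c x b \<oplus>\<^bsub>R\<^esub> c y b)"
      using cx[OF xy(1)] cx[OF xy(2)] finite_subset[OF sub fin] by (auto simp: co_def)
  qed (use that in auto)
  have smult: "c (r \<odot>\<^bsub>M\<^esub> x) = (\<lambda>b. r \<otimes>\<^bsub>R\<^esub> c x b)" if r: "r \<in> carrier R" and x: "x \<in> carrier M" for r x
  proof (rule cuniq)
    let ?A = "{b. c x b \<noteq> \<zero>\<^bsub>R\<^esub>}"
    have fin: "finite ?A" using cx x by (auto simp: co_def)
    have A: "?A \<subseteq> carrier M" using subc[OF cx] x by auto
    have sub: "{b. r \<otimes>\<^bsub>R\<^esub> c x b \<noteq> \<zero>\<^bsub>R\<^esub>} \<subseteq> ?A" using r by auto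
    have "r \<odot>\<^bsub>M\<^esub> x = r \<odot>\<^bsub>M\<^esub> (\<Oplus>\<^bsub>M\<^esub>b\<in>?A. c x b \<odot>\<^bsub>M\<^esub> b)"
      using sup[OF cx[OF x] fin _ A] by auto
    also have "\<dots> = (\<Oplus>\<^bsub>M\<^esub>b\<in>?A. r \<odot>\<^bsub>M\<^esub> (c x b \<odot>\<^bsub>M\<^esub> b))"
      using A x r fin by (intro M.finsum_smult_ldistr) (auto simp: ccl subset_iff)
    also have "\<dots> = (\<Oplus>\<^bsub>M\<^esub>b\<in>?A. (r \<otimes>\<^bsub>R\<^esub> c x b) \<odot>\<^bsub>M\<^esub> b)"
      using A x r by (intro M.finsum_cong') (auto simp: ccl M.smult_assoc1)
    also have "\<dots> = (\<Oplus>\<^bsub>M\<^esub>b\<in>{b. r \<otimes>\<^bsub>R\<^esub> c x b \<noteq> \<zero>\<^bsub>R\<^esub>}. (r \<otimes>\<^bsub>R\<^esub> c x b) \<odot>\<^bsub>M\<^esub> b)"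
      using A sub x r fin by (intro finsum_superset[symmetric]) (auto simp: ccl intro: M.abelian_monoid_axioms)
    finally show "co B (r \<odot>\<^bsub>M\<^esub> x) (\<lambda>b. r \<otimes>\<^bsub>R\<^esub> c x b)"
      using cx[OF x] r finite_subset[OF sub fin] by (auto simp: co_def)
  qed (use that in auto)
  have delta: "c l k = (if k = l then \<one>\<^bsub>R\<^esub> else \<zero>\<^bsub>R\<^esub>)" if "l \<in> B" for k l
  proof -
    have "co B l (\<lambda>k. if k = l then \<one>\<^bsub>R\<^esub> else \<zero>\<^bsub>R\<^esub>)"
    proof (cases "\<one>\<^bsub>R\<^esub> = \<zero>\<^bsub>R\<^esub>")
      case True
      have "l = \<one>\<^bsub>R\<^esub> \<odot>\<^bsub>M\<^esub> l" using that B by auto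
      also have "\<dots> = \<zero>\<^bsub>M\<^esub>" using that B by (simp add: True subset_iff del: M.smult_one)
      finally show ?thesis using True by (simp add: co_def)
    next
      case False
      have "{b. (if b = l then \<one>\<^bsub>R\<^esub> else \<zero>\<^bsub>R\<^esub>) \<noteq> \<zero>\<^bsub>R\<^esub>} = {l}" using False by auto
      moreover have "l \<in> carrier M" using that B by auto
      ultimately show ?thesis using that by (simp add: co_def)
    qed
    from cuniq[OF _ this] show ?thesis using that B by auto
  qed
  have "spans R M ((\<lambda>b. b) ` B)"
    unfolding spans_def
  proof (intro conjI allI impI)
    fix L assume "submodule L R M \<and> (\<lambda>b. b) ` B \<subseteq> L"
    then have L: "submodule L R M" "B \<subseteq> L" by auto
    show "carrier M \<subseteq> L"
    proof
      fix x assume x: "x \<in> carrier M"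
      have "(\<Oplus>\<^bsub>M\<^esub>b\<in>{b. c x b \<noteq> \<zero>\<^bsub>R\<^esub>}. c x b \<odot>\<^bsub>M\<^esub> b) \<in> L"
        using cx[OF x] L by (intro submodule_finsum[OF M L(1)] submodule_smult[OF L(1)]) (auto simp: co_def)
      then show "x \<in> L" using cx[OF x] by (auto simp: co_def)
    qed
  qed (use B in auto)
  then have "dual_basis R M B (\<lambda>b. b) (\<lambda>b x. c x b)"
    unfolding dual_basis_def using M B
    by (auto intro!: module_homI simp: ccl add smult delta)
  then show thesis by (rule that)
qed

text \<open>Applying the functionals to a linear combination shows that its coefficients are unique.  The zero
  ring is treated separately, since there biorthogonality does not force \<open>b\<close> to be injective.\<close>

lemma dual_basis_imp_free_module:
  assumes "dual_basis R M K b \<kappa>"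
  shows "free_module R M"
proof -
  have M: "module R M"
    and hom: "\<And>k. k \<in> K \<Longrightarrow> \<kappa> k \<in> module_hom R M (regular_module R)"
    and delta: "\<And>k l. k \<in> K \<Longrightarrow> l \<in> K \<Longrightarrow> \<kappa> k (b l) = (if k = l then \<one>\<^bsub>R\<^esub> else \<zero>\<^bsub>R\<^esub>)"
    using assms by (auto simp: dual_basis_def)
  have bM: "k \<in> K \<Longrightarrow> b k \<in> carrier M" for k using dual_basis_mem[OF assms] .
  interpret M: module R M by fact
  have RR: "module R (regular_module R)" by (rule module_regular) (rule M.is_cring)
  have kc: "\<kappa> k x \<in> carrier R" if "k \<in> K" "x \<in> carrier M" for k x
    using module_hom_closed[OF hom[OF that(1)] that(2)] by simp
  show ?thesis
  proof (cases "\<one>\<^bsub>R\<^esub> = \<zero>\<^bsub>R\<^esub>")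
    case True
    have R0: "r = \<zero>\<^bsub>R\<^esub>" if "r \<in> carrier R" for r
      using that True by (metis M.R.l_one M.R.l_null)
    have M0: "x = \<zero>\<^bsub>M\<^esub>" if "x \<in> carrier M" for x
      using that True by (metis M.smult_l_null M.smult_one)
    show ?thesis unfolding free_module_def
    proof (intro conjI exI[of _ "{}"] ballI ex1I[of _ "\<lambda>_. \<zero>\<^bsub>R\<^esub>"])
      show "module R M" by fact
    next
      fix x assume "x \<in> carrier M"
      then show "x = (\<Oplus>\<^bsub>M\<^esub>b\<in>{b. \<zero>\<^bsub>R\<^esub> \<noteq> \<zero>\<^bsub>R\<^esub>}. \<zero>\<^bsub>R\<^esub> \<odot>\<^bsub>M\<^esub> b)" using M0 by simp
    qed auto
  next
    case False
    have inj: "inj_on b K"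
      by (rule inj_onI) (metis delta False)
    have ex: "\<exists>c. (\<forall>m. c m \<in> carrier R) \<and> (\<forall>m. m \<notin> b ` K \<longrightarrow> c m = \<zero>\<^bsub>R\<^esub>) \<and>
       finite {m. c m \<noteq> \<zero>\<^bsub>R\<^esub>} \<and> x = (\<Oplus>\<^bsub>M\<^esub>m\<in>{m. c m \<noteq> \<zero>\<^bsub>R\<^esub>}. c m \<odot>\<^bsub>M\<^esub> m)" if x: "x \<in> carrier M" for x
    proof -
      obtain A where A: "A \<subseteq> K" "finite A" "\<forall>k\<in>K - A. \<kappa> k x = \<zero>\<^bsub>R\<^esub>" "x = (\<Oplus>\<^bsub>M\<^esub>k\<in>A. \<kappa> k x \<odot>\<^bsub>M\<^esub> b k)"
        using dual_basis_expansion[OF assms x] by auto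
      define c where "c m = (if m \<in> b ` K then \<kappa> (the_inv_into K b m) x else \<zero>\<^bsub>R\<^esub>)" for m
      have cb: "c (b k) = \<kappa> k x" if "k \<in> K" for k
        using that inj by (simp add: c_def the_inv_into_f_f)
      have sub: "{m. c m \<noteq> \<zero>\<^bsub>R\<^esub>} \<subseteq> b ` A"
        using A(3) cb by (auto simp: c_def split: if_splits)
      have cc: "c m \<in> carrier R" for m
        using x kc cb by (auto simp: c_def the_inv_into_f_f[OF inj])
      have "(\<Oplus>\<^bsub>M\<^esub>m\<in>{m. c m \<noteq> \<zero>\<^bsub>R\<^esub>}. c m \<odot>\<^bsub>M\<^esub> m) = (\<Oplus>\<^bsub>M\<^esub>m\<in>b ` A. c m \<odot>\<^bsub>M\<^esub> m)"
        using A sub bM cc by (intro finsum_superset) (auto intro: M.abelian_monoid_axioms)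
      also have "\<dots> = (\<Oplus>\<^bsub>M\<^esub>k\<in>A. c (b k) \<odot>\<^bsub>M\<^esub> b k)"
        using A bM cc inj_on_subset[OF inj A(1)] by (intro M.finsum_reindex) auto
      also have "\<dots> = (\<Oplus>\<^bsub>M\<^esub>k\<in>A. \<kappa> k x \<odot>\<^bsub>M\<^esub> b k)"
        using A(1) bM kc[OF _ x] cb by (intro M.finsum_cong') auto
      finally have "x = (\<Oplus>\<^bsub>M\<^esub>m\<in>{m. c m \<noteq> \<zero>\<^bsub>R\<^esub>}. c m \<odot>\<^bsub>M\<^esub> m)" using A(4) by simp
      moreover have "c m = \<zero>\<^bsub>R\<^esub>" if "m \<notin> b ` K" for m using that by (auto simp: c_def)
      ultimately show ?thesis using cc finite_subset[OF sub] A(2) by blast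
    qed
    have uniq: "c (b k) = \<kappa> k x"
      if x: "x \<in> carrier M" and k: "k \<in> K" and c: "\<forall>m. c m \<in> carrier R" "\<forall>m. m \<notin> b ` K \<longrightarrow> c m = \<zero>\<^bsub>R\<^esub>"
       "finite {m. c m \<noteq> \<zero>\<^bsub>R\<^esub>}" "x = (\<Oplus>\<^bsub>M\<^esub>m\<in>{m. c m \<noteq> \<zero>\<^bsub>R\<^esub>}. c m \<odot>\<^bsub>M\<^esub> m)" for x k c
    proof -
      let ?S = "{m. c m \<noteq> \<zero>\<^bsub>R\<^esub>}"
      have S: "?S \<subseteq> b ` K" using c by auto
      have "\<kappa> k x = (\<Oplus>\<^bsub>regular_module R\<^esub>m\<in>?S. \<kappa> k (c m \<odot>\<^bsub>M\<^esub> m))"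
        unfolding c(4) using S bM c(1)
        by (intro module_hom_finsum[OF hom[OF k] M RR]) (auto simp: c(4)[symmetric])
      also have "\<dots> = (\<Oplus>\<^bsub>regular_module R\<^esub>m\<in>?S. if m = b k then c m else \<zero>\<^bsub>R\<^esub>)"
      proof (rule abelian_monoid.finsum_cong'[OF abelian_group.axioms(1)[OF module_abelian_group[OF RR]] refl])
        fix m assume "m \<in> ?S"
        then obtain l where l: "m = b l" "l \<in> K" using S by auto
        then show "\<kappa> k (c m \<odot>\<^bsub>M\<^esub> m) = (if m = b k then c m else \<zero>\<^bsub>R\<^esub>)"
          using c(1) k inj bM by (auto simp: module_hom_smult[OF hom] delta inj_on_eq_iff)
      qed (use c(1) in auto)
      also have "\<dots> = (\<Oplus>\<^bsub>regular_module R\<^esub>m\<in>insert (b k) ?S. if m = b k then c m else \<zero>\<^bsub>R\<^esub>)"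
        using c by (intro finsum_superset[OF abelian_group.axioms(1)[OF module_abelian_group[OF RR]]]) auto
      also have "\<dots> = (\<Oplus>\<^bsub>regular_module R\<^esub>m\<in>{b k}. if m = b k then c m else \<zero>\<^bsub>R\<^esub>)"
        using c by (intro finsum_superset[OF abelian_group.axioms(1)[OF module_abelian_group[OF RR]], symmetric]) auto
      also have "\<dots> = c (b k)"
      proof -
        interpret RM: module R "regular_module R" by fact
        have "(\<Oplus>\<^bsub>regular_module R\<^esub>m\<in>{b k}. if m = b k then c m else \<zero>\<^bsub>R\<^esub>)
          = c (b k) \<oplus>\<^bsub>regular_module R\<^esub> \<zero>\<^bsub>regular_module R\<^esub>"
          using c(1) by (subst RM.finsum_insert) auto
        then show ?thesis using c(1) by simp
      qed
      finally show ?thesis ..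
    qed
    have "\<exists>!c. (\<forall>m. c m \<in> carrier R) \<and> (\<forall>m. m \<notin> b ` K \<longrightarrow> c m = \<zero>\<^bsub>R\<^esub>) \<and>
       finite {m. c m \<noteq> \<zero>\<^bsub>R\<^esub>} \<and> x = (\<Oplus>\<^bsub>M\<^esub>m\<in>{m. c m \<noteq> \<zero>\<^bsub>R\<^esub>}. c m \<odot>\<^bsub>M\<^esub> m)" if x: "x \<in> carrier M" for x
    proof (rule ex_ex1I)
      fix c d
      assume c: "(\<forall>m. c m \<in> carrier R) \<and> (\<forall>m. m \<notin> b ` K \<longrightarrow> c m = \<zero>\<^bsub>R\<^esub>) \<and>
       finite {m. c m \<noteq> \<zero>\<^bsub>R\<^esub>} \<and> x = (\<Oplus>\<^bsub>M\<^esub>m\<in>{m. c m \<noteq> \<zero>\<^bsub>R\<^esub>}. c m \<odot>\<^bsub>M\<^esub> m)"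
      and d: "(\<forall>m. d m \<in> carrier R) \<and> (\<forall>m. m \<notin> b ` K \<longrightarrow> d m = \<zero>\<^bsub>R\<^esub>) \<and>
       finite {m. d m \<noteq> \<zero>\<^bsub>R\<^esub>} \<and> x = (\<Oplus>\<^bsub>M\<^esub>m\<in>{m. d m \<noteq> \<zero>\<^bsub>R\<^esub>}. d m \<odot>\<^bsub>M\<^esub> m)"
      show "c = d"
      proof
        fix m show "c m = d m"
        proof (cases "m \<in> b ` K")
          case True
          then obtain k where k: "k \<in> K" "m = b k" by auto
          show ?thesis using uniq[OF x k(1), of c] uniq[OF x k(1), of d] c d k by metis
        next
          case False
          then show ?thesis using c d by metis
        qed
      qed
    qed (rule ex[OF x])
    then show ?thesis unfolding free_module_def using M bM by (intro conjI exI[of _ "b ` K"]) auto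
  qed
qed

section \<open>Homomorphisms out of direct sums\<close>

definition dsum_lift ::
  "('k \<Rightarrow> ('a, 'm) module) \<Rightarrow> ('a, 'p) module \<Rightarrow> ('k \<Rightarrow> 'm \<Rightarrow> 'p) \<Rightarrow> ('k \<Rightarrow> 'm) \<Rightarrow> 'p" where
  "dsum_lift M P h f = (\<Oplus>\<^bsub>P\<^esub>k\<in>{k. f k \<noteq> \<zero>\<^bsub>M k\<^esub>}. h k (f k))"

text \<open>The sum over the support is awkward under addition; sums over a common finite set that contains the
  supports involved are not.\<close>

lemma dsum_lift_superset:
  assumes "module R P" "\<And>k. module R (M k)" "\<And>k. k \<in> K \<Longrightarrow> h k \<in> module_hom R (M k) P"
    and "f \<in> carrier (dsum_module K M)" "finite S" "{k. f k \<noteq> \<zero>\<^bsub>M k\<^esub>} \<subseteq> S" "S \<subseteq> K"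
  shows "dsum_lift M P h f = (\<Oplus>\<^bsub>P\<^esub>k\<in>S. h k (f k))"
  unfolding dsum_lift_def
proof (rule finsum_superset)
  show "abelian_monoid P" using module_abelian_group[OF assms(1)] by (simp add: abelian_group_def)
  show "h k (f k) \<in> carrier P" if "k \<in> S" for k
    using that assms(7) module_hom_closed[OF assms(3) dsum_closed[OF assms(4)]] by auto
  show "h k (f k) = \<zero>\<^bsub>P\<^esub>" if "k \<in> S" "k \<notin> {k. f k \<noteq> \<zero>\<^bsub>M k\<^esub>}" for k
    using that assms(7) module_hom_zero[OF assms(3) assms(2) assms(1)] by auto
qed (use assms in auto)

lemma dsum_support:
  assumes "f \<in> carrier (dsum_module K M)"
  shows "finite {k. f k \<noteq> \<zero>\<^bsub>M k\<^esub>}" "{k. f k \<noteq> \<zero>\<^bsub>M k\<^esub>} \<subseteq> K"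
  using assms by (auto simp: dsum_carrier_iff)

lemma dsum_lift_hom:
  assumes "module R P" "\<And>k. module R (M k)" "\<And>k. k \<in> K \<Longrightarrow> h k \<in> module_hom R (M k) P"
  shows "dsum_lift M P h \<in> module_hom R (dsum_module K M) P"
proof (rule module_homI)
  interpret P: module R P by fact
  have D: "module R (dsum_module K M)" using module_dsum[OF P.is_cring assms(2)] .
  interpret D: module R "dsum_module K M" by fact
  have hc: "h k (f k) \<in> carrier P" if "k \<in> K" "f \<in> carrier (dsum_module K M)" for k f
    using module_hom_closed[OF assms(3)[OF that(1)] dsum_closed[OF that(2)]] .
  show "dsum_lift M P h f \<in> carrier P" if f: "f \<in> carrier (dsum_module K M)" for f
    unfolding dsum_lift_def using dsum_support[OF f] hc[OF _ f] by (intro P.finsum_closed) auto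
  fix f assume f: "f \<in> carrier (dsum_module K M)"
  {
    fix g assume g: "g \<in> carrier (dsum_module K M)"
    let ?S = "{k. f k \<noteq> \<zero>\<^bsub>M k\<^esub>} \<union> {k. g k \<noteq> \<zero>\<^bsub>M k\<^esub>}"
    have S: "finite ?S" "?S \<subseteq> K" using dsum_support[OF f] dsum_support[OF g] by auto
    have mz: "\<zero>\<^bsub>M k\<^esub> \<oplus>\<^bsub>M k\<^esub> \<zero>\<^bsub>M k\<^esub> = \<zero>\<^bsub>M k\<^esub>" for k
      using assms(2)[of k] by (simp add: module_def abelian_group_def abelian_monoid.l_zero abelian_monoid.zero_closed)
    have "dsum_lift M P h (f \<oplus>\<^bsub>dsum_module K M\<^esub> g) = (\<Oplus>\<^bsub>P\<^esub>k\<in>?S. h k (f k \<oplus>\<^bsub>M k\<^esub> g k))"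
      using dsum_lift_superset[OF assms D.M.a_closed[OF f g] S(1) _ S(2)] mz by force
    also have "\<dots> = (\<Oplus>\<^bsub>P\<^esub>k\<in>?S. h k (f k) \<oplus>\<^bsub>P\<^esub> h k (g k))"
      using S(2) by (intro P.finsum_cong')
        (auto simp: module_hom_add[OF assms(3)] dsum_closed[OF f] dsum_closed[OF g] hc[OF _ f] hc[OF _ g])
    also have "\<dots> = dsum_lift M P h f \<oplus>\<^bsub>P\<^esub> dsum_lift M P h g"
      using S(2) by (subst P.finsum_addf)
        (auto simp: hc[OF _ f] hc[OF _ g] dsum_lift_superset[OF assms f S(1) _ S(2)]
          dsum_lift_superset[OF assms g S(1) _ S(2)])
    finally show "dsum_lift M P h (f \<oplus>\<^bsub>dsum_module K M\<^esub> g) = dsum_lift M P h f \<oplus>\<^bsub>P\<^esub> dsum_lift M P h g" .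
  }
  fix r assume r: "r \<in> carrier R"
  let ?S = "{k. f k \<noteq> \<zero>\<^bsub>M k\<^esub>}"
  note S = dsum_support[OF f]
  have "dsum_lift M P h (r \<odot>\<^bsub>dsum_module K M\<^esub> f) = (\<Oplus>\<^bsub>P\<^esub>k\<in>?S. h k (r \<odot>\<^bsub>M k\<^esub> f k))"
    using dsum_lift_superset[OF assms D.smult_closed[OF r f] S(1) _ S(2)]
      module.smult_r_null[OF assms(2) r] by force
  also have "\<dots> = (\<Oplus>\<^bsub>P\<^esub>k\<in>?S. r \<odot>\<^bsub>P\<^esub> h k (f k))"
    using S(2) by (intro P.finsum_cong')
      (auto simp: module_hom_smult[OF assms(3)] r dsum_closed[OF f] hc[OF _ f])
  also have "\<dots> = r \<odot>\<^bsub>P\<^esub> dsum_lift M P h f"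
    unfolding dsum_lift_def using S hc[OF _ f] r by (intro P.finsum_smult_ldistr[symmetric]) auto
  finally show "dsum_lift M P h (r \<odot>\<^bsub>dsum_module K M\<^esub> f) = r \<odot>\<^bsub>P\<^esub> dsum_lift M P h f" .
qed

lemma dsum_lift_inj:
  assumes "module R P" "\<And>k. module R (M k)" "\<And>k. k \<in> K \<Longrightarrow> h k \<in> module_hom R (M k) P"
    and "k \<in> K" "x \<in> carrier (M k)"
  shows "dsum_lift M P h (dsum_inj M k x) = h k x"
proof -
  interpret P: module R P by fact
  have c: "dsum_inj M k x \<in> carrier (dsum_module K M)"
    using module_hom_closed[OF dsum_inj_hom[of R M, OF P.is_cring assms(2,4)] assms(5)] .
  have "dsum_lift M P h (dsum_inj M k x) = (\<Oplus>\<^bsub>P\<^esub>l\<in>{k}. h l (dsum_inj M k x l))"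
    using assms(4) by (intro dsum_lift_superset[OF assms(1-3) c]) (auto simp: dsum_inj_def)
  then show ?thesis using module_hom_closed[OF assms(3)[OF assms(4)] assms(5)] by simp
qed

lemma dsum_hom_eq:
  assumes "\<And>k. module R (M k)" "module R P"
    and "f \<in> module_hom R (dsum_module K M) P" "g \<in> module_hom R (dsum_module K M) P"
    and "\<And>k x. k \<in> K \<Longrightarrow> x \<in> carrier (M k) \<Longrightarrow> f (dsum_inj M k x) = g (dsum_inj M k x)"
    and "u \<in> carrier (dsum_module K M)"
  shows "f u = g u"
proof -
  have R: "cring R" using module_cring[OF assms(2)] .
  show ?thesis
  proof (rule spans_hom_eq[OF dsum_spans[of R M K, OF R assms(1)] module_dsum[of R M, OF R assms(1)] assms(2-4)])
    show "f x = g x" if "x \<in> (\<Union>k\<in>K. dsum_inj M k ` carrier (M k))" for x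
      using that assms(5) by blast
  qed (rule assms(6))
qed

section \<open>Tensor products\<close>

text \<open>Tensors are cosets of formal sums.  Everything about them is first proved for formal sums modulo
  the subgroup \<open>null\<close> generated by the relations and then transported along the quotient map \<open>cls\<close>.\<close>

locale module_pair =
  fixes R :: "('a, 'r) ring_scheme" and M :: "('a, 'm) module" and N :: "('a, 'n) module"
  assumes M: "module R M" and N: "module R N"
begin

interpretation M: module R M by (rule M)
interpretation N: module R N by (rule N)

abbreviation G where "G \<equiv> tensor_free M N"
abbreviation null where "null \<equiv> tensor_null R M N"
abbreviation T where "T \<equiv> tensor_module R M N"
abbreviation pure where "pure \<equiv> pure_tensor R M N"

interpretation G: comm_group G by (rule abelian_free_Abelian_group)

lemma keys_diff_subset: "Poly_Mapping.keys u \<subseteq> A \<Longrightarrow> Poly_Mapping.keys v \<subseteq> A \<Longrightarrow>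
    Poly_Mapping.keys (u - v) \<subseteq> A"
  for u v :: "'z \<Rightarrow>\<^sub>0 int"
  using keys_diff[of u v] by (rule subset_trans) (rule Un_least)

lemma keys_of_subset: "a \<in> A \<Longrightarrow> Poly_Mapping.keys (frag_of a) \<subseteq> A"
  by simp

lemma frag_induct [consumes 1, case_names zero diff gen]:
  assumes "Poly_Mapping.keys u \<subseteq> carrier M \<times> carrier N" "Q 0"
    and "\<And>u v. Poly_Mapping.keys u \<subseteq> carrier M \<times> carrier N \<Longrightarrow> Poly_Mapping.keys v \<subseteq> carrier M \<times> carrier N \<Longrightarrow>
           Q u \<Longrightarrow> Q v \<Longrightarrow> Q (u - v)"
    and "\<And>x y. x \<in> carrier M \<Longrightarrow> y \<in> carrier N \<Longrightarrow> Q (frag_of (x, y))"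
  shows "Q u"
  by (rule free_Abelian_group_induct[OF assms(1)]) (use assms(2-4) in auto)

lemma rels_carrier: "tensor_rels R M N \<subseteq> carrier G"
proof
  fix u assume "u \<in> tensor_rels R M N"
  then have "Poly_Mapping.keys u \<subseteq> carrier M \<times> carrier N"
    unfolding tensor_rels_def
    by (elim UnE CollectE exE conjE, simp_all only:) (intro keys_diff_subset keys_of_subset; simp)+
  then show "u \<in> carrier G" by simp
qed

lemma null_subgroup: "subgroup null G"
  unfolding tensor_null_def by (rule G.generate_is_subgroup[OF rels_carrier])

lemma null_carrier: "u \<in> null \<Longrightarrow> Poly_Mapping.keys u \<subseteq> carrier M \<times> carrier N"
  using subsetD[OF subgroup.subset[OF null_subgroup], of u] by simp

lemma null_zero: "0 \<in> null"
  using subgroup.one_closed[OF null_subgroup] by simp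

lemma null_add: "u \<in> null \<Longrightarrow> v \<in> null \<Longrightarrow> u + v \<in> null"
  using subgroup.m_closed[OF null_subgroup, of u v] by simp

lemma null_minus: "u \<in> null \<Longrightarrow> - u \<in> null"
  using subgroup.m_inv_closed[OF null_subgroup, of u] null_carrier[of u] by simp

lemma null_diff: "u \<in> null \<Longrightarrow> v \<in> null \<Longrightarrow> u - v \<in> null"
  using null_add[of u "- v"] null_minus[of v] by simp

lemma rels_null: "u \<in> tensor_rels R M N \<Longrightarrow> u \<in> null"
  unfolding tensor_null_def by (rule generate.incl)

lemma null_induct [consumes 1, case_names zero rel diff]:
  assumes "u \<in> null" "P 0" "\<And>u. u \<in> tensor_rels R M N \<Longrightarrow> P u"
    and "\<And>u v. u \<in> null \<Longrightarrow> v \<in> null \<Longrightarrow> P u \<Longrightarrow> P v \<Longrightarrow> P (u - v)"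
  shows "P u"
proof -
  have neg: "P (- u)" if "u \<in> null" "P u" for u
    using assms(4)[OF null_zero that(1) assms(2) that(2)] by simp
  show ?thesis using assms(1) unfolding tensor_null_def
  proof (induction u rule: generate.induct)
    case one
    then show ?case using assms(2) by simp
  next
    case (incl h)
    then show ?case by (rule assms(3))
  next
    case (inv h)
    then show ?case
      using neg[OF rels_null[OF inv] assms(3)[OF inv]] null_carrier[OF rels_null[OF inv]] by simp
  next
    case (eng u v)
    then have "u \<in> null" "v \<in> null" by (auto simp: tensor_null_def)
    with eng neg assms(4)[of u "- v"] null_minus show ?case by simp
  qed
qed

definition cls :: "('m \<times> 'n \<Rightarrow>\<^sub>0 int) \<Rightarrow> ('m \<times> 'n \<Rightarrow>\<^sub>0 int) set" where
  "cls u = null #>\<^bsub>G\<^esub> u"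

lemma mem_cls: "v \<in> cls u \<longleftrightarrow> v - u \<in> null"
  by (auto simp: cls_def r_coset_def) (metis diff_add_cancel)

lemma cls_self: "u \<in> cls u"
  by (simp add: mem_cls null_zero)

lemma cls_eqI:
  assumes "u - v \<in> null" shows "cls u = cls v"
proof (rule Set.set_eqI)
  fix w
  show "w \<in> cls u \<longleftrightarrow> w \<in> cls v" unfolding mem_cls
    using assms null_add[of "w - u" "u - v"] null_diff[of "w - v" "u - v"] by auto
qed

lemma pure_eq_cls: "pure x y = cls (frag_of (x, y))"
  by (simp add: pure_tensor_def cls_def)

lemma T_zero: "\<zero>\<^bsub>T\<^esub> = cls 0"
  by (auto simp: tensor_module_def mem_cls)

lemma T_add: "cls u \<oplus>\<^bsub>T\<^esub> cls v = cls (u + v)"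
proof -
  have "(w \<in> cls u <#>\<^bsub>G\<^esub> cls v) = (w \<in> cls (u + v))" for w
  proof
    assume "w \<in> cls u <#>\<^bsub>G\<^esub> cls v"
    then obtain a b where "a \<in> cls u" "b \<in> cls v" "w = a + b" by (auto simp: set_mult_def)
    then show "w \<in> cls (u + v)" using null_add[of "a - u" "b - v"] by (simp add: mem_cls algebra_simps)
  next
    assume "w \<in> cls (u + v)"
    then have "w - v \<in> cls u" by (simp add: mem_cls algebra_simps)
    then have "\<exists>a\<in>cls u. \<exists>b\<in>cls v. w = a + b"
      using cls_self[of v] by (intro bexI[of _ "w - v"] bexI[of _ v]) simp_all
    then show "w \<in> cls u <#>\<^bsub>G\<^esub> cls v" by (auto simp: set_mult_def)
  qed
  then show ?thesis by (auto simp: tensor_module_def)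
qed

lemma T_carrier: "carrier T = cls ` {u. Poly_Mapping.keys u \<subseteq> carrier M \<times> carrier N}"
  by (auto simp: tensor_module_def RCOSETS_def cls_def)

definition scal :: "'a \<Rightarrow> ('m \<times> 'n \<Rightarrow>\<^sub>0 int) \<Rightarrow> ('m \<times> 'n \<Rightarrow>\<^sub>0 int)" where
  "scal r = frag_extend (\<lambda>(x, y). frag_of (r \<odot>\<^bsub>M\<^esub> x, y))"

lemma scal_simps [simp]:
  "scal r (u - v) = scal r u - scal r v" "scal r (u + v) = scal r u + scal r v" "scal r 0 = 0"
  "scal r (frag_of (x, y)) = frag_of (r \<odot>\<^bsub>M\<^esub> x, y)"
  by (simp_all add: scal_def frag_extend_diff frag_extend_add)

lemma scal_keys:
  assumes "r \<in> carrier R" "Poly_Mapping.keys u \<subseteq> carrier M \<times> carrier N"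
  shows "Poly_Mapping.keys (scal r u) \<subseteq> carrier M \<times> carrier N"
  using assms(2)
  by (induction u rule: frag_induct) (simp_all add: assms(1) keys_diff_subset)

lemma rel_left: "x \<in> carrier M \<Longrightarrow> x' \<in> carrier M \<Longrightarrow> y \<in> carrier N \<Longrightarrow>
    frag_of (x \<oplus>\<^bsub>M\<^esub> x', y) - frag_of (x, y) - frag_of (x', y) \<in> null"
  by (intro rels_null) (auto simp: tensor_rels_def)

lemma rel_right: "x \<in> carrier M \<Longrightarrow> y \<in> carrier N \<Longrightarrow> y' \<in> carrier N \<Longrightarrow>
    frag_of (x, y \<oplus>\<^bsub>N\<^esub> y') - frag_of (x, y) - frag_of (x, y') \<in> null"
  by (intro rels_null) (auto simp: tensor_rels_def)

lemma rel_balance: "r \<in> carrier R \<Longrightarrow> x \<in> carrier M \<Longrightarrow> y \<in> carrier N \<Longrightarrow>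
    frag_of (r \<odot>\<^bsub>M\<^esub> x, y) - frag_of (x, r \<odot>\<^bsub>N\<^esub> y) \<in> null"
  by (intro rels_null) (auto simp: tensor_rels_def)

text \<open>Each relation is mapped to a relation of the same kind; for the balancing relations this uses that
  \<open>R\<close> is commutative.\<close>

lemma scal_null:
  assumes "r \<in> carrier R" "u \<in> null"
  shows "scal r u \<in> null"
  using assms(2)
proof (induction u rule: null_induct)
  case (rel u)
  consider x x' y where "u = frag_of (x \<oplus>\<^bsub>M\<^esub> x', y) - frag_of (x, y) - frag_of (x', y)"
      "x \<in> carrier M" "x' \<in> carrier M" "y \<in> carrier N"
    | x y y' where "u = frag_of (x, y \<oplus>\<^bsub>N\<^esub> y') - frag_of (x, y) - frag_of (x, y')"
      "x \<in> carrier M" "y \<in> carrier N" "y' \<in> carrier N"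
    | t x y where "u = frag_of (t \<odot>\<^bsub>M\<^esub> x, y) - frag_of (x, t \<odot>\<^bsub>N\<^esub> y)"
      "t \<in> carrier R" "x \<in> carrier M" "y \<in> carrier N"
    using rel unfolding tensor_rels_def by blast
  then show ?case
  proof cases
    case 1
    then show ?thesis using rel_left[of "r \<odot>\<^bsub>M\<^esub> x" "r \<odot>\<^bsub>M\<^esub> x'" y] assms(1) by (simp add: M.smult_r_distr)
  next
    case 2
    then show ?thesis using rel_right[of "r \<odot>\<^bsub>M\<^esub> x" y y'] assms(1) by simp
  next
    case 3
    have "r \<odot>\<^bsub>M\<^esub> (t \<odot>\<^bsub>M\<^esub> x) = t \<odot>\<^bsub>M\<^esub> (r \<odot>\<^bsub>M\<^esub> x)"
      using 3 assms(1) by (metis M.smult_assoc1 M.R.m_comm)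
    then show ?thesis using 3 rel_balance[of t "r \<odot>\<^bsub>M\<^esub> x" y] assms(1) by simp
  qed
qed (auto simp: null_zero null_diff)

lemma T_smult:
  assumes "r \<in> carrier R"
  shows "r \<odot>\<^bsub>T\<^esub> cls u = cls (scal r u)"
proof -
  have "r \<odot>\<^bsub>T\<^esub> cls u = (\<Union>v\<in>cls u. cls (scal r v))"
    by (simp add: tensor_module_def cls_def scal_def)
  moreover have "cls (scal r v) = cls (scal r u)" if "v \<in> cls u" for v
    using that scal_null[OF assms, of "v - u"] by (intro cls_eqI) (simp add: mem_cls)
  ultimately show ?thesis using cls_self by blast
qed

lemma T_module: "module R T"
proof (rule module_of_inverses)
  show "cring R" by (rule M.is_cring)
  note sub = keys_diff_subset
  have add: "Poly_Mapping.keys (u + v) \<subseteq> A" if "Poly_Mapping.keys u \<subseteq> A" "Poly_Mapping.keys v \<subseteq> A"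
    for u v :: "'m \<times> 'n \<Rightarrow>\<^sub>0 int" and A using Poly_Mapping.keys_add[of u v] that by auto
  show "x \<oplus>\<^bsub>T\<^esub> y \<in> carrier T" if "x \<in> carrier T" "y \<in> carrier T" for x y
    using that add by (auto simp: T_carrier T_add)
  show "x \<oplus>\<^bsub>T\<^esub> y = y \<oplus>\<^bsub>T\<^esub> x" if "x \<in> carrier T" "y \<in> carrier T" for x y
    using that by (auto simp only: T_carrier T_add add.commute image_iff)
  show "\<zero>\<^bsub>T\<^esub> \<in> carrier T" by (auto simp: T_carrier T_zero)
  show "\<exists>y\<in>carrier T. y \<oplus>\<^bsub>T\<^esub> x = \<zero>\<^bsub>T\<^esub>" if "x \<in> carrier T" for x
  proof -
    obtain u where u: "x = cls u" "Poly_Mapping.keys u \<subseteq> carrier M \<times> carrier N"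
      using \<open>x \<in> carrier T\<close> by (auto simp: T_carrier)
    then show ?thesis by (intro bexI[of _ "cls (- u)"]) (auto simp: T_carrier T_zero T_add)
  qed
  show "a \<odot>\<^bsub>T\<^esub> x \<in> carrier T" if "a \<in> carrier R" "x \<in> carrier T" for a x
    using that scal_keys by (auto simp: T_carrier T_smult)
  have smult_eqI: "f a \<in> null" if "Poly_Mapping.keys a \<subseteq> carrier M \<times> carrier N"
    "f 0 = 0" "\<And>u v. f (u - v) = f u - f v" "\<And>x y. x \<in> carrier M \<Longrightarrow> y \<in> carrier N \<Longrightarrow> f (frag_of (x, y)) \<in> null" for a f
    using that(1) by (induction a rule: frag_induct) (auto simp: that null_zero null_diff)
  show "(a \<oplus>\<^bsub>R\<^esub> b) \<odot>\<^bsub>T\<^esub> x = (a \<odot>\<^bsub>T\<^esub> x) \<oplus>\<^bsub>T\<^esub> (b \<odot>\<^bsub>T\<^esub> x)"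
    if ab: "a \<in> carrier R" "b \<in> carrier R" and x: "x \<in> carrier T" for a b x
  proof -
    obtain u where u: "x = cls u" "Poly_Mapping.keys u \<subseteq> carrier M \<times> carrier N"
      using x by (auto simp: T_carrier)
    have "scal (a \<oplus>\<^bsub>R\<^esub> b) u - scal a u - scal b u \<in> null"
      by (rule smult_eqI[OF u(2), of "\<lambda>u. scal (a \<oplus>\<^bsub>R\<^esub> b) u - scal a u - scal b u"])
        (auto simp: M.smult_l_distr ab intro!: rel_left)
    then show ?thesis using ab by (auto simp: u(1) T_smult T_add algebra_simps intro!: cls_eqI)
  qed
  show "(a \<otimes>\<^bsub>R\<^esub> b) \<odot>\<^bsub>T\<^esub> x = a \<odot>\<^bsub>T\<^esub> (b \<odot>\<^bsub>T\<^esub> x)"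
    if ab: "a \<in> carrier R" "b \<in> carrier R" and x: "x \<in> carrier T" for a b x
  proof -
    obtain u where u: "x = cls u" "Poly_Mapping.keys u \<subseteq> carrier M \<times> carrier N"
      using x by (auto simp: T_carrier)
    have "scal (a \<otimes>\<^bsub>R\<^esub> b) u - scal a (scal b u) \<in> null"
      by (rule smult_eqI[OF u(2), of "\<lambda>u. scal (a \<otimes>\<^bsub>R\<^esub> b) u - scal a (scal b u)"])
        (auto simp: M.smult_assoc1 ab null_zero)
    then show ?thesis using ab by (auto simp: u(1) T_smult intro!: cls_eqI)
  qed
  show "\<one>\<^bsub>R\<^esub> \<odot>\<^bsub>T\<^esub> x = x" if x: "x \<in> carrier T" for x
  proof -
    obtain u where u: "x = cls u" "Poly_Mapping.keys u \<subseteq> carrier M \<times> carrier N"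
      using x by (auto simp: T_carrier)
    have "scal \<one>\<^bsub>R\<^esub> u - u \<in> null"
      by (rule smult_eqI[OF u(2), of "\<lambda>u. scal \<one>\<^bsub>R\<^esub> u - u"]) (auto simp: null_zero)
    then show ?thesis by (auto simp: u(1) T_smult intro!: cls_eqI)
  qed
qed (auto simp: T_carrier T_zero T_add T_smult add.assoc)

interpretation T: module R T by (rule T_module)

lemma pure_closed: "x \<in> carrier M \<Longrightarrow> y \<in> carrier N \<Longrightarrow> pure x y \<in> carrier T"
  by (auto simp: T_carrier pure_eq_cls)

lemma pure_add_left: "x \<in> carrier M \<Longrightarrow> x' \<in> carrier M \<Longrightarrow> y \<in> carrier N \<Longrightarrow>
    pure (x \<oplus>\<^bsub>M\<^esub> x') y = pure x y \<oplus>\<^bsub>T\<^esub> pure x' y"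
  unfolding pure_eq_cls T_add using rel_left[of x x' y] by (intro cls_eqI) (simp add: algebra_simps)

lemma pure_add_right: "x \<in> carrier M \<Longrightarrow> y \<in> carrier N \<Longrightarrow> y' \<in> carrier N \<Longrightarrow>
    pure x (y \<oplus>\<^bsub>N\<^esub> y') = pure x y \<oplus>\<^bsub>T\<^esub> pure x y'"
  unfolding pure_eq_cls T_add using rel_right[of x y y'] by (intro cls_eqI) (simp add: algebra_simps)

lemma pure_smult_left: "r \<in> carrier R \<Longrightarrow> x \<in> carrier M \<Longrightarrow> y \<in> carrier N \<Longrightarrow>
    pure (r \<odot>\<^bsub>M\<^esub> x) y = r \<odot>\<^bsub>T\<^esub> pure x y"
  by (simp add: pure_eq_cls T_smult)

lemma pure_smult_right: "r \<in> carrier R \<Longrightarrow> x \<in> carrier M \<Longrightarrow> y \<in> carrier N \<Longrightarrow>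
    pure x (r \<odot>\<^bsub>N\<^esub> y) = r \<odot>\<^bsub>T\<^esub> pure x y"
  using rel_balance[of r x y] pure_smult_left[of r x y] by (metis pure_eq_cls cls_eqI)

lemma pure_hom_left: "y \<in> carrier N \<Longrightarrow> (\<lambda>x. pure x y) \<in> module_hom R M T"
  by (intro module_homI) (auto simp: pure_closed pure_add_left pure_smult_left)

lemma pure_hom_right: "x \<in> carrier M \<Longrightarrow> pure x \<in> module_hom R N T"
  by (intro module_homI) (auto simp: pure_closed pure_add_right pure_smult_right)

lemma pure_zero_left: "y \<in> carrier N \<Longrightarrow> pure \<zero>\<^bsub>M\<^esub> y = \<zero>\<^bsub>T\<^esub>"
  using module_hom_zero[OF pure_hom_left M T_module] by simp

lemma pure_zero_right: "x \<in> carrier M \<Longrightarrow> pure x \<zero>\<^bsub>N\<^esub> = \<zero>\<^bsub>T\<^esub>"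
  using module_hom_zero[OF pure_hom_right N T_module] by simp

lemma pure_spans: "spans R T {pure x y | x y. x \<in> carrier M \<and> y \<in> carrier N}"
  unfolding spans_def
proof (intro conjI allI impI)
  fix L assume L': "submodule L R T \<and> {pure x y |x y. x \<in> carrier M \<and> y \<in> carrier N} \<subseteq> L"
  then have L: "submodule L R T" and p: "\<And>x y. x \<in> carrier M \<Longrightarrow> y \<in> carrier N \<Longrightarrow> pure x y \<in> L" by auto
  have "cls u \<in> L" if "Poly_Mapping.keys u \<subseteq> carrier M \<times> carrier N" for u
    using that
  proof (induction u rule: frag_induct)
    case zero
    then show ?case using submodule_zero[OF L] by (simp add: T_zero)
  next
    case (diff u v)
    have "cls (- v) \<oplus>\<^bsub>T\<^esub> cls v = \<zero>\<^bsub>T\<^esub>" by (simp add: T_add T_zero)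
    then have "\<ominus>\<^bsub>T\<^esub> cls v = cls (- v)"
      using diff(2) by (intro T.M.minus_equality) (auto simp: T_carrier)
    then show ?case
      using submodule_add[OF L diff(3) submodule_minus[OF T_module L diff(4)]] by (simp add: T_add)
  next
    case (gen x y)
    then show ?case using p[of x y] by (simp add: pure_eq_cls)
  qed
  then show "carrier T \<subseteq> L" by (auto simp: T_carrier)
qed (auto simp: pure_closed)

end

definition balanced_map ::
  "('a, 'r) ring_scheme \<Rightarrow> ('a, 'm) module \<Rightarrow> ('a, 'n) module \<Rightarrow> ('a, 'p) module \<Rightarrow> ('m \<Rightarrow> 'n \<Rightarrow> 'p) \<Rightarrow> bool" where
  "balanced_map R M N P b \<longleftrightarrow> (\<forall>x\<in>carrier M. b x \<in> module_hom R N P) \<and>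
     (\<forall>y\<in>carrier N. (\<lambda>x. b x y) \<in> module_hom R M P)"

context module_pair
begin

interpretation M: module R M by (rule M)
interpretation N: module R N by (rule N)
interpretation T: module R T by (rule T_module)

context
  fixes P :: "('a, 'p) module" and b :: "'m \<Rightarrow> 'n \<Rightarrow> 'p"
  assumes P: "module R P" and b: "balanced_map R M N P b"
begin

interpretation P: module R P by (rule P)

lemma b_closed: "x \<in> carrier M \<Longrightarrow> y \<in> carrier N \<Longrightarrow> b x y \<in> carrier P"
  using b by (auto simp: balanced_map_def intro: module_hom_closed)

text \<open>The additive extension of \<open>b\<close> to formal sums, before passing to the quotient.\<close>

definition evl :: "('m \<times> 'n \<Rightarrow>\<^sub>0 int) \<Rightarrow> 'p" where
  "evl u = (\<Oplus>\<^bsub>P\<^esub>z\<in>Poly_Mapping.keys u. [Poly_Mapping.lookup u z] \<cdot>\<^bsub>P\<^esub> b (fst z) (snd z))"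

lemma evl_superset:
  assumes "finite S" "Poly_Mapping.keys u \<subseteq> S" "S \<subseteq> carrier M \<times> carrier N"
  shows "evl u = (\<Oplus>\<^bsub>P\<^esub>z\<in>S. [Poly_Mapping.lookup u z] \<cdot>\<^bsub>P\<^esub> b (fst z) (snd z))"
  unfolding evl_def
proof (rule finsum_superset[OF _ assms(1,2)])
  show "[Poly_Mapping.lookup u z] \<cdot>\<^bsub>P\<^esub> b (fst z) (snd z) \<in> carrier P" if "z \<in> S" for z
    using that assms(3) b_closed[of "fst z" "snd z"] by auto
  show "[Poly_Mapping.lookup u z] \<cdot>\<^bsub>P\<^esub> b (fst z) (snd z) = \<zero>\<^bsub>P\<^esub>" if "z \<notin> Poly_Mapping.keys u" for z
    using that by (simp add: not_in_keys_iff_lookup_eq_zero add_pow_def int_pow_def2)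
qed (rule P.abelian_monoid_axioms)

lemma evl_closed: "Poly_Mapping.keys u \<subseteq> carrier M \<times> carrier N \<Longrightarrow> evl u \<in> carrier P"
  unfolding evl_def by (intro P.finsum_closed) (auto intro!: P.add.int_pow_closed b_closed)

lemma evl_add:
  assumes "Poly_Mapping.keys u \<subseteq> carrier M \<times> carrier N" "Poly_Mapping.keys v \<subseteq> carrier M \<times> carrier N"
  shows "evl (u + v) = evl u \<oplus>\<^bsub>P\<^esub> evl v"
proof -
  let ?S = "Poly_Mapping.keys u \<union> Poly_Mapping.keys v"
  have S: "finite ?S" "?S \<subseteq> carrier M \<times> carrier N" using assms by auto
  have c: "[k] \<cdot>\<^bsub>P\<^esub> b (fst z) (snd z) \<in> carrier P" if "z \<in> ?S" for z and k :: int
    using that S(2) b_closed[of "fst z" "snd z"] by auto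
  have bc: "b (fst z) (snd z) \<in> carrier P" if "z \<in> ?S" for z
    using that S(2) b_closed[of "fst z" "snd z"] by auto
  have "evl (u + v) = (\<Oplus>\<^bsub>P\<^esub>z\<in>?S. [Poly_Mapping.lookup (u + v) z] \<cdot>\<^bsub>P\<^esub> b (fst z) (snd z))"
    by (rule evl_superset[OF S(1) Poly_Mapping.keys_add S(2)])
  also have "\<dots> = (\<Oplus>\<^bsub>P\<^esub>z\<in>?S. [Poly_Mapping.lookup u z] \<cdot>\<^bsub>P\<^esub> b (fst z) (snd z) \<oplus>\<^bsub>P\<^esub>
      [Poly_Mapping.lookup v z] \<cdot>\<^bsub>P\<^esub> b (fst z) (snd z))"
    using c bc by (intro P.finsum_cong')
      (auto simp: lookup_add P.add.int_pow_mult)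
  also have "\<dots> = evl u \<oplus>\<^bsub>P\<^esub> evl v"
    using c by (subst P.finsum_addf) (auto simp: evl_superset[OF S(1) _ S(2)])
  finally show ?thesis .
qed

lemma evl_zero: "evl 0 = \<zero>\<^bsub>P\<^esub>"
  by (simp add: evl_def)

lemma evl_of: "x \<in> carrier M \<Longrightarrow> y \<in> carrier N \<Longrightarrow> evl (frag_of (x, y)) = b x y"
  by (simp add: evl_def b_closed P.add.int_pow_1)

lemma evl_diff:
  assumes "Poly_Mapping.keys u \<subseteq> carrier M \<times> carrier N" "Poly_Mapping.keys v \<subseteq> carrier M \<times> carrier N"
  shows "evl (u - v) = evl u \<oplus>\<^bsub>P\<^esub> \<ominus>\<^bsub>P\<^esub> evl v"
proof -
  have uv: "Poly_Mapping.keys (u - v) \<subseteq> carrier M \<times> carrier N"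
    by (rule keys_diff_subset[OF assms])
  have "evl u = evl (u - v) \<oplus>\<^bsub>P\<^esub> evl v" using evl_add[OF uv assms(2)] by simp
  then show ?thesis using evl_closed[OF uv] evl_closed[OF assms(2)] by (simp add: P.M.a_assoc P.M.r_neg)
qed

lemma evl_null:
  assumes "u \<in> null" shows "evl u = \<zero>\<^bsub>P\<^esub>"
  using assms
proof (induction u rule: null_induct)
  case (rel u)
  note d = evl_diff[OF keys_diff_subset] evl_diff
  have bl: "b (x \<oplus>\<^bsub>M\<^esub> x') y = b x y \<oplus>\<^bsub>P\<^esub> b x' y" if "x \<in> carrier M" "x' \<in> carrier M" "y \<in> carrier N" for x x' y
    using b that module_hom_add[of "\<lambda>x. b x y" R M P x x'] by (auto simp: balanced_map_def)
  have br: "b x (y \<oplus>\<^bsub>N\<^esub> y') = b x y \<oplus>\<^bsub>P\<^esub> b x y'" if "x \<in> carrier M" "y \<in> carrier N" "y' \<in> carrier N" for x y y'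
    using b that module_hom_add[of "b x" R N P y y'] by (auto simp: balanced_map_def)
  have bs: "b (r \<odot>\<^bsub>M\<^esub> x) y = b x (r \<odot>\<^bsub>N\<^esub> y)" if "x \<in> carrier M" "r \<in> carrier R" "y \<in> carrier N" for x r y
    using b that module_hom_smult[of "b x" R N P r y] module_hom_smult[of "\<lambda>x. b x y" R M P r x]
    by (auto simp: balanced_map_def)
  have cancel: "p \<oplus>\<^bsub>P\<^esub> q \<oplus>\<^bsub>P\<^esub> \<ominus>\<^bsub>P\<^esub> p \<oplus>\<^bsub>P\<^esub> \<ominus>\<^bsub>P\<^esub> q = \<zero>\<^bsub>P\<^esub>" if "p \<in> carrier P" "q \<in> carrier P" for p q
    using that by (simp add: P.M.a_assoc P.M.a_comm[of q] P.M.r_neg1 P.M.l_neg P.M.r_neg flip: P.M.minus_add)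
  consider x x' y where "u = frag_of (x \<oplus>\<^bsub>M\<^esub> x', y) - frag_of (x, y) - frag_of (x', y)"
      "x \<in> carrier M" "x' \<in> carrier M" "y \<in> carrier N"
    | x y y' where "u = frag_of (x, y \<oplus>\<^bsub>N\<^esub> y') - frag_of (x, y) - frag_of (x, y')"
      "x \<in> carrier M" "y \<in> carrier N" "y' \<in> carrier N"
    | t x y where "u = frag_of (t \<odot>\<^bsub>M\<^esub> x, y) - frag_of (x, t \<odot>\<^bsub>N\<^esub> y)"
      "t \<in> carrier R" "x \<in> carrier M" "y \<in> carrier N"
    using rel unfolding tensor_rels_def by blast
  then show ?case
    by cases (simp_all add: d evl_of bl br bs b_closed cancel P.M.r_neg)
next
  case (diff u v)
  then show ?case using evl_diff[OF null_carrier null_carrier] by (simp add: module_minus_zero[OF P])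
qed (rule evl_zero)

text \<open>The representative picked by \<open>tensor_lift\<close> differs from \<open>u\<close> by relations, on which \<open>evl\<close>
  vanishes.\<close>

lemma tensor_lift_cls:
  assumes "Poly_Mapping.keys u \<subseteq> carrier M \<times> carrier N"
  shows "tensor_lift P b (cls u) = evl u"
proof -
  define v where "v = (SOME v. v \<in> cls u)"
  have "v \<in> cls u" unfolding v_def using cls_self by (rule someI)
  then have n: "v - u \<in> null" by (simp add: mem_cls)
  have "evl v = evl ((v - u) + u)" by simp
  also have "\<dots> = evl u" using evl_add[OF null_carrier[OF n] assms] evl_null[OF n] evl_closed[OF assms] by simp
  finally show ?thesis by (simp add: tensor_lift_def v_def evl_def Let_def)
qed

lemma tensor_lift_pure:
  assumes "x \<in> carrier M" "y \<in> carrier N"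
  shows "tensor_lift P b (pure x y) = b x y"
  using assms by (simp add: pure_eq_cls tensor_lift_cls evl_of)

lemma tensor_lift_hom: "tensor_lift P b \<in> module_hom R T P"
proof (rule module_homI)
  note add = subset_trans[OF Poly_Mapping.keys_add Un_least]
  fix A assume "A \<in> carrier T"
  then obtain u where u: "A = cls u" "Poly_Mapping.keys u \<subseteq> carrier M \<times> carrier N"
    by (auto simp: T_carrier)
  then show "tensor_lift P b A \<in> carrier P" by (simp add: tensor_lift_cls evl_closed)
  {
    fix B assume "B \<in> carrier T"
    then obtain v where "B = cls v" "Poly_Mapping.keys v \<subseteq> carrier M \<times> carrier N"
      by (auto simp: T_carrier)
    then show "tensor_lift P b (A \<oplus>\<^bsub>T\<^esub> B) = tensor_lift P b A \<oplus>\<^bsub>P\<^esub> tensor_lift P b B"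
      using u by (simp add: T_add tensor_lift_cls evl_add add)
  }
  fix r assume r: "r \<in> carrier R"
  have "evl (scal r u) = r \<odot>\<^bsub>P\<^esub> evl u" using u(2)
  proof (induction u rule: frag_induct)
    case zero
    then show ?case using r by (simp add: evl_zero)
  next
    case (diff u v)
    then show ?case using r
      by (simp add: evl_diff scal_keys P.smult_r_distr P.smult_r_minus evl_closed)
  next
    case (gen x y)
    then show ?case using r b module_hom_smult[of "\<lambda>x. b x y" R M P r x]
      by (simp add: evl_of balanced_map_def)
  qed
  then show "tensor_lift P b (r \<odot>\<^bsub>T\<^esub> A) = r \<odot>\<^bsub>P\<^esub> tensor_lift P b A"
    using u r by (simp add: T_smult tensor_lift_cls scal_keys)
qed

end

lemma tensor_hom_eq:
  assumes "module R P" "f \<in> module_hom R T P" "g \<in> module_hom R T P"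
    and "\<And>x y. x \<in> carrier M \<Longrightarrow> y \<in> carrier N \<Longrightarrow> f (pure x y) = g (pure x y)"
    and "t \<in> carrier T"
  shows "f t = g t"
proof (rule spans_hom_eq[OF pure_spans T_module assms(1-3)])
  show "f t = g t" if "t \<in> {pure x y |x y. x \<in> carrier M \<and> y \<in> carrier N}" for t
    using that assms(4) by blast
qed (rule assms(5))

end

lemmas module_tensor = module_pair.T_module[OF module_pair.intro]
lemmas pure_tensor_closed = module_pair.pure_closed[OF module_pair.intro]
lemmas pure_tensor_hom_left = module_pair.pure_hom_left[OF module_pair.intro]
lemmas pure_tensor_hom_right = module_pair.pure_hom_right[OF module_pair.intro]
lemmas pure_tensor_zero_left = module_pair.pure_zero_left[OF module_pair.intro]
lemmas pure_tensor_zero_right = module_pair.pure_zero_right[OF module_pair.intro]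
lemmas tensor_spans = module_pair.pure_spans[OF module_pair.intro]
lemmas tensor_lift_module_hom = module_pair.tensor_lift_hom[OF module_pair.intro]
lemmas tensor_lift_pure_tensor = module_pair.tensor_lift_pure[OF module_pair.intro]
lemmas tensor_module_hom_eq = module_pair.tensor_hom_eq[OF module_pair.intro]

section \<open>Functoriality of the tensor product\<close>

lemma balanced_pure_tensor:
  assumes "module R M'" "module R N'" "f \<in> module_hom R M M'" "g \<in> module_hom R N N'"
  shows "balanced_map R M N (tensor_module R M' N') (\<lambda>x y. pure_tensor R M' N' (f x) (g y))"
  unfolding balanced_map_def
  using module_hom_comp[OF assms(4) pure_tensor_hom_right[OF assms(1,2)]]
    module_hom_comp[OF assms(3) pure_tensor_hom_left[OF assms(1,2)]]
    module_hom_closed[OF assms(3)] module_hom_closed[OF assms(4)] by auto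

lemma balanced_mapI:
  assumes "\<And>x. x \<in> carrier M \<Longrightarrow> (\<lambda>y. b x y) \<in> module_hom R N P"
    and "\<And>y. y \<in> carrier N \<Longrightarrow> (\<lambda>x. b x y) \<in> module_hom R M P"
  shows "balanced_map R M N P b"
  using assms by (auto simp: balanced_map_def)

lemma balanced_map_right: "balanced_map R M N P b \<Longrightarrow> x \<in> carrier M \<Longrightarrow> (\<lambda>y. b x y) \<in> module_hom R N P"
  by (auto simp: balanced_map_def)

lemma balanced_map_left: "balanced_map R M N P b \<Longrightarrow> y \<in> carrier N \<Longrightarrow> (\<lambda>x. b x y) \<in> module_hom R M P"
  by (auto simp: balanced_map_def)

lemma balanced_map_comp:
  assumes "balanced_map R M N P b" "h \<in> module_hom R P Q"
  shows "balanced_map R M N Q (\<lambda>x y. h (b x y))"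
  by (rule balanced_mapI)
    (rule module_hom_comp[OF _ assms(2)], erule balanced_map_right[OF assms(1)] balanced_map_left[OF assms(1)])+

lemma balanced_map_plus:
  assumes "balanced_map R M N P b" "balanced_map R M N P c" "module R P"
  shows "balanced_map R M N P (\<lambda>x y. b x y \<oplus>\<^bsub>P\<^esub> c x y)"
  by (rule balanced_mapI; rule module_hom_plus[OF _ _ assms(3)])
    (erule balanced_map_right[OF assms(1)] balanced_map_right[OF assms(2)]
      balanced_map_left[OF assms(1)] balanced_map_left[OF assms(2)])+

lemma balanced_map_sign:
  assumes "balanced_map R M N P b" "module R P"
  shows "balanced_map R M N P (\<lambda>x y. sign_smult P k (b x y))"
  by (rule balanced_mapI; rule module_hom_sign[OF _ assms(2)])
    (erule balanced_map_right[OF assms(1)] balanced_map_left[OF assms(1)])+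

lemma balanced_map_zero:
  assumes "module R P"
  shows "balanced_map R M N P (\<lambda>x y. \<zero>\<^bsub>P\<^esub>)"
  unfolding balanced_map_def by (intro conjI ballI module_hom_const_zero[OF assms])

definition tensor_map ::
  "('a, 'r) ring_scheme \<Rightarrow> ('a, 'm) module \<Rightarrow> ('a, 'n) module \<Rightarrow> ('k \<Rightarrow> 'm) \<Rightarrow> ('l \<Rightarrow> 'n)
    \<Rightarrow> ('k \<times> 'l \<Rightarrow>\<^sub>0 int) set \<Rightarrow> ('m \<times> 'n \<Rightarrow>\<^sub>0 int) set" where
  "tensor_map R M' N' f g =
     tensor_lift (tensor_module R M' N') (\<lambda>x y. pure_tensor R M' N' (f x) (g y))"

lemma tensor_map_hom:
  assumes "module R M" "module R N" "module R M'" "module R N'"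
    and "f \<in> module_hom R M M'" "g \<in> module_hom R N N'"
  shows "tensor_map R M' N' f g \<in> module_hom R (tensor_module R M N) (tensor_module R M' N')"
  unfolding tensor_map_def
  by (rule tensor_lift_module_hom[OF assms(1,2) module_tensor[OF assms(3,4)]
        balanced_pure_tensor[OF assms(3-6)]])

lemma tensor_map_pure:
  assumes "module R M" "module R N" "module R M'" "module R N'"
    and "f \<in> module_hom R M M'" "g \<in> module_hom R N N'" "x \<in> carrier M" "y \<in> carrier N"
  shows "tensor_map R M' N' f g (pure_tensor R M N x y) = pure_tensor R M' N' (f x) (g y)"
  unfolding tensor_map_def
  by (rule tensor_lift_pure_tensor[OF assms(1,2) module_tensor[OF assms(3,4)]
        balanced_pure_tensor[OF assms(3-6)] assms(7,8)])

lemma tensor_map_comp: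
  assumes "module R M" "module R N" "module R M'" "module R N'" "module R M''" "module R N''"
    and "f \<in> module_hom R M M'" "g \<in> module_hom R N N'"
    and "f' \<in> module_hom R M' M''" "g' \<in> module_hom R N' N''"
    and "t \<in> carrier (tensor_module R M N)"
  shows "tensor_map R M'' N'' f' g' (tensor_map R M' N' f g t) =
         tensor_map R M'' N'' (\<lambda>x. f' (f x)) (\<lambda>y. g' (g y)) t"
proof (rule tensor_module_hom_eq[OF assms(1,2) module_tensor[OF assms(5,6)] _ _ _ assms(11)])
  note h1 = tensor_map_hom[OF assms(1-4,7,8)] and h2 = tensor_map_hom[OF assms(3-6,9,10)]
  note f = module_hom_comp[OF assms(7,9)] and g = module_hom_comp[OF assms(8,10)]
  show "(\<lambda>t. tensor_map R M'' N'' f' g' (tensor_map R M' N' f g t))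
      \<in> module_hom R (tensor_module R M N) (tensor_module R M'' N'')"
    by (rule module_hom_comp[OF h1 h2])
  show "tensor_map R M'' N'' (\<lambda>x. f' (f x)) (\<lambda>y. g' (g y))
      \<in> module_hom R (tensor_module R M N) (tensor_module R M'' N'')"
    by (rule tensor_map_hom[OF assms(1,2,5,6) f g])
  show "tensor_map R M'' N'' f' g' (tensor_map R M' N' f g (pure_tensor R M N x y)) =
      tensor_map R M'' N'' (\<lambda>x. f' (f x)) (\<lambda>y. g' (g y)) (pure_tensor R M N x y)"
    if "x \<in> carrier M" "y \<in> carrier N" for x y
    using that by (simp add: tensor_map_pure[OF assms(1-4,7,8)] tensor_map_pure[OF assms(3-6,9,10)]
        tensor_map_pure[OF assms(1,2,5,6) f g] module_hom_closed[OF assms(7)] module_hom_closed[OF assms(8)])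
qed

lemma tensor_map_cong:
  assumes "module R M" "module R N" "module R M'" "module R N'"
    and "f \<in> module_hom R M M'" "g \<in> module_hom R N N'"
    and "\<And>x. x \<in> carrier M \<Longrightarrow> f x = f' x" "\<And>y. y \<in> carrier N \<Longrightarrow> g y = g' y"
    and "t \<in> carrier (tensor_module R M N)"
  shows "tensor_map R M' N' f g t = tensor_map R M' N' f' g' t"
proof (rule tensor_module_hom_eq[OF assms(1,2) module_tensor[OF assms(3,4)] _ _ _ assms(9)])
  note f' = module_hom_cong[OF assms(5,1,7)] and g' = module_hom_cong[OF assms(6,2,8)]
  show "tensor_map R M' N' f g \<in> module_hom R (tensor_module R M N) (tensor_module R M' N')"
    by (rule tensor_map_hom[OF assms(1-6)])
  show "tensor_map R M' N' f' g' \<in> module_hom R (tensor_module R M N) (tensor_module R M' N')"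
    by (rule tensor_map_hom[OF assms(1-4) f' g'])
  show "tensor_map R M' N' f g (pure_tensor R M N x y) = tensor_map R M' N' f' g' (pure_tensor R M N x y)"
    if "x \<in> carrier M" "y \<in> carrier N" for x y
    using that by (simp add: tensor_map_pure[OF assms(1-6)] tensor_map_pure[OF assms(1-4) f' g'] assms(7,8))
qed

lemma module_hom_id: "(\<lambda>x. x) \<in> module_hom R M M"
  by (rule module_homI) auto

lemma tensor_map_id:
  assumes "module R M" "module R N" "t \<in> carrier (tensor_module R M N)"
  shows "tensor_map R M N (\<lambda>x. x) (\<lambda>y. y) t = t"
  by (rule tensor_module_hom_eq[OF assms(1,2) module_tensor[OF assms(1,2)]
        tensor_map_hom[OF assms(1,2) assms(1,2) module_hom_id module_hom_id] module_hom_id _ assms(3)])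
    (rule tensor_map_pure[OF assms(1,2) assms(1,2) module_hom_id module_hom_id])

lemma tensor_map_zero:
  assumes "module R M" "module R N" "module R M'" "module R N'"
    and "f \<in> module_hom R M M'" "g \<in> module_hom R N N'"
    and "(\<forall>x\<in>carrier M. f x = \<zero>\<^bsub>M'\<^esub>) \<or> (\<forall>y\<in>carrier N. g y = \<zero>\<^bsub>N'\<^esub>)"
    and "t \<in> carrier (tensor_module R M N)"
  shows "tensor_map R M' N' f g t = \<zero>\<^bsub>tensor_module R M' N'\<^esub>"
proof (rule tensor_module_hom_eq[OF assms(1,2) module_tensor[OF assms(3,4)] tensor_map_hom[OF assms(1-6)]
    module_hom_const_zero[OF module_tensor[OF assms(3,4)]] _ assms(8)])
  show "tensor_map R M' N' f g (pure_tensor R M N x y) = \<zero>\<^bsub>tensor_module R M' N'\<^esub>"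
    if "x \<in> carrier M" "y \<in> carrier N" for x y
    using that assms(7) module_hom_closed[OF assms(5)] module_hom_closed[OF assms(6)]
    by (auto simp: tensor_map_pure[OF assms(1-6)] pure_tensor_zero_left[OF assms(3,4)]
        pure_tensor_zero_right[OF assms(3,4)])
qed

lemma tensor_map_surj:
  assumes "module R M" "module R N" "module R M'" "module R N'"
    and "f \<in> module_hom R M M'" "g \<in> module_hom R N N'"
    and "f ` carrier M = carrier M'" "g ` carrier N = carrier N'"
    and "t \<in> carrier (tensor_module R M' N')"
  shows "t \<in> tensor_map R M' N' f g ` carrier (tensor_module R M N)"
proof (rule spansD[OF tensor_spans[OF assms(3,4)] _ _ assms(9)])
  show "submodule (tensor_map R M' N' f g ` carrier (tensor_module R M N)) R (tensor_module R M' N')"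
    by (intro submodule_image[OF tensor_map_hom[OF assms(1-6)]] module_tensor submodule_carrier assms(1-4))
  show "{pure_tensor R M' N' x y |x y. x \<in> carrier M' \<and> y \<in> carrier N'}
      \<subseteq> tensor_map R M' N' f g ` carrier (tensor_module R M N)"
  proof clarify
    fix x y assume "x \<in> carrier M'" "y \<in> carrier N'"
    then obtain x' y' where "x' \<in> carrier M" "x = f x'" "y' \<in> carrier N" "y = g y'"
      using assms(7,8) by (metis imageE)
    then show "pure_tensor R M' N' x y \<in> tensor_map R M' N' f g ` carrier (tensor_module R M N)"
      using tensor_map_pure[OF assms(1-6)] pure_tensor_closed[OF assms(1,2)] by (metis imageI)
  qed
qed

lemma tensor_trivial:
  assumes "module R M" "module R N" "carrier M = {\<zero>\<^bsub>M\<^esub>} \<or> carrier N = {\<zero>\<^bsub>N\<^esub>}"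
  shows "carrier (tensor_module R M N) = {\<zero>\<^bsub>tensor_module R M N\<^esub>}"
proof -
  interpret T: module R "tensor_module R M N" by (rule module_tensor[OF assms(1,2)])
  have "t = \<zero>\<^bsub>tensor_module R M N\<^esub>" if t: "t \<in> carrier (tensor_module R M N)" for t
    using tensor_map_zero[OF assms(1,2) assms(1,2) module_hom_id module_hom_id _ t] assms(3)
      tensor_map_id[OF assms(1,2) t] by auto
  then show ?thesis by auto
qed

definition tensor_swap ::
  "('a, 'r) ring_scheme \<Rightarrow> ('a, 'm) module \<Rightarrow> ('a, 'n) module
    \<Rightarrow> ('m \<times> 'n \<Rightarrow>\<^sub>0 int) set \<Rightarrow> ('n \<times> 'm \<Rightarrow>\<^sub>0 int) set" where
  "tensor_swap R M N = tensor_lift (tensor_module R N M) (\<lambda>x y. pure_tensor R N M y x)"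

lemma balanced_swap:
  assumes "module R M" "module R N"
  shows "balanced_map R M N (tensor_module R N M) (\<lambda>x y. pure_tensor R N M y x)"
  using pure_tensor_hom_left[OF assms(2,1)] pure_tensor_hom_right[OF assms(2,1)]
  unfolding balanced_map_def by auto

lemma tensor_swap_hom:
  assumes "module R M" "module R N"
  shows "tensor_swap R M N \<in> module_hom R (tensor_module R M N) (tensor_module R N M)"
  unfolding tensor_swap_def
  by (rule tensor_lift_module_hom[OF assms module_tensor[OF assms(2,1)] balanced_swap[OF assms]])

lemma tensor_swap_pure:
  assumes "module R M" "module R N" "x \<in> carrier M" "y \<in> carrier N"
  shows "tensor_swap R M N (pure_tensor R M N x y) = pure_tensor R N M y x"
  unfolding tensor_swap_def
  by (rule tensor_lift_pure_tensor[OF assms(1,2) module_tensor[OF assms(2,1)] balanced_swap[OF assms(1,2)] assms(3,4)])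

lemma tensor_swap_swap:
  assumes "module R M" "module R N" "t \<in> carrier (tensor_module R M N)"
  shows "tensor_swap R N M (tensor_swap R M N t) = t"
  by (rule tensor_module_hom_eq[OF assms(1,2) module_tensor[OF assms(1,2)]
      module_hom_comp[OF tensor_swap_hom[OF assms(1,2)] tensor_swap_hom[OF assms(2,1)]] module_hom_id _ assms(3)])
    (simp add: tensor_swap_pure[OF assms(1,2)] tensor_swap_pure[OF assms(2,1)])

lemma tensor_swap_map:
  assumes "module R M" "module R N" "module R M'" "module R N'"
    and "f \<in> module_hom R M M'" "g \<in> module_hom R N N'"
    and "t \<in> carrier (tensor_module R M N)"
  shows "tensor_swap R M' N' (tensor_map R M' N' f g t) = tensor_map R N' M' g f (tensor_swap R M N t)"
  by (rule tensor_module_hom_eq[OF assms(1,2) module_tensor[OF assms(4,3)]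
      module_hom_comp[OF tensor_map_hom[OF assms(1-6)] tensor_swap_hom[OF assms(3,4)]]
      module_hom_comp[OF tensor_swap_hom[OF assms(1,2)] tensor_map_hom[OF assms(2,1,4,3,6,5)]] _ assms(7)])
    (simp add: tensor_swap_pure[OF assms(1,2)] tensor_swap_pure[OF assms(3,4)] tensor_map_pure[OF assms(1-6)]
      tensor_map_pure[OF assms(2,1,4,3,6,5)] module_hom_closed[OF assms(5)] module_hom_closed[OF assms(6)])

section \<open>Free modules are flat\<close>

text \<open>The tensors of this form are the image of a direct sum of copies of \<open>N\<close>, hence a submodule, and it
  contains all pure tensors.\<close>

lemma free_tensor_expansion:
  assumes "dual_basis R F K b \<kappa>" "module R N" "z \<in> carrier (tensor_module R F N)"
  shows "\<exists>A y. A \<subseteq> K \<and> finite A \<and> y \<in> A \<rightarrow> carrier N \<and>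
           z = (\<Oplus>\<^bsub>tensor_module R F N\<^esub>k\<in>A. pure_tensor R F N (b k) (y k))"
proof -
  let ?T = "tensor_module R F N"
  have F: "module R F" and sp: "spans R F (b ` K)"
    using assms(1) by (auto simp: dual_basis_def)
  have bF: "k \<in> K \<Longrightarrow> b k \<in> carrier F" for k using dual_basis_mem[OF assms(1)] .
  interpret N: module R N by fact
  have T: "module R ?T" by (rule module_tensor[OF F assms(2)])
  let ?D = "dsum_module K (\<lambda>_. N)"
  have D: "module R ?D" by (rule module_dsum) (use N.is_cring assms(2) in auto)
  let ?h = "\<lambda>k. pure_tensor R F N (b k)"
  have h: "k \<in> K \<Longrightarrow> ?h k \<in> module_hom R N ?T" for k
    using pure_tensor_hom_right[OF F assms(2) bF] .
  note th = dsum_lift_hom[of R ?T "\<lambda>_. N", OF T assms(2) h]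
  have sub: "submodule (dsum_lift (\<lambda>_. N) ?T ?h ` carrier ?D) R ?T" (is "submodule ?I R ?T")
    by (rule submodule_image[OF th D T submodule_carrier[OF D]])
  have "pure_tensor R F N (b k) y \<in> ?I" if "k \<in> K" "y \<in> carrier N" for k y
  proof -
    have "dsum_inj (\<lambda>_. N) k y \<in> carrier ?D"
      using module_hom_closed[OF dsum_inj_hom[of R "\<lambda>_. N" k K, OF N.is_cring assms(2) that(1)] that(2)] .
    then show ?thesis
      using dsum_lift_inj[of R ?T "\<lambda>_. N" K ?h, OF T assms(2) h that] by (metis (lifting) imageI)
  qed
  then have "pure_tensor R F N x y \<in> ?I" if "x \<in> carrier F" "y \<in> carrier N" for x y
    using spans_image_subset[OF sp F T pure_tensor_hom_left[OF F assms(2) that(2)] sub _ that(1)] that by auto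
  then have "z \<in> ?I"
    using spansD[OF tensor_spans[OF F assms(2)] sub _ assms(3)] by auto
  then obtain u where u: "u \<in> carrier ?D" "z = dsum_lift (\<lambda>_. N) ?T ?h u" by auto
  then show ?thesis
    by (intro exI[of _ "{k. u k \<noteq> \<zero>\<^bsub>N\<^esub>}"] exI[of _ u])
      (auto simp: dsum_lift_def dsum_carrier_iff)
qed

text \<open>Contracting with the functional dual to a basis element recovers the coordinate at that element.  So
  if \<open>1 \<otimes> g\<close> kills a tensor then \<open>g\<close> kills its coordinates, and these can be lifted along \<open>f\<close>
  one by one.\<close>

lemma free_tensor_exact:
  assumes "free_module R F" "module R N'" "module R N" "module R N''"
    and "f \<in> module_hom R N' N" "g \<in> module_hom R N N''"
    and exact: "\<And>y. y \<in> carrier N \<Longrightarrow> g y = \<zero>\<^bsub>N''\<^esub> \<Longrightarrow> y \<in> f ` carrier N'"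
    and "z \<in> carrier (tensor_module R F N)"
    and "tensor_map R F N'' (\<lambda>x. x) g z = \<zero>\<^bsub>tensor_module R F N''\<^esub>"
  shows "z \<in> tensor_map R F N (\<lambda>x. x) f ` carrier (tensor_module R F N')"
proof -
  obtain K \<kappa> where db: "dual_basis R F K (\<lambda>b. b) \<kappa>" using free_module_imp_dual_basis[OF assms(1)] .
  have F: "module R F" using assms(1) by (simp add: free_module_def)
  interpret N: module R N by fact
  interpret N'': module R N'' by fact
  obtain A y where A: "A \<subseteq> K" "finite A" "y \<in> A \<rightarrow> carrier N"
    and z: "z = (\<Oplus>\<^bsub>tensor_module R F N\<^esub>k\<in>A. pure_tensor R F N k (y k))"
    using free_tensor_expansion[OF db assms(3,8)] by auto
  have \<kappa>: "k \<in> K \<Longrightarrow> \<kappa> k \<in> module_hom R F (regular_module R)"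
    and \<delta>: "k \<in> K \<Longrightarrow> l \<in> K \<Longrightarrow> \<kappa> k l = (if k = l then \<one>\<^bsub>R\<^esub> else \<zero>\<^bsub>R\<^esub>)" for k l
    using db by (auto simp: dual_basis_def)
  have KF: "k \<in> K \<Longrightarrow> k \<in> carrier F" for k using dual_basis_mem[OF db] .
  have kc: "k \<in> K \<Longrightarrow> x \<in> carrier F \<Longrightarrow> \<kappa> k x \<in> carrier R" for k x
    using module_hom_closed[OF \<kappa>] by simp
  note T = module_tensor[OF F assms(3)] and T'' = module_tensor[OF F assms(4)] and T' = module_tensor[OF F assms(2)]
  note G = tensor_map_hom[OF F assms(3) F assms(4) module_hom_id assms(6)]
  note Fm = tensor_map_hom[OF F assms(2) F assms(3) module_hom_id assms(5)]
  have pc: "k \<in> A \<Longrightarrow> pure_tensor R F N k (y k) \<in> carrier (tensor_module R F N)" for k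
    using A KF by (auto intro!: pure_tensor_closed[OF F assms(3)])
  have "y k \<in> f ` carrier N'" if k: "k \<in> A" for k
  proof (rule exact)
    show "y k \<in> carrier N" using k A by auto
    have kK: "k \<in> K" using k A by auto
    let ?b = "\<lambda>x y. \<kappa> k x \<odot>\<^bsub>N''\<^esub> y"
    have bal: "balanced_map R F N'' N'' ?b"
      unfolding balanced_map_def
      by (auto intro!: module_homI simp: kc[OF kK] N''.smult_r_distr N''.smult_l_distr N''.smult_assoc1
          module_hom_add[OF \<kappa>[OF kK]] module_hom_smult[OF \<kappa>[OF kK]])
        (metis N''.smult_assoc1 N.R.m_comm kc[OF kK])
    note C = tensor_lift_module_hom[OF F assms(4) assms(4) bal]
    note Cp = tensor_lift_pure_tensor[OF F assms(4) assms(4) bal]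
    have "\<zero>\<^bsub>N''\<^esub> = tensor_lift N'' ?b (tensor_map R F N'' (\<lambda>x. x) g z)"
      using module_hom_zero[OF C T'' assms(4)] assms(9) by simp
    also have "tensor_map R F N'' (\<lambda>x. x) g z = (\<Oplus>\<^bsub>tensor_module R F N''\<^esub>l\<in>A. tensor_map R F N'' (\<lambda>x. x) g (pure_tensor R F N l (y l)))"
      unfolding z by (rule module_hom_finsum[OF G T T'' pc])
    also have "tensor_lift N'' ?b \<dots> = (\<Oplus>\<^bsub>N''\<^esub>l\<in>A. tensor_lift N'' ?b (tensor_map R F N'' (\<lambda>x. x) g (pure_tensor R F N l (y l))))"
      by (rule module_hom_finsum[OF C T'' assms(4)]) (use module_hom_closed[OF G pc] in auto)
    also have "\<dots> = (\<Oplus>\<^bsub>N''\<^esub>l\<in>A. if l = k then g (y l) else \<zero>\<^bsub>N''\<^esub>)"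
    proof (rule N''.finsum_cong')
      fix l assume l: "l \<in> A"
      then have "l \<in> K" "y l \<in> carrier N" using A by auto
      then show "tensor_lift N'' ?b (tensor_map R F N'' (\<lambda>x. x) g (pure_tensor R F N l (y l))) = (if l = k then g (y l) else \<zero>\<^bsub>N''\<^esub>)"
        using kK by (cases "l = k") (simp_all add: tensor_map_pure[OF F assms(3) F assms(4) module_hom_id assms(6)] KF Cp
            module_hom_closed[OF assms(6)] \<delta>)
    qed (use A in \<open>auto intro!: module_hom_closed[OF assms(6)]\<close>)
    also have "\<dots> = (\<Oplus>\<^bsub>N''\<^esub>l\<in>{k}. if l = k then g (y l) else \<zero>\<^bsub>N''\<^esub>)"
      by (rule finsum_superset[symmetric]) (use A k in \<open>auto intro!: module_hom_closed[OF assms(6)] N''.abelian_monoid_axioms\<close>)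
    also have "\<dots> = g (y k)"
    proof -
      have "y k \<in> carrier N" using k A by auto
      then have "g (y k) \<in> carrier N''" by (rule module_hom_closed[OF assms(6)])
      then show ?thesis by simp
    qed
    finally show "g (y k) = \<zero>\<^bsub>N''\<^esub>" by simp
  qed
  then have im: "\<exists>v\<in>carrier N'. y k = f v" if "k \<in> A" for k
    using that by auto
  have "pure_tensor R F N k (y k) \<in> tensor_map R F N (\<lambda>x. x) f ` carrier (tensor_module R F N')" if k: "k \<in> A" for k
  proof -
    obtain v where v: "v \<in> carrier N'" "y k = f v" using im[OF k] by auto
    have kF: "k \<in> carrier F" using k A KF by auto
    show ?thesis
      using tensor_map_pure[OF F assms(2) F assms(3) module_hom_id assms(5) kF v(1)]
        pure_tensor_closed[OF F assms(2) kF v(1)] unfolding v(2) by (metis imageI)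
  qed
  then show ?thesis unfolding z
    by (intro submodule_finsum[OF T submodule_image[OF Fm T' T submodule_carrier[OF T']]])
qed

lemma tensor_free_exact:
  assumes "free_module R F" "module R N'" "module R N" "module R N''"
    and "f \<in> module_hom R N' N" "g \<in> module_hom R N N''"
    and exact: "\<And>y. y \<in> carrier N \<Longrightarrow> g y = \<zero>\<^bsub>N''\<^esub> \<Longrightarrow> y \<in> f ` carrier N'"
    and "z \<in> carrier (tensor_module R N F)"
    and "tensor_map R N'' F g (\<lambda>x. x) z = \<zero>\<^bsub>tensor_module R N'' F\<^esub>"
  shows "z \<in> tensor_map R N F f (\<lambda>x. x) ` carrier (tensor_module R N' F)"
proof -
  have F: "module R F" using assms(1) by (simp add: free_module_def)
  have "tensor_map R F N'' (\<lambda>x. x) g (tensor_swap R N F z) = \<zero>\<^bsub>tensor_module R F N''\<^esub>"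
    using tensor_swap_map[OF assms(3) F assms(4) F assms(6) module_hom_id assms(8)] assms(9)
      module_hom_zero[OF tensor_swap_hom[OF assms(4) F] module_tensor[OF assms(4) F] module_tensor[OF F assms(4)]] by simp
  then obtain w where w: "w \<in> carrier (tensor_module R F N')" "tensor_swap R N F z = tensor_map R F N (\<lambda>x. x) f w"
    using free_tensor_exact[OF assms(1-6) exact module_hom_closed[OF tensor_swap_hom[OF assms(3) F] assms(8)]] by auto
  have "z = tensor_map R N F f (\<lambda>x. x) (tensor_swap R F N' w)"
    using tensor_swap_map[OF F assms(2) F assms(3) module_hom_id assms(5) w(1)] w(2)
      tensor_swap_swap[OF assms(3) F assms(8)] by simp
  then show ?thesis using module_hom_closed[OF tensor_swap_hom[OF F assms(2)] w(1)] by auto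
qed

section \<open>Constructions preserving freeness\<close>

lemma free_module_trivial:
  assumes "module R M" "carrier M = {\<zero>\<^bsub>M\<^esub>}"
  shows "free_module R M"
proof (rule dual_basis_imp_free_module)
  show "dual_basis R M {} (\<lambda>b. b) (\<lambda>_ _. undefined)"
    unfolding dual_basis_def spans_def using assms submodule_zero by auto
qed

lemma free_module_regular:
  assumes "cring R" shows "free_module R (regular_module R)"
proof (rule dual_basis_imp_free_module)
  interpret cring R by fact
  have "carrier R \<subseteq> L" if L: "submodule L R (regular_module R)" "\<one>\<^bsub>R\<^esub> \<in> L" for L
  proof
    fix x assume "x \<in> carrier R"
    then show "x \<in> L" using submodule_smult[OF L(1) _ L(2), of x] by simp
  qed
  then show "dual_basis R (regular_module R) {()} (\<lambda>_. \<one>\<^bsub>R\<^esub>) (\<lambda>_ x. x)"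
    unfolding dual_basis_def spans_def using module_regular[OF assms] module_hom_id by auto
qed

lemma free_module_tensor:
  assumes "free_module R M" "free_module R N"
  shows "free_module R (tensor_module R M N)"
proof -
  obtain K \<kappa> where K: "dual_basis R M K (\<lambda>b. b) \<kappa>" using free_module_imp_dual_basis[OF assms(1)] .
  obtain L \<mu> where L: "dual_basis R N L (\<lambda>b. b) \<mu>" using free_module_imp_dual_basis[OF assms(2)] .
  have M: "module R M" and N: "module R N" using assms by (auto simp: free_module_def)
  note T = module_tensor[OF M N]
  interpret M: module R M by fact
  have KM: "k \<in> K \<Longrightarrow> k \<in> carrier M" for k using dual_basis_mem[OF K] .
  have LN: "k \<in> L \<Longrightarrow> k \<in> carrier N" for k using dual_basis_mem[OF L] .
  have \<kappa>: "k \<in> K \<Longrightarrow> \<kappa> k \<in> module_hom R M (regular_module R)" for k using K by (auto simp: dual_basis_def)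
  have \<mu>: "k \<in> L \<Longrightarrow> \<mu> k \<in> module_hom R N (regular_module R)" for k using L by (auto simp: dual_basis_def)
  have \<kappa>c: "k \<in> K \<Longrightarrow> x \<in> carrier M \<Longrightarrow> \<kappa> k x \<in> carrier R" for k x using module_hom_closed[OF \<kappa>] by simp
  have \<mu>c: "k \<in> L \<Longrightarrow> x \<in> carrier N \<Longrightarrow> \<mu> k x \<in> carrier R" for k x using module_hom_closed[OF \<mu>] by simp
  note RR = module_regular[OF M.is_cring]
  let ?b = "\<lambda>k l x y. \<kappa> k x \<otimes>\<^bsub>R\<^esub> \<mu> l y"
  have bal: "balanced_map R M N (regular_module R) (?b k l)" if "k \<in> K" "l \<in> L" for k l
    unfolding balanced_map_def using that
    by (auto intro!: module_homI simp: \<kappa>c \<mu>c module_hom_add[OF \<kappa>] module_hom_add[OF \<mu>]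
        module_hom_smult[OF \<kappa>] module_hom_smult[OF \<mu>] M.R.r_distr M.R.l_distr M.R.m_ac)
  have "dual_basis R (tensor_module R M N) (K \<times> L) (\<lambda>(k, l). pure_tensor R M N k l)
     (\<lambda>(k, l). tensor_lift (regular_module R) (?b k l))"
    unfolding dual_basis_def
  proof (intro conjI ballI)
    show "spans R (tensor_module R M N) ((\<lambda>(k, l). pure_tensor R M N k l) ` (K \<times> L))"
      unfolding spans_def
    proof (intro conjI allI impI)
      show "(\<lambda>(k, l). pure_tensor R M N k l) ` (K \<times> L) \<subseteq> carrier (tensor_module R M N)"
        using pure_tensor_closed[OF M N] KM LN by auto
      fix H assume "submodule H R (tensor_module R M N) \<and> (\<lambda>(k, l). pure_tensor R M N k l) ` (K \<times> L) \<subseteq> H"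
      then have H: "submodule H R (tensor_module R M N)" and kl: "\<And>k l. k \<in> K \<Longrightarrow> l \<in> L \<Longrightarrow> pure_tensor R M N k l \<in> H"
        by auto
      have spM: "spans R M ((\<lambda>b. b) ` K)" and spN: "spans R N ((\<lambda>b. b) ` L)"
        using K L by (auto simp: dual_basis_def)
      have xl: "pure_tensor R M N x l \<in> H" if "x \<in> carrier M" "l \<in> L" for x l
        using spans_image_subset[OF spM M T pure_tensor_hom_left[OF M N LN[OF that(2)]] H _ that(1)] kl that by auto
      have "pure_tensor R M N x y \<in> H" if "x \<in> carrier M" "y \<in> carrier N" for x y
        using spans_image_subset[OF spN N T pure_tensor_hom_right[OF M N that(1)] H _ that(2)] xl that by auto
      then show "carrier (tensor_module R M N) \<subseteq> H"
        using spansD[OF tensor_spans[OF M N] H] by blast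
    qed
    show "(case kl of (k, l) \<Rightarrow> tensor_lift (regular_module R) (?b k l)) \<in> module_hom R (tensor_module R M N) (regular_module R)"
      if "kl \<in> K \<times> L" for kl
      using that tensor_lift_module_hom[OF M N RR bal] by auto
    show "(case kl of (k, l) \<Rightarrow> tensor_lift (regular_module R) (?b k l)) (case kl' of (k, l) \<Rightarrow> pure_tensor R M N k l)
      = (if kl = kl' then \<one>\<^bsub>R\<^esub> else \<zero>\<^bsub>R\<^esub>)" if "kl \<in> K \<times> L" "kl' \<in> K \<times> L" for kl kl'
    proof -
      obtain k l k' l' where kl: "kl = (k, l)" "kl' = (k', l')" "k \<in> K" "l \<in> L" "k' \<in> K" "l' \<in> L"
        using \<open>kl \<in> K \<times> L\<close> \<open>kl' \<in> K \<times> L\<close> by auto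
      then show ?thesis
        using K L KM LN by (cases "k = k'"; cases "l = l'") (auto simp: tensor_lift_pure_tensor[OF M N RR bal] dual_basis_def)
    qed
  qed (rule T)
  then show ?thesis by (rule dual_basis_imp_free_module)
qed

lemma dsum_proj_hom: "(\<lambda>f. f k) \<in> module_hom R (dsum_module K M) (M k)"
  by (rule module_homI) (auto simp: dsum_closed)

lemma free_module_dsum:
  assumes "cring R" "\<And>k. free_module R (M k)"
  shows "free_module R (dsum_module K M)"
proof -
  have M: "module R (M k)" for k using assms(2) by (auto simp: free_module_def)
  have "\<exists>B \<kappa>. dual_basis R (M k) B (\<lambda>b. b) \<kappa>" for k
    using free_module_imp_dual_basis[OF assms(2)[of k]] by metis
  then obtain B \<kappa> where db: "\<And>k. dual_basis R (M k) (B k) (\<lambda>b. b) (\<kappa> k)" by metis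
  have B: "b \<in> B k \<Longrightarrow> b \<in> carrier (M k)" for b k using dual_basis_mem[OF db] .
  have \<kappa>: "b \<in> B k \<Longrightarrow> \<kappa> k b \<in> module_hom R (M k) (regular_module R)"
    and \<delta>: "b \<in> B k \<Longrightarrow> c \<in> B k \<Longrightarrow> \<kappa> k b c = (if b = c then \<one>\<^bsub>R\<^esub> else \<zero>\<^bsub>R\<^esub>)"
    and sp: "spans R (M k) ((\<lambda>b. b) ` B k)" for b c k
    using db by (auto simp: dual_basis_def)
  note D = module_dsum[of R M, OF assms(1) M]
  note inj = dsum_inj_hom[of R M, OF assms(1) M]
  note RR = module_regular[OF assms(1)]
  have "dual_basis R (dsum_module K M) (Sigma K B) (\<lambda>(k, b). dsum_inj M k b) (\<lambda>(k, b) f. \<kappa> k b (f k))"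
    unfolding dual_basis_def
  proof (intro conjI ballI)
    show "spans R (dsum_module K M) ((\<lambda>(k, b). dsum_inj M k b) ` Sigma K B)"
      unfolding spans_def
    proof (intro conjI allI impI)
      show "(\<lambda>(k, b). dsum_inj M k b) ` Sigma K B \<subseteq> carrier (dsum_module K M)"
        using B module_hom_closed[OF inj] by auto
      fix H assume "submodule H R (dsum_module K M) \<and> (\<lambda>(k, b). dsum_inj M k b) ` Sigma K B \<subseteq> H"
      then have H: "submodule H R (dsum_module K M)" and kb: "\<And>k b. k \<in> K \<Longrightarrow> b \<in> B k \<Longrightarrow> dsum_inj M k b \<in> H"
        by auto
      have "dsum_inj M k x \<in> H" if "k \<in> K" "x \<in> carrier (M k)" for k x
        by (rule spans_image_subset[OF sp M D inj[OF that(1)] H _ that(2)]) (use kb that in auto)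
      then show "carrier (dsum_module K M) \<subseteq> H"
        using spansD[OF dsum_spans[of R M K, OF assms(1) M] H] by blast
    qed
    show "(case kb of (k, b) \<Rightarrow> \<lambda>f. \<kappa> k b (f k)) \<in> module_hom R (dsum_module K M) (regular_module R)"
      if "kb \<in> Sigma K B" for kb
      using that by (auto intro: module_hom_comp[OF dsum_proj_hom[of _ R K M] \<kappa>])
    show "(case kb of (k, b) \<Rightarrow> \<lambda>f. \<kappa> k b (f k)) (case lc of (k, b) \<Rightarrow> dsum_inj M k b)
        = (if kb = lc then \<one>\<^bsub>R\<^esub> else \<zero>\<^bsub>R\<^esub>)" if "kb \<in> Sigma K B" "lc \<in> Sigma K B" for kb lc
      using that \<delta> module_hom_zero[OF \<kappa> M RR] by (auto simp: dsum_inj_def split: if_splits)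
  qed (rule D)
  then show ?thesis by (rule dual_basis_imp_free_module)
qed

lemma free_module_prod:
  assumes "free_module R M" "free_module R N"
  shows "free_module R (prod_module M N)"
proof -
  obtain K \<kappa> where K: "dual_basis R M K (\<lambda>b. b) \<kappa>" using free_module_imp_dual_basis[OF assms(1)] .
  obtain L \<mu> where L: "dual_basis R N L (\<lambda>b. b) \<mu>" using free_module_imp_dual_basis[OF assms(2)] .
  have M: "module R M" and N: "module R N" using assms by (auto simp: free_module_def)
  note P = module_prod[OF M N]
  interpret M: module R M by fact
  interpret N: module R N by fact
  have \<kappa>: "k \<in> K \<Longrightarrow> \<kappa> k \<in> module_hom R M (regular_module R)" for k using K by (auto simp: dual_basis_def)
  have \<mu>: "k \<in> L \<Longrightarrow> \<mu> k \<in> module_hom R N (regular_module R)" for k using L by (auto simp: dual_basis_def)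
  note RR = module_regular[OF M.is_cring]
  have h1: "(\<lambda>x. (x, \<zero>\<^bsub>N\<^esub>)) \<in> module_hom R M (prod_module M N)" by (rule module_homI) auto
  have h2: "(\<lambda>y. (\<zero>\<^bsub>M\<^esub>, y)) \<in> module_hom R N (prod_module M N)" by (rule module_homI) auto
  have p1: "fst \<in> module_hom R (prod_module M N) M" by (rule module_homI) auto
  have p2: "snd \<in> module_hom R (prod_module M N) N" by (rule module_homI) auto
  have spM: "spans R M ((\<lambda>b. b) ` K)" and spN: "spans R N ((\<lambda>b. b) ` L)"
    using K L by (auto simp: dual_basis_def)
  have "dual_basis R (prod_module M N) (K <+> L)
     (case_sum (\<lambda>k. (k, \<zero>\<^bsub>N\<^esub>)) (\<lambda>l. (\<zero>\<^bsub>M\<^esub>, l))) (case_sum (\<lambda>k z. \<kappa> k (fst z)) (\<lambda>l z. \<mu> l (snd z)))"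
    unfolding dual_basis_def
  proof (intro conjI ballI)
    show "spans R (prod_module M N) (case_sum (\<lambda>k. (k, \<zero>\<^bsub>N\<^esub>)) (\<lambda>l. (\<zero>\<^bsub>M\<^esub>, l)) ` (K <+> L))"
      unfolding spans_def
    proof (intro conjI allI impI)
      show "case_sum (\<lambda>k. (k, \<zero>\<^bsub>N\<^esub>)) (\<lambda>l. (\<zero>\<^bsub>M\<^esub>, l)) ` (K <+> L) \<subseteq> carrier (prod_module M N)"
        using dual_basis_mem[OF K] dual_basis_mem[OF L] by auto
      fix H assume *: "submodule H R (prod_module M N) \<and> case_sum (\<lambda>k. (k, \<zero>\<^bsub>N\<^esub>)) (\<lambda>l. (\<zero>\<^bsub>M\<^esub>, l)) ` (K <+> L) \<subseteq> H"
      then have H: "submodule H R (prod_module M N)" by auto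
      have k: "(k, \<zero>\<^bsub>N\<^esub>) \<in> H" if "k \<in> K" for k using * that by (force simp: image_subset_iff)
      have l: "(\<zero>\<^bsub>M\<^esub>, l) \<in> H" if "l \<in> L" for l using * that by (force simp: image_subset_iff)
      have x: "(x, \<zero>\<^bsub>N\<^esub>) \<in> H" if "x \<in> carrier M" for x
        using spans_image_subset[OF spM M P h1 H _ that] k by auto
      have y: "(\<zero>\<^bsub>M\<^esub>, y) \<in> H" if "y \<in> carrier N" for y
        using spans_image_subset[OF spN N P h2 H _ that] l by auto
      show "carrier (prod_module M N) \<subseteq> H"
      proof clarsimp
        fix a b assume "a \<in> carrier M" "b \<in> carrier N"
        then show "(a, b) \<in> H" using submodule_add[OF H x y, of a b] by simp
      qed
    qed
    show "case_sum (\<lambda>k z. \<kappa> k (fst z)) (\<lambda>l z. \<mu> l (snd z)) i \<in> module_hom R (prod_module M N) (regular_module R)"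
      if "i \<in> K <+> L" for i
      using that module_hom_comp[OF p1 \<kappa>] module_hom_comp[OF p2 \<mu>] by auto
    show "case_sum (\<lambda>k z. \<kappa> k (fst z)) (\<lambda>l z. \<mu> l (snd z)) i (case_sum (\<lambda>k. (k, \<zero>\<^bsub>N\<^esub>)) (\<lambda>l. (\<zero>\<^bsub>M\<^esub>, l)) j)
      = (if i = j then \<one>\<^bsub>R\<^esub> else \<zero>\<^bsub>R\<^esub>)" if "i \<in> K <+> L" "j \<in> K <+> L" for i j
    proof -
      have "\<kappa> k k = \<one>\<^bsub>R\<^esub>" "l \<in> K \<Longrightarrow> k \<noteq> l \<Longrightarrow> \<kappa> k l = \<zero>\<^bsub>R\<^esub>" if "k \<in> K" for k l
        using K that by (simp_all add: dual_basis_def)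
      moreover have "\<mu> k k = \<one>\<^bsub>R\<^esub>" "l \<in> L \<Longrightarrow> k \<noteq> l \<Longrightarrow> \<mu> k l = \<zero>\<^bsub>R\<^esub>" if "k \<in> L" for k l
        using L that by (simp_all add: dual_basis_def)
      ultimately show ?thesis
        using that module_hom_zero[OF \<kappa> M RR] module_hom_zero[OF \<mu> N RR] by auto metis+
    qed
  qed (rule P)
  then show ?thesis by (rule dual_basis_imp_free_module)
qed

section \<open>Double complexes\<close>

text \<open>The two differentials are taken to anticommute, so that the sign of the total complex is
  part of the vertical differential and rows and columns play symmetric roles.\<close>

locale double_complex =
  fixes R :: "('a, 'r) ring_scheme" and A :: "int \<times> int \<Rightarrow> ('a, 'z) module"
    and D1 D2 :: "int \<Rightarrow> int \<Rightarrow> 'z \<Rightarrow> 'z"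
  assumes cring: "cring R"
    and A_module: "\<And>k. module R (A k)"
    and D1_hom: "\<And>i j. D1 i j \<in> module_hom R (A (i, j)) (A (i - 1, j))"
    and D2_hom: "\<And>i j. D2 i j \<in> module_hom R (A (i, j)) (A (i, j - 1))"
    and D1_D1: "\<And>i j x. x \<in> carrier (A (i, j)) \<Longrightarrow> D1 (i - 1) j (D1 i j x) = \<zero>\<^bsub>A (i - 2, j)\<^esub>"
    and D2_D2: "\<And>i j x. x \<in> carrier (A (i, j)) \<Longrightarrow> D2 i (j - 1) (D2 i j x) = \<zero>\<^bsub>A (i, j - 2)\<^esub>"
    and D1_D2: "\<And>i j x. x \<in> carrier (A (i, j)) \<Longrightarrow>
       D1 i (j - 1) (D2 i j x) \<oplus>\<^bsub>A (i - 1, j - 1)\<^esub> D2 (i - 1) j (D1 i j x) = \<zero>\<^bsub>A (i - 1, j - 1)\<^esub>"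
begin

abbreviation Tot :: "int \<Rightarrow> ('a, int \<times> int \<Rightarrow> 'z) module" where
  "Tot n \<equiv> dsum_module {(i, j). i + j = n} A"

definition tot :: "(int \<times> int \<Rightarrow> 'z) \<Rightarrow> int \<times> int \<Rightarrow> 'z" where
  "tot f = (\<lambda>(i, j). D1 (i + 1) j (f (i + 1, j)) \<oplus>\<^bsub>A (i, j)\<^esub> D2 i (j + 1) (f (i, j + 1)))"

lemma tot_apply: "tot f (i, j) = D1 (i + 1) j (f (i + 1, j)) \<oplus>\<^bsub>A (i, j)\<^esub> D2 i (j + 1) (f (i, j + 1))"
  by (simp add: tot_def)

lemma Tot_module: "module R (Tot n)"
  by (rule module_dsum[OF cring A_module])

lemma A_zero [simp]: "\<zero>\<^bsub>A k\<^esub> \<in> carrier (A k)"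
  using module_abelian_group[OF A_module] by (simp add: abelian_group_def abelian_monoid.zero_closed)

lemma A_add [simp]: "x \<in> carrier (A k) \<Longrightarrow> y \<in> carrier (A k) \<Longrightarrow> x \<oplus>\<^bsub>A k\<^esub> y \<in> carrier (A k)"
  using module_abelian_group[OF A_module] by (simp add: abelian_group_def abelian_monoid.a_closed)

lemma A_lzero [simp]: "x \<in> carrier (A k) \<Longrightarrow> \<zero>\<^bsub>A k\<^esub> \<oplus>\<^bsub>A k\<^esub> x = x"
  using module_abelian_group[OF A_module] by (simp add: abelian_group_def abelian_monoid.l_zero)

lemma A_rzero [simp]: "x \<in> carrier (A k) \<Longrightarrow> x \<oplus>\<^bsub>A k\<^esub> \<zero>\<^bsub>A k\<^esub> = x"
  using module_abelian_group[OF A_module] by (simp add: abelian_group_def abelian_monoid.r_zero)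

lemma A_neg [simp]: "x \<in> carrier (A k) \<Longrightarrow> \<ominus>\<^bsub>A k\<^esub> x \<in> carrier (A k)"
  using module_abelian_group[OF A_module] by (simp add: abelian_group.a_inv_closed)

lemma A_rneg [simp]: "x \<in> carrier (A k) \<Longrightarrow> x \<oplus>\<^bsub>A k\<^esub> \<ominus>\<^bsub>A k\<^esub> x = \<zero>\<^bsub>A k\<^esub>"
  using module_eq_iff_minus[OF A_module] by blast

lemma A_minus_zero [simp]: "\<ominus>\<^bsub>A k\<^esub> \<zero>\<^bsub>A k\<^esub> = \<zero>\<^bsub>A k\<^esub>"
  by (rule module_minus_zero[OF A_module])

lemma D1_closed [simp]: "x \<in> carrier (A (i, j)) \<Longrightarrow> D1 i j x \<in> carrier (A (i - 1, j))"
  by (rule module_hom_closed[OF D1_hom])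

lemma D2_closed [simp]: "x \<in> carrier (A (i, j)) \<Longrightarrow> D2 i j x \<in> carrier (A (i, j - 1))"
  by (rule module_hom_closed[OF D2_hom])

lemma D1_up: "D1 (i + 1) j \<in> module_hom R (A (i + 1, j)) (A (i, j))"
  using D1_hom[of "i + 1" j] by simp

lemma D2_up: "D2 i (j + 1) \<in> module_hom R (A (i, j + 1)) (A (i, j))"
  using D2_hom[of i "j + 1"] by simp

lemma D1_zero [simp]: "D1 i j \<zero>\<^bsub>A (i, j)\<^esub> = \<zero>\<^bsub>A (i - 1, j)\<^esub>"
  by (rule module_hom_zero[OF D1_hom A_module A_module])

lemma D2_zero [simp]: "D2 i j \<zero>\<^bsub>A (i, j)\<^esub> = \<zero>\<^bsub>A (i, j - 1)\<^esub>"
  by (rule module_hom_zero[OF D2_hom A_module A_module])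

lemma tot_hom: "tot \<in> module_hom R (Tot n) (Tot (n - 1))"
proof (rule module_homI)
  fix f assume f: "f \<in> carrier (Tot n)"
  note fc = dsum_closed[OF f]
  let ?S = "{k. f k \<noteq> \<zero>\<^bsub>A k\<^esub>}"
  have "k \<in> (\<lambda>(i, j). (i - 1, j)) ` ?S \<union> (\<lambda>(i, j). (i, j - 1)) ` ?S" if nz: "tot f k \<noteq> \<zero>\<^bsub>A k\<^esub>" for k
  proof -
    obtain i j where k: "k = (i, j)" by (cases k)
    have "f (i + 1, j) \<noteq> \<zero>\<^bsub>A (i + 1, j)\<^esub> \<or> f (i, j + 1) \<noteq> \<zero>\<^bsub>A (i, j + 1)\<^esub>"
      using nz D1_zero[of "i + 1" j] D2_zero[of i "j + 1"] by (auto simp: k tot_apply)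
    then show ?thesis unfolding k by (force simp: image_iff)
  qed
  then have sub: "{k. tot f k \<noteq> \<zero>\<^bsub>A k\<^esub>} \<subseteq> (\<lambda>(i, j). (i - 1, j)) ` ?S \<union> (\<lambda>(i, j). (i, j - 1)) ` ?S"
    by blast
  have fin: "finite {k. tot f k \<noteq> \<zero>\<^bsub>A k\<^esub>}"
    by (rule finite_subset[OF sub]) (intro finite_UnI finite_imageI dsum_support(1)[OF f])
  have "tot f k \<in> carrier (A k)" for k
    using fc module_hom_closed[OF D1_up] module_hom_closed[OF D2_up] by (cases k) (auto simp: tot_apply)
  moreover have "tot f k = \<zero>\<^bsub>A k\<^esub>" if "k \<notin> {(i, j). i + j = n - 1}" for k
  proof -
    obtain i j where k: "k = (i, j)" by (cases k)
    have "f (i + 1, j) = \<zero>\<^bsub>A (i + 1, j)\<^esub>" "f (i, j + 1) = \<zero>\<^bsub>A (i, j + 1)\<^esub>"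
      using dsum_outside[OF f] that by (auto simp: k)
    then show ?thesis using D1_zero[of "i + 1" j] D2_zero[of i "j + 1"] by (simp add: k tot_apply)
  qed
  ultimately show "tot f \<in> carrier (Tot (n - 1))" using fin by (auto simp: dsum_carrier_iff)
  {
    fix g assume g: "g \<in> carrier (Tot n)"
    show "tot (f \<oplus>\<^bsub>Tot n\<^esub> g) = tot f \<oplus>\<^bsub>Tot (n - 1)\<^esub> tot g"
    proof
      fix k :: "int \<times> int" obtain i j where k: "k = (i, j)" by (cases k)
      interpret Ak: module R "A (i, j)" by (rule A_module)
      show "tot (f \<oplus>\<^bsub>Tot n\<^esub> g) k = (tot f \<oplus>\<^bsub>Tot (n - 1)\<^esub> tot g) k"
        using fc dsum_closed[OF g] module_hom_closed[OF D1_up] module_hom_closed[OF D2_up]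
        by (simp add: k tot_apply module_hom_add[OF D1_up] module_hom_add[OF D2_up] Ak.M.a_ac)
    qed
  }
  fix r assume r: "r \<in> carrier R"
  show "tot (r \<odot>\<^bsub>Tot n\<^esub> f) = r \<odot>\<^bsub>Tot (n - 1)\<^esub> tot f"
  proof
    fix k :: "int \<times> int" obtain i j where k: "k = (i, j)" by (cases k)
    interpret Ak: module R "A (i, j)" by (rule A_module)
    show "tot (r \<odot>\<^bsub>Tot n\<^esub> f) k = (r \<odot>\<^bsub>Tot (n - 1)\<^esub> tot f) k"
      using fc r module_hom_closed[OF D1_up] module_hom_closed[OF D2_up]
      by (simp add: k tot_apply module_hom_smult[OF D1_up] module_hom_smult[OF D2_up] Ak.smult_r_distr)
  qed
qed

lemmas tot_closed = module_hom_closed[OF tot_hom]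

lemma tot_inj:
  assumes "x \<in> carrier (A (i, j))"
  shows "tot (dsum_inj A (i, j) x) =
    (\<lambda>k. dsum_inj A (i - 1, j) (D1 i j x) k \<oplus>\<^bsub>A k\<^esub> dsum_inj A (i, j - 1) (D2 i j x) k)"
proof
  fix k :: "int \<times> int" obtain a b where k: "k = (a, b)" by (cases k)
  have 1: "D1 (a + 1) b (dsum_inj A (i, j) x (a + 1, b)) = dsum_inj A (i - 1, j) (D1 i j x) (a, b)"
    using D1_zero[of "a + 1" b] by (auto simp: dsum_inj_def)
  have 2: "D2 a (b + 1) (dsum_inj A (i, j) x (a, b + 1)) = dsum_inj A (i, j - 1) (D2 i j x) (a, b)"
    using D2_zero[of a "b + 1"] by (auto simp: dsum_inj_def)
  show "tot (dsum_inj A (i, j) x) k = dsum_inj A (i - 1, j) (D1 i j x) k \<oplus>\<^bsub>A k\<^esub> dsum_inj A (i, j - 1) (D2 i j x) k"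
    by (simp only: k tot_apply 1 2)
qed

lemma tot_tot:
  assumes "f \<in> carrier (Tot n)" shows "tot (tot f) = (\<lambda>k. \<zero>\<^bsub>A k\<^esub>)"
proof
  fix k :: "int \<times> int" obtain i j where k: "k = (i, j)" by (cases k)
  interpret Ak: module R "A (i, j)" by (rule A_module)
  note fc = dsum_closed[OF assms]
  define p where "p = D1 (i + 1 + 1) j (f (i + 1 + 1, j))"
  define q where "q = D2 i (j + 1 + 1) (f (i, j + 1 + 1))"
  define m where "m = f (i + 1, j + 1)"
  have mc: "m \<in> carrier (A (i + 1, j + 1))" unfolding m_def by (rule fc)
  have pq: "p \<in> carrier (A (i + 1, j))" "q \<in> carrier (A (i, j + 1))"
    unfolding p_def q_def by (rule module_hom_closed[OF D1_up fc] module_hom_closed[OF D2_up fc])+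
  have m1: "D2 (i + 1) (j + 1) m \<in> carrier (A (i + 1, j))"
    by (rule module_hom_closed[OF D2_up mc])
  have m2: "D1 (i + 1) (j + 1) m \<in> carrier (A (i, j + 1))"
    by (rule module_hom_closed[OF D1_up mc])
  have t1: "tot f (i + 1, j) = p \<oplus>\<^bsub>A (i + 1, j)\<^esub> D2 (i + 1) (j + 1) m"
    unfolding tot_apply p_def m_def ..
  have t2: "tot f (i, j + 1) = D1 (i + 1) (j + 1) m \<oplus>\<^bsub>A (i, j + 1)\<^esub> q"
    unfolding tot_apply q_def m_def ..
  have a: "D1 (i + 1) j p = \<zero>\<^bsub>A (i, j)\<^esub>"
    using D1_D1[OF fc, of "i + 1 + 1" j] by (simp add: p_def ac_simps)
  have b: "D2 i (j + 1) q = \<zero>\<^bsub>A (i, j)\<^esub>"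
    using D2_D2[OF fc, of i "j + 1 + 1"] by (simp add: q_def ac_simps)
  have c: "D1 (i + 1) j (D2 (i + 1) (j + 1) m) \<oplus>\<^bsub>A (i, j)\<^esub> D2 i (j + 1) (D1 (i + 1) (j + 1) m) = \<zero>\<^bsub>A (i, j)\<^esub>"
    using D1_D2[OF mc] by simp
  note cl = module_hom_closed[OF D1_up m1] module_hom_closed[OF D2_up m2]
  have "tot (tot f) (i, j) = D1 (i + 1) j (tot f (i + 1, j)) \<oplus>\<^bsub>A (i, j)\<^esub> D2 i (j + 1) (tot f (i, j + 1))"
    by (rule tot_apply)
  also have "\<dots> = \<zero>\<^bsub>A (i, j)\<^esub>"
    unfolding t1 t2 using cl c
    by (simp add: module_hom_add[OF D1_up pq(1) m1] module_hom_add[OF D2_up m2 pq(2)] a b)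
  finally show "tot (tot f) k = \<zero>\<^bsub>A k\<^esub>" by (simp add: k)
qed

lemma inj_closed: "x \<in> carrier (A (i, j)) \<Longrightarrow> i + j = n \<Longrightarrow> dsum_inj A (i, j) x \<in> carrier (Tot n)"
  by (rule module_hom_closed[OF dsum_inj_hom[of R A, OF cring A_module]]) auto

definition boundary :: "int \<Rightarrow> (int \<times> int \<Rightarrow> 'z) \<Rightarrow> bool" where
  "boundary n f \<longleftrightarrow> (\<exists>g\<in>carrier (Tot (n + 1)). tot g = f)"

lemma boundary_diff:
  assumes "f \<in> carrier (Tot n)" "g \<in> carrier (Tot (n + 1))"
    and "boundary n (\<lambda>k. f k \<oplus>\<^bsub>A k\<^esub> \<ominus>\<^bsub>A k\<^esub> tot g k)"
  shows "boundary n f"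
proof -
  obtain h where h: "h \<in> carrier (Tot (n + 1))" "tot h = (\<lambda>k. f k \<oplus>\<^bsub>A k\<^esub> \<ominus>\<^bsub>A k\<^esub> tot g k)"
    using assms(3) by (auto simp: boundary_def)
  interpret T: module R "Tot (n + 1)" by (rule Tot_module)
  have tg: "tot g \<in> carrier (Tot n)" using tot_closed[OF assms(2)] by simp
  have "f k = f k \<oplus>\<^bsub>A k\<^esub> \<ominus>\<^bsub>A k\<^esub> tot g k \<oplus>\<^bsub>A k\<^esub> tot g k" for k
  proof -
    interpret Ak: module R "A k" by (rule A_module)
    show ?thesis using dsum_closed[OF assms(1), of k] dsum_closed[OF tg, of k]
      by (simp add: Ak.M.a_assoc Ak.M.l_neg)
  qed
  then have "tot (h \<oplus>\<^bsub>Tot (n + 1)\<^esub> g) = f"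
    using module_hom_add[OF tot_hom h(1) assms(2)] h(2) by auto
  then show ?thesis using h(1) assms(2) unfolding boundary_def by blast
qed

lemma cycle_diff:
  assumes "f \<in> carrier (Tot n)" "g \<in> carrier (Tot (n + 1))"
  shows "(\<lambda>k. f k \<oplus>\<^bsub>A k\<^esub> \<ominus>\<^bsub>A k\<^esub> tot g k) \<in> carrier (Tot n)"
    and "tot (\<lambda>k. f k \<oplus>\<^bsub>A k\<^esub> \<ominus>\<^bsub>A k\<^esub> tot g k) = tot f"
proof -
  interpret T: module R "Tot n" by (rule Tot_module)
  interpret T1: module R "Tot (n - 1)" by (rule Tot_module)
  have tg: "tot g \<in> carrier (Tot n)" using tot_closed[OF assms(2)] by simp
  have e: "(\<lambda>k. f k \<oplus>\<^bsub>A k\<^esub> \<ominus>\<^bsub>A k\<^esub> tot g k) = f \<oplus>\<^bsub>Tot n\<^esub> \<ominus>\<^bsub>Tot n\<^esub> tot g"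
    using dsum_minus[of R A, OF cring A_module tg] by simp
  show "(\<lambda>k. f k \<oplus>\<^bsub>A k\<^esub> \<ominus>\<^bsub>A k\<^esub> tot g k) \<in> carrier (Tot n)"
    unfolding e using assms(1) tg by (simp del: dsum_module_simps)
  have "tot (f \<oplus>\<^bsub>Tot n\<^esub> \<ominus>\<^bsub>Tot n\<^esub> tot g) = tot f \<oplus>\<^bsub>Tot (n - 1)\<^esub> \<ominus>\<^bsub>Tot (n - 1)\<^esub> tot (tot g)"
    using module_hom_add[OF tot_hom assms(1), of "\<ominus>\<^bsub>Tot n\<^esub> tot g"] tg
      module_hom_minus[OF tot_hom Tot_module Tot_module tg] by (simp del: dsum_module_simps)
  also have "\<dots> = tot f"
  proof -
    have "tot (tot g) = \<zero>\<^bsub>Tot (n - 1)\<^esub>" using tot_tot[OF assms(2)] by simp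
    then show ?thesis
      by (simp only: module_minus_zero[OF Tot_module] T1.M.r_zero[OF tot_closed[OF assms(1)]])
  qed
  finally show "tot (\<lambda>k. f k \<oplus>\<^bsub>A k\<^esub> \<ominus>\<^bsub>A k\<^esub> tot g k) = tot f" unfolding e .
qed

lemma zero_boundary: "boundary n (\<lambda>k. \<zero>\<^bsub>A k\<^esub>)"
proof -
  interpret T: module R "Tot (n + 1)" by (rule Tot_module)
  show ?thesis unfolding boundary_def
    using T.M.zero_closed module_hom_zero[OF tot_hom Tot_module Tot_module, of "n + 1"] by auto
qed

text \<open>The rightmost component of a cycle that is supported above the row \<open>j0\<close> is a vertical cycle, hence
  a vertical boundary.  Subtracting the corresponding total boundary removes this component and
  changes only its left neighbour on the antidiagonal.  As the double complex vanishes to the left of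
  \<open>i0\<close>, this stops after finitely many steps.\<close>

lemma column_exact_above:
  assumes left: "\<And>i j. i < i0 \<Longrightarrow> carrier (A (i, j)) = {\<zero>\<^bsub>A (i, j)\<^esub>}"
    and col: "\<And>i j x. i + j = n \<Longrightarrow> j0 < j \<Longrightarrow> x \<in> carrier (A (i, j)) \<Longrightarrow> D2 i j x = \<zero>\<^bsub>A (i, j - 1)\<^esub> \<Longrightarrow>
       \<exists>y\<in>carrier (A (i, j + 1)). x = D2 i (j + 1) y"
    and "f \<in> carrier (Tot n)" "tot f = (\<lambda>k. \<zero>\<^bsub>A k\<^esub>)"
    and "\<And>i j. i + j = n \<Longrightarrow> j \<le> j0 \<Longrightarrow> f (i, j) = \<zero>\<^bsub>A (i, j)\<^esub>"
  shows "boundary n f"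
proof -
  have "boundary n f" if "f \<in> carrier (Tot n)" "tot f = (\<lambda>k. \<zero>\<^bsub>A k\<^esub>)"
    "\<And>i j. i + j = n \<Longrightarrow> j \<le> j0 \<Longrightarrow> f (i, j) = \<zero>\<^bsub>A (i, j)\<^esub>"
    "\<And>i j. i + j = n \<Longrightarrow> i \<ge> i0 + int m \<Longrightarrow> f (i, j) = \<zero>\<^bsub>A (i, j)\<^esub>" for m f
    using that
  proof (induction m arbitrary: f)
    case 0
    have "f k = \<zero>\<^bsub>A k\<^esub>" for k
    proof -
      obtain i j where k: "k = (i, j)" by (cases k)
      show ?thesis
        using 0(4)[of i j] left[of i j] dsum_closed[OF 0(1), of k] dsum_outside[OF 0(1), of k]
        by (cases "i + j = n"; cases "i < i0") (auto simp: k)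
    qed
    then have "f = (\<lambda>k. \<zero>\<^bsub>A k\<^esub>)" by auto
    then show ?case using zero_boundary by simp
  next
    case (Suc m)
    define i where "i = i0 + int m"
    define j where "j = n - i"
    have ij: "i + j = n" by (simp add: j_def)
    have fc: "f k \<in> carrier (A k)" for k by (rule dsum_closed[OF Suc.prems(1)])
    show ?case
    proof (cases "j \<le> j0")
      case True
      have "f (a, b) = \<zero>\<^bsub>A (a, b)\<^esub>" if "a + b = n" "a \<ge> i0 + int m" for a b
      proof (cases "a = i")
        case True
        then show ?thesis using that ij \<open>j \<le> j0\<close> Suc.prems(3)[of a b] by simp
      next
        case False
        then show ?thesis using that Suc.prems(4)[of a b] by (simp add: i_def)
      qed
      then show ?thesis using Suc.IH[OF Suc.prems(1-3)] by blast
    next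
      case False
      have "f (i + 1, j - 1) = \<zero>\<^bsub>A (i + 1, j - 1)\<^esub>"
        using Suc.prems(4)[of "i + 1" "j - 1"] ij by (simp add: i_def)
      then have "D2 i j (f (i, j)) = \<zero>\<^bsub>A (i, j - 1)\<^esub>"
        using fun_cong[OF Suc.prems(2), of "(i, j - 1)"] D1_zero[of "i + 1" "j - 1"] D2_closed[OF fc, of i j]
        by (simp add: tot_apply)
      then obtain y where y: "y \<in> carrier (A (i, j + 1))" "f (i, j) = D2 i (j + 1) y"
        using col[OF ij _ fc] False by auto
      let ?g = "dsum_inj A (i, j + 1) y"
      have g: "?g \<in> carrier (Tot (n + 1))" using y(1) ij by (intro inj_closed) auto
      let ?f = "\<lambda>k. f k \<oplus>\<^bsub>A k\<^esub> \<ominus>\<^bsub>A k\<^esub> tot ?g k"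
      have tg: "tot ?g = (\<lambda>k. dsum_inj A (i - 1, j + 1) (D1 i (j + 1) y) k \<oplus>\<^bsub>A k\<^esub> dsum_inj A (i, j) (f (i, j)) k)"
        using tot_inj[OF y(1)] y(2) by simp
      have at: "?f (i, j) = \<zero>\<^bsub>A (i, j)\<^esub>" using fc by (simp add: tg)
      have off: "?f (a, b) = f (a, b)" if "a \<noteq> i - 1" "a \<noteq> i" for a b
        using that fc by (simp add: tg)
      have offb: "?f (a, b) = f (a, b)" if "b \<le> j0" for a b
        using that False fc by (simp add: tg)
      have "boundary n ?f"
      proof (rule Suc.IH)
        show "?f \<in> carrier (Tot n)" by (rule cycle_diff(1)[OF Suc.prems(1) g])
        show "tot ?f = (\<lambda>k. \<zero>\<^bsub>A k\<^esub>)" using cycle_diff(2)[OF Suc.prems(1) g] Suc.prems(2) by simp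
        show "?f (a, b) = \<zero>\<^bsub>A (a, b)\<^esub>" if "a + b = n" "b \<le> j0" for a b
          by (rule trans[OF offb[OF that(2)] Suc.prems(3)[OF that]])
        show "?f (a, b) = \<zero>\<^bsub>A (a, b)\<^esub>" if "a + b = n" "a \<ge> i0 + int m" for a b
        proof (cases "a = i")
          case True
          then have "b = j" using that ij by simp
          with True at show ?thesis by simp
        next
          case False
          then have "a \<noteq> i - 1" "a \<noteq> i" "a \<ge> i0 + int (Suc m)" using that by (auto simp: i_def)
          then show ?thesis by (intro trans[OF off Suc.prems(4)[OF that(1)]]) auto
        qed
      qed
      then show ?thesis by (rule boundary_diff[OF Suc.prems(1) g])
    qed
  qed
  moreover have "\<And>i j. i + j = n \<Longrightarrow> i \<ge> i0 + int (nat (n - j0 - i0)) \<Longrightarrow> f (i, j) = \<zero>\<^bsub>A (i, j)\<^esub>"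
    by (rule assms(5)) linarith+
  ultimately show ?thesis using assms(3-5) by blast
qed

text \<open>The condition on the bottom row takes the place of column exactness there: it allows one to subtract
  a total boundary that makes the bottom component of the cycle vanish.\<close>

lemma columns_exact_imp_boundary:
  assumes left: "\<And>i j. i < i0 \<Longrightarrow> carrier (A (i, j)) = {\<zero>\<^bsub>A (i, j)\<^esub>}"
    and bottom: "\<And>i j. j < j0 \<Longrightarrow> carrier (A (i, j)) = {\<zero>\<^bsub>A (i, j)\<^esub>}"
    and col: "\<And>i j x. i + j = n \<Longrightarrow> j0 < j \<Longrightarrow> x \<in> carrier (A (i, j)) \<Longrightarrow> D2 i j x = \<zero>\<^bsub>A (i, j - 1)\<^esub> \<Longrightarrow>
       \<exists>y\<in>carrier (A (i, j + 1)). x = D2 i (j + 1) y"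
    and bot: "\<And>i x w. i + j0 = n \<Longrightarrow> x \<in> carrier (A (i, j0)) \<Longrightarrow> w \<in> carrier (A (i - 1, j0 + 1)) \<Longrightarrow>
       D1 i j0 x = D2 (i - 1) (j0 + 1) w \<Longrightarrow>
       \<exists>u\<in>carrier (A (i + 1, j0)). \<exists>v\<in>carrier (A (i, j0 + 1)). x = D1 (i + 1) j0 u \<oplus>\<^bsub>A (i, j0)\<^esub> D2 i (j0 + 1) v"
    and f: "f \<in> carrier (Tot n)" and tf: "tot f = (\<lambda>k. \<zero>\<^bsub>A k\<^esub>)"
  shows "boundary n f"
proof -
  have fc: "f k \<in> carrier (A k)" for k by (rule dsum_closed[OF f])
  define i where "i = n - j0"
  have ij: "i + j0 = n" by (simp add: i_def)
  have c1: "D1 i j0 (f (i, j0)) \<in> carrier (A (i - 1, j0))" using fc by simp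
  have c2: "D2 (i - 1) (j0 + 1) (f (i - 1, j0 + 1)) \<in> carrier (A (i - 1, j0))"
    using D2_closed[OF fc, of "i - 1" "j0 + 1"] by simp
  have "D1 i j0 (f (i, j0)) \<oplus>\<^bsub>A (i - 1, j0)\<^esub> D2 (i - 1) (j0 + 1) (f (i - 1, j0 + 1)) = \<zero>\<^bsub>A (i - 1, j0)\<^esub>"
    using fun_cong[OF tf, of "(i - 1, j0)"] by (simp add: tot_apply)
  then have "D1 i j0 (f (i, j0)) = D2 (i - 1) (j0 + 1) (\<ominus>\<^bsub>A (i - 1, j0 + 1)\<^esub> f (i - 1, j0 + 1))"
    using module_add_eq_zeroD[OF A_module c1 c2] module_hom_minus[OF D2_up A_module A_module fc] by simp
  then obtain u v where uv: "u \<in> carrier (A (i + 1, j0))" "v \<in> carrier (A (i, j0 + 1))"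
    "f (i, j0) = D1 (i + 1) j0 u \<oplus>\<^bsub>A (i, j0)\<^esub> D2 i (j0 + 1) v"
    using bot[OF ij fc A_neg[OF fc]] by auto
  let ?gu = "dsum_inj A (i + 1, j0) u" and ?gv = "dsum_inj A (i, j0 + 1) v"
  have gu: "?gu \<in> carrier (Tot (n + 1))" using uv ij by (intro inj_closed) auto
  have gv: "?gv \<in> carrier (Tot (n + 1))" using uv ij by (intro inj_closed) auto
  interpret T: module R "Tot (n + 1)" by (rule Tot_module)
  let ?g = "?gu \<oplus>\<^bsub>Tot (n + 1)\<^esub> ?gv"
  have g: "?g \<in> carrier (Tot (n + 1))" by (rule T.M.a_closed[OF gu gv])
  have tg: "tot ?g (i, j0) = f (i, j0)"
  proof -
    have "tot ?g (i, j0) = tot ?gu (i, j0) \<oplus>\<^bsub>A (i, j0)\<^esub> tot ?gv (i, j0)"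
      using module_hom_add[OF tot_hom gu gv] by simp
    moreover have "tot ?gu (i, j0) = D1 (i + 1) j0 u"
      unfolding tot_inj[OF uv(1)] using module_hom_closed[OF D1_up uv(1)] by simp
    moreover have "tot ?gv (i, j0) = D2 i (j0 + 1) v"
      unfolding tot_inj[OF uv(2)] using module_hom_closed[OF D2_up uv(2)] by simp
    ultimately show ?thesis using uv(3) by simp
  qed
  show ?thesis
  proof (rule boundary_diff[OF f g], rule column_exact_above[OF left col])
    show "(\<lambda>k. f k \<oplus>\<^bsub>A k\<^esub> \<ominus>\<^bsub>A k\<^esub> tot ?g k) \<in> carrier (Tot n)" by (rule cycle_diff(1)[OF f g])
    show "tot (\<lambda>k. f k \<oplus>\<^bsub>A k\<^esub> \<ominus>\<^bsub>A k\<^esub> tot ?g k) = (\<lambda>k. \<zero>\<^bsub>A k\<^esub>)"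
      using cycle_diff(2)[OF f g] tf by simp
    show "f (a, b) \<oplus>\<^bsub>A (a, b)\<^esub> \<ominus>\<^bsub>A (a, b)\<^esub> tot ?g (a, b) = \<zero>\<^bsub>A (a, b)\<^esub>" if "a + b = n" "b \<le> j0" for a b
    proof (cases "b = j0")
      case True
      then have "a = i" using that ij by simp
      then show ?thesis using True tg fc by simp
    next
      case False
      then have "carrier (A (a, b)) = {\<zero>\<^bsub>A (a, b)\<^esub>}" using that bottom by auto
      then show ?thesis using dsum_closed[OF cycle_diff(1)[OF f g], of "(a, b)"] by auto
    qed
  qed
qed

text \<open>Let the total differential of \<open>f\<close> vanish in the columns to the left of \<open>k\<close>.  Its component in column
  \<open>k\<close> is then a horizontal cycle, and exactness of the rows allows one to remove it by changing \<open>f\<close>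
  in column \<open>k + 1\<close> only.  This ends when the antidiagonal leaves the upper half plane.\<close>

lemma extend_to_cycle:
  assumes bottom: "\<And>i j. j < 0 \<Longrightarrow> carrier (A (i, j)) = {\<zero>\<^bsub>A (i, j)\<^esub>}"
    and row: "\<And>i j x. 1 \<le> i \<Longrightarrow> x \<in> carrier (A (i, j)) \<Longrightarrow> D1 i j x = \<zero>\<^bsub>A (i - 1, j)\<^esub> \<Longrightarrow>
       \<exists>y\<in>carrier (A (i + 1, j)). x = D1 (i + 1) j y"
    and "f \<in> carrier (Tot n)" "1 \<le> k" "\<And>i j. i < k \<Longrightarrow> tot f (i, j) = \<zero>\<^bsub>A (i, j)\<^esub>"
  shows "\<exists>g\<in>carrier (Tot n). tot g = (\<lambda>k. \<zero>\<^bsub>A k\<^esub>) \<and> (\<forall>j. g (0, j) = f (0, j))"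
  using assms(3-5)
proof (induction "nat (n - k)" arbitrary: f k rule: less_induct)
  case less
  have fc: "f k \<in> carrier (A k)" for k by (rule dsum_closed[OF less.prems(1)])
  note tf = tot_closed[OF less.prems(1)]
  have tfc: "tot f k \<in> carrier (A k)" for k by (rule dsum_closed[OF tf])
  show ?case
  proof (cases "k < n")
    case False
    have "tot f (i, j) = \<zero>\<^bsub>A (i, j)\<^esub>" for i j
    proof -
      consider "i < k" | "i + j \<noteq> n - 1" | "j < 0" using False by linarith
      then show ?thesis
        using less.prems(3)[of i j] dsum_outside[OF tf, of "(i, j)"] bottom[of j i] tfc[of "(i, j)"]
        by cases auto
    qed
    then have "tot f = (\<lambda>k. \<zero>\<^bsub>A k\<^esub>)" by (auto simp: fun_eq_iff)
    then show ?thesis using less.prems(1) by auto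
  next
    case True
    define j where "j = n - 1 - k"
    have "tot (tot f) (k - 1, j) = \<zero>\<^bsub>A (k - 1, j)\<^esub>" using tot_tot[OF less.prems(1)] by simp
    moreover have "tot f (k - 1, j + 1) = \<zero>\<^bsub>A (k - 1, j + 1)\<^esub>" using less.prems(3) by simp
    ultimately have "D1 k j (tot f (k, j)) = \<zero>\<^bsub>A (k - 1, j)\<^esub>"
      using D2_zero[of "k - 1" "j + 1"] tfc by (simp add: tot_apply[of "tot f"])
    then obtain y where y: "y \<in> carrier (A (k + 1, j))" "tot f (k, j) = D1 (k + 1) j y"
      using row[OF less.prems(2) tfc] by auto
    let ?y = "dsum_inj A (k + 1, j) y"
    have yc: "?y \<in> carrier (Tot n)" using y(1) by (intro inj_closed) (auto simp: j_def)
    interpret T: module R "Tot n" by (rule Tot_module)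
    let ?f = "f \<oplus>\<^bsub>Tot n\<^esub> \<ominus>\<^bsub>Tot n\<^esub> ?y"
    have f': "?f \<in> carrier (Tot n)" using less.prems(1) yc by (simp del: dsum_module_simps)
    have my: "\<ominus>\<^bsub>Tot n\<^esub> ?y = (\<lambda>k. \<ominus>\<^bsub>A k\<^esub> ?y k)" by (rule dsum_minus[of R A, OF cring A_module yc])
    have tf': "tot ?f l = tot f l \<oplus>\<^bsub>A l\<^esub> \<ominus>\<^bsub>A l\<^esub> tot ?y l" for l
      using module_hom_add[OF tot_hom less.prems(1) T.a_inv_closed[OF yc]]
        module_hom_minus[OF tot_hom Tot_module Tot_module yc]
        dsum_minus[of R A, OF cring A_module tot_closed[OF yc]] by simp
    have ty: "tot ?y = (\<lambda>l. dsum_inj A (k, j) (tot f (k, j)) l \<oplus>\<^bsub>A l\<^esub> dsum_inj A (k + 1, j - 1) (D2 (k + 1) j y) l)"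
      unfolding tot_inj[OF y(1)] by (simp add: y(2))
    have "\<exists>g\<in>carrier (Tot n). tot g = (\<lambda>k. \<zero>\<^bsub>A k\<^esub>) \<and> (\<forall>j. g (0, j) = ?f (0, j))"
    proof (rule less.hyps[of "k + 1"])
      show "nat (n - (k + 1)) < nat (n - k)" using True by simp
      show "?f \<in> carrier (Tot n)" by fact
      show "1 \<le> k + 1" using less.prems(2) by simp
      show "tot ?f (a, b) = \<zero>\<^bsub>A (a, b)\<^esub>" if "a < k + 1" for a b
      proof (cases "(a, b) = (k, j)")
        case True
        then show ?thesis unfolding tf' ty using tfc by simp
      next
        case False
        have "tot f (a, b) = \<zero>\<^bsub>A (a, b)\<^esub>"
        proof (cases "a = k")
          case True
          then have "a + b \<noteq> n - 1" using False by (auto simp: j_def)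
          then show ?thesis using dsum_outside[OF tf] by auto
        next
          case False
          then show ?thesis using that less.prems(3) by simp
        qed
        then show ?thesis unfolding tf' ty using that False by simp
      qed
    qed
    moreover have "?f (0, b) = f (0, b)" for b
      unfolding my using less.prems(2) fc by simp
    ultimately show ?thesis by auto
  qed
qed

text \<open>The element \<open>z - w\<close> of the total complex extends to a total cycle; a total preimage of that cycle
  has the wanted components.\<close>

lemma left_edge_condition:
  assumes left: "\<And>i j. i < 0 \<Longrightarrow> carrier (A (i, j)) = {\<zero>\<^bsub>A (i, j)\<^esub>}"
    and bottom: "\<And>i j. j < 0 \<Longrightarrow> carrier (A (i, j)) = {\<zero>\<^bsub>A (i, j)\<^esub>}"
    and row: "\<And>i j x. 1 \<le> i \<Longrightarrow> x \<in> carrier (A (i, j)) \<Longrightarrow> D1 i j x = \<zero>\<^bsub>A (i - 1, j)\<^esub> \<Longrightarrow>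
       \<exists>y\<in>carrier (A (i + 1, j)). x = D1 (i + 1) j y"
    and total: "\<And>f. f \<in> carrier (Tot n) \<Longrightarrow> tot f = (\<lambda>k. \<zero>\<^bsub>A k\<^esub>) \<Longrightarrow> boundary n f"
    and z: "z \<in> carrier (A (0, n))" and w: "w \<in> carrier (A (1, n - 1))" and "D2 0 n z = D1 1 (n - 1) w"
  shows "\<exists>u\<in>carrier (A (1, n)). \<exists>v\<in>carrier (A (0, n + 1)). z = D1 1 n u \<oplus>\<^bsub>A (0, n)\<^esub> D2 0 (n + 1) v"
proof -
  interpret T: module R "Tot n" by (rule Tot_module)
  let ?z = "dsum_inj A (0, n) z" and ?w = "dsum_inj A (1, n - 1) w"
  have zc: "?z \<in> carrier (Tot n)" using z by (intro inj_closed) auto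
  have wc: "?w \<in> carrier (Tot n)" using w by (intro inj_closed) auto
  let ?f = "?z \<oplus>\<^bsub>Tot n\<^esub> \<ominus>\<^bsub>Tot n\<^esub> ?w"
  have f: "?f \<in> carrier (Tot n)" using zc wc by (simp del: dsum_module_simps)
  have tf: "tot ?f l = tot ?z l \<oplus>\<^bsub>A l\<^esub> \<ominus>\<^bsub>A l\<^esub> tot ?w l" for l
    using module_hom_add[OF tot_hom zc T.a_inv_closed[OF wc]]
      module_hom_minus[OF tot_hom Tot_module Tot_module wc]
      dsum_minus[of R A, OF cring A_module tot_closed[OF wc]] by simp
  have D2z: "D2 0 n z \<in> carrier (A (0, n - 1))" using z by simp
  have tf0: "tot ?f (i, j) = \<zero>\<^bsub>A (i, j)\<^esub>" if "i < 1" for i j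
  proof (cases "i < 0")
    case True
    then show ?thesis using left dsum_closed[OF tot_closed[OF f], of "(i, j)"] by auto
  next
    case False
    then have i: "i = 0" using that by simp
    show ?thesis
      unfolding tf tot_inj[OF z] tot_inj[OF w] i using D2z assms(7) by (cases "j = n - 1") simp_all
  qed
  have "\<exists>g\<in>carrier (Tot n). tot g = (\<lambda>k. \<zero>\<^bsub>A k\<^esub>) \<and> (\<forall>j. g (0, j) = ?f (0, j))"
    by (rule extend_to_cycle[OF bottom row f order_refl tf0])
  then obtain g where g: "g \<in> carrier (Tot n)" "tot g = (\<lambda>k. \<zero>\<^bsub>A k\<^esub>)" "\<forall>j. g (0, j) = ?f (0, j)"
    by blast
  then obtain h where h: "h \<in> carrier (Tot (n + 1))" "tot h = g"
    using total by (auto simp: boundary_def)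
  have "g (0, n) = z"
    using g(3) z dsum_minus[of R A, OF cring A_module wc] by simp
  then have "z = D1 1 n (h (1, n)) \<oplus>\<^bsub>A (0, n)\<^esub> D2 0 (n + 1) (h (0, n + 1))"
    using fun_cong[OF h(2), of "(0, n)"] by (simp add: tot_apply)
  then show ?thesis using dsum_closed[OF h(1)] by blast
qed

end

section \<open>The tensor product of complexes as a total complex\<close>

lemma chain_complex_module: "chain_complex R C \<Longrightarrow> module R (Md C n)"
  by (simp add: chain_complex_def)

lemma chain_complex_hom: "chain_complex R C \<Longrightarrow> bd C n \<in> module_hom R (Md C n) (Md C (n - 1))"
  by (simp add: chain_complex_def)

lemma chain_complex_bd_bd:
  "chain_complex R C \<Longrightarrow> x \<in> carrier (Md C n) \<Longrightarrow> bd C (n - 1) (bd C n x) = \<zero>\<^bsub>Md C (n - 2)\<^esub>"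
  by (simp add: chain_complex_def)

lemma chain_complex_hom_up:
  "chain_complex R C \<Longrightarrow> bd C (n + 1) \<in> module_hom R (Md C (n + 1)) (Md C n)"
  using chain_complex_hom[of R C "n + 1"] by simp

lemma chain_complex_cring: "chain_complex R C \<Longrightarrow> cring R"
  using chain_complex_module module_cring by blast

lemma sign_smult_sign_smult:
  assumes "module R M" "x \<in> carrier M"
  shows "sign_smult M k (sign_smult M k x) = x"
proof -
  interpret M: module R M by fact
  show ?thesis using assms(2) by (simp add: sign_smult_def)
qed

lemma sign_smult_cancel:
  assumes "module R M" "x \<in> carrier M" "odd (k + l)"
  shows "sign_smult M k x \<oplus>\<^bsub>M\<^esub> sign_smult M l x = \<zero>\<^bsub>M\<^esub>"
proof -
  interpret M: module R M by fact
  show ?thesis using assms(2,3) by (auto simp: sign_smult_def M.M.l_neg M.M.r_neg)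
qed

lemma bigraded_tensor_apply [simp]: "bigraded_tensor R X Y (i, j) = tensor_module R (Md X i) (Md Y j)"
  by (simp add: bigraded_tensor_def)

lemma bigraded_tensor_module:
  assumes "\<And>i. module R (Md X i)" "\<And>j. module R (Md Y j)"
  shows "module R (bigraded_tensor R X Y k)"
  using module_tensor[OF assms] by (cases k) simp

definition tensor_D1 ::
  "('a, 'r) ring_scheme \<Rightarrow> ('a, 'm) cplx \<Rightarrow> ('a, 'n) cplx \<Rightarrow> int \<Rightarrow> int
    \<Rightarrow> ('m \<times> 'n \<Rightarrow>\<^sub>0 int) set \<Rightarrow> ('m \<times> 'n \<Rightarrow>\<^sub>0 int) set" where
  "tensor_D1 R X Y i j = tensor_map R (Md X (i - 1)) (Md Y j) (bd X i) (\<lambda>y. y)"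

definition tensor_D2 ::
  "('a, 'r) ring_scheme \<Rightarrow> ('a, 'm) cplx \<Rightarrow> ('a, 'n) cplx \<Rightarrow> int \<Rightarrow> int
    \<Rightarrow> ('m \<times> 'n \<Rightarrow>\<^sub>0 int) set \<Rightarrow> ('m \<times> 'n \<Rightarrow>\<^sub>0 int) set" where
  "tensor_D2 R X Y i j = (\<lambda>t. sign_smult (bigraded_tensor R X Y (i, j - 1)) i
     (tensor_map R (Md X i) (Md Y (j - 1)) (\<lambda>x. x) (bd Y j) t))"

context
  fixes R :: "('a, 'r) ring_scheme" and X :: "('a, 'm) cplx" and Y :: "('a, 'n) cplx"
  assumes X: "chain_complex R X" and Y: "chain_complex R Y"
begin

lemmas Xm = chain_complex_module[OF X] and Ym = chain_complex_module[OF Y]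
lemmas Xh = chain_complex_hom[OF X] and Yh = chain_complex_hom[OF Y]

lemma tensor_D1_hom:
  "tensor_D1 R X Y i j \<in> module_hom R (tensor_module R (Md X i) (Md Y j)) (tensor_module R (Md X (i - 1)) (Md Y j))"
  unfolding tensor_D1_def by (rule tensor_map_hom[OF Xm Ym Xm Ym Xh module_hom_id])

lemma tensor_vertical_hom:
  "tensor_map R (Md X i) (Md Y (j - 1)) (\<lambda>x. x) (bd Y j)
    \<in> module_hom R (tensor_module R (Md X i) (Md Y j)) (tensor_module R (Md X i) (Md Y (j - 1)))"
  by (rule tensor_map_hom[OF Xm Ym Xm Ym module_hom_id Yh])

lemma tensor_D2_hom:
  "tensor_D2 R X Y i j \<in> module_hom R (tensor_module R (Md X i) (Md Y j)) (tensor_module R (Md X i) (Md Y (j - 1)))"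
  unfolding tensor_D2_def bigraded_tensor_apply
  by (rule module_hom_sign[OF tensor_vertical_hom module_tensor[OF Xm Ym]])

lemma tensor_double_complex:
  "double_complex R (bigraded_tensor R X Y) (tensor_D1 R X Y) (tensor_D2 R X Y)"
proof (rule double_complex.intro)
  show "cring R" using chain_complex_cring[OF X] .
  show "module R (bigraded_tensor R X Y k)" for k by (rule bigraded_tensor_module[OF Xm Ym])
  show "tensor_D1 R X Y i j \<in> module_hom R (bigraded_tensor R X Y (i, j)) (bigraded_tensor R X Y (i - 1, j))" for i j
    using tensor_D1_hom by simp
  show "tensor_D2 R X Y i j \<in> module_hom R (bigraded_tensor R X Y (i, j)) (bigraded_tensor R X Y (i, j - 1))" for i j
    using tensor_D2_hom by simp
  fix i j t assume "t \<in> carrier (bigraded_tensor R X Y (i, j))"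
  then have t: "t \<in> carrier (tensor_module R (Md X i) (Md Y j))" by simp
  note T = module_tensor[OF Xm Ym]
  have X2: "bd X (i - 1) \<in> module_hom R (Md X (i - 1)) (Md X (i - 2))" using Xh[of "i - 1"] by simp
  have Y2: "bd Y (j - 1) \<in> module_hom R (Md Y (j - 1)) (Md Y (j - 2))" using Yh[of "j - 1"] by simp
  show "tensor_D1 R X Y (i - 1) j (tensor_D1 R X Y i j t) = \<zero>\<^bsub>bigraded_tensor R X Y (i - 2, j)\<^esub>"
    using tensor_map_comp[OF Xm Ym Xm Ym Xm Ym Xh module_hom_id X2 module_hom_id t]
      tensor_map_zero[OF Xm Ym Xm Ym module_hom_comp[OF Xh X2] module_hom_comp[OF module_hom_id module_hom_id] _ t]
      chain_complex_bd_bd[OF X] by (simp add: tensor_D1_def)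
  have vt: "tensor_map R (Md X i) (Md Y (j - 1)) (\<lambda>x. x) (bd Y j) t \<in> carrier (tensor_module R (Md X i) (Md Y (j - 1)))"
    by (rule module_hom_closed[OF tensor_vertical_hom t])
  have v2: "tensor_map R (Md X i) (Md Y (j - 2)) (\<lambda>x. x) (bd Y (j - 1))
    \<in> module_hom R (tensor_module R (Md X i) (Md Y (j - 1))) (tensor_module R (Md X i) (Md Y (j - 2)))"
    by (rule tensor_map_hom[OF Xm Ym Xm Ym module_hom_id Y2])
  have "tensor_map R (Md X i) (Md Y (j - 2)) (\<lambda>x. x) (bd Y (j - 1))
      (tensor_map R (Md X i) (Md Y (j - 1)) (\<lambda>x. x) (bd Y j) t) = \<zero>\<^bsub>tensor_module R (Md X i) (Md Y (j - 2))\<^esub>"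
    using tensor_map_comp[OF Xm Ym Xm Ym Xm Ym module_hom_id Yh module_hom_id Y2 t]
      tensor_map_zero[OF Xm Ym Xm Ym module_hom_comp[OF module_hom_id module_hom_id] module_hom_comp[OF Yh Y2] _ t]
      chain_complex_bd_bd[OF Y] by simp
  then show "tensor_D2 R X Y i (j - 1) (tensor_D2 R X Y i j t) = \<zero>\<^bsub>bigraded_tensor R X Y (i, j - 2)\<^esub>"
    by (simp add: tensor_D2_def module_hom_sign_smult[OF v2 T T vt] sign_smult_sign_smult[OF T] sign_smult_zero[OF T])
  have d1v: "tensor_D1 R X Y i (j - 1) (tensor_map R (Md X i) (Md Y (j - 1)) (\<lambda>x. x) (bd Y j) t)
     = tensor_map R (Md X (i - 1)) (Md Y (j - 1)) (bd X i) (bd Y j) t"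
    unfolding tensor_D1_def
    by (rule tensor_map_comp[OF Xm Ym Xm Ym Xm Ym module_hom_id Yh Xh module_hom_id t])
  have vd1: "tensor_map R (Md X (i - 1)) (Md Y (j - 1)) (\<lambda>x. x) (bd Y j) (tensor_D1 R X Y i j t)
     = tensor_map R (Md X (i - 1)) (Md Y (j - 1)) (bd X i) (bd Y j) t"
    unfolding tensor_D1_def
    by (rule tensor_map_comp[OF Xm Ym Xm Ym Xm Ym Xh module_hom_id module_hom_id Yh t])
  have c: "tensor_map R (Md X (i - 1)) (Md Y (j - 1)) (bd X i) (bd Y j) t \<in> carrier (tensor_module R (Md X (i - 1)) (Md Y (j - 1)))"
    by (rule module_hom_closed[OF tensor_map_hom[OF Xm Ym Xm Ym Xh Yh] t])
  have "tensor_D1 R X Y i (j - 1) (tensor_D2 R X Y i j t) =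
      sign_smult (tensor_module R (Md X (i - 1)) (Md Y (j - 1))) i (tensor_map R (Md X (i - 1)) (Md Y (j - 1)) (bd X i) (bd Y j) t)"
    unfolding tensor_D2_def bigraded_tensor_apply
    by (simp only: module_hom_sign_smult[OF tensor_D1_hom T T vt] d1v)
  moreover have "tensor_D2 R X Y (i - 1) j (tensor_D1 R X Y i j t) =
      sign_smult (tensor_module R (Md X (i - 1)) (Md Y (j - 1))) (i - 1) (tensor_map R (Md X (i - 1)) (Md Y (j - 1)) (bd X i) (bd Y j) t)"
    unfolding tensor_D2_def bigraded_tensor_apply by (simp only: vd1)
  ultimately show "tensor_D1 R X Y i (j - 1) (tensor_D2 R X Y i j t) \<oplus>\<^bsub>bigraded_tensor R X Y (i - 1, j - 1)\<^esub>
     tensor_D2 R X Y (i - 1) j (tensor_D1 R X Y i j t) = \<zero>\<^bsub>bigraded_tensor R X Y (i - 1, j - 1)\<^esub>"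
    using sign_smult_cancel[OF T c, of i "i - 1"] by simp
qed

lemma tensor_row_exact:
  assumes "free_module R (Md Y j)" "cycles X i = boundaries X i"
    and t: "t \<in> carrier (tensor_module R (Md X i) (Md Y j))"
    and "tensor_D1 R X Y i j t = \<zero>\<^bsub>tensor_module R (Md X (i - 1)) (Md Y j)\<^esub>"
  shows "\<exists>u\<in>carrier (tensor_module R (Md X (i + 1)) (Md Y j)). t = tensor_D1 R X Y (i + 1) j u"
proof -
  have "t \<in> tensor_map R (Md X i) (Md Y j) (bd X (i + 1)) (\<lambda>y. y) ` carrier (tensor_module R (Md X (i + 1)) (Md Y j))"
    using assms(2,4)
    by (intro tensor_free_exact[OF assms(1) Xm Xm Xm chain_complex_hom_up[OF X] Xh _ t])
      (auto simp: cycles_def boundaries_def tensor_D1_def)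
  then show ?thesis by (auto simp: tensor_D1_def)
qed

text \<open>The sign in the vertical differential changes neither its image nor its kernel.\<close>

lemma tensor_D2_image:
  assumes "w \<in> carrier (tensor_module R (Md X i) (Md Y (j + 1)))"
    and "t = tensor_map R (Md X i) (Md Y j) (\<lambda>x. x) (bd Y (j + 1)) w"
  shows "\<exists>u\<in>carrier (tensor_module R (Md X i) (Md Y (j + 1))). t = tensor_D2 R X Y i (j + 1) u"
proof -
  note T = module_tensor[OF Xm Ym]
  let ?u = "sign_smult (tensor_module R (Md X i) (Md Y (j + 1))) i w"
  have v: "tensor_map R (Md X i) (Md Y j) (\<lambda>x. x) (bd Y (j + 1))
    \<in> module_hom R (tensor_module R (Md X i) (Md Y (j + 1))) (tensor_module R (Md X i) (Md Y j))"
    using tensor_vertical_hom[of i "j + 1"] by simp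
  have "t = tensor_D2 R X Y i (j + 1) ?u"
    using module_hom_sign_smult[OF v T T assms(1), of i] module_hom_closed[OF v assms(1)] assms(2)
    by (simp add: tensor_D2_def sign_smult_sign_smult[OF T])
  then show ?thesis using sign_smult_closed[OF T assms(1)] by blast
qed

lemma tensor_D2_eq_zeroD:
  assumes "t \<in> carrier (tensor_module R (Md X i) (Md Y j))"
    and "tensor_D2 R X Y i j t = \<zero>\<^bsub>tensor_module R (Md X i) (Md Y (j - 1))\<^esub>"
  shows "tensor_map R (Md X i) (Md Y (j - 1)) (\<lambda>x. x) (bd Y j) t = \<zero>\<^bsub>tensor_module R (Md X i) (Md Y (j - 1))\<^esub>"
  using assms(2) sign_smult_sign_smult[OF module_tensor[OF Xm Ym] module_hom_closed[OF tensor_vertical_hom assms(1)], of i]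
    sign_smult_zero[OF module_tensor[OF Xm Ym]]
  by (simp add: tensor_D2_def)

lemma tensor_column_exact:
  assumes "free_module R (Md X i)" "cycles Y j = boundaries Y j"
    and t: "t \<in> carrier (tensor_module R (Md X i) (Md Y j))"
    and "tensor_D2 R X Y i j t = \<zero>\<^bsub>tensor_module R (Md X i) (Md Y (j - 1))\<^esub>"
  shows "\<exists>u\<in>carrier (tensor_module R (Md X i) (Md Y (j + 1))). t = tensor_D2 R X Y i (j + 1) u"
proof -
  have "t \<in> tensor_map R (Md X i) (Md Y j) (\<lambda>x. x) (bd Y (j + 1)) ` carrier (tensor_module R (Md X i) (Md Y (j + 1)))"
    using assms(2) tensor_D2_eq_zeroD[OF t assms(4)]
    by (intro free_tensor_exact[OF assms(1) Ym Ym Ym chain_complex_hom_up[OF Y] Yh _ t])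
      (auto simp: cycles_def boundaries_def)
  then show ?thesis using tensor_D2_image by auto
qed

end

section \<open>Linear extension from homogeneous tensors\<close>

context
  fixes R :: "('a, 'r) ring_scheme" and X :: "('a, 'm) cplx" and Y :: "('a, 'n) cplx"
  assumes Xm: "\<And>i. module R (Md X i)" and Ym: "\<And>j. module R (Md Y j)"
begin

lemma bitensor_lift_eq: "bitensor_lift R X Y P b = dsum_lift (bigraded_tensor R X Y) P (\<lambda>k. tensor_lift P (b k))"
  by (simp add: bitensor_lift_def[abs_def] dsum_lift_def[abs_def])

lemma bigraded_cring: "cring R"
  using module_cring[OF Xm] .

lemma bitensor_component_hom:
  assumes "module R P" "\<And>i j. (i, j) \<in> K \<Longrightarrow> balanced_map R (Md X i) (Md Y j) P (b (i, j))" "k \<in> K"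
  shows "tensor_lift P (b k) \<in> module_hom R (bigraded_tensor R X Y k) P"
  using assms(3) tensor_lift_module_hom[OF Xm Ym assms(1,2)] by (cases k) simp

lemma bitensor_lift_hom:
  assumes "module R P" "\<And>i j. (i, j) \<in> K \<Longrightarrow> balanced_map R (Md X i) (Md Y j) P (b (i, j))"
  shows "bitensor_lift R X Y P b \<in> module_hom R (dsum_module K (bigraded_tensor R X Y)) P"
  unfolding bitensor_lift_eq
  by (rule dsum_lift_hom[of R P "bigraded_tensor R X Y", OF assms(1) bigraded_tensor_module[OF Xm Ym]])
    (rule bitensor_component_hom[OF assms])

lemma bitensor_lift_inj:
  assumes "module R P" "\<And>i j. (i, j) \<in> K \<Longrightarrow> balanced_map R (Md X i) (Md Y j) P (b (i, j))"
    and "(i, j) \<in> K" "t \<in> carrier (tensor_module R (Md X i) (Md Y j))"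
  shows "bitensor_lift R X Y P b (dsum_inj (bigraded_tensor R X Y) (i, j) t) = tensor_lift P (b (i, j)) t"
  unfolding bitensor_lift_eq
  by (rule dsum_lift_inj[of R P "bigraded_tensor R X Y", OF assms(1) bigraded_tensor_module[OF Xm Ym]
        bitensor_component_hom[OF assms(1,2)]]) (use assms(3,4) in auto)

lemma bitensor_lift_homog:
  assumes "module R P" "\<And>i j. (i, j) \<in> K \<Longrightarrow> balanced_map R (Md X i) (Md Y j) P (b (i, j))"
    and "(i, j) \<in> K" "x \<in> carrier (Md X i)" "y \<in> carrier (Md Y j)"
  shows "bitensor_lift R X Y P b (homog_tensor R X Y (i, j) x y) = b (i, j) x y"
  using bitensor_lift_inj[OF assms(1-3) pure_tensor_closed[OF Xm Ym assms(4,5)]]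
    tensor_lift_pure_tensor[OF Xm Ym assms(1,2) assms(4,5)] assms(3)
  by (simp add: homog_tensor_def)

lemma homog_tensor_balanced:
  assumes "(i, j) \<in> K"
  shows "balanced_map R (Md X i) (Md Y j) (dsum_module K (bigraded_tensor R X Y)) (homog_tensor R X Y (i, j))"
proof -
  have h: "dsum_inj (bigraded_tensor R X Y) (i, j) \<in> module_hom R (tensor_module R (Md X i) (Md Y j)) (dsum_module K (bigraded_tensor R X Y))"
    using dsum_inj_hom[of R "bigraded_tensor R X Y", OF bigraded_cring bigraded_tensor_module[OF Xm Ym] assms] by simp
  have "balanced_map R (Md X i) (Md Y j) (dsum_module K (bigraded_tensor R X Y))
     (\<lambda>x y. dsum_inj (bigraded_tensor R X Y) (i, j) (pure_tensor R (Md X i) (Md Y j) x y))"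
    by (rule balanced_map_comp[OF balanced_pure_tensor[OF Xm Ym module_hom_id module_hom_id] h])
  then show ?thesis by (simp add: homog_tensor_def)
qed

lemma bitensor_hom_eq:
  assumes "module R P"
    and f: "f \<in> module_hom R (dsum_module K (bigraded_tensor R X Y)) P"
    and g: "g \<in> module_hom R (dsum_module K (bigraded_tensor R X Y)) P"
    and eq: "\<And>i j x y. (i, j) \<in> K \<Longrightarrow> x \<in> carrier (Md X i) \<Longrightarrow> y \<in> carrier (Md Y j) \<Longrightarrow>
      f (homog_tensor R X Y (i, j) x y) = g (homog_tensor R X Y (i, j) x y)"
    and u: "u \<in> carrier (dsum_module K (bigraded_tensor R X Y))"
  shows "f u = g u"
proof (rule dsum_hom_eq[of R "bigraded_tensor R X Y", OF bigraded_tensor_module[OF Xm Ym] assms(1) f g _ u])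
  fix k t assume k: "k \<in> K" and t: "t \<in> carrier (bigraded_tensor R X Y k)"
  obtain i j where ij: "k = (i, j)" by (cases k)
  have h: "dsum_inj (bigraded_tensor R X Y) (i, j) \<in> module_hom R (tensor_module R (Md X i) (Md Y j)) (dsum_module K (bigraded_tensor R X Y))"
    using dsum_inj_hom[of R "bigraded_tensor R X Y", OF bigraded_cring bigraded_tensor_module[OF Xm Ym] k] ij by simp
  show "f (dsum_inj (bigraded_tensor R X Y) k t) = g (dsum_inj (bigraded_tensor R X Y) k t)"
    unfolding ij
  proof (rule tensor_module_hom_eq[OF Xm Ym assms(1) module_hom_comp[OF h f] module_hom_comp[OF h g]])
    show "t \<in> carrier (tensor_module R (Md X i) (Md Y j))" using t ij by simp
    show "f (dsum_inj (bigraded_tensor R X Y) (i, j) (pure_tensor R (Md X i) (Md Y j) x y)) =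
        g (dsum_inj (bigraded_tensor R X Y) (i, j) (pure_tensor R (Md X i) (Md Y j) x y))"
      if "x \<in> carrier (Md X i)" "y \<in> carrier (Md Y j)" for x y
      using eq[OF _ that] k ij by (simp add: homog_tensor_def)
  qed
qed

end

lemma balanced_map_pre:
  assumes "balanced_map R M' N' P b" "f \<in> module_hom R M M'" "g \<in> module_hom R N N'"
  shows "balanced_map R M N P (\<lambda>x y. b (f x) (g y))"
proof (rule balanced_mapI)
  show "(\<lambda>y. b (f x) (g y)) \<in> module_hom R N P" if "x \<in> carrier M" for x
    by (rule module_hom_comp[OF assms(3) balanced_map_right[OF assms(1) module_hom_closed[OF assms(2) that]]])
  show "(\<lambda>x. b (f x) (g y)) \<in> module_hom R M P" if "y \<in> carrier N" for y
    by (rule module_hom_comp[OF assms(2) balanced_map_left[OF assms(1) module_hom_closed[OF assms(3) that]]])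
qed

context
  fixes R :: "('a, 'r) ring_scheme" and X :: "('a, 'm) cplx" and Y :: "('a, 'n) cplx"
  assumes X: "chain_complex R X" and Y: "chain_complex R Y"
begin

interpretation XY: double_complex R "bigraded_tensor R X Y" "tensor_D1 R X Y" "tensor_D2 R X Y"
  by (rule tensor_double_complex[OF X Y])

lemma tensor_cplx_bd_balanced:
  assumes "i + j = n"
  shows "balanced_map R (Md X i) (Md Y j) (XY.Tot (n - 1)) (\<lambda>x y.
         homog_tensor R X Y (i - 1, j) (bd X i x) y \<oplus>\<^bsub>XY.Tot (n - 1)\<^esub>
         sign_smult (XY.Tot (n - 1)) i (homog_tensor R X Y (i, j - 1) x (bd Y j y)))"
proof -
  note Xm = chain_complex_module[OF X] and Ym = chain_complex_module[OF Y]
  have k: "(i - 1, j) \<in> {(i, j). i + j = n - 1}" "(i, j - 1) \<in> {(i, j). i + j = n - 1}" using assms by auto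
  show ?thesis
    by (intro balanced_map_plus balanced_map_sign XY.Tot_module
        balanced_map_pre[OF homog_tensor_balanced[OF Xm Ym k(1)] chain_complex_hom[OF X] module_hom_id]
        balanced_map_pre[OF homog_tensor_balanced[OF Xm Ym k(2)] module_hom_id chain_complex_hom[OF Y]])
qed

lemma tensor_cplx_bd_homog:
  assumes "i + j = n" "x \<in> carrier (Md X i)" "y \<in> carrier (Md Y j)"
  shows "bd (tensor_cplx R X Y) n (homog_tensor R X Y (i, j) x y) =
     homog_tensor R X Y (i - 1, j) (bd X i x) y \<oplus>\<^bsub>tensor_cplx_Md R X Y (n - 1)\<^esub>
         sign_smult (tensor_cplx_Md R X Y (n - 1)) i (homog_tensor R X Y (i, j - 1) x (bd Y j y))"
proof -
  note Xm = chain_complex_module[OF X] and Ym = chain_complex_module[OF Y]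
  show ?thesis unfolding tensor_cplx_def tensor_cplx_Md_def Let_def cplx.simps
    by (subst bitensor_lift_homog[OF Xm Ym XY.Tot_module, of "{(i, j). i + j = n}"])
      (use assms tensor_cplx_bd_balanced in \<open>auto simp del: dsum_module_simps\<close>)
qed

lemma tensor_cplx_bd_hom:
  "bd (tensor_cplx R X Y) n \<in> module_hom R (XY.Tot n) (XY.Tot (n - 1))"
proof -
  note Xm = chain_complex_module[OF X] and Ym = chain_complex_module[OF Y]
  show ?thesis unfolding tensor_cplx_def tensor_cplx_Md_def Let_def cplx.simps
    by (rule bitensor_lift_hom[OF Xm Ym XY.Tot_module])
      (use tensor_cplx_bd_balanced in \<open>auto simp del: dsum_module_simps\<close>)
qed

text \<open>Both sides are linear, so it suffices to compare them on homogeneous tensors.  From here on the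
  differential of a tensor product is computed componentwise.\<close>

lemma tensor_cplx_bd:
  assumes "f \<in> carrier (XY.Tot n)"
  shows "bd (tensor_cplx R X Y) n f = XY.tot f"
proof -
  note Xm = chain_complex_module[OF X] and Ym = chain_complex_module[OF Y]
  show ?thesis
  proof (rule bitensor_hom_eq[OF Xm Ym XY.Tot_module tensor_cplx_bd_hom XY.tot_hom _ assms])
    fix i j x y assume "(i, j) \<in> {(i, j). i + j = n}" and x: "x \<in> carrier (Md X i)" and y: "y \<in> carrier (Md Y j)"
    then have ij: "i + j = n" by auto
    let ?p = "pure_tensor R (Md X i) (Md Y (j - 1)) x (bd Y j y)"
    have p: "?p \<in> carrier (bigraded_tensor R X Y (i, j - 1))"
      using pure_tensor_closed[OF Xm Ym x module_hom_closed[OF chain_complex_hom[OF Y] y]] by simp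
    have k: "(i, j - 1) \<in> {(i, j). i + j = n - 1}" using ij by auto
    note h = dsum_inj_hom[of R "bigraded_tensor R X Y", OF XY.cring XY.A_module k]
    have 1: "tensor_D1 R X Y i j (pure_tensor R (Md X i) (Md Y j) x y) = pure_tensor R (Md X (i - 1)) (Md Y j) (bd X i x) y"
      unfolding tensor_D1_def by (rule tensor_map_pure[OF Xm Ym Xm Ym chain_complex_hom[OF X] module_hom_id x y])
    have 2: "tensor_D2 R X Y i j (pure_tensor R (Md X i) (Md Y j) x y) = sign_smult (bigraded_tensor R X Y (i, j - 1)) i ?p"
      unfolding tensor_D2_def by (simp only: tensor_map_pure[OF Xm Ym Xm Ym module_hom_id chain_complex_hom[OF Y] x y])
    have "XY.tot (homog_tensor R X Y (i, j) x y) =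
       homog_tensor R X Y (i - 1, j) (bd X i x) y \<oplus>\<^bsub>XY.Tot (n - 1)\<^esub>
       dsum_inj (bigraded_tensor R X Y) (i, j - 1) (sign_smult (bigraded_tensor R X Y (i, j - 1)) i ?p)"
      using XY.tot_inj[of "pure_tensor R (Md X i) (Md Y j) x y" i j] pure_tensor_closed[OF Xm Ym x y]
      by (simp add: homog_tensor_def 1 2)
    also have "dsum_inj (bigraded_tensor R X Y) (i, j - 1) (sign_smult (bigraded_tensor R X Y (i, j - 1)) i ?p)
       = sign_smult (XY.Tot (n - 1)) i (homog_tensor R X Y (i, j - 1) x (bd Y j y))"
      using module_hom_sign_smult[OF h XY.A_module XY.Tot_module p] by (simp add: homog_tensor_def del: dsum_module_simps)
    finally show "bd (tensor_cplx R X Y) n (homog_tensor R X Y (i, j) x y) = XY.tot (homog_tensor R X Y (i, j) x y)"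
      using tensor_cplx_bd_homog[OF ij x y] by (simp add: tensor_cplx_Md_def)
  qed
qed

lemma tensor_cplx_chain_complex: "chain_complex R (tensor_cplx R X Y)"
  unfolding chain_complex_def
proof (intro allI conjI ballI)
  fix n
  have md: "Md (tensor_cplx R X Y) m = XY.Tot m" for m
    by (simp add: tensor_cplx_def tensor_cplx_Md_def)
  show "module R (Md (tensor_cplx R X Y) n)" unfolding md by (rule XY.Tot_module)
  show "bd (tensor_cplx R X Y) n \<in> module_hom R (Md (tensor_cplx R X Y) n) (Md (tensor_cplx R X Y) (n - 1))"
    unfolding md by (rule tensor_cplx_bd_hom)
  fix f assume f: "f \<in> carrier (Md (tensor_cplx R X Y) n)"
  then have f: "f \<in> carrier (XY.Tot n)" by (simp add: md)
  have "bd (tensor_cplx R X Y) (n - 1) (bd (tensor_cplx R X Y) n f) = XY.tot (XY.tot f)"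
    using tensor_cplx_bd[OF f] tensor_cplx_bd[OF XY.tot_closed[OF f]] by simp
  then show "bd (tensor_cplx R X Y) (n - 1) (bd (tensor_cplx R X Y) n f) = \<zero>\<^bsub>Md (tensor_cplx R X Y) (n - 2)\<^esub>"
    using XY.tot_tot[OF f] by (simp add: md)
qed

end

section \<open>Balancing Tor\<close>

lemma afr_chain: "augmented_free_resolution R C \<epsilon> M \<Longrightarrow> chain_complex R C"
  by (simp add: augmented_free_resolution_def)

lemma afr_free: "augmented_free_resolution R C \<epsilon> M \<Longrightarrow> free_module R (Md C n)"
  by (simp add: augmented_free_resolution_def)

lemma afr_neg: "augmented_free_resolution R C \<epsilon> M \<Longrightarrow> n < 0 \<Longrightarrow> carrier (Md C n) = {\<zero>\<^bsub>Md C n\<^esub>}"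
  by (simp add: augmented_free_resolution_def)

lemma afr_exact: "augmented_free_resolution R C \<epsilon> M \<Longrightarrow> 1 \<le> n \<Longrightarrow> cycles C n = boundaries C n"
  by (simp add: augmented_free_resolution_def)

lemma afr_hom: "augmented_free_resolution R C \<epsilon> M \<Longrightarrow> \<epsilon> \<in> module_hom R (Md C 0) M"
  by (simp add: augmented_free_resolution_def)

lemma afr_surj: "augmented_free_resolution R C \<epsilon> M \<Longrightarrow> \<epsilon> ` carrier (Md C 0) = carrier M"
  by (simp add: augmented_free_resolution_def)

lemma afr_kernel:
  "augmented_free_resolution R C \<epsilon> M \<Longrightarrow> x \<in> carrier (Md C 0) \<Longrightarrow> \<epsilon> x = \<zero>\<^bsub>M\<^esub> \<longleftrightarrow> x \<in> bd C 1 ` carrier (Md C 1)"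
  by (auto simp: augmented_free_resolution_def boundaries_def set_eq_iff)

lemma afr_aug_bd:
  assumes "augmented_free_resolution R C \<epsilon> M" "x \<in> carrier (Md C 1)"
  shows "\<epsilon> (bd C 1 x) = \<zero>\<^bsub>M\<^esub>"
  using afr_kernel[OF assms(1), of "bd C 1 x"] assms(2)
    module_hom_closed[OF chain_complex_hom[OF afr_chain[OF assms(1)], of 1] assms(2)] by auto

definition tensor_acyclic ::
  "('a, 'r) ring_scheme \<Rightarrow> ('a, 'm) cplx \<Rightarrow> ('a, 'n) module \<Rightarrow> bool" where
  "tensor_acyclic R F N \<longleftrightarrow> (\<forall>n\<ge>1. \<forall>z\<in>carrier (tensor_module R (Md F n) N).
     tensor_map R (Md F (n - 1)) N (bd F n) (\<lambda>y. y) z = \<zero>\<^bsub>tensor_module R (Md F (n - 1)) N\<^esub> \<longrightarrow>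
     z \<in> tensor_map R (Md F n) N (bd F (n + 1)) (\<lambda>y. y) ` carrier (tensor_module R (Md F (n + 1)) N))"

text \<open>The image of \<open>z\<close> in \<open>F\<^sub>n \<otimes> N\<close> is a cycle, hence the image of the horizontal differential
  of some \<open>u\<close>.  The difference of \<open>z\<close> and that differential dies in \<open>F\<^sub>n \<otimes> N\<close>, so it comes from
  \<open>F\<^sub>n \<otimes> G\<^sub>1\<close>, because tensoring with the free module \<open>F\<^sub>n\<close> preserves exactness.\<close>

lemma tensor_acyclic_edge:
  assumes F: "chain_complex R F" "free_module R (Md F n)"
    and G: "augmented_free_resolution R G \<eta> N" and N: "module R N"
    and ac: "tensor_acyclic R F N" and n: "1 \<le> n"
    and z: "z \<in> carrier (tensor_module R (Md F n) (Md G 0))"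
    and w: "w \<in> carrier (tensor_module R (Md F (n - 1)) (Md G 1))"
    and eq: "tensor_D1 R F G n 0 z = tensor_D2 R F G (n - 1) 1 w"
  shows "\<exists>u\<in>carrier (tensor_module R (Md F (n + 1)) (Md G 0)). \<exists>v\<in>carrier (tensor_module R (Md F n) (Md G 1)).
     z = tensor_D1 R F G (n + 1) 0 u \<oplus>\<^bsub>tensor_module R (Md F n) (Md G 0)\<^esub> tensor_D2 R F G n 1 v"
proof -
  note G' = afr_chain[OF G]
  note Fm = chain_complex_module[OF F(1)] and Gm = chain_complex_module[OF G']
  note T = module_tensor[OF Fm Gm] and TN = module_tensor[OF Fm N]
  note \<eta> = afr_hom[OF G]
  have q: "tensor_map R (Md F m) N (\<lambda>x. x) \<eta> \<in> module_hom R (tensor_module R (Md F m) (Md G 0)) (tensor_module R (Md F m) N)" for m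
    by (rule tensor_map_hom[OF Fm Gm Fm N module_hom_id \<eta>])
  have b1: "bd G 1 \<in> module_hom R (Md G 1) (Md G 0)" using chain_complex_hom[OF G', of 1] by simp
  have v1: "tensor_map R (Md F m) (Md G 0) (\<lambda>x. x) (bd G 1) \<in> module_hom R (tensor_module R (Md F m) (Md G 1)) (tensor_module R (Md F m) (Md G 0))" for m
    by (rule tensor_map_hom[OF Fm Gm Fm Gm module_hom_id b1])
  have qv: "tensor_map R (Md F m) N (\<lambda>x. x) \<eta> (tensor_map R (Md F m) (Md G 0) (\<lambda>x. x) (bd G 1) w) = \<zero>\<^bsub>tensor_module R (Md F m) N\<^esub>"
    if w: "w \<in> carrier (tensor_module R (Md F m) (Md G 1))" for m w
    using tensor_map_comp[OF Fm Gm Fm Gm Fm N module_hom_id b1 module_hom_id \<eta> w]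
      tensor_map_zero[OF Fm Gm Fm N module_hom_comp[OF module_hom_id module_hom_id] module_hom_comp[OF b1 \<eta>] _ w]
      afr_aug_bd[OF G] by simp
  have qD1: "tensor_map R (Md F (m - 1)) N (\<lambda>x. x) \<eta> (tensor_D1 R F G m 0 t) =
     tensor_map R (Md F (m - 1)) N (bd F m) (\<lambda>y. y) (tensor_map R (Md F m) N (\<lambda>x. x) \<eta> t)"
    if t: "t \<in> carrier (tensor_module R (Md F m) (Md G 0))" for m t
    unfolding tensor_D1_def
    using tensor_map_comp[OF Fm Gm Fm Gm Fm N chain_complex_hom[OF F(1)] module_hom_id module_hom_id \<eta> t]
      tensor_map_comp[OF Fm Gm Fm N Fm N module_hom_id \<eta> chain_complex_hom[OF F(1)] module_hom_id t] by simp
  have "tensor_map R (Md F (n - 1)) N (\<lambda>x. x) \<eta> (tensor_D2 R F G (n - 1) 1 w) = \<zero>\<^bsub>tensor_module R (Md F (n - 1)) N\<^esub>"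
    using module_hom_sign_smult[OF q T TN module_hom_closed[OF v1 w], of "n - 1"] qv[OF w] sign_smult_zero[OF TN]
    by (simp add: tensor_D2_def)
  then have "tensor_map R (Md F (n - 1)) N (bd F n) (\<lambda>y. y) (tensor_map R (Md F n) N (\<lambda>x. x) \<eta> z) = \<zero>\<^bsub>tensor_module R (Md F (n - 1)) N\<^esub>"
    using qD1[OF z] eq by simp
  then obtain s where s: "s \<in> carrier (tensor_module R (Md F (n + 1)) N)"
    "tensor_map R (Md F n) N (\<lambda>x. x) \<eta> z = tensor_map R (Md F n) N (bd F (n + 1)) (\<lambda>y. y) s"
    using ac n module_hom_closed[OF q z] unfolding tensor_acyclic_def by blast
  obtain u where u: "u \<in> carrier (tensor_module R (Md F (n + 1)) (Md G 0))" "s = tensor_map R (Md F (n + 1)) N (\<lambda>x. x) \<eta> u"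
    using tensor_map_surj[OF Fm Gm Fm N module_hom_id \<eta> image_ident afr_surj[OF G] s(1)] by auto
  have D1u: "tensor_D1 R F G (n + 1) 0 u \<in> carrier (tensor_module R (Md F n) (Md G 0))"
    using module_hom_closed[OF tensor_D1_hom[OF F(1) G'] u(1)] by simp
  have qu: "tensor_map R (Md F n) N (\<lambda>x. x) \<eta> (tensor_D1 R F G (n + 1) 0 u) = tensor_map R (Md F n) N (\<lambda>x. x) \<eta> z"
    using qD1[OF u(1)] s(2) u(2) by simp
  interpret T: module R "tensor_module R (Md F n) (Md G 0)" by (rule T)
  interpret TN: module R "tensor_module R (Md F n) N" by (rule TN)
  let ?d = "z \<oplus>\<^bsub>tensor_module R (Md F n) (Md G 0)\<^esub> \<ominus>\<^bsub>tensor_module R (Md F n) (Md G 0)\<^esub> tensor_D1 R F G (n + 1) 0 u"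
  have d: "?d \<in> carrier (tensor_module R (Md F n) (Md G 0))" using z D1u by simp
  have "tensor_map R (Md F n) N (\<lambda>x. x) \<eta> ?d = \<zero>\<^bsub>tensor_module R (Md F n) N\<^esub>"
    using module_hom_add[OF q z T.a_inv_closed[OF D1u]] module_hom_minus[OF q T TN D1u] qu module_hom_closed[OF q z]
    by (simp add: TN.M.r_neg)
  then have "?d \<in> tensor_map R (Md F n) (Md G 0) (\<lambda>x. x) (bd G 1) ` carrier (tensor_module R (Md F n) (Md G 1))"
    by (intro free_tensor_exact[OF F(2) Gm Gm N b1 \<eta> _ d]) (use afr_kernel[OF G] in auto)
  then obtain v' where "v' \<in> carrier (tensor_module R (Md F n) (Md G 1))"
    "?d = tensor_map R (Md F n) (Md G 0) (\<lambda>x. x) (bd G 1) v'" by blast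
  then obtain v where v: "v \<in> carrier (tensor_module R (Md F n) (Md G 1))" "?d = tensor_D2 R F G n 1 v"
    using tensor_D2_image[OF F(1) G', of v' n 0 ?d] by auto
  have "z = tensor_D1 R F G (n + 1) 0 u \<oplus>\<^bsub>tensor_module R (Md F n) (Md G 0)\<^esub> ?d"
    using z D1u by (simp add: T.M.a_lcomm[of _ z] T.M.r_neg)
  then show ?thesis using u(1) v by metis
qed

text \<open>The edge condition along the bottom row gives exactness of the total complex, from which the
  condition along the left column follows.\<close>

lemma tensor_acyclic_left_edge:
  assumes F: "augmented_free_resolution R F \<epsilon> M" and G: "augmented_free_resolution R G \<eta> N"
    and N: "module R N" and ac: "tensor_acyclic R F N" and n: "1 \<le> n"
    and z: "z \<in> carrier (tensor_module R (Md F 0) (Md G n))"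
    and w: "w \<in> carrier (tensor_module R (Md F 1) (Md G (n - 1)))"
    and eq: "tensor_D2 R F G 0 n z = tensor_D1 R F G 1 (n - 1) w"
  shows "\<exists>u\<in>carrier (tensor_module R (Md F 1) (Md G n)). \<exists>v\<in>carrier (tensor_module R (Md F 0) (Md G (n + 1))).
      z = tensor_D1 R F G 1 n u \<oplus>\<^bsub>tensor_module R (Md F 0) (Md G n)\<^esub> tensor_D2 R F G 0 (n + 1) v"
proof -
  note F' = afr_chain[OF F] and G' = afr_chain[OF G]
  note Fm = chain_complex_module[OF F'] and Gm = chain_complex_module[OF G']
  interpret FG: double_complex R "bigraded_tensor R F G" "tensor_D1 R F G" "tensor_D2 R F G"
    by (rule tensor_double_complex[OF F' G'])
  have left: "carrier (bigraded_tensor R F G (i, j)) = {\<zero>\<^bsub>bigraded_tensor R F G (i, j)\<^esub>}" if "i < 0" for i j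
    using tensor_trivial[OF Fm Gm] afr_neg[OF F that] by simp
  have bottom: "carrier (bigraded_tensor R F G (i, j)) = {\<zero>\<^bsub>bigraded_tensor R F G (i, j)\<^esub>}" if "j < 0" for i j
    using tensor_trivial[OF Fm Gm] afr_neg[OF G that] by simp
  have total: "FG.boundary n f" if "f \<in> carrier (FG.Tot n)" "FG.tot f = (\<lambda>k. \<zero>\<^bsub>bigraded_tensor R F G k\<^esub>)" for f
  proof (rule FG.columns_exact_imp_boundary[OF left bottom _ _ that])
    fix i j x assume "i + j = n" "0 < j" "x \<in> carrier (bigraded_tensor R F G (i, j))"
      "tensor_D2 R F G i j x = \<zero>\<^bsub>bigraded_tensor R F G (i, j - 1)\<^esub>"
    then show "\<exists>y\<in>carrier (bigraded_tensor R F G (i, j + 1)). x = tensor_D2 R F G i (j + 1) y"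
      using tensor_column_exact[OF F' G' afr_free[OF F] afr_exact[OF G, of j]] by simp
  next
    fix i x w assume "i + 0 = n" "x \<in> carrier (bigraded_tensor R F G (i, 0))"
      "w \<in> carrier (bigraded_tensor R F G (i - 1, 0 + 1))" "tensor_D1 R F G i 0 x = tensor_D2 R F G (i - 1) (0 + 1) w"
    then show "\<exists>u\<in>carrier (bigraded_tensor R F G (i + 1, 0)). \<exists>v\<in>carrier (bigraded_tensor R F G (i, 0 + 1)).
       x = tensor_D1 R F G (i + 1) 0 u \<oplus>\<^bsub>bigraded_tensor R F G (i, 0)\<^esub> tensor_D2 R F G i (0 + 1) v"
      using tensor_acyclic_edge[OF F' afr_free[OF F] G N ac n] by simp
  qed
  have row: "\<exists>y\<in>carrier (bigraded_tensor R F G (i + 1, j)). x = tensor_D1 R F G (i + 1) j y"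
    if "1 \<le> i" "x \<in> carrier (bigraded_tensor R F G (i, j))" "tensor_D1 R F G i j x = \<zero>\<^bsub>bigraded_tensor R F G (i - 1, j)\<^esub>" for i j x
    using tensor_row_exact[OF F' G' afr_free[OF G] afr_exact[OF F that(1)]] that(2,3) by simp
  have "\<exists>u\<in>carrier (bigraded_tensor R F G (1, n)). \<exists>v\<in>carrier (bigraded_tensor R F G (0, n + 1)).
      z = tensor_D1 R F G 1 n u \<oplus>\<^bsub>bigraded_tensor R F G (0, n)\<^esub> tensor_D2 R F G 0 (n + 1) v"
    by (rule FG.left_edge_condition[OF left bottom row total _ _ eq]) (use z w in auto)
  then show ?thesis by simp
qed

text \<open>Symmetry of Tor.  A cycle in \<open>M \<otimes> G\<^sub>n\<close> lifts to an element of \<open>F\<^sub>0 \<otimes> G\<^sub>n\<close> to which the edge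
  condition along the left column applies.\<close>

lemma tensor_acyclic_swap:
  assumes F: "augmented_free_resolution R F \<epsilon> M" and G: "augmented_free_resolution R G \<eta> N"
    and M: "module R M" and N: "module R N" and ac: "tensor_acyclic R F N"
  shows "tensor_acyclic R G M"
  unfolding tensor_acyclic_def
proof (intro allI impI ballI)
  fix n :: int and z'
  assume n: "1 \<le> n" and z': "z' \<in> carrier (tensor_module R (Md G n) M)"
    and bz': "tensor_map R (Md G (n - 1)) M (bd G n) (\<lambda>y. y) z' = \<zero>\<^bsub>tensor_module R (Md G (n - 1)) M\<^esub>"
  note F' = afr_chain[OF F] and G' = afr_chain[OF G]
  note Fm = chain_complex_module[OF F'] and Gm = chain_complex_module[OF G']
  note \<epsilon> = afr_hom[OF F]
  have sw': "tensor_swap R (Md G m) M \<in> module_hom R (tensor_module R (Md G m) M) (tensor_module R M (Md G m))" for m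
    by (rule tensor_swap_hom[OF Gm M])
  have q: "tensor_map R M (Md G m) \<epsilon> (\<lambda>y. y) \<in> module_hom R (tensor_module R (Md F 0) (Md G m)) (tensor_module R M (Md G m))" for m
    by (rule tensor_map_hom[OF Fm Gm M Gm \<epsilon> module_hom_id])
  have vM: "tensor_map R M (Md G m) (\<lambda>x. x) (bd G (m + 1)) \<in> module_hom R (tensor_module R M (Md G (m + 1))) (tensor_module R M (Md G m))" for m
    by (rule tensor_map_hom[OF M Gm M Gm module_hom_id chain_complex_hom_up[OF G']])
  have b1: "bd F 1 \<in> module_hom R (Md F 1) (Md F 0)" using chain_complex_hom[OF F', of 1] by simp
  let ?z' = "tensor_swap R (Md G n) M z'"
  have sz': "?z' \<in> carrier (tensor_module R M (Md G n))" by (rule module_hom_closed[OF sw' z'])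
  obtain z where z: "z \<in> carrier (tensor_module R (Md F 0) (Md G n))" "?z' = tensor_map R M (Md G n) \<epsilon> (\<lambda>y. y) z"
    using tensor_map_surj[OF Fm Gm M Gm \<epsilon> module_hom_id afr_surj[OF F] image_ident sz'] by auto
  have qD2: "tensor_map R M (Md G (m - 1)) \<epsilon> (\<lambda>y. y) (tensor_D2 R F G 0 m t) =
     tensor_map R M (Md G (m - 1)) (\<lambda>x. x) (bd G m) (tensor_map R M (Md G m) \<epsilon> (\<lambda>y. y) t)"
    if t: "t \<in> carrier (tensor_module R (Md F 0) (Md G m))" for m t
    using tensor_map_comp[OF Fm Gm Fm Gm M Gm module_hom_id chain_complex_hom[OF G'] \<epsilon> module_hom_id t]
      tensor_map_comp[OF Fm Gm M Gm M Gm \<epsilon> module_hom_id module_hom_id chain_complex_hom[OF G'] t]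
    by (simp add: tensor_D2_def sign_smult_def)
  have "tensor_map R M (Md G (n - 1)) (\<lambda>x. x) (bd G n) ?z' = \<zero>\<^bsub>tensor_module R M (Md G (n - 1))\<^esub>"
    using tensor_swap_map[OF Gm M Gm M chain_complex_hom[OF G'] module_hom_id z'] bz'
      module_hom_zero[OF sw' module_tensor[OF Gm M] module_tensor[OF M Gm]] by simp
  then have "tensor_map R M (Md G (n - 1)) \<epsilon> (\<lambda>y. y) (tensor_D2 R F G 0 n z) = \<zero>\<^bsub>tensor_module R M (Md G (n - 1))\<^esub>"
    using qD2[OF z(1)] z(2) by simp
  then have "tensor_D2 R F G 0 n z \<in> tensor_map R (Md F 0) (Md G (n - 1)) (bd F 1) (\<lambda>y. y) ` carrier (tensor_module R (Md F 1) (Md G (n - 1)))"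
    by (intro tensor_free_exact[OF afr_free[OF G] Fm Fm M b1 \<epsilon> _ module_hom_closed[OF tensor_D2_hom[OF F' G'] z(1)]])
      (use afr_kernel[OF F] in auto)
  then obtain w where w: "w \<in> carrier (tensor_module R (Md F 1) (Md G (n - 1)))" "tensor_D2 R F G 0 n z = tensor_D1 R F G 1 (n - 1) w"
    by (auto simp: tensor_D1_def)
  from tensor_acyclic_left_edge[OF F G N ac n z(1) w]
  obtain u v where u: "u \<in> carrier (tensor_module R (Md F 1) (Md G n))"
    and v: "v \<in> carrier (tensor_module R (Md F 0) (Md G (n + 1)))"
    and zuv: "z = tensor_D1 R F G 1 n u \<oplus>\<^bsub>tensor_module R (Md F 0) (Md G n)\<^esub> tensor_D2 R F G 0 (n + 1) v"
    by blast
  have D1u: "tensor_D1 R F G 1 n u \<in> carrier (tensor_module R (Md F 0) (Md G n))"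
    using module_hom_closed[OF tensor_D1_hom[OF F' G'] u] by simp
  have D2v: "tensor_D2 R F G 0 (n + 1) v \<in> carrier (tensor_module R (Md F 0) (Md G n))"
    using module_hom_closed[OF tensor_D2_hom[OF F' G'] v] by simp
  have qu: "tensor_map R M (Md G n) \<epsilon> (\<lambda>y. y) (tensor_D1 R F G 1 n u) = \<zero>\<^bsub>tensor_module R M (Md G n)\<^esub>"
    using tensor_map_comp[OF Fm Gm Fm Gm M Gm b1 module_hom_id \<epsilon> module_hom_id u]
      tensor_map_zero[OF Fm Gm M Gm module_hom_comp[OF b1 \<epsilon>] module_hom_comp[OF module_hom_id module_hom_id] _ u]
      afr_aug_bd[OF F] by (simp add: tensor_D1_def)
  let ?v = "tensor_map R M (Md G (n + 1)) \<epsilon> (\<lambda>y. y) v"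
  have vc: "?v \<in> carrier (tensor_module R M (Md G (n + 1)))" by (rule module_hom_closed[OF q v])
  interpret TM: module R "tensor_module R M (Md G n)" by (rule module_tensor[OF M Gm])
  have "?z' = tensor_map R M (Md G n) (\<lambda>x. x) (bd G (n + 1)) ?v"
    unfolding z(2) zuv
    using module_hom_add[OF q D1u D2v] qu qD2[OF v] module_hom_closed[OF vM vc] by simp
  moreover have "z' = tensor_swap R M (Md G n) ?z'"
    using tensor_swap_swap[OF Gm M z'] by simp
  ultimately have "z' = tensor_map R (Md G n) M (bd G (n + 1)) (\<lambda>y. y) (tensor_swap R M (Md G (n + 1)) ?v)"
    using tensor_swap_map[OF M Gm M Gm module_hom_id chain_complex_hom_up[OF G'] vc] by simp
  then show "z' \<in> tensor_map R (Md G n) M (bd G (n + 1)) (\<lambda>y. y) ` carrier (tensor_module R (Md G (n + 1)) M)"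
    using module_hom_closed[OF tensor_swap_hom[OF M Gm] vc] by auto
qed

lemma homology_trivial_imp_exact:
  assumes "chain_complex R C" "carrier (homology C n) = {\<zero>\<^bsub>homology C n\<^esub>}" "x \<in> cycles C n"
  shows "x \<in> boundaries C n"
proof -
  interpret C: module R "Md C n" by (rule chain_complex_module[OF assms(1)])
  have c1: "bd C (n + 1) \<in> module_hom R (Md C (n + 1)) (Md C n)" by (rule chain_complex_hom_up[OF assms(1)])
  have x: "x \<in> carrier (Md C n)" using assms(3) by (simp add: cycles_def)
  have z: "\<zero>\<^bsub>Md C n\<^esub> \<in> boundaries C n"
    using module_hom_zero[OF c1 chain_complex_module[OF assms(1)] chain_complex_module[OF assms(1)]]
      abelian_monoid.zero_closed[OF abelian_group.axioms(1)[OF module_abelian_group[OF chain_complex_module[OF assms(1)]]], of "n + 1"]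
    unfolding boundaries_def by (metis imageI)
  let ?Z = "restrict_module (Md C n) (cycles C n)"
  have "boundaries C n +>\<^bsub>?Z\<^esub> x \<in> a_rcosets\<^bsub>?Z\<^esub> (boundaries C n)"
    using assms(3) by (auto simp: A_RCOSETS_def' )
  then have "boundaries C n +>\<^bsub>?Z\<^esub> x = boundaries C n"
    using assms(2) by (simp add: homology_def quot_module_def)
  moreover have "x \<in> boundaries C n +>\<^bsub>?Z\<^esub> x"
    unfolding a_r_coset_def' using z x by (auto intro!: bexI[of _ "\<zero>\<^bsub>Md C n\<^esub>"])
  ultimately show ?thesis by simp
qed

lemma tensor_cplx_module_chain_complex:
  assumes F: "chain_complex R F" and N: "module R N"
  shows "chain_complex R (tensor_cplx_module R F N)"
proof -
  note Fm = chain_complex_module[OF F]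
  note h = chain_complex_hom[OF F]
  have b: "bd (tensor_cplx_module R F N) n = tensor_map R (Md F (n - 1)) N (bd F n) (\<lambda>y. y)" for n
    by (simp add: tensor_cplx_module_def tensor_map_def)
  have m: "Md (tensor_cplx_module R F N) n = tensor_module R (Md F n) N" for n
    by (simp add: tensor_cplx_module_def)
  have h2: "bd F (n - 1) \<in> module_hom R (Md F (n - 1)) (Md F (n - 2))" for n
    using h[of "n - 1"] by simp
  show ?thesis unfolding chain_complex_def b m
  proof (intro allI conjI ballI)
    fix n
    show "module R (tensor_module R (Md F n) N)" by (rule module_tensor[OF Fm N])
    show "tensor_map R (Md F (n - 1)) N (bd F n) (\<lambda>y. y) \<in> module_hom R (tensor_module R (Md F n) N) (tensor_module R (Md F (n - 1)) N)"
      by (rule tensor_map_hom[OF Fm N Fm N h module_hom_id])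
    fix x assume x: "x \<in> carrier (tensor_module R (Md F n) N)"
    show "tensor_map R (Md F (n - 1 - 1)) N (bd F (n - 1)) (\<lambda>y. y) (tensor_map R (Md F (n - 1)) N (bd F n) (\<lambda>y. y) x) = \<zero>\<^bsub>tensor_module R (Md F (n - 2)) N\<^esub>"
      using tensor_map_comp[OF Fm N Fm N Fm N h module_hom_id h2 module_hom_id x]
        tensor_map_zero[OF Fm N Fm N module_hom_comp[OF h h2] module_hom_comp[OF module_hom_id module_hom_id] _ x]
        chain_complex_bd_bd[OF F] by simp
  qed
qed

lemma homology_trivial_imp_tensor_acyclic:
  assumes F: "chain_complex R F" and N: "module R N"
    and "\<And>i. 1 \<le> i \<Longrightarrow> carrier (homology (tensor_cplx_module R F N) i) = {\<zero>\<^bsub>homology (tensor_cplx_module R F N) i\<^esub>}"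
  shows "tensor_acyclic R F N"
  unfolding tensor_acyclic_def
proof (intro allI impI ballI)
  fix n :: int and z
  assume n: "1 \<le> n" and z: "z \<in> carrier (tensor_module R (Md F n) N)"
    and b: "tensor_map R (Md F (n - 1)) N (bd F n) (\<lambda>y. y) z = \<zero>\<^bsub>tensor_module R (Md F (n - 1)) N\<^esub>"
  have "z \<in> cycles (tensor_cplx_module R F N) n"
    using z b by (simp add: cycles_def tensor_cplx_module_def tensor_map_def)
  from homology_trivial_imp_exact[OF tensor_cplx_module_chain_complex[OF F N] assms(3)[OF n] this]
  show "z \<in> tensor_map R (Md F n) N (bd F (n + 1)) (\<lambda>y. y) ` carrier (tensor_module R (Md F (n + 1)) N)"
    by (simp add: boundaries_def tensor_cplx_module_def tensor_map_def)
qed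

section \<open>Cyclic modules\<close>

lemma ideal_zero_mem: "ideal I R \<Longrightarrow> \<zero>\<^bsub>R\<^esub> \<in> I"
  by (simp add: ideal_def additive_subgroup.zero_closed)

lemma ideal_submodule:
  assumes "cring R" "ideal I R"
  shows "submodule I R (regular_module R)"
proof -
  interpret cring R by fact
  interpret I: ideal I R by fact
  show ?thesis
    by (rule submodule_closedI[OF module_regular[OF assms(1)]])
      (use I.a_subset I.I_l_closed in \<open>auto intro: ideal_zero_mem assms(2)\<close>)
qed

lemma submodule_ideal:
  assumes "cring R" "submodule I R (regular_module R)"
  shows "ideal I R"
proof -
  interpret cring R by fact
  note RR = module_regular[OF assms(1)]
  have sub: "I \<subseteq> carrier R" using submodule_subset[OF assms(2)] by auto
  have min: "\<ominus>\<^bsub>R\<^esub> x \<in> I" if "x \<in> I" for x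
    using submodule_smult[OF assms(2), of "\<ominus>\<^bsub>R\<^esub> \<one>\<^bsub>R\<^esub>" x] that sub by (auto simp: l_minus)
  show ?thesis
  proof (rule idealI)
    show "ring R" by (rule ring_axioms)
    show "subgroup I (add_monoid R)"
    proof (rule add.subgroupI)
      show "I \<noteq> {}" using submodule_zero[OF assms(2)] by auto
    qed (use sub min submodule_add[OF assms(2)] in \<open>auto simp: a_inv_def\<close>)
    show "x \<otimes>\<^bsub>R\<^esub> a \<in> I" if "a \<in> I" "x \<in> carrier R" for a x
      using submodule_smult[OF assms(2) that(2,1)] by simp
    then show "a \<otimes>\<^bsub>R\<^esub> x \<in> I" if "a \<in> I" "x \<in> carrier R" for a x
      using that sub by (metis m_comm subsetD)
  qed
qed

lemma cyclic_coset:
  "I +>\<^bsub>regular_module R\<^esub> x = I +>\<^bsub>R\<^esub> x"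
  by (simp add: a_r_coset_def')

lemma cyclic_module_facts:
  assumes "cring R" "ideal I R"
  shows cyclic_carrier: "carrier (cyclic_module R I) = (\<lambda>x. I +>\<^bsub>R\<^esub> x) ` carrier R"
    and cyclic_zero: "\<zero>\<^bsub>cyclic_module R I\<^esub> = I"
    and cyclic_add: "\<And>x y. x \<in> carrier R \<Longrightarrow> y \<in> carrier R \<Longrightarrow>
       (I +>\<^bsub>R\<^esub> x) \<oplus>\<^bsub>cyclic_module R I\<^esub> (I +>\<^bsub>R\<^esub> y) = I +>\<^bsub>R\<^esub> (x \<oplus>\<^bsub>R\<^esub> y)"
    and cyclic_smult: "\<And>r x. r \<in> carrier R \<Longrightarrow> x \<in> carrier R \<Longrightarrow>
       r \<odot>\<^bsub>cyclic_module R I\<^esub> (I +>\<^bsub>R\<^esub> x) = I +>\<^bsub>R\<^esub> (r \<otimes>\<^bsub>R\<^esub> x)"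
proof -
  interpret cring R by fact
  interpret I: ideal I R by fact
  show "carrier (cyclic_module R I) = (\<lambda>x. I +>\<^bsub>R\<^esub> x) ` carrier R"
    by (auto simp: cyclic_module_def quot_module_def A_RCOSETS_def' cyclic_coset a_r_coset_def')
  show "\<zero>\<^bsub>cyclic_module R I\<^esub> = I"
    by (simp add: cyclic_module_def quot_module_def)
  have set_add: "A <+>\<^bsub>regular_module R\<^esub> B = A <+>\<^bsub>R\<^esub> B" for A B
    by (simp add: set_add_def')
  show "(I +>\<^bsub>R\<^esub> x) \<oplus>\<^bsub>cyclic_module R I\<^esub> (I +>\<^bsub>R\<^esub> y) = I +>\<^bsub>R\<^esub> (x \<oplus>\<^bsub>R\<^esub> y)"
    if "x \<in> carrier R" "y \<in> carrier R" for x y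
    using I.a_rcos_sum[OF that] by (simp add: cyclic_module_def quot_module_def set_add)
  show "r \<odot>\<^bsub>cyclic_module R I\<^esub> (I +>\<^bsub>R\<^esub> x) = I +>\<^bsub>R\<^esub> (r \<otimes>\<^bsub>R\<^esub> x)"
    if r: "r \<in> carrier R" and x: "x \<in> carrier R" for r x
  proof -
    have eq: "I +>\<^bsub>R\<^esub> (r \<otimes>\<^bsub>R\<^esub> y) = I +>\<^bsub>R\<^esub> (r \<otimes>\<^bsub>R\<^esub> x)" if y: "y \<in> I +>\<^bsub>R\<^esub> x" for y
    proof -
      obtain a where a: "a \<in> I" "y = a \<oplus>\<^bsub>R\<^esub> x" using y by (auto simp: a_r_coset_def')
      have aR: "a \<in> carrier R" using a(1) by (rule I.a_Hcarr)
      have "r \<otimes>\<^bsub>R\<^esub> y = r \<otimes>\<^bsub>R\<^esub> a \<oplus>\<^bsub>R\<^esub> r \<otimes>\<^bsub>R\<^esub> x" using a r x aR by (simp add: r_distr)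
      moreover have "r \<otimes>\<^bsub>R\<^esub> a \<in> I" using a(1) r by (rule I.I_l_closed)
      ultimately have "r \<otimes>\<^bsub>R\<^esub> y \<in> I +>\<^bsub>R\<^esub> (r \<otimes>\<^bsub>R\<^esub> x)" by (auto simp: a_r_coset_def')
      then show ?thesis using r x by (intro a_repr_independence[symmetric]) (auto intro: additive_subgroup.a_subgroup[OF I.additive_subgroup_axioms])
    qed
    have self: "x \<in> I +>\<^bsub>R\<^esub> x" using x by (rule I.a_rcos_self)
    have "r \<odot>\<^bsub>cyclic_module R I\<^esub> (I +>\<^bsub>R\<^esub> x) = (\<Union>y\<in>I +>\<^bsub>R\<^esub> x. I +>\<^bsub>R\<^esub> (r \<otimes>\<^bsub>R\<^esub> y))"
      by (simp add: cyclic_module_def quot_module_def cyclic_coset)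
    also have "\<dots> = (\<Union>y\<in>I +>\<^bsub>R\<^esub> x. I +>\<^bsub>R\<^esub> (r \<otimes>\<^bsub>R\<^esub> x))"
      by (rule SUP_cong[OF refl eq])
    also have "\<dots> = I +>\<^bsub>R\<^esub> (r \<otimes>\<^bsub>R\<^esub> x)" using self by blast
    finally show ?thesis .
  qed
qed

lemma module_cyclic:
  assumes "cring R" "ideal I R"
  shows "module R (cyclic_module R I)"
proof -
  interpret cring R by fact
  note c = cyclic_module_facts[OF assms]
  show ?thesis
  proof (rule module_of_inverses)
    have z: "I = I +>\<^bsub>R\<^esub> \<zero>\<^bsub>R\<^esub>"
      using assms(2) by (simp add: ideal_def additive_subgroup.a_subset)
    show "\<zero>\<^bsub>cyclic_module R I\<^esub> \<in> carrier (cyclic_module R I)" unfolding c(1,2) by (subst z) auto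
    show "\<zero>\<^bsub>cyclic_module R I\<^esub> \<oplus>\<^bsub>cyclic_module R I\<^esub> x = x" if "x \<in> carrier (cyclic_module R I)" for x
      using that c(3)[OF zero_closed] by (auto simp: c(1,2) simp flip: z)
    show "\<exists>y\<in>carrier (cyclic_module R I). y \<oplus>\<^bsub>cyclic_module R I\<^esub> x = \<zero>\<^bsub>cyclic_module R I\<^esub>"
      if "x \<in> carrier (cyclic_module R I)" for x
    proof -
      obtain r where r: "r \<in> carrier R" "x = I +>\<^bsub>R\<^esub> r" using \<open>x \<in> _\<close> c(1) by auto
      then show ?thesis
        using c(3)[of "\<ominus>\<^bsub>R\<^esub> r" r] by (intro bexI[of _ "I +>\<^bsub>R\<^esub> (\<ominus>\<^bsub>R\<^esub> r)"]) (auto simp: c(1,2) l_neg simp flip: z)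
    qed
  qed (auto simp: c assms(1) a_ac l_distr r_distr m_assoc)
qed

lemma cyclic_proj_hom:
  assumes "cring R" "ideal I R"
  shows "(\<lambda>x. I +>\<^bsub>R\<^esub> x) \<in> module_hom R (regular_module R) (cyclic_module R I)"
  by (rule module_homI) (auto simp: cyclic_module_facts[OF assms])

lemma cyclic_coset_eq_zero:
  assumes "cring R" "ideal I R" "x \<in> carrier R"
  shows "I +>\<^bsub>R\<^esub> x = I \<longleftrightarrow> x \<in> I"
proof -
  interpret cring R by fact
  interpret I: ideal I R by fact
  show ?thesis using assms(3) I.a_rcos_self[OF assms(3)] I.a_rcos_const[of x] by auto
qed

section \<open>Resolutions by finitely generated free modules\<close>

text \<open>The free module \<open>R\<^sup>k\<close> on the first \<open>k\<close> coordinates; all ranks share one type, as the modules of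
  a complex must.\<close>

definition free_power :: "('a, 'r) ring_scheme \<Rightarrow> nat \<Rightarrow> ('a, nat \<Rightarrow> 'a) module" where
  "free_power R k = dsum_module {..<k} (\<lambda>_. regular_module R)"

context
  fixes R :: "('a, 'r) ring_scheme"
  assumes R: "cring R" and noeth: "noetherian_ring R"
begin

interpretation cring R by (rule R)

lemma free_power_free: "free_module R (free_power R k)"
  unfolding free_power_def by (rule free_module_dsum[OF R free_module_regular[OF R]])

lemma free_power_module: "module R (free_power R k)"
  using free_power_free by (simp add: free_module_def)

lemma free_power_simps [simp]:
  "\<zero>\<^bsub>free_power R k\<^esub> = (\<lambda>_. \<zero>\<^bsub>R\<^esub>)"
  "f \<oplus>\<^bsub>free_power R k\<^esub> g = (\<lambda>i. f i \<oplus>\<^bsub>R\<^esub> g i)"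
  "r \<odot>\<^bsub>free_power R k\<^esub> f = (\<lambda>i. r \<otimes>\<^bsub>R\<^esub> f i)"
  by (simp_all add: free_power_def)

lemma free_power_carrier:
  "f \<in> carrier (free_power R k) \<longleftrightarrow> (\<forall>i. f i \<in> carrier R) \<and> (\<forall>i\<ge>k. f i = \<zero>\<^bsub>R\<^esub>)"
proof -
  have "finite {i. f i \<noteq> \<zero>\<^bsub>R\<^esub>}" if "\<forall>i\<ge>k. f i = \<zero>\<^bsub>R\<^esub>"
    by (rule finite_subset[of _ "{..<k}"]) (use that in \<open>auto simp: not_le[symmetric]\<close>)
  then show ?thesis by (auto simp: free_power_def dsum_carrier_iff not_less)
qed

lemma free_power_proj: "(\<lambda>f. f i) \<in> module_hom R (free_power R k) (regular_module R)"
  unfolding free_power_def by (rule dsum_proj_hom)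

lemma submodule_inter:
  assumes "module R M" "submodule L R M" "submodule H R M"
  shows "submodule (L \<inter> H) R M"
  by (rule submodule_closedI[OF assms(1)])
    (use assms submodule_subset submodule_zero submodule_add submodule_smult in auto)

lemma submodule_last_zero:
  assumes "submodule L R (free_power R (Suc k))"
  shows "submodule {f \<in> L. f k = \<zero>\<^bsub>R\<^esub>} R (free_power R k)"
proof (rule submodule_closedI[OF free_power_module])
  show "{f \<in> L. f k = \<zero>\<^bsub>R\<^esub>} \<subseteq> carrier (free_power R k)"
    using submodule_subset[OF assms] by (auto simp: free_power_carrier) (metis Suc_leI le_neq_implies_less)
qed (use submodule_zero[OF assms] submodule_add[OF assms] submodule_smult[OF assms] in auto)

text \<open>Hilbert's argument: the last coordinates of L form a finitely generated ideal, and the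
  elements with vanishing last coordinate lie in a free module of smaller rank.\<close>

lemma submodule_finitely_generated:
  assumes "submodule L R (free_power R k)"
  shows "\<exists>G\<subseteq>L. finite G \<and> (\<forall>H. submodule H R (free_power R k) \<and> G \<subseteq> H \<longrightarrow> L \<subseteq> H)"
  using assms
proof (induction k arbitrary: L)
  case 0
  have "f = (\<lambda>_. \<zero>\<^bsub>R\<^esub>)" if "f \<in> L" for f
    using submodule_subset[OF 0 that] by (auto simp: free_power_carrier)
  then show ?case using submodule_zero by (intro exI[of _ "{}"]) fastforce
next
  case (Suc k)
  note P = free_power_module[of "Suc k"] and RR = module_regular[OF R]
  interpret P: module R "free_power R (Suc k)" by (rule P)
  note pr = free_power_proj[of k "Suc k"]
  have img: "ideal ((\<lambda>f. f k) ` L') R" if "submodule L' R (free_power R (Suc k))" for L'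
    by (rule submodule_ideal[OF R submodule_image[OF pr P RR that]])
  obtain A where A: "A \<subseteq> carrier R" "finite A" "(\<lambda>f. f k) ` L = Idl\<^bsub>R\<^esub> A"
    using noetherian_ring.finetely_gen[OF noeth img[OF Suc.prems]] by auto
  have "A \<subseteq> (\<lambda>f. f k) ` L" using genideal_self[OF A(1)] A(3) by simp
  then have "\<forall>a\<in>A. \<exists>f\<in>L. f k = a" by force
  then obtain g where g: "\<And>a. a \<in> A \<Longrightarrow> g a \<in> L \<and> g a k = a" by metis
  obtain G0 where G0: "G0 \<subseteq> {f \<in> L. f k = \<zero>\<^bsub>R\<^esub>}" "finite G0"
    "\<And>H. submodule H R (free_power R k) \<Longrightarrow> G0 \<subseteq> H \<Longrightarrow> {f \<in> L. f k = \<zero>\<^bsub>R\<^esub>} \<subseteq> H"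
    using Suc.IH[OF submodule_last_zero[OF Suc.prems]] by auto
  show ?case
  proof (intro exI[of _ "g ` A \<union> G0"] conjI allI impI)
    show "g ` A \<union> G0 \<subseteq> L" "finite (g ` A \<union> G0)" using g G0 A(2) by auto
    fix H assume "submodule H R (free_power R (Suc k)) \<and> g ` A \<union> G0 \<subseteq> H"
    then have H: "submodule H R (free_power R (Suc k))" and gH: "g ` A \<subseteq> H" and GH: "G0 \<subseteq> H" by auto
    have L0: "{f \<in> L. f k = \<zero>\<^bsub>R\<^esub>} \<subseteq> {f \<in> H. f k = \<zero>\<^bsub>R\<^esub>}"
      using G0 GH by (intro G0(3) submodule_last_zero[OF H]) auto
    have "A \<subseteq> (\<lambda>f. f k) ` (L \<inter> H)"
    proof
      fix a assume a: "a \<in> A"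
      then have "a = g a k" "g a \<in> L \<inter> H" using g[OF a] gH by auto
      then show "a \<in> (\<lambda>f. f k) ` (L \<inter> H)" by (rule image_eqI)
    qed
    then have J: "(\<lambda>f. f k) ` L \<subseteq> (\<lambda>f. f k) ` (L \<inter> H)"
      unfolding A(3) by (intro genideal_minimal img submodule_inter P Suc.prems H)
    show "L \<subseteq> H"
    proof
      fix f assume f: "f \<in> L"
      then have "f k \<in> (\<lambda>f. f k) ` (L \<inter> H)" using J by blast
      then obtain h where h: "h \<in> L" "h \<in> H" "h k = f k" by auto
      have fc: "f \<in> carrier (free_power R (Suc k))" and hc: "h \<in> carrier (free_power R (Suc k))"
        using submodule_subset[OF Suc.prems] f h(1) by auto
      let ?d = "f \<oplus>\<^bsub>free_power R (Suc k)\<^esub> \<ominus>\<^bsub>free_power R (Suc k)\<^esub> h"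
      have "?d \<in> L" using submodule_add[OF Suc.prems f submodule_minus[OF P Suc.prems h(1)]] .
      moreover have "?d k = \<zero>\<^bsub>R\<^esub>"
        using module_hom_add[OF pr fc P.a_inv_closed[OF hc]] module_hom_minus[OF pr P RR hc]
          h(3) module_eq_iff_minus[OF RR, of "f k" "f k"] fc by (simp add: free_power_carrier)
      ultimately have "?d \<in> H" using L0 by blast
      then have "?d \<oplus>\<^bsub>free_power R (Suc k)\<^esub> h \<in> H" using submodule_add[OF H _ h(2)] by blast
      moreover have "?d \<oplus>\<^bsub>free_power R (Suc k)\<^esub> h = f"
        using P.M.a_assoc[OF fc P.a_inv_closed[OF hc] hc] P.M.l_neg[OF hc] P.M.r_zero[OF fc] by metis
      ultimately show "f \<in> H" by metis
    qed
  qed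
qed

lemma submodule_presentation:
  assumes L: "submodule L R (free_power R k)"
  shows "\<exists>m. \<exists>g\<in>module_hom R (free_power R m) (free_power R k). g ` carrier (free_power R m) = L"
proof -
  note P = free_power_module and RR = module_regular[OF R]
  interpret P: module R "free_power R k" by (rule P)
  obtain G where G: "G \<subseteq> L" "finite G" "\<And>H. submodule H R (free_power R k) \<Longrightarrow> G \<subseteq> H \<Longrightarrow> L \<subseteq> H"
    using submodule_finitely_generated[OF L] by auto
  obtain e where e: "bij_betw e {0..<card G} G" using ex_bij_betw_nat_finite[OF G(2)] by auto
  have eG: "e i \<in> L" if "i < card G" for i
    using e G(1) that by (auto simp: bij_betw_def)
  have eP: "e i \<in> carrier (free_power R k)" if "i < card G" for i
    using submodule_subset[OF L eG[OF that]] .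
  let ?h = "\<lambda>i r. r \<odot>\<^bsub>free_power R k\<^esub> e i"
  have h: "?h i \<in> module_hom R (regular_module R) (free_power R k)" if "i \<in> {..<card G}" for i
    by (rule module_homI)
      (use eP[of i] that in \<open>auto simp: P.smult_l_distr P.smult_assoc1 simp del: free_power_simps\<close>)
  let ?g = "dsum_lift (\<lambda>_. regular_module R) (free_power R k) ?h"
  have g: "?g \<in> module_hom R (free_power R (card G)) (free_power R k)"
    unfolding free_power_def[of R "card G"]
    by (rule dsum_lift_hom[of R "free_power R k" "\<lambda>_. regular_module R", OF P RR h])
  have gi: "?g (dsum_inj (\<lambda>_. regular_module R) i r) = r \<odot>\<^bsub>free_power R k\<^esub> e i" if "i < card G" "r \<in> carrier R" for i r
    using dsum_lift_inj[of R "free_power R k" "\<lambda>_. regular_module R" "{..<card G}" ?h i r, OF P RR h] that by simp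
  have ic: "dsum_inj (\<lambda>_. regular_module R) i r \<in> carrier (free_power R (card G))" if "i < card G" "r \<in> carrier R" for i r
    using module_hom_closed[OF dsum_inj_hom[of R "\<lambda>_. regular_module R" i "{..<card G}", OF R RR], of r] that
    by (simp add: free_power_def)
  have "?g ` carrier (free_power R (card G)) = L"
  proof
    show "L \<subseteq> ?g ` carrier (free_power R (card G))"
    proof (rule G(3)[OF submodule_image[OF g P P submodule_carrier[OF P]]])
      show "G \<subseteq> ?g ` carrier (free_power R (card G))"
      proof
        fix x assume "x \<in> G"
        then obtain i where i: "i < card G" "x = e i"
          using bij_betw_imp_surj_on[OF e] by (metis atLeastLessThan_iff imageE)
        then show "x \<in> ?g ` carrier (free_power R (card G))"
          using gi[OF i(1) one_closed] ic[OF i(1) one_closed] P.smult_one[OF eP[OF i(1)]] by (metis imageI)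
      qed
    qed
    show "?g ` carrier (free_power R (card G)) \<subseteq> L"
    proof clarify
      fix u assume u: "u \<in> carrier (free_power R (card G))"
      have sp: "spans R (free_power R (card G)) (\<Union>i\<in>{..<card G}. dsum_inj (\<lambda>_. regular_module R) i ` carrier (regular_module R))"
        unfolding free_power_def by (rule dsum_spans[of R "\<lambda>_. regular_module R", OF R RR])
      show "?g u \<in> L"
      proof (rule spans_image_subset[OF sp P P g L _ u])
        fix x assume "x \<in> (\<Union>i\<in>{..<card G}. dsum_inj (\<lambda>_. regular_module R) i ` carrier (regular_module R))"
        then obtain i r where "i < card G" "r \<in> carrier R" "x = dsum_inj (\<lambda>_. regular_module R) i r" by auto
        then show "?g x \<in> L" using gi submodule_smult[OF L] eG by metis
      qed
    qed
  qed
  then show ?thesis using g by blast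
qed

lemma kernel_submodule:
  assumes "h \<in> module_hom R M N" "module R M" "module R N"
  shows "submodule {x \<in> carrier M. h x = \<zero>\<^bsub>N\<^esub>} R M"
  using submodule_preimage[OF assms submodule_zero_singleton[OF assms(3)]] by simp

text \<open>The kernel of each differential is finitely generated, so it is covered by the next \<open>R\<^sup>m\<close>.\<close>

lemma cyclic_free_resolution_exists:
  assumes I: "ideal I R"
  shows "\<exists>F :: ('a, nat \<Rightarrow> 'a) cplx. free_resolution R F (cyclic_module R I)"
proof -
  note P = free_power_module and RR = module_regular[OF R] and C = module_cyclic[OF R I]
  define K where "K = {f \<in> carrier (free_power R 1). f 0 \<in> I}"
  have KS: "submodule K R (free_power R 1)"
    unfolding K_def by (rule submodule_preimage[OF free_power_proj P RR ideal_submodule[OF R I]])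
  \<comment> \<open>A state consists of the rank of the source, the rank of the target and a map between them.\<close>
  define ok where "ok n s \<longleftrightarrow> snd (snd s) \<in> module_hom R (free_power R (fst s)) (free_power R (fst (snd s))) \<and>
     (n = 0 \<longrightarrow> fst (snd s) = 1 \<and> snd (snd s) ` carrier (free_power R (fst s)) = K)"
    for n :: nat and s :: "nat \<times> nat \<times> ((nat \<Rightarrow> 'a) \<Rightarrow> nat \<Rightarrow> 'a)"
  define nxt where "nxt s s' \<longleftrightarrow> fst (snd s') = fst s \<and>
     snd (snd s') ` carrier (free_power R (fst s')) =
       {f \<in> carrier (free_power R (fst s)). snd (snd s) f = \<zero>\<^bsub>free_power R (fst (snd s))\<^esub>}"
    for s s' :: "nat \<times> nat \<times> ((nat \<Rightarrow> 'a) \<Rightarrow> nat \<Rightarrow> 'a)"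
  have "\<exists>s. ok 0 s"
  proof -
    obtain m g where "g \<in> module_hom R (free_power R m) (free_power R 1)" "g ` carrier (free_power R m) = K"
      using submodule_presentation[OF KS] by auto
    then show ?thesis by (intro exI[of _ "(m, 1, g)"]) (simp add: ok_def)
  qed
  moreover have "\<exists>s'. ok (Suc n) s' \<and> nxt s s'" if "ok n s" for n s
  proof -
    have "snd (snd s) \<in> module_hom R (free_power R (fst s)) (free_power R (fst (snd s)))"
      using that by (simp add: ok_def)
    from submodule_presentation[OF kernel_submodule[OF this P P]]
    obtain m g where "g \<in> module_hom R (free_power R m) (free_power R (fst s))"
      "g ` carrier (free_power R m) = {f \<in> carrier (free_power R (fst s)). snd (snd s) f = \<zero>\<^bsub>free_power R (fst (snd s))\<^esub>}"
      by blast
    then show ?thesis by (intro exI[of _ "(m, fst s, g)"]) (simp add: ok_def nxt_def)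
  qed
  ultimately obtain s where s: "\<And>n. ok n (s n)" "\<And>n. nxt (s n) (s (Suc n))"
    using dependent_nat_choice[of ok "\<lambda>_. nxt"] by blast
  define k where "k n = fst (snd (s n))" for n
  define g where "g n = snd (snd (s n))" for n
  have km: "fst (s n) = k (Suc n)" for n using s(2)[of n] by (simp add: nxt_def k_def)
  have k0: "k 0 = 1" using s(1)[of 0] by (simp add: ok_def k_def)
  have g: "g n \<in> module_hom R (free_power R (k (Suc n))) (free_power R (k n))" for n
    using s(1)[of n] by (simp add: ok_def g_def km k_def[symmetric])
  have g0: "g 0 ` carrier (free_power R (k (Suc 0))) = K"
    using s(1)[of 0] by (simp add: ok_def g_def km)
  have gS: "g (Suc n) ` carrier (free_power R (k (Suc (Suc n)))) =
     {f \<in> carrier (free_power R (k (Suc n))). g n f = \<zero>\<^bsub>free_power R (k n)\<^esub>}" for n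
    using s(2)[of n] by (simp only: nxt_def g_def km k_def[symmetric])
  define F :: "('a, nat \<Rightarrow> 'a) cplx" where
    "F = \<lparr>Md = \<lambda>i. free_power R (if i < 0 then 0 else k (nat i)),
          bd = \<lambda>i. if i \<ge> 1 then g (nat (i - 1)) else (\<lambda>_ _. \<zero>\<^bsub>R\<^esub>)\<rparr>"
  have Fi: "Md F i = free_power R (k n)" "bd F (i + 1) = g n" if "i = int n" for i n
    using that by (auto simp: F_def)
  have Fn: "Md F i = free_power R 0" if "i < 0" for i using that by (simp add: F_def)
  have F0: "bd F i = (\<lambda>_ _. \<zero>\<^bsub>R\<^esub>)" if "i \<le> 0" for i using that by (simp add: F_def)
  have zF: "\<zero>\<^bsub>Md F i\<^esub> = (\<lambda>_. \<zero>\<^bsub>R\<^esub>)" for i by (simp add: F_def)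
  have FP: "module R (Md F i)" for i by (simp add: F_def P)
  have bh: "bd F i \<in> module_hom R (Md F i) (Md F (i - 1))" for i
  proof (cases "i \<ge> 1")
    case True
    then have "i = int (nat (i - 1)) + 1" by simp
    then obtain n where n: "i = int n + 1" by blast
    have "Md F i = free_power R (k (Suc n))" using Fi(1)[of i "Suc n"] n by simp
    moreover have "Md F (i - 1) = free_power R (k n)" using Fi(1)[of "i - 1" n] n by simp
    moreover have "bd F i = g n" using Fi(2)[of "int n" n] n by simp
    ultimately show ?thesis using g by simp
  next
    case False
    then show ?thesis using F0[of i] module_hom_const_zero[OF FP, of "i - 1"] by (simp add: zF)
  qed
  have ex: "cycles F i = boundaries F i" if "1 \<le> i" for i
  proof -
    have "i = int (nat (i - 1)) + 1" using that by simp
    then obtain n where n: "i = int n + 1" by blast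
    have "Md F i = free_power R (k (Suc n))" "bd F (i + 1) = g (Suc n)" using Fi[of i "Suc n"] n by simp_all
    moreover have "Md F (i + 1) = free_power R (k (Suc (Suc n)))" using Fi(1)[of "i + 1" "Suc (Suc n)"] n by simp
    moreover have "bd F i = g n" using Fi(2)[of "int n" n] n by simp
    ultimately show ?thesis using gS[of n] by (simp add: cycles_def boundaries_def zF)
  qed
  have bb: "bd F (i - 1) (bd F i x) = \<zero>\<^bsub>Md F (i - 2)\<^esub>" if x: "x \<in> carrier (Md F i)" for i x
  proof (cases "i - 1 \<ge> 1")
    case True
    have "bd F i x \<in> boundaries F (i - 1)" using x by (auto simp: boundaries_def)
    then have "bd F i x \<in> cycles F (i - 1)" using ex[OF True] by simp
    then show ?thesis by (simp add: cycles_def)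
  next
    case False
    then show ?thesis using F0[of "i - 1"] by (simp add: zF)
  qed
  let ?\<epsilon> = "\<lambda>f. I +>\<^bsub>R\<^esub> f (0::nat)"
  have M0: "Md F 0 = free_power R 1" using Fi(1)[of 0 0] k0 by simp
  have "augmented_free_resolution R F ?\<epsilon> (cyclic_module R I)"
    unfolding augmented_free_resolution_def
  proof (intro conjI allI impI)
    show "chain_complex R F" using FP bh bb by (simp add: chain_complex_def)
    show "free_module R (Md F n)" for n by (simp add: F_def free_power_free)
    show "carrier (Md F n) = {\<zero>\<^bsub>Md F n\<^esub>}" if "n < 0" for n
      using Fn[OF that] by (auto simp: free_power_carrier)
    show "cycles F n = boundaries F n" if "1 \<le> n" for n by (rule ex[OF that])
    show "?\<epsilon> \<in> module_hom R (Md F 0) (cyclic_module R I)"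
      unfolding M0 by (rule module_hom_comp[OF free_power_proj cyclic_proj_hom[OF R I]])
    show "?\<epsilon> ` carrier (Md F 0) = carrier (cyclic_module R I)"
    proof -
      have "r \<in> (\<lambda>f. f 0) ` carrier (free_power R 1)" if "r \<in> carrier R" for r
        using that by (intro image_eqI[of _ _ "\<lambda>i. if i = 0 then r else \<zero>\<^bsub>R\<^esub>"]) (auto simp: free_power_carrier)
      moreover have "(\<lambda>f. f 0) ` carrier (free_power R 1) \<subseteq> carrier R" by (auto simp: free_power_carrier)
      ultimately have "(\<lambda>f. f 0) ` carrier (free_power R 1) = carrier R" by blast
      then show ?thesis unfolding M0 cyclic_carrier[OF R I] by (metis image_image)
    qed
    have "boundaries F 0 = K"
      using g0 Fi(1)[of 1 1] Fi(2)[of 0 0] by (simp add: boundaries_def)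
    moreover have "I +>\<^bsub>R\<^esub> f 0 = I \<longleftrightarrow> f 0 \<in> I" if "f \<in> carrier (free_power R 1)" for f
      using that by (intro cyclic_coset_eq_zero[OF R I]) (simp add: free_power_carrier)
    ultimately show "{x \<in> carrier (Md F 0). ?\<epsilon> x = \<zero>\<^bsub>cyclic_module R I\<^esub>} = boundaries F 0"
      unfolding M0 K_def cyclic_zero[OF R I] by blast
  qed
  then show ?thesis by (auto simp: free_resolution_def)
qed

text \<open>Symmetry of Tor is applied twice: from the chosen resolution of \<open>R/I\<close> to \<open>Y\<close>, and from \<open>Y\<close>
  to the given resolution \<open>X\<close>.\<close>

lemma Tor_independent_imp_tensor_acyclic:
  assumes I: "ideal I R" and J: "ideal J R" and ti: "Tor_independent R I J"
    and X: "augmented_free_resolution R X \<epsilon> (cyclic_module R I)"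
    and Y: "augmented_free_resolution R Y \<eta> (cyclic_module R J)"
  shows "tensor_acyclic R X (cyclic_module R J)"
proof -
  let ?F = "chosen_resolution R (cyclic_module R I)"
  have "free_resolution R ?F (cyclic_module R I)"
    unfolding chosen_resolution_def using cyclic_free_resolution_exists[OF I] by (rule someI_ex)
  then obtain \<delta> where F: "augmented_free_resolution R ?F \<delta> (cyclic_module R I)"
    by (auto simp: free_resolution_def)
  note CI = module_cyclic[OF R I] and CJ = module_cyclic[OF R J]
  have "tensor_acyclic R ?F (cyclic_module R J)"
    using ti by (intro homology_trivial_imp_tensor_acyclic[OF afr_chain[OF F] CJ])
      (simp add: Tor_independent_def Tor_def)
  then have Yac: "tensor_acyclic R Y (cyclic_module R I)"
    by (rule tensor_acyclic_swap[OF F Y CI CJ])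
  show "tensor_acyclic R X (cyclic_module R J)"
    by (rule tensor_acyclic_swap[OF Y X CJ CI Yac])
qed

end

section \<open>Further exactness in double complexes\<close>

lemma dsum_transpose:
  fixes A :: "int \<times> int \<Rightarrow> ('a, 'z) module"
  assumes "f \<in> carrier (dsum_module {(i, j). i + j = n} A)"
  shows "(\<lambda>(i, j). f (j, i)) \<in> carrier (dsum_module {(i, j). i + j = n} (\<lambda>(i, j). A (j, i)))"
proof -
  have "{k. (case k of (i, j) \<Rightarrow> f (j, i)) \<noteq> \<zero>\<^bsub>(case k of (i, j) \<Rightarrow> A (j, i))\<^esub>} = prod.swap ` {k. f k \<noteq> \<zero>\<^bsub>A k\<^esub>}"
    by (auto simp: image_iff)
  moreover have "finite {k. f k \<noteq> \<zero>\<^bsub>A k\<^esub>}" by (rule dsum_support(1)[OF assms])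
  ultimately have "finite {k. (case k of (i, j) \<Rightarrow> f (j, i)) \<noteq> \<zero>\<^bsub>(case k of (i, j) \<Rightarrow> A (j, i))\<^esub>}" by simp
  then show ?thesis
    using dsum_closed[OF assms] dsum_outside[OF assms] by (auto simp: dsum_carrier_iff add.commute)
qed

context double_complex
begin

lemma transpose: "double_complex R (\<lambda>(i, j). A (j, i)) (\<lambda>i j. D2 j i) (\<lambda>i j. D1 j i)"
proof (rule double_complex.intro)
  fix i j x assume x: "x \<in> carrier (case (i, j) of (i, j) \<Rightarrow> A (j, i))"
  then have x: "x \<in> carrier (A (j, i))" by simp
  have "abelian_monoid (A (j - 1, i - 1))"
    using module_abelian_group[OF A_module] by (simp add: abelian_group_def)
  moreover have "D1 j (i - 1) (D2 j i x) \<in> carrier (A (j - 1, i - 1))" "D2 (j - 1) i (D1 j i x) \<in> carrier (A (j - 1, i - 1))"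
    using D1_closed[OF D2_closed[OF x]] D2_closed[OF D1_closed[OF x]] by simp_all
  ultimately show "D2 (j - 1) i (D1 j i x) \<oplus>\<^bsub>(case (i - 1, j - 1) of (i, j) \<Rightarrow> A (j, i))\<^esub> D1 j (i - 1) (D2 j i x)
      = \<zero>\<^bsub>(case (i - 1, j - 1) of (i, j) \<Rightarrow> A (j, i))\<^esub>"
    using D1_D2[OF x] by (simp add: abelian_monoid.a_comm)
qed (auto simp: cring A_module D1_hom D2_hom D1_D1 D2_D2 split: prod.split)

lemma rows_exact_imp_boundary:
  assumes left: "\<And>i j. i < i0 \<Longrightarrow> carrier (A (i, j)) = {\<zero>\<^bsub>A (i, j)\<^esub>}"
    and bottom: "\<And>i j. j < j0 \<Longrightarrow> carrier (A (i, j)) = {\<zero>\<^bsub>A (i, j)\<^esub>}"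
    and row: "\<And>i j x. i + j = n \<Longrightarrow> i0 < i \<Longrightarrow> x \<in> carrier (A (i, j)) \<Longrightarrow> D1 i j x = \<zero>\<^bsub>A (i - 1, j)\<^esub> \<Longrightarrow>
       \<exists>y\<in>carrier (A (i + 1, j)). x = D1 (i + 1) j y"
    and edge: "\<And>j x w. i0 + j = n \<Longrightarrow> x \<in> carrier (A (i0, j)) \<Longrightarrow> w \<in> carrier (A (i0 + 1, j - 1)) \<Longrightarrow>
       D2 i0 j x = D1 (i0 + 1) (j - 1) w \<Longrightarrow>
       \<exists>u\<in>carrier (A (i0 + 1, j)). \<exists>v\<in>carrier (A (i0, j + 1)). x = D1 (i0 + 1) j u \<oplus>\<^bsub>A (i0, j)\<^esub> D2 i0 (j + 1) v"
    and f: "f \<in> carrier (Tot n)" and tf: "tot f = (\<lambda>k. \<zero>\<^bsub>A k\<^esub>)"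
  shows "boundary n f"
proof -
  interpret T: double_complex R "\<lambda>(i, j). A (j, i)" "\<lambda>i j. D2 j i" "\<lambda>i j. D1 j i"
    by (rule transpose)
  let ?f = "\<lambda>(i, j). f (j, i)"
  have mon: "abelian_monoid (A k)" for k
    using module_abelian_group[OF A_module] by (simp add: abelian_group_def)
  have tot_transpose: "T.tot (\<lambda>(i, j). h (j, i)) (i, j) = tot h (j, i)" if "\<And>k. h k \<in> carrier (A k)" for h i j
    using abelian_monoid.a_comm[OF mon module_hom_closed[OF D2_up[of j i] that[of "(j, i + 1)"]]
        module_hom_closed[OF D1_up[of j i] that[of "(j + 1, i)"]]]
    by (simp add: T.tot_apply tot_apply)
  have "T.boundary n ?f"
  proof (rule T.columns_exact_imp_boundary[of j0 i0])
    show "?f \<in> carrier (T.Tot n)" by (rule dsum_transpose[OF f])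
    show "T.tot ?f = (\<lambda>k. \<zero>\<^bsub>case k of (i, j) \<Rightarrow> A (j, i)\<^esub>)"
      using tot_transpose[OF dsum_closed[OF f]] tf by (auto simp: fun_eq_iff)
  next
    fix j x w assume *: "j + i0 = n" "x \<in> carrier (case (j, i0) of (i, j) \<Rightarrow> A (j, i))"
      "w \<in> carrier (case (j - 1, i0 + 1) of (i, j) \<Rightarrow> A (j, i))" "D2 i0 j x = D1 (i0 + 1) (j - 1) w"
    then have "\<exists>u\<in>carrier (A (i0 + 1, j)). \<exists>v\<in>carrier (A (i0, j + 1)). x = D1 (i0 + 1) j u \<oplus>\<^bsub>A (i0, j)\<^esub> D2 i0 (j + 1) v"
      using edge[of j x w] by (simp add: add.commute)
    then obtain u v where uv: "u \<in> carrier (A (i0 + 1, j))" "v \<in> carrier (A (i0, j + 1))"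
      "x = D1 (i0 + 1) j u \<oplus>\<^bsub>A (i0, j)\<^esub> D2 i0 (j + 1) v" by blast
    then have "x = D2 i0 (j + 1) v \<oplus>\<^bsub>A (i0, j)\<^esub> D1 (i0 + 1) j u"
      using abelian_monoid.a_comm[OF mon module_hom_closed[OF D1_up uv(1)] module_hom_closed[OF D2_up uv(2)]] by simp
    then show "\<exists>u\<in>carrier (case (j + 1, i0) of (i, j) \<Rightarrow> A (j, i)). \<exists>v\<in>carrier (case (j, i0 + 1) of (i, j) \<Rightarrow> A (j, i)).
         x = D2 i0 (j + 1) u \<oplus>\<^bsub>(case (j, i0) of (i, j) \<Rightarrow> A (j, i))\<^esub> D1 (i0 + 1) j v"
      using uv(1,2) by auto
  qed (use left bottom row in \<open>auto simp: add.commute\<close>)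
  then obtain g where g: "g \<in> carrier (T.Tot (n + 1))" "T.tot g = ?f" by (auto simp: T.boundary_def)
  let ?g = "\<lambda>(i, j). g (j, i)"
  have "?g \<in> carrier (Tot (n + 1))" using dsum_transpose[OF g(1)] by simp
  moreover have "tot ?g = f"
  proof
    fix k :: "int \<times> int" obtain i j where k: "k = (i, j)" by (cases k)
    have "T.tot (\<lambda>(a, b). ?g (b, a)) (j, i) = tot ?g (i, j)"
      by (rule tot_transpose) (use dsum_closed[OF \<open>?g \<in> carrier (Tot (n + 1))\<close>] in auto)
    then show "tot ?g k = f k" using g(2) by (simp add: k)
  qed
  ultimately show ?thesis unfolding boundary_def by blast
qed

text \<open>On an antidiagonal with a single nonzero module, a total preimage has to be right in one component
  only.\<close>

lemma boundary_of_component: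
  assumes "f \<in> carrier (Tot n)" "i + j = n"
    and triv: "\<And>a b. a + b = n \<Longrightarrow> a \<noteq> i \<Longrightarrow> carrier (A (a, b)) = {\<zero>\<^bsub>A (a, b)\<^esub>}"
    and u: "u \<in> carrier (A (i + 1, j))" and v: "v \<in> carrier (A (i, j + 1))"
    and "f (i, j) = D1 (i + 1) j u \<oplus>\<^bsub>A (i, j)\<^esub> D2 i (j + 1) v"
  shows "boundary n f"
proof -
  let ?gu = "dsum_inj A (i + 1, j) u" and ?gv = "dsum_inj A (i, j + 1) v"
  have gu: "?gu \<in> carrier (Tot (n + 1))" using u assms(2) by (intro inj_closed) auto
  have gv: "?gv \<in> carrier (Tot (n + 1))" using v assms(2) by (intro inj_closed) auto
  interpret T: module R "Tot (n + 1)" by (rule Tot_module)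
  let ?g = "?gu \<oplus>\<^bsub>Tot (n + 1)\<^esub> ?gv"
  have g: "?g \<in> carrier (Tot (n + 1))" by (rule T.M.a_closed[OF gu gv])
  have tg: "tot ?g \<in> carrier (Tot n)" using tot_closed[OF g] by simp
  have "tot ?g (i, j) = tot ?gu (i, j) \<oplus>\<^bsub>A (i, j)\<^esub> tot ?gv (i, j)"
    using module_hom_add[OF tot_hom gu gv] by simp
  moreover have "tot ?gu (i, j) = D1 (i + 1) j u"
    unfolding tot_inj[OF u] using module_hom_closed[OF D1_up u] by simp
  moreover have "tot ?gv (i, j) = D2 i (j + 1) v"
    unfolding tot_inj[OF v] using module_hom_closed[OF D2_up v] by simp
  ultimately have at: "tot ?g (i, j) = f (i, j)" using assms(6) by simp
  have "tot ?g k = f k" for k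
  proof -
    obtain a b where k: "k = (a, b)" by (cases k)
    show ?thesis
    proof (cases "a + b = n")
      case True
      show ?thesis
      proof (cases "a = i")
        case True
        then have "b = j" using \<open>a + b = n\<close> assms(2) by simp
        then show ?thesis using True k at by simp
      next
        case False
        then show ?thesis
          using triv[OF \<open>a + b = n\<close> False] dsum_closed[OF tg, of k] dsum_closed[OF assms(1), of k] k by auto
      qed
    next
      case False
      then show ?thesis using dsum_outside[OF tg, of k] dsum_outside[OF assms(1), of k] k by auto
    qed
  qed
  then show ?thesis using g unfolding boundary_def by blast
qed

text \<open>The vertical image of \<open>z\<close> is a horizontal cycle, hence a horizontal boundary, and the edge condition
  allows one to choose its preimage of the form \<open>D2 q\<close>.  As the differentials anticommute, \<open>z + D1 q\<close>
  is a vertical cycle.\<close>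

lemma corner_chase:
  assumes row: "\<And>x. x \<in> carrier (A (i, j)) \<Longrightarrow> D1 i j x = \<zero>\<^bsub>A (i - 1, j)\<^esub> \<Longrightarrow>
       \<exists>y\<in>carrier (A (i + 1, j)). x = D1 (i + 1) j y"
    and edge: "\<And>x w. x \<in> carrier (A (i + 1, j)) \<Longrightarrow> w \<in> carrier (A (i, j + 1)) \<Longrightarrow> D1 (i + 1) j x = D2 i (j + 1) w \<Longrightarrow>
       \<exists>u\<in>carrier (A (i + 1 + 1, j)). \<exists>v\<in>carrier (A (i + 1, j + 1)). x = D1 (i + 1 + 1) j u \<oplus>\<^bsub>A (i + 1, j)\<^esub> D2 (i + 1) (j + 1) v"
    and col: "\<And>x. x \<in> carrier (A (i, j + 1)) \<Longrightarrow> D2 i (j + 1) x = \<zero>\<^bsub>A (i, j)\<^esub> \<Longrightarrow>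
       \<exists>y\<in>carrier (A (i, j + 1 + 1)). x = D2 i (j + 1 + 1) y"
    and z: "z \<in> carrier (A (i, j + 1))" and "D1 i j (D2 i (j + 1) z) = \<zero>\<^bsub>A (i - 1, j)\<^esub>"
  shows "\<exists>u\<in>carrier (A (i + 1, j + 1)). \<exists>v\<in>carrier (A (i, j + 1 + 1)).
     z = D1 (i + 1) (j + 1) u \<oplus>\<^bsub>A (i, j + 1)\<^esub> D2 i (j + 1 + 1) v"
proof -
  interpret A0: module R "A (i, j)" by (rule A_module)
  interpret A1: module R "A (i, j + 1)" by (rule A_module)
  have wz: "D2 i (j + 1) z \<in> carrier (A (i, j))" by (rule module_hom_closed[OF D2_up z])
  then obtain x where x: "x \<in> carrier (A (i + 1, j))" "D2 i (j + 1) z = D1 (i + 1) j x"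
    using row assms(5) by blast
  obtain p q where pq: "p \<in> carrier (A (i + 1 + 1, j))" "q \<in> carrier (A (i + 1, j + 1))"
    "x = D1 (i + 1 + 1) j p \<oplus>\<^bsub>A (i + 1, j)\<^esub> D2 (i + 1) (j + 1) q"
    using edge[OF x(1) z] x(2) by auto
  have c1: "D1 (i + 1 + 1) j p \<in> carrier (A (i + 1, j))" by (rule module_hom_closed[OF D1_up pq(1)])
  have c2: "D2 (i + 1) (j + 1) q \<in> carrier (A (i + 1, j))" by (rule module_hom_closed[OF D2_up pq(2)])
  have "D1 (i + 1) j (D1 (i + 1 + 1) j p) = \<zero>\<^bsub>A (i, j)\<^esub>"
    using D1_D1[OF pq(1)] by (simp add: ac_simps)
  then have D1x: "D1 (i + 1) j x = D1 (i + 1) j (D2 (i + 1) (j + 1) q)"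
    unfolding pq(3) using module_hom_add[OF D1_up c1 c2] module_hom_closed[OF D1_up c2] by simp
  have d: "D1 (i + 1) (j + 1) q \<in> carrier (A (i, j + 1))" by (rule module_hom_closed[OF D1_up pq(2)])
  have "D1 (i + 1) j (D2 (i + 1) (j + 1) q) \<oplus>\<^bsub>A (i, j)\<^esub> D2 i (j + 1) (D1 (i + 1) (j + 1) q) = \<zero>\<^bsub>A (i, j)\<^esub>"
    using D1_D2[OF pq(2)] by simp
  then have "D2 i (j + 1) (z \<oplus>\<^bsub>A (i, j + 1)\<^esub> D1 (i + 1) (j + 1) q) = \<zero>\<^bsub>A (i, j)\<^esub>"
    using module_hom_add[OF D2_up z d] x(2) D1x by simp
  then obtain v where v: "v \<in> carrier (A (i, j + 1 + 1))" "z \<oplus>\<^bsub>A (i, j + 1)\<^esub> D1 (i + 1) (j + 1) q = D2 i (j + 1 + 1) v"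
    using col[OF A1.M.a_closed[OF z d]] by auto
  have mq: "\<ominus>\<^bsub>A (i + 1, j + 1)\<^esub> q \<in> carrier (A (i + 1, j + 1))" using pq(2) by simp
  have "z = D1 (i + 1) (j + 1) (\<ominus>\<^bsub>A (i + 1, j + 1)\<^esub> q) \<oplus>\<^bsub>A (i, j + 1)\<^esub> D2 i (j + 1 + 1) v"
    unfolding v(2)[symmetric] module_hom_minus[OF D1_up A_module A_module pq(2)]
    using z d by (simp add: A1.M.a_lcomm[of _ z] A1.M.l_neg)
  then show ?thesis using mq v(1) by blast
qed

end

section \<open>Operations on complexes\<close>

lemma trunc1_Md: "1 \<le> q \<Longrightarrow> Md (trunc1 C) q = Md C q"
  "q < 1 \<Longrightarrow> Md (trunc1 C) q = zero_submodule (Md C q)"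
  by (simp_all add: trunc1_def)

lemma trunc1_bd: "1 < q \<Longrightarrow> bd (trunc1 C) q = bd C q"
  "q \<le> 1 \<Longrightarrow> bd (trunc1 C) q = (\<lambda>_. \<zero>\<^bsub>Md C (q - 1)\<^esub>)"
  by (simp_all add: trunc1_def)

lemma trunc1_zero: "\<zero>\<^bsub>Md (trunc1 C) q\<^esub> = \<zero>\<^bsub>Md C q\<^esub>"
  by (simp add: trunc1_def)

lemma trunc1_trivial: "q < 1 \<Longrightarrow> carrier (Md (trunc1 C) q) = {\<zero>\<^bsub>Md (trunc1 C) q\<^esub>}"
  by (simp add: trunc1_def)

lemma trunc1_chain_complex:
  assumes C: "chain_complex R C"
  shows "chain_complex R (trunc1 C)"
proof -
  note Cm = chain_complex_module[OF C]
  have m: "module R (Md (trunc1 C) q)" for q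
    using Cm module_restrict[OF Cm submodule_zero_singleton[OF Cm]] by (simp add: trunc1_def)
  have h: "bd (trunc1 C) q \<in> module_hom R (Md (trunc1 C) q) (Md (trunc1 C) (q - 1))" for q
  proof (cases "1 < q")
    case True
    then show ?thesis using chain_complex_hom[OF C, of q] by (simp add: trunc1_Md trunc1_bd)
  next
    case False
    then show ?thesis using module_hom_const_zero[OF m[of "q - 1"], of "Md (trunc1 C) q"] by (simp add: trunc1_bd trunc1_zero)
  qed
  have "bd (trunc1 C) (q - 1) (bd (trunc1 C) q x) = \<zero>\<^bsub>Md (trunc1 C) (q - 2)\<^esub>" if "x \<in> carrier (Md (trunc1 C) q)" for q x
  proof (cases "1 < q - 1")
    case True
    then show ?thesis using chain_complex_bd_bd[OF C, of x q] that by (simp add: trunc1_Md trunc1_bd)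
  next
    case False
    then show ?thesis by (simp add: trunc1_bd trunc1_zero)
  qed
  then show ?thesis using m h by (simp add: chain_complex_def)
qed

lemma trunc1_free:
  assumes "\<And>q. free_module R (Md C q)"
  shows "free_module R (Md (trunc1 C) q)"
proof (cases "1 \<le> q")
  case True
  then show ?thesis using assms by (simp add: trunc1_Md)
next
  case False
  have M: "module R (Md C q)" using assms by (simp add: free_module_def)
  show ?thesis using False
    by (auto simp: trunc1_Md intro!: free_module_trivial module_restrict[OF M submodule_zero_singleton[OF M]])
qed

text \<open>Truncating an exact complex destroys exactness in degree one only, where the truncation has the
  cokernel of \<open>C\<^sub>2 \<rightarrow> C\<^sub>1\<close> as homology.\<close>

lemma trunc1_exact:
  assumes "2 \<le> q" "cycles C q = boundaries C q"
  shows "cycles (trunc1 C) q = boundaries (trunc1 C) q"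
  using assms by (simp add: cycles_def boundaries_def trunc1_Md trunc1_bd)

lemma shift_chain_complex:
  assumes C: "chain_complex R C"
  shows "chain_complex R (shift l C)"
proof -
  note Cm = chain_complex_module[OF C]
  have h: "bd C (i - l) \<in> module_hom R (Md C (i - l)) (Md C (i - l - 1))" for i
    by (rule chain_complex_hom[OF C])
  have e: "i - 1 - l = i - l - 1" "i - 2 - l = i - l - 2" for i by simp_all
  show ?thesis unfolding chain_complex_def shift_def cplx.simps e
  proof (intro allI conjI ballI)
    fix i
    show "module R (Md C (i - l))" by (rule Cm)
    show "(\<lambda>x. sign_smult (Md C (i - l - 1)) l (bd C (i - l) x)) \<in> module_hom R (Md C (i - l)) (Md C (i - l - 1))"
      by (rule module_hom_sign[OF h Cm])
    fix x assume x: "x \<in> carrier (Md C (i - l))"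
    have h2: "bd C (i - l - 1) \<in> module_hom R (Md C (i - l - 1)) (Md C (i - l - 1 - 1))" by (rule chain_complex_hom[OF C])
    have "bd C (i - l - 1) (sign_smult (Md C (i - l - 1)) l (bd C (i - l) x)) = \<zero>\<^bsub>Md C (i - l - 2)\<^esub>"
      using module_hom_sign_smult[OF h2 Cm Cm module_hom_closed[OF h x], of l] chain_complex_bd_bd[OF C x]
        sign_smult_zero[OF Cm, of "i - l - 2" l] by simp
    then show "sign_smult (Md C (i - l - 1 - 1)) l (bd C (i - l - 1) (sign_smult (Md C (i - l - 1)) l (bd C (i - l) x)))
       = \<zero>\<^bsub>Md C (i - l - 2)\<^esub>"
      using sign_smult_zero[OF Cm, of "i - l - 2" l] by simp
  qed
qed

lemma dsum_cplx_chain_complex: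
  assumes C: "chain_complex R C" and D: "chain_complex R D"
  shows "chain_complex R (dsum_cplx C D)"
  unfolding chain_complex_def dsum_cplx_def cplx.simps
proof (intro allI conjI ballI)
  note Cm = chain_complex_module[OF C] and Dm = chain_complex_module[OF D]
  note Ch = chain_complex_hom[OF C] and Dh = chain_complex_hom[OF D]
  fix n
  show "module R (prod_module (Md C n) (Md D n))" by (rule module_prod[OF Cm Dm])
  show "(\<lambda>(x, y). (bd C n x, bd D n y)) \<in> module_hom R (prod_module (Md C n) (Md D n)) (prod_module (Md C (n - 1)) (Md D (n - 1)))"
    by (rule module_homI) (auto simp: module_hom_closed[OF Ch] module_hom_closed[OF Dh] module_hom_add[OF Ch] module_hom_add[OF Dh]
        module_hom_smult[OF Ch] module_hom_smult[OF Dh])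
  fix z assume "z \<in> carrier (prod_module (Md C n) (Md D n))"
  then show "(\<lambda>(x, y). (bd C (n - 1) x, bd D (n - 1) y)) ((\<lambda>(x, y). (bd C n x, bd D n y)) z)
      = \<zero>\<^bsub>prod_module (Md C (n - 2)) (Md D (n - 2))\<^esub>"
    by (auto simp: chain_complex_bd_bd[OF C] chain_complex_bd_bd[OF D])
qed

lemma chain_map_hom: "chain_map R C D f \<Longrightarrow> f n \<in> module_hom R (Md C n) (Md D n)"
  by (simp add: chain_map_def)

lemma chain_map_comm: "chain_map R C D f \<Longrightarrow> x \<in> carrier (Md C n) \<Longrightarrow> bd D n (f n x) = f (n - 1) (bd C n x)"
  by (simp add: chain_map_def)

context
  fixes R :: "('a, 'r) ring_scheme" and C :: "('a, 'm) cplx" and D :: "('a, 'n) cplx"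
    and f :: "int \<Rightarrow> 'm \<Rightarrow> 'n"
  assumes C: "chain_complex R C" and D: "chain_complex R D" and f: "chain_map R C D f"
begin

lemma mapping_cone_bd:
  "bd (mapping_cone C D f) n (d, c) =
     (bd D n d \<oplus>\<^bsub>Md D (n - 1)\<^esub> f (n - 1) c, \<ominus>\<^bsub>Md C (n - 2)\<^esub> bd C (n - 1) c)"
  by (simp add: mapping_cone_def)

lemma mapping_cone_chain_complex: "chain_complex R (mapping_cone C D f)"
  unfolding chain_complex_def
proof (intro allI conjI ballI)
  note Cm = chain_complex_module[OF C] and Dm = chain_complex_module[OF D]
  note Ch = chain_complex_hom[OF C] and Dh = chain_complex_hom[OF D] and fh = chain_map_hom[OF f]
  fix n
  have Ch': "bd C (n - 1) \<in> module_hom R (Md C (n - 1)) (Md C (n - 2))" for n using Ch[of "n - 1"] by simp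
  have md: "Md (mapping_cone C D f) n = prod_module (Md D n) (Md C (n - 1))" for n
    by (simp add: mapping_cone_def)
  show "module R (Md (mapping_cone C D f) n)" unfolding md by (rule module_prod[OF Dm Cm])
  interpret D1: module R "Md D (n - 1)" by (rule Dm)
  interpret C2: module R "Md C (n - 2)" by (rule Cm)
  have h1: "(\<lambda>p. bd D n (fst p) \<oplus>\<^bsub>Md D (n - 1)\<^esub> f (n - 1) (snd p)) \<in> module_hom R (prod_module (Md D n) (Md C (n - 1))) (Md D (n - 1))"
  proof (rule module_hom_plus[OF module_hom_comp[OF _ Dh] module_hom_comp[OF _ fh] Dm])
    show "fst \<in> module_hom R (prod_module (Md D n) (Md C (n - 1))) (Md D n)" by (rule module_homI) auto
    show "snd \<in> module_hom R (prod_module (Md D n) (Md C (n - 1))) (Md C (n - 1))" by (rule module_homI) auto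
  qed
  have h2: "(\<lambda>p. \<ominus>\<^bsub>Md C (n - 2)\<^esub> bd C (n - 1) (snd p)) \<in> module_hom R (prod_module (Md D n) (Md C (n - 1))) (Md C (n - 2))"
  proof (rule module_hom_uminus[OF module_hom_comp[OF _ Ch'] Cm])
    show "snd \<in> module_hom R (prod_module (Md D n) (Md C (n - 1))) (Md C (n - 1))" by (rule module_homI) auto
  qed
  show "bd (mapping_cone C D f) n \<in> module_hom R (Md (mapping_cone C D f) n) (Md (mapping_cone C D f) (n - 1))"
    unfolding md
  proof (rule module_homI)
    fix x assume x: "x \<in> carrier (prod_module (Md D n) (Md C (n - 1)))"
    then show "bd (mapping_cone C D f) n x \<in> carrier (prod_module (Md D (n - 1)) (Md C (n - 1 - 1)))"
      using module_hom_closed[OF h1 x] module_hom_closed[OF h2 x] by (cases x) (simp add: mapping_cone_bd)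
    { fix y assume y: "y \<in> carrier (prod_module (Md D n) (Md C (n - 1)))"
      then show "bd (mapping_cone C D f) n (x \<oplus>\<^bsub>prod_module (Md D n) (Md C (n - 1))\<^esub> y) =
          bd (mapping_cone C D f) n x \<oplus>\<^bsub>prod_module (Md D (n - 1)) (Md C (n - 1 - 1))\<^esub> bd (mapping_cone C D f) n y"
        using module_hom_add[OF h1 x y] module_hom_add[OF h2 x y] by (cases x; cases y) (simp add: mapping_cone_bd) }
    fix r assume "r \<in> carrier R"
    then show "bd (mapping_cone C D f) n (r \<odot>\<^bsub>prod_module (Md D n) (Md C (n - 1))\<^esub> x) =
        r \<odot>\<^bsub>prod_module (Md D (n - 1)) (Md C (n - 1 - 1))\<^esub> bd (mapping_cone C D f) n x"
      using module_hom_smult[OF h1 _ x] module_hom_smult[OF h2 _ x] by (cases x) (simp add: mapping_cone_bd)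
  qed
  fix x assume "x \<in> carrier (Md (mapping_cone C D f) n)"
  then obtain d c where x: "x = (d, c)" "d \<in> carrier (Md D n)" "c \<in> carrier (Md C (n - 1))" by (auto simp: md)
  interpret D2: module R "Md D (n - 2)" by (rule Dm)
  have Dh2: "bd D (n - 1) \<in> module_hom R (Md D (n - 1)) (Md D (n - 2))" using Dh[of "n - 1"] by simp
  have Ch2: "bd C (n - 2) \<in> module_hom R (Md C (n - 2)) (Md C (n - 3))" using Ch[of "n - 2"] by simp
  have bc: "bd C (n - 1) c \<in> carrier (Md C (n - 2))" by (rule module_hom_closed[OF Ch' x(3)])
  have bd1: "bd D n d \<in> carrier (Md D (n - 1))" by (rule module_hom_closed[OF Dh x(2)])
  have fc: "f (n - 1) c \<in> carrier (Md D (n - 1))" by (rule module_hom_closed[OF fh x(3)])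
  have fbc: "f (n - 2) (bd C (n - 1) c) \<in> carrier (Md D (n - 2))" by (rule module_hom_closed[OF fh bc])
  have 1: "bd D (n - 1) (bd D n d \<oplus>\<^bsub>Md D (n - 1)\<^esub> f (n - 1) c) = f (n - 2) (bd C (n - 1) c)"
    using module_hom_add[OF Dh2 bd1 fc] chain_complex_bd_bd[OF D x(2)] chain_map_comm[OF f x(3)] fbc by simp
  have 2: "f (n - 2) (\<ominus>\<^bsub>Md C (n - 2)\<^esub> bd C (n - 1) c) = \<ominus>\<^bsub>Md D (n - 2)\<^esub> f (n - 2) (bd C (n - 1) c)"
    by (rule module_hom_minus[OF fh Cm Dm bc])
  have 3: "bd C (n - 2) (\<ominus>\<^bsub>Md C (n - 2)\<^esub> bd C (n - 1) c) = \<zero>\<^bsub>Md C (n - 3)\<^esub>"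
    using module_hom_minus[OF Ch2 Cm Cm bc] chain_complex_bd_bd[OF C x(3)] module_minus_zero[OF Cm, of "n - 3"] by simp
  have "bd (mapping_cone C D f) (n - 1) (bd (mapping_cone C D f) n x) =
     (bd D (n - 1) (bd D n d \<oplus>\<^bsub>Md D (n - 1)\<^esub> f (n - 1) c) \<oplus>\<^bsub>Md D (n - 2)\<^esub> f (n - 2) (\<ominus>\<^bsub>Md C (n - 2)\<^esub> bd C (n - 1) c),
      \<ominus>\<^bsub>Md C (n - 3)\<^esub> bd C (n - 2) (\<ominus>\<^bsub>Md C (n - 2)\<^esub> bd C (n - 1) c))"
    using mapping_cone_bd[of "n - 1"] by (simp add: x(1) mapping_cone_bd)
  then show "bd (mapping_cone C D f) (n - 1) (bd (mapping_cone C D f) n x) = \<zero>\<^bsub>Md (mapping_cone C D f) (n - 2)\<^esub>"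
    unfolding 1 2 3 md using D2.M.r_neg[OF fbc] module_minus_zero[OF Cm, of "n - 3"] by simp
qed

text \<open>The second hypothesis says that \<open>f\<close> is injective on homology in degree \<open>n - 1\<close>; together with the
  vanishing of the homology of \<open>D\<close> in degree \<open>n\<close> this is what the long exact sequence of the cone
  requires.\<close>

lemma mapping_cone_exact:
  assumes ex: "cycles D n = boundaries D n"
    and src: "\<And>d c. d \<in> carrier (Md D n) \<Longrightarrow> c \<in> cycles C (n - 1) \<Longrightarrow>
      bd D n d \<oplus>\<^bsub>Md D (n - 1)\<^esub> f (n - 1) c = \<zero>\<^bsub>Md D (n - 1)\<^esub> \<Longrightarrow> c \<in> boundaries C (n - 1)"
  shows "cycles (mapping_cone C D f) n = boundaries (mapping_cone C D f) n"
proof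
  note K = mapping_cone_chain_complex
  show "boundaries (mapping_cone C D f) n \<subseteq> cycles (mapping_cone C D f) n"
    using module_hom_closed[OF chain_complex_hom_up[OF K, of n]] chain_complex_bd_bd[OF K, of _ "n + 1"]
    by (auto simp: boundaries_def cycles_def)
  note Cm = chain_complex_module[OF C] and Dm = chain_complex_module[OF D]
  note Ch = chain_complex_hom[OF C] and Dh = chain_complex_hom[OF D] and fh = chain_map_hom[OF f]
  have md: "Md (mapping_cone C D f) n = prod_module (Md D n) (Md C (n - 1))" for n
    by (simp add: mapping_cone_def)
  interpret D0: module R "Md D n" by (rule Dm)
  interpret D1: module R "Md D (n - 1)" by (rule Dm)
  have Cup: "bd C n \<in> module_hom R (Md C n) (Md C (n - 1))" by (rule Ch)
  have C1h: "bd C (n - 1) \<in> module_hom R (Md C (n - 1)) (Md C (n - 2))" using Ch[of "n - 1"] by simp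
  show "cycles (mapping_cone C D f) n \<subseteq> boundaries (mapping_cone C D f) n"
  proof
    fix x assume xc: "x \<in> cycles (mapping_cone C D f) n"
    then obtain d c where x: "x = (d, c)" "d \<in> carrier (Md D n)" "c \<in> carrier (Md C (n - 1))"
      by (auto simp: md cycles_def)
    have bc: "bd C (n - 1) c \<in> carrier (Md C (n - 2))" by (rule module_hom_closed[OF C1h x(3)])
    interpret C2: module R "Md C (n - 2)" by (rule Cm)
    have eq: "bd D n d \<oplus>\<^bsub>Md D (n - 1)\<^esub> f (n - 1) c = \<zero>\<^bsub>Md D (n - 1)\<^esub>"
      and "\<ominus>\<^bsub>Md C (n - 2)\<^esub> bd C (n - 1) c = \<zero>\<^bsub>Md C (n - 2)\<^esub>"
      using xc by (simp_all add: cycles_def x(1) mapping_cone_bd md)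
    then have "bd C (n - 1) c = \<zero>\<^bsub>Md C (n - 2)\<^esub>"
      using bc C2.M.minus_minus[OF bc] module_minus_zero[OF Cm, of "n - 2"] by simp
    then have "c \<in> cycles C (n - 1)" using x(3) by (simp add: cycles_def)
    from src[OF x(2) this eq] obtain b where b: "b \<in> carrier (Md C n)" "c = bd C n b"
      by (auto simp: boundaries_def)
    let ?b = "\<ominus>\<^bsub>Md C n\<^esub> b"
    have mb: "?b \<in> carrier (Md C n)"
      using b(1) abelian_group.a_inv_closed[OF module_abelian_group[OF Cm]] by auto
    have fb: "f n b \<in> carrier (Md D n)" by (rule module_hom_closed[OF fh b(1)])
    have fmb: "f n ?b = \<ominus>\<^bsub>Md D n\<^esub> f n b" by (rule module_hom_minus[OF fh Cm Dm b(1)])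
    let ?d = "d \<oplus>\<^bsub>Md D n\<^esub> f n b"
    have "bd D n ?d = bd D n d \<oplus>\<^bsub>Md D (n - 1)\<^esub> f (n - 1) c"
      using module_hom_add[OF Dh x(2) fb] chain_map_comm[OF f b(1)] b(2) by simp
    then have "?d \<in> cycles D n" using x(2) fb eq by (simp add: cycles_def)
    then obtain e where e: "e \<in> carrier (Md D (n + 1))" "?d = bd D (n + 1) e"
      using ex by (auto simp: boundaries_def)
    have "bd (mapping_cone C D f) (n + 1) (e, ?b) = (?d \<oplus>\<^bsub>Md D n\<^esub> f n ?b, \<ominus>\<^bsub>Md C (n - 1)\<^esub> bd C n ?b)"
      using mapping_cone_bd[of "n + 1" e ?b] e(2) by simp
    also have "?d \<oplus>\<^bsub>Md D n\<^esub> f n ?b = d"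
      unfolding fmb using x(2) fb by (simp add: D0.M.a_assoc D0.M.r_neg)
    also have "\<ominus>\<^bsub>Md C (n - 1)\<^esub> bd C n ?b = c"
      using module_hom_minus[OF Cup Cm Cm b(1)] b(2) x(3)
        abelian_group.minus_minus[OF module_abelian_group[OF Cm]] by simp
    finally have "x = bd (mapping_cone C D f) (n + 1) (e, ?b)" using x(1) by simp
    moreover have "(e, ?b) \<in> carrier (Md (mapping_cone C D f) (n + 1))" using e(1) mb by (simp add: md)
    ultimately show "x \<in> boundaries (mapping_cone C D f) n" unfolding boundaries_def by blast
  qed
qed

end

section \<open>The tensor product of chain maps\<close>

lemma dsum_map_hom:
  assumes "\<And>k. module R (M k)" "\<And>k. module R (N k)" "\<And>k. h k \<in> module_hom R (M k) (N k)"
  shows "(\<lambda>u k. h k (u k)) \<in> module_hom R (dsum_module K M) (dsum_module K N)"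
proof (rule module_homI)
  fix u assume u: "u \<in> carrier (dsum_module K M)"
  have z: "h k \<zero>\<^bsub>M k\<^esub> = \<zero>\<^bsub>N k\<^esub>" for k by (rule module_hom_zero[OF assms(3,1,2)])
  have "{k. h k (u k) \<noteq> \<zero>\<^bsub>N k\<^esub>} \<subseteq> {k. u k \<noteq> \<zero>\<^bsub>M k\<^esub>}" using z by auto
  then have "finite {k. h k (u k) \<noteq> \<zero>\<^bsub>N k\<^esub>}" using dsum_support(1)[OF u] by (rule finite_subset)
  then show "(\<lambda>k. h k (u k)) \<in> carrier (dsum_module K N)"
    using module_hom_closed[OF assms(3) dsum_closed[OF u]] dsum_outside[OF u] z by (auto simp: dsum_carrier_iff)
  show "(\<lambda>k. h k ((r \<odot>\<^bsub>dsum_module K M\<^esub> u) k)) = r \<odot>\<^bsub>dsum_module K N\<^esub> (\<lambda>k. h k (u k))" if "r \<in> carrier R" for r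
    using that by (simp add: fun_eq_iff module_hom_smult[OF assms(3)] dsum_closed[OF u])
  show "(\<lambda>k. h k ((u \<oplus>\<^bsub>dsum_module K M\<^esub> v) k)) = (\<lambda>k. h k (u k)) \<oplus>\<^bsub>dsum_module K N\<^esub> (\<lambda>k. h k (v k))"
    if "v \<in> carrier (dsum_module K M)" for v
    using dsum_closed[OF that] by (simp add: fun_eq_iff module_hom_add[OF assms(3)] dsum_closed[OF u])
qed

lemma dsum_module_restrict:
  assumes "K' \<subseteq> K" "\<And>k. k \<in> K \<Longrightarrow> k \<notin> K' \<Longrightarrow> carrier (M k) = {\<zero>\<^bsub>M k\<^esub>}"
  shows "dsum_module K M = dsum_module K' M"
proof -
  have "(\<forall>k. k \<notin> K \<longrightarrow> f k = \<zero>\<^bsub>M k\<^esub>) \<longleftrightarrow> (\<forall>k. k \<notin> K' \<longrightarrow> f k = \<zero>\<^bsub>M k\<^esub>)" if "\<forall>k. f k \<in> carrier (M k)" for f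
    using assms that by blast
  then have "carrier (dsum_module K M) = carrier (dsum_module K' M)"
    by (auto simp: dsum_carrier_iff)
  then show ?thesis by (simp add: dsum_module_def)
qed

definition tensor_chain_map ::
  "('a, 'r) ring_scheme \<Rightarrow> ('a, 'x) cplx \<Rightarrow> ('a, 'y) cplx \<Rightarrow> (int \<Rightarrow> 'p \<Rightarrow> 'x) \<Rightarrow> (int \<Rightarrow> 'q \<Rightarrow> 'y)
    \<Rightarrow> ('p, 'q) bitensor \<Rightarrow> ('x, 'y) bitensor" where
  "tensor_chain_map R X Y p q u = (\<lambda>k. tensor_map R (Md X (fst k)) (Md Y (snd k)) (p (fst k)) (q (snd k)) (u k))"

context
  fixes R :: "('a, 'r) ring_scheme" and P :: "('a, 'p) cplx" and Q :: "('a, 'q) cplx"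
    and X :: "('a, 'x) cplx" and Y :: "('a, 'y) cplx" and p :: "int \<Rightarrow> 'p \<Rightarrow> 'x" and q :: "int \<Rightarrow> 'q \<Rightarrow> 'y"
  assumes P: "chain_complex R P" and Q: "chain_complex R Q" and X: "chain_complex R X" and Y: "chain_complex R Y"
    and p: "chain_map R P X p" and q: "chain_map R Q Y q"
begin

interpretation PQ: double_complex R "bigraded_tensor R P Q" "tensor_D1 R P Q" "tensor_D2 R P Q"
  by (rule tensor_double_complex[OF P Q])
interpretation XY: double_complex R "bigraded_tensor R X Y" "tensor_D1 R X Y" "tensor_D2 R X Y"
  by (rule tensor_double_complex[OF X Y])

lemmas tcm_modules = chain_complex_module[OF P] chain_complex_module[OF Q]
  chain_complex_module[OF X] chain_complex_module[OF Y]

lemma tensor_component_hom: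
  "tensor_map R (Md X i) (Md Y j) (p i) (q j) \<in> module_hom R (tensor_module R (Md P i) (Md Q j)) (tensor_module R (Md X i) (Md Y j))"
  by (rule tensor_map_hom[OF tcm_modules chain_map_hom[OF p] chain_map_hom[OF q]])

lemma tensor_chain_map_hom:
  "tensor_chain_map R X Y p q \<in> module_hom R (dsum_module K (bigraded_tensor R P Q)) (dsum_module K (bigraded_tensor R X Y))"
proof -
  have "tensor_map R (Md X (fst k)) (Md Y (snd k)) (p (fst k)) (q (snd k))
    \<in> module_hom R (bigraded_tensor R P Q k) (bigraded_tensor R X Y k)" for k
    using tensor_component_hom by (cases k) simp
  from dsum_map_hom[of R "bigraded_tensor R P Q" "bigraded_tensor R X Y", OF PQ.A_module XY.A_module this]
  show ?thesis by (simp add: tensor_chain_map_def[abs_def])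
qed

lemma tensor_chain_map_homog:
  assumes "x \<in> carrier (Md P i)" "y \<in> carrier (Md Q j)"
  shows "tensor_chain_map R X Y p q (homog_tensor R P Q (i, j) x y) = homog_tensor R X Y (i, j) (p i x) (q j y)"
proof
  fix k
  show "tensor_chain_map R X Y p q (homog_tensor R P Q (i, j) x y) k = homog_tensor R X Y (i, j) (p i x) (q j y) k"
  proof (cases "k = (i, j)")
    case True
    then show ?thesis
      by (simp add: tensor_chain_map_def homog_tensor_def
          tensor_map_pure[OF tcm_modules chain_map_hom[OF p] chain_map_hom[OF q] assms])
  next
    case False
    obtain a b where k: "k = (a, b)" by (cases k)
    have z: "homog_tensor R P Q (i, j) x y (a, b) = \<zero>\<^bsub>tensor_module R (Md P a) (Md Q b)\<^esub>"
      using False by (auto simp: homog_tensor_def dsum_inj_def k)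
    have z': "homog_tensor R X Y (i, j) (p i x) (q j y) (a, b) = \<zero>\<^bsub>tensor_module R (Md X a) (Md Y b)\<^esub>"
      using False by (auto simp: homog_tensor_def dsum_inj_def k)
    show ?thesis unfolding k tensor_chain_map_def fst_conv snd_conv z z'
      by (rule module_hom_zero[OF tensor_component_hom module_tensor[OF tcm_modules(1,2)] module_tensor[OF tcm_modules(3,4)]])
  qed
qed

lemma tensor_chain_map_tot:
  assumes u: "u \<in> carrier (PQ.Tot n)"
  shows "XY.tot (tensor_chain_map R X Y p q u) = tensor_chain_map R X Y p q (PQ.tot u)"
proof
  fix k :: "int \<times> int" obtain i j where k: "k = (i, j)" by (cases k)
  note pm = chain_map_hom[OF p] and qm = chain_map_hom[OF q]
  note T = module_tensor[OF tcm_modules(1,2)] and T' = module_tensor[OF tcm_modules(3,4)]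
  have uc: "u (a, b) \<in> carrier (tensor_module R (Md P a) (Md Q b))" for a b
    using dsum_closed[OF u, of "(a, b)"] by simp
  have 1: "tensor_D1 R X Y (i + 1) j (tensor_map R (Md X (i + 1)) (Md Y j) (p (i + 1)) (q j) t) =
      tensor_map R (Md X i) (Md Y j) (p i) (q j) (tensor_D1 R P Q (i + 1) j t)"
    if t: "t \<in> carrier (tensor_module R (Md P (i + 1)) (Md Q j))" for t
  proof -
    have "tensor_D1 R X Y (i + 1) j (tensor_map R (Md X (i + 1)) (Md Y j) (p (i + 1)) (q j) t) =
        tensor_map R (Md X i) (Md Y j) (\<lambda>x. bd X (i + 1) (p (i + 1) x)) (\<lambda>y. q j y) t"
      using tensor_map_comp[OF tcm_modules tcm_modules(3,4) pm qm chain_complex_hom_up[OF X] module_hom_id t]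
      by (simp add: tensor_D1_def)
    also have "\<dots> = tensor_map R (Md X i) (Md Y j) (\<lambda>x. p i (bd P (i + 1) x)) (\<lambda>y. q j y) t"
      by (rule tensor_map_cong[OF tcm_modules module_hom_comp[OF pm chain_complex_hom_up[OF X]] qm _ _ t])
        (use chain_map_comm[OF p, of _ "i + 1"] in auto)
    also have "\<dots> = tensor_map R (Md X i) (Md Y j) (p i) (q j) (tensor_D1 R P Q (i + 1) j t)"
      using tensor_map_comp[OF tcm_modules(1,2) tcm_modules chain_complex_hom_up[OF P] module_hom_id pm qm t]
      by (simp add: tensor_D1_def)
    finally show ?thesis .
  qed
  have 2: "tensor_D2 R X Y i (j + 1) (tensor_map R (Md X i) (Md Y (j + 1)) (p i) (q (j + 1)) t) =
      tensor_map R (Md X i) (Md Y j) (p i) (q j) (tensor_D2 R P Q i (j + 1) t)"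
    if t: "t \<in> carrier (tensor_module R (Md P i) (Md Q (j + 1)))" for t
  proof -
    have vt: "tensor_map R (Md P i) (Md Q j) (\<lambda>x. x) (bd Q (j + 1)) t \<in> carrier (tensor_module R (Md P i) (Md Q j))"
      using module_hom_closed[OF tensor_vertical_hom[OF P Q, of i "j + 1"] t] by simp
    have "tensor_map R (Md X i) (Md Y j) (\<lambda>x. x) (bd Y (j + 1)) (tensor_map R (Md X i) (Md Y (j + 1)) (p i) (q (j + 1)) t) =
        tensor_map R (Md X i) (Md Y j) (\<lambda>x. p i x) (\<lambda>y. bd Y (j + 1) (q (j + 1) y)) t"
      using tensor_map_comp[OF tcm_modules tcm_modules(3,4) pm qm module_hom_id chain_complex_hom_up[OF Y] t] by simp
    also have "\<dots> = tensor_map R (Md X i) (Md Y j) (\<lambda>x. p i x) (\<lambda>y. q j (bd Q (j + 1) y)) t"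
      by (rule tensor_map_cong[OF tcm_modules pm module_hom_comp[OF qm chain_complex_hom_up[OF Y]] _ _ t])
        (use chain_map_comm[OF q, of _ "j + 1"] in auto)
    also have "\<dots> = tensor_map R (Md X i) (Md Y j) (p i) (q j) (tensor_map R (Md P i) (Md Q j) (\<lambda>x. x) (bd Q (j + 1)) t)"
      using tensor_map_comp[OF tcm_modules(1,2) tcm_modules module_hom_id chain_complex_hom_up[OF Q] pm qm t] by simp
    finally show ?thesis
      using module_hom_sign_smult[OF tensor_component_hom T T' vt, of i] by (simp add: tensor_D2_def)
  qed
  have c1: "tensor_D1 R P Q (i + 1) j (u (i + 1, j)) \<in> carrier (tensor_module R (Md P i) (Md Q j))"
    using module_hom_closed[OF tensor_D1_hom[OF P Q] uc, of "i + 1" j] by simp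
  have c2: "tensor_D2 R P Q i (j + 1) (u (i, j + 1)) \<in> carrier (tensor_module R (Md P i) (Md Q j))"
    using module_hom_closed[OF tensor_D2_hom[OF P Q] uc, of i "j + 1"] by simp
  show "XY.tot (tensor_chain_map R X Y p q u) k = tensor_chain_map R X Y p q (PQ.tot u) k"
    using 1[OF uc] 2[OF uc] module_hom_add[OF tensor_component_hom c1 c2]
    by (simp add: k XY.tot_apply PQ.tot_apply tensor_chain_map_def)
qed

end

text \<open>A map into a truncated complex has to vanish in the degrees that are cut off, where only the zero
  element is left.\<close>

definition trunc1_map :: "('a, 'x) cplx \<Rightarrow> (int \<Rightarrow> 'p \<Rightarrow> 'x) \<Rightarrow> int \<Rightarrow> 'p \<Rightarrow> 'x" where
  "trunc1_map X p i = (if 1 \<le> i then p i else (\<lambda>_. \<zero>\<^bsub>Md X i\<^esub>))"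

lemma trunc1_map_zero_hom:
  assumes "chain_complex R X" "q < 1"
  shows "(\<lambda>_. \<zero>\<^bsub>Md X q\<^esub>) \<in> module_hom R M (Md (trunc1 X) q)"
  using module_hom_const_zero[OF chain_complex_module[OF trunc1_chain_complex[OF assms(1)], of q]] by (simp add: trunc1_zero)

lemma trunc1_chain_map:
  assumes P: "chain_complex R P" and X: "chain_complex R X" and p: "chain_map R P X p"
  shows "chain_map R (trunc1 P) (trunc1 X) (trunc1_map X p)"
  unfolding chain_map_def
proof (intro allI conjI ballI)
  fix n
  note pm = chain_map_hom[OF p]
  note Pm = chain_complex_module[OF P] and Xm = chain_complex_module[OF X]
  show "trunc1_map X p n \<in> module_hom R (Md (trunc1 P) n) (Md (trunc1 X) n)"
    using pm[of n] trunc1_map_zero_hom[OF X, of n] by (cases "n < 1") (simp_all add: trunc1_map_def trunc1_Md)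
  fix x assume x: "x \<in> carrier (Md (trunc1 P) n)"
  show "bd (trunc1 X) n (trunc1_map X p n x) = trunc1_map X p (n - 1) (bd (trunc1 P) n x)"
  proof (cases "1 < n")
    case True
    then show ?thesis using x chain_map_comm[OF p, of x n] by (simp add: trunc1_map_def trunc1_Md trunc1_bd)
  next
    case False
    then show ?thesis by (simp add: trunc1_map_def trunc1_bd)
  qed
qed

text \<open>The truncation is a quotient complex, and this is the projection onto it.\<close>

lemma truncation_chain_map:
  assumes X: "chain_complex R X"
  shows "chain_map R X (trunc1 X) (trunc1_map X (\<lambda>_ x. x))"
  unfolding chain_map_def
proof (intro allI conjI ballI)
  fix n
  show "trunc1_map X (\<lambda>_ x. x) n \<in> module_hom R (Md X n) (Md (trunc1 X) n)"
    using trunc1_map_zero_hom[OF X, of n] module_hom_id by (cases "n < 1") (simp_all add: trunc1_map_def trunc1_Md)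
  show "bd (trunc1 X) n (trunc1_map X (\<lambda>_ x. x) n x) = trunc1_map X (\<lambda>_ x. x) (n - 1) (bd X n x)" for x
    by (cases "1 < n") (simp_all add: trunc1_map_def trunc1_bd)
qed

section \<open>The star product and its chain maps\<close>

text \<open>The maps \<open>e1\<close> and \<open>e2\<close> are the identifications in degree zero that occur in the definitions of
  the comparison maps; they agree with \<open>\<phi>\<close> and \<open>\<psi>\<close> there, but only on the carriers.\<close>

locale star_setup =
  fixes R :: "('a, 'r) ring_scheme" and X :: "('a, 'x) cplx" and Y :: "('a, 'y) cplx"
    and S :: "('a, 's) cplx" and T :: "('a, 't) cplx"
    and \<phi> :: "int \<Rightarrow> 's \<Rightarrow> 'x" and \<psi> :: "int \<Rightarrow> 't \<Rightarrow> 'y"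
    and e1 :: "'s \<Rightarrow> 'x" and e2 :: "'t \<Rightarrow> 'y"
  assumes X: "chain_complex R X" and Y: "chain_complex R Y"
    and S: "chain_complex R S" and T: "chain_complex R T"
    and \<phi>: "chain_map R S X \<phi>" and \<psi>: "chain_map R T Y \<psi>"
    and e1: "\<And>a. a \<in> carrier (Md S 0) \<Longrightarrow> e1 a = \<phi> 0 a"
    and e2: "\<And>a. a \<in> carrier (Md T 0) \<Longrightarrow> e2 a = \<psi> 0 a"
    and X_neg: "\<And>n. n < 0 \<Longrightarrow> carrier (Md X n) = {\<zero>\<^bsub>Md X n\<^esub>}"
    and Y_neg: "\<And>n. n < 0 \<Longrightarrow> carrier (Md Y n) = {\<zero>\<^bsub>Md Y n\<^esub>}"
begin

lemmas tX = trunc1_chain_complex[OF X] and tY = trunc1_chain_complex[OF Y]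
  and tS = trunc1_chain_complex[OF S] and tT = trunc1_chain_complex[OF T]
lemmas Xm = chain_complex_module[OF X] and Ym = chain_complex_module[OF Y]
  and Sm = chain_complex_module[OF S] and Tm = chain_complex_module[OF T]
lemmas tXm = chain_complex_module[OF tX] and tYm = chain_complex_module[OF tY]
  and tSm = chain_complex_module[OF tS] and tTm = chain_complex_module[OF tT]

sublocale XY: double_complex R "bigraded_tensor R (trunc1 X) (trunc1 Y)"
    "tensor_D1 R (trunc1 X) (trunc1 Y)" "tensor_D2 R (trunc1 X) (trunc1 Y)"
  by (rule tensor_double_complex[OF tX tY])
sublocale SY: double_complex R "bigraded_tensor R (trunc1 S) Y" "tensor_D1 R (trunc1 S) Y" "tensor_D2 R (trunc1 S) Y"
  by (rule tensor_double_complex[OF tS Y])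
sublocale XT: double_complex R "bigraded_tensor R X (trunc1 T)" "tensor_D1 R X (trunc1 T)" "tensor_D2 R X (trunc1 T)"
  by (rule tensor_double_complex[OF X tT])

abbreviation B where "B \<equiv> bigraded_tensor R X Y"

lemma B_module: "module R (B k)" by (rule bigraded_tensor_module[OF Xm Ym])

lemma XY_trivial: "i < 1 \<or> j < 1 \<Longrightarrow> carrier (bigraded_tensor R (trunc1 X) (trunc1 Y) (i, j)) = {\<zero>\<^bsub>bigraded_tensor R (trunc1 X) (trunc1 Y) (i, j)\<^esub>}"
  using tensor_trivial[OF tXm tYm] trunc1_trivial[of i X] trunc1_trivial[of j Y] by auto

lemma SY_trivial: "i < 1 \<or> j < 0 \<Longrightarrow> carrier (bigraded_tensor R (trunc1 S) Y (i, j)) = {\<zero>\<^bsub>bigraded_tensor R (trunc1 S) Y (i, j)\<^esub>}"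
  using tensor_trivial[OF tSm Ym] trunc1_trivial[of i S] Y_neg[of j] by auto

lemma XT_trivial: "i < 0 \<or> j < 1 \<Longrightarrow> carrier (bigraded_tensor R X (trunc1 T) (i, j)) = {\<zero>\<^bsub>bigraded_tensor R X (trunc1 T) (i, j)\<^esub>}"
  using tensor_trivial[OF Xm tTm] trunc1_trivial[of j T] X_neg[of i] by auto

lemma XY_Tot2: "XY.Tot 2 = dsum_module {(1, 1)} (bigraded_tensor R (trunc1 X) (trunc1 Y))"
proof (rule dsum_module_restrict, goal_cases)
  case (2 k)
  obtain i j where k: "k = (i, j)" by (cases k)
  then have "i < 1 \<or> j < 1" using 2 by auto
  then show ?case unfolding k by (rule XY_trivial)
qed auto

lemma SY_Tot: "SY.Tot n = dsum_module {(i, j). i + j = n \<and> 1 \<le> i \<and> 0 \<le> j} (bigraded_tensor R (trunc1 S) Y)"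
proof (rule dsum_module_restrict, goal_cases)
  case (2 k)
  obtain i j where k: "k = (i, j)" by (cases k)
  then have "i < 1 \<or> j < 0" using 2 by auto
  then show ?case unfolding k by (rule SY_trivial)
qed auto

lemma XT_Tot: "XT.Tot n = dsum_module {(i, j). i + j = n \<and> 0 \<le> i \<and> 1 \<le> j} (bigraded_tensor R X (trunc1 T))"
proof (rule dsum_module_restrict, goal_cases)
  case (2 k)
  obtain i j where k: "k = (i, j)" by (cases k)
  then have "i < 0 \<or> j < 1" using 2 by auto
  then show ?case unfolding k by (rule XT_trivial)
qed auto

lemma star_Md_pos: "1 \<le> n \<Longrightarrow> star_Md R X Y n = XY.Tot (n + 1)"
  by (simp add: star_Md_def tensor_cplx_def tensor_cplx_Md_def)

lemma star_Md_0: "star_Md R X Y 0 = dsum_module {(0, 0)} B"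
  by (simp add: star_Md_def)

lemma star_Md_neg: "n < 0 \<Longrightarrow> star_Md R X Y n = dsum_module {} B"
  by (simp add: star_Md_def)

lemma star_module: "module R (star_Md R X Y n)"
proof -
  have B: "module R (dsum_module K B)" for K by (rule module_dsum[OF XY.cring B_module])
  consider "1 \<le> n" | "n = 0" | "n < 0" by linarith
  then show ?thesis
    by cases (simp_all add: star_Md_pos star_Md_0 star_Md_neg XY.Tot_module B)
qed

lemma star_neg_trivial: "n < 0 \<Longrightarrow> x \<in> carrier (star_Md R X Y n) \<Longrightarrow> x = \<zero>\<^bsub>star_Md R X Y n\<^esub>"
  by (auto simp: star_Md_neg dsum_carrier_iff)

lemma B0_hom: "dsum_inj B (0, 0) \<in> module_hom R (tensor_module R (Md X 0) (Md Y 0)) (star_Md R X Y 0)"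
  using dsum_inj_hom[of R B "(0, 0)" "{(0, 0)}", OF XY.cring B_module] by (simp add: star_Md_0)

lemma bd1: "bd X 1 \<in> module_hom R (Md X 1) (Md X 0)" "bd Y 1 \<in> module_hom R (Md Y 1) (Md Y 0)"
  "bd S 1 \<in> module_hom R (Md S 1) (Md S 0)" "bd T 1 \<in> module_hom R (Md T 1) (Md T 0)"
  using chain_complex_hom[OF X, of 1] chain_complex_hom[OF Y, of 1]
    chain_complex_hom[OF S, of 1] chain_complex_hom[OF T, of 1] by simp_all

lemma star_elem_0: "star_elem R X Y (0, 0) = homog_tensor R X Y (0, 0)"
  by (simp add: star_elem_def)

lemma homog_0: "homog_tensor R X Y (0, 0) x y = dsum_inj B (0, 0) (pure_tensor R (Md X 0) (Md Y 0) x y)"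
  by (simp add: homog_tensor_def)

lemma trunc1_1: "Md (trunc1 X) 1 = Md X 1" "Md (trunc1 Y) 1 = Md Y 1"
  "Md (trunc1 S) 1 = Md S 1" "Md (trunc1 T) 1 = Md T 1"
  by (simp_all add: trunc1_Md)

text \<open>The differential of the star product in degree one and the comparison maps in degree zero are all
  of this form.\<close>

lemma lift_to_degree_0:
  fixes P :: "('a, 'p) cplx" and Q :: "('a, 'q) cplx"
  assumes Pm: "\<And>i. module R (Md P i)" and Qm: "\<And>i. module R (Md Q i)"
    and f: "f \<in> module_hom R (Md P i) (Md X 0)" and g: "g \<in> module_hom R (Md Q j) (Md Y 0)"
    and b: "\<And>x y. b (i, j) x y = homog_tensor R X Y (0, 0) (f x) (g y)"
    and u: "u \<in> carrier (dsum_module {(i, j)} (bigraded_tensor R P Q))"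
  shows "bitensor_lift R P Q (star_Md R X Y 0) b u = dsum_inj B (0, 0) (tensor_map R (Md X 0) (Md Y 0) f g (u (i, j)))"
    and "bitensor_lift R P Q (star_Md R X Y 0) b \<in> module_hom R (dsum_module {(i, j)} (bigraded_tensor R P Q)) (star_Md R X Y 0)"
proof -
  have bij: "b (i, j) = (\<lambda>x y. homog_tensor R X Y (0, 0) (f x) (g y))" using b by presburger
  have "balanced_map R (Md P i) (Md Q j) (star_Md R X Y 0) (\<lambda>x y. homog_tensor R X Y (0, 0) (f x) (g y))"
    unfolding star_Md_0
    by (rule balanced_map_pre[OF homog_tensor_balanced[OF Xm Ym] f g]) simp
  then have bal: "balanced_map R (Md P i') (Md Q j') (star_Md R X Y 0) (b (i', j'))" if "(i', j') \<in> {(i, j)}" for i' j'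
    using that bij by simp
  show h: "bitensor_lift R P Q (star_Md R X Y 0) b \<in> module_hom R (dsum_module {(i, j)} (bigraded_tensor R P Q)) (star_Md R X Y 0)"
    by (rule bitensor_lift_hom[OF Pm Qm star_module bal])
  have tm: "tensor_map R (Md X 0) (Md Y 0) f g \<in> module_hom R (tensor_module R (Md P i) (Md Q j)) (tensor_module R (Md X 0) (Md Y 0))"
    by (rule tensor_map_hom[OF Pm Qm Xm Ym f g])
  have pr: "(\<lambda>u. u (i, j)) \<in> module_hom R (dsum_module {(i, j)} (bigraded_tensor R P Q)) (tensor_module R (Md P i) (Md Q j))"
    using dsum_proj_hom[of "(i, j)" R "{(i, j)}" "bigraded_tensor R P Q"] by simp
  show "bitensor_lift R P Q (star_Md R X Y 0) b u = dsum_inj B (0, 0) (tensor_map R (Md X 0) (Md Y 0) f g (u (i, j)))"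
  proof (rule bitensor_hom_eq[OF Pm Qm star_module h module_hom_comp[OF module_hom_comp[OF pr tm] B0_hom] _ u])
    fix i' j' x y assume "(i', j') \<in> {(i, j)}" and "x \<in> carrier (Md P i')" "y \<in> carrier (Md Q j')"
    then have ij: "i' = i" "j' = j" and x: "x \<in> carrier (Md P i)" and y: "y \<in> carrier (Md Q j)" by auto
    show "bitensor_lift R P Q (star_Md R X Y 0) b (homog_tensor R P Q (i', j') x y) =
        dsum_inj B (0, 0) (tensor_map R (Md X 0) (Md Y 0) f g (homog_tensor R P Q (i', j') x y (i, j)))"
    proof -
      have "bitensor_lift R P Q (star_Md R X Y 0) b (homog_tensor R P Q (i, j) x y) = b (i, j) x y"
        by (rule bitensor_lift_homog[where K = "{(i, j)}" and b = b, OF Pm Qm star_module bal _ x y]) simp_all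
      also have "\<dots> = homog_tensor R X Y (0, 0) (f x) (g y)" by (rule b)
      also have "\<dots> = dsum_inj B (0, 0) (tensor_map R (Md X 0) (Md Y 0) f g (pure_tensor R (Md P i) (Md Q j) x y))"
        by (simp only: homog_0 tensor_map_pure[OF Pm Qm Xm Ym f g x y])
      also have "pure_tensor R (Md P i) (Md Q j) x y = homog_tensor R P Q (i, j) x y (i, j)"
        by (simp add: homog_tensor_def)
      finally show ?thesis unfolding ij .
    qed
  qed
qed

lemma star_bd_pos: "2 \<le> n \<Longrightarrow> f \<in> carrier (XY.Tot (n + 1)) \<Longrightarrow> bd (star_product R X Y) n f = XY.tot f"
  by (simp add: star_product_def tensor_cplx_bd[OF tX tY])

lemma star_bd_1:
  assumes "f \<in> carrier (XY.Tot 2)"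
  shows "bd (star_product R X Y) 1 f = dsum_inj B (0, 0) (tensor_map R (Md X 0) (Md Y 0) (bd X 1) (bd Y 1) (f (1, 1)))"
  using lift_to_degree_0(1)[OF tXm tYm, of "bd X 1" 1 "bd Y 1" 1] assms bd1
  by (simp add: star_product_def star_elem_0 XY_Tot2 trunc1_1)

lemma star_bd_nonpos: "n \<le> 0 \<Longrightarrow> bd (star_product R X Y) n = (\<lambda>_. \<zero>\<^bsub>star_Md R X Y (n - 1)\<^esub>)"
  by (simp add: star_product_def)

lemma star_Md_product: "Md (star_product R X Y) = star_Md R X Y"
  by (simp add: star_product_def)

lemma XY_component: "f \<in> carrier (XY.Tot n) \<Longrightarrow> f (i, j) \<in> carrier (tensor_module R (Md (trunc1 X) i) (Md (trunc1 Y) j))"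
  by (drule dsum_closed[where k = "(i, j)"]) simp

text \<open>The splice point of the star product: the map \<open>\<partial>\<^sub>1 \<otimes> \<partial>\<^sub>1\<close> kills the differentials that
  arrive in bidegree (1, 1), because one of the factors then undergoes \<open>\<partial>\<^sub>1 \<partial>\<^sub>2\<close>.\<close>

lemma bd_bd_tot_zero:
  assumes "f \<in> carrier (XY.Tot 3)"
  shows "tensor_map R (Md X 0) (Md Y 0) (bd X 1) (bd Y 1) (XY.tot f (1, 1)) = \<zero>\<^bsub>tensor_module R (Md X 0) (Md Y 0)\<^esub>"
proof -
  note T = module_tensor[OF Xm Ym]
  have h2: "bd X 2 \<in> module_hom R (Md X 2) (Md X 1)" "bd Y 2 \<in> module_hom R (Md Y 2) (Md Y 1)"
    using chain_complex_hom[OF X, of 2] chain_complex_hom[OF Y, of 2] by simp_all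
  have tm: "tensor_map R (Md X 0) (Md Y 0) (bd X 1) (bd Y 1) \<in> module_hom R (tensor_module R (Md X 1) (Md Y 1)) (tensor_module R (Md X 0) (Md Y 0))"
    by (rule tensor_map_hom[OF Xm Ym Xm Ym bd1(1,2)])
  have f21: "f (2, 1) \<in> carrier (tensor_module R (Md X 2) (Md Y 1))"
    using XY_component[OF assms, of 2 1] by (simp add: trunc1_Md)
  have f12: "f (1, 2) \<in> carrier (tensor_module R (Md X 1) (Md Y 2))"
    using XY_component[OF assms, of 1 2] by (simp add: trunc1_Md)
  let ?a = "tensor_map R (Md X 1) (Md Y 1) (bd X 2) (\<lambda>y. y) (f (2, 1))"
  let ?b = "tensor_map R (Md X 1) (Md Y 1) (\<lambda>x. x) (bd Y 2) (f (1, 2))"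
  have a: "?a \<in> carrier (tensor_module R (Md X 1) (Md Y 1))"
    by (rule module_hom_closed[OF tensor_map_hom[OF Xm Ym Xm Ym h2(1) module_hom_id] f21])
  have b: "?b \<in> carrier (tensor_module R (Md X 1) (Md Y 1))"
    by (rule module_hom_closed[OF tensor_map_hom[OF Xm Ym Xm Ym module_hom_id h2(2)] f12])
  have tot: "XY.tot f (1, 1) = ?a \<oplus>\<^bsub>tensor_module R (Md X 1) (Md Y 1)\<^esub> sign_smult (tensor_module R (Md X 1) (Md Y 1)) 1 ?b"
    by (simp add: XY.tot_apply tensor_D1_def tensor_D2_def trunc1_Md trunc1_bd)
  have "tensor_map R (Md X 0) (Md Y 0) (bd X 1) (bd Y 1) ?a = \<zero>\<^bsub>tensor_module R (Md X 0) (Md Y 0)\<^esub>"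
    using tensor_map_comp[OF Xm Ym Xm Ym Xm Ym h2(1) module_hom_id bd1(1,2) f21]
      tensor_map_zero[OF Xm Ym Xm Ym module_hom_comp[OF h2(1) bd1(1)] module_hom_comp[OF module_hom_id bd1(2)] _ f21]
      chain_complex_bd_bd[OF X, of _ 2] by simp
  moreover have "tensor_map R (Md X 0) (Md Y 0) (bd X 1) (bd Y 1) ?b = \<zero>\<^bsub>tensor_module R (Md X 0) (Md Y 0)\<^esub>"
    using tensor_map_comp[OF Xm Ym Xm Ym Xm Ym module_hom_id h2(2) bd1(1,2) f12]
      tensor_map_zero[OF Xm Ym Xm Ym module_hom_comp[OF module_hom_id bd1(1)] module_hom_comp[OF h2(2) bd1(2)] _ f12]
      chain_complex_bd_bd[OF Y, of _ 2] by simp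
  moreover have "\<zero>\<^bsub>tensor_module R (Md X 0) (Md Y 0)\<^esub> \<oplus>\<^bsub>tensor_module R (Md X 0) (Md Y 0)\<^esub> \<zero>\<^bsub>tensor_module R (Md X 0) (Md Y 0)\<^esub>
      = \<zero>\<^bsub>tensor_module R (Md X 0) (Md Y 0)\<^esub>"
    using abelian_monoid.l_zero[OF abelian_group.axioms(1)[OF module_abelian_group[OF T]]]
      abelian_monoid.zero_closed[OF abelian_group.axioms(1)[OF module_abelian_group[OF T]]] by blast
  ultimately show ?thesis
    unfolding tot
    using module_hom_add[OF tm a sign_smult_closed[OF T b, of 1]] module_hom_sign_smult[OF tm T T b, of 1]
      sign_smult_zero[OF T, of 0 0 1] by simp
qed

lemma star_chain_complex: "chain_complex R (star_product R X Y)"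
  unfolding chain_complex_def star_Md_product
proof (intro allI conjI ballI)
  fix n
  show "module R (star_Md R X Y n)" by (rule star_module)
  consider "2 \<le> n" | "n = 1" | "n \<le> 0" by linarith
  then show "bd (star_product R X Y) n \<in> module_hom R (star_Md R X Y n) (star_Md R X Y (n - 1))"
  proof cases
    case 1
    then show ?thesis
      using tensor_cplx_bd_hom[OF tX tY, of "n + 1"] star_Md_pos[of n] star_Md_pos[of "n - 1"]
      by (simp add: star_product_def)
  next
    case 2
    have "dsum_module {(1, 1)} (bigraded_tensor R (trunc1 X) (trunc1 Y)) = star_Md R X Y 1"
      using star_Md_pos[of 1] XY_Tot2 by simp
    then show ?thesis
      using 2 lift_to_degree_0(2)[OF tXm tYm, of "bd X 1" 1 "bd Y 1" 1 _ "\<zero>\<^bsub>XY.Tot 2\<^esub>"] bd1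
        abelian_monoid.zero_closed[OF abelian_group.axioms(1)[OF module_abelian_group[OF XY.Tot_module]], of 2]
      by (simp add: star_product_def star_elem_0 XY_Tot2 trunc1_1 del: dsum_module_simps)
  next
    case 3
    then show ?thesis using star_bd_nonpos module_hom_const_zero[OF star_module] by simp
  qed
  fix f assume f: "f \<in> carrier (star_Md R X Y n)"
  consider "3 \<le> n" | "n = 2" | "n \<le> 1" by linarith
  then show "bd (star_product R X Y) (n - 1) (bd (star_product R X Y) n f) = \<zero>\<^bsub>star_Md R X Y (n - 2)\<^esub>"
  proof cases
    case 1
    have f': "f \<in> carrier (XY.Tot (n + 1))" using f 1 star_Md_pos by simp
    have "XY.tot f \<in> carrier (XY.Tot n)" using XY.tot_closed[OF f'] by simp
    then show ?thesis
      using 1 f' star_bd_pos[of n f] star_bd_pos[of "n - 1" "XY.tot f"] XY.tot_tot[OF f'] star_Md_pos[of "n - 2"] by simp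
  next
    case 2
    have f': "f \<in> carrier (XY.Tot 3)" using f 2 star_Md_pos[of 2] by simp
    have "XY.tot f \<in> carrier (XY.Tot 2)" using XY.tot_closed[OF f'] by simp
    then show ?thesis
      using 2 f' star_bd_pos[of 2 f] star_bd_1 bd_bd_tot_zero[OF f']
        module_hom_zero[OF B0_hom module_tensor[OF Xm Ym] star_module] by simp
  next
    case 3
    then show ?thesis using star_bd_nonpos by simp
  qed
qed

end

lemma sign_smult_pred:
  assumes "module R M" "x \<in> carrier M"
  shows "sign_smult M (k - 1) (sign_smult M (- 1) x) = sign_smult M k x"
  using assms(2) abelian_group.minus_minus[OF module_abelian_group[OF assms(1)] assms(2)]
  by (simp add: sign_smult_def)

lemma shift_simps:
  "Md (shift (- 1) C) n = Md C (n + 1)"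
  "bd (shift (- 1) C) n x = sign_smult (Md C n) (- 1) (bd C (n + 1) x)"
  by (simp_all add: shift_def)

context star_setup
begin

text \<open>In positive degrees the maps \<open>\<Phi>\<close> and \<open>\<Psi>\<close> are, up to a sign alternating with the degree, a tensor
  product of chain maps into the truncated complexes; the alternation accounts for the sign of the
  shift.  Hence only the square between degrees one and zero needs a separate verification.\<close>

lemma star_map_comm:
  fixes P :: "('a, 'p) cplx" and Q :: "('a, 'q) cplx" and F :: "int \<Rightarrow> ('p, 'q) bitensor \<Rightarrow> ('x, 'y) bitensor"
  assumes P: "chain_complex R P" and Q: "chain_complex R Q"
    and p: "chain_map R P (trunc1 X) p" and q: "chain_map R Q (trunc1 Y) q"
    and hom: "\<And>n. F n \<in> module_hom R (tensor_cplx_Md R P Q (n + 1)) (star_Md R X Y n)"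
    and F: "\<And>n u. 1 \<le> n \<Longrightarrow> u \<in> carrier (tensor_cplx_Md R P Q (n + 1)) \<Longrightarrow>
       F n u = sign_smult (star_Md R X Y n) (n + s) (tensor_chain_map R (trunc1 X) (trunc1 Y) p q u)"
    and n: "n \<noteq> 1" and u: "u \<in> carrier (tensor_cplx_Md R P Q (n + 1))"
  shows "bd (star_product R X Y) n (F n u) =
    F (n - 1) (sign_smult (tensor_cplx_Md R P Q n) (- 1) (bd (tensor_cplx R P Q) (n + 1) u))"
proof -
  interpret PQ: double_complex R "bigraded_tensor R P Q" "tensor_D1 R P Q" "tensor_D2 R P Q"
    by (rule tensor_double_complex[OF P Q])
  have u': "u \<in> carrier (PQ.Tot (n + 1))" using u by (simp add: tensor_cplx_Md_def)
  have tu: "PQ.tot u \<in> carrier (PQ.Tot n)" using PQ.tot_closed[OF u'] by simp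
  have stu: "sign_smult (PQ.Tot n) (- 1) (PQ.tot u) \<in> carrier (PQ.Tot n)"
    by (rule sign_smult_closed[OF PQ.Tot_module tu])
  have bdu: "bd (tensor_cplx R P Q) (n + 1) u = PQ.tot u" by (rule tensor_cplx_bd[OF P Q u'])
  show ?thesis
  proof (cases "2 \<le> n")
    case True
    let ?h = "tensor_chain_map R (trunc1 X) (trunc1 Y) p q"
    note th = tensor_chain_map_hom[OF P Q tX tY p q]
    have s1: "star_Md R X Y n = XY.Tot (n + 1)" and s0: "star_Md R X Y (n - 1) = XY.Tot n"
      using True star_Md_pos[of n] star_Md_pos[of "n - 1"] by simp_all
    have hu: "?h u \<in> carrier (XY.Tot (n + 1))" by (rule module_hom_closed[OF th u'])
    have htu: "?h (PQ.tot u) \<in> carrier (XY.Tot n)" by (rule module_hom_closed[OF th tu])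
    have toth: "XY.tot \<in> module_hom R (XY.Tot (n + 1)) (XY.Tot n)" using XY.tot_hom[of "n + 1"] by simp
    have "bd (star_product R X Y) n (F n u) = XY.tot (sign_smult (XY.Tot (n + 1)) (n + s) (?h u))"
      using F[OF _ u] True s1 star_bd_pos[OF True sign_smult_closed[OF XY.Tot_module hu]] by simp
    also have "\<dots> = sign_smult (XY.Tot n) (n + s) (XY.tot (?h u))"
      by (rule module_hom_sign_smult[OF toth XY.Tot_module XY.Tot_module hu])
    also have "XY.tot (?h u) = ?h (PQ.tot u)"
      by (rule tensor_chain_map_tot[OF P Q tX tY p q u'])
    also have "sign_smult (XY.Tot n) (n + s) (?h (PQ.tot u)) =
        sign_smult (XY.Tot n) (n - 1 + s) (sign_smult (XY.Tot n) (- 1) (?h (PQ.tot u)))"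
      using sign_smult_pred[OF XY.Tot_module htu, of "n + s"] by (simp add: algebra_simps)
    also have "\<dots> = F (n - 1) (sign_smult (PQ.Tot n) (- 1) (PQ.tot u))"
      using F[of "n - 1" "sign_smult (PQ.Tot n) (- 1) (PQ.tot u)"] True stu s0
        module_hom_sign_smult[OF th PQ.Tot_module XY.Tot_module tu, of "- 1"]
      by (simp add: tensor_cplx_Md_def)
    finally show ?thesis using bdu by (simp add: tensor_cplx_Md_def)
  next
    case False
    then have n0: "n \<le> 0" using n by simp
    have "F (n - 1) (sign_smult (PQ.Tot n) (- 1) (PQ.tot u)) \<in> carrier (star_Md R X Y (n - 1))"
      using module_hom_closed[OF hom[of "n - 1"], of "sign_smult (PQ.Tot n) (- 1) (PQ.tot u)"] stu
      by (simp add: tensor_cplx_Md_def)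
    then have "F (n - 1) (sign_smult (PQ.Tot n) (- 1) (PQ.tot u)) = \<zero>\<^bsub>star_Md R X Y (n - 1)\<^esub>"
      using n0 star_neg_trivial[of "n - 1"] by simp
    then show ?thesis using star_bd_nonpos[OF n0] bdu by (simp add: tensor_cplx_Md_def)
  qed
qed

lemma trunc1_hom:
  "1 \<le> i \<Longrightarrow> \<phi> i \<in> module_hom R (Md (trunc1 S) i) (Md (trunc1 X) i)"
  "1 \<le> j \<Longrightarrow> \<psi> j \<in> module_hom R (Md (trunc1 T) j) (Md (trunc1 Y) j)"
  using chain_map_hom[OF \<phi>] chain_map_hom[OF \<psi>] by (simp_all add: trunc1_Md)

lemma e1_bd_hom: "(\<lambda>a. e1 (bd S 1 a)) \<in> module_hom R (Md S 1) (Md X 0)"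
  using module_hom_cong[OF module_hom_comp[OF bd1(3) chain_map_hom[OF \<phi>]] Sm] e1 module_hom_closed[OF bd1(3)] by simp

lemma e2_bd_hom: "(\<lambda>a. e2 (bd T 1 a)) \<in> module_hom R (Md T 1) (Md Y 0)"
  using module_hom_cong[OF module_hom_comp[OF bd1(4) chain_map_hom[OF \<psi>]] Tm] e2 module_hom_closed[OF bd1(4)] by simp

lemma e1_bd: "a \<in> carrier (Md S 1) \<Longrightarrow> e1 (bd S 1 a) = bd X 1 (\<phi> 1 a)"
  using e1[OF module_hom_closed[OF bd1(3)]] chain_map_comm[OF \<phi>, of a 1] by simp

lemma e2_bd: "a \<in> carrier (Md T 1) \<Longrightarrow> e2 (bd T 1 a) = bd Y 1 (\<psi> 1 a)"
  using e2[OF module_hom_closed[OF bd1(4)]] chain_map_comm[OF \<psi>, of a 1] by simp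

lemma star_elem_pos: "1 \<le> i \<Longrightarrow> star_elem R X Y (i, j) = homog_tensor R (trunc1 X) (trunc1 Y) (i, j)"
  by (simp add: star_elem_def)

lemmas T_chain = T

subsection \<open>The map \<Phi>\<close>

definition Phi_rule :: "int \<Rightarrow> int \<times> int \<Rightarrow> 's \<Rightarrow> 'y \<Rightarrow> ('x, 'y) bitensor" where
  "Phi_rule n = (\<lambda>(i, j) \<alpha> \<beta>.
       if j > 0 then sign_smult (star_Md R X Y n) (i + j) (star_elem R X Y (i, j) (\<phi> i \<alpha>) \<beta>)
       else if j = 0 \<and> i = 1 then star_elem R X Y (0, 0) (e1 (bd S 1 \<alpha>)) \<beta>
       else \<zero>\<^bsub>star_Md R X Y n\<^esub>)"

lemma Phi_eq: "Phi R S X Y \<phi> e1 n = bitensor_lift R (trunc1 S) Y (star_Md R X Y n) (Phi_rule n)"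
  by (simp add: Phi_def[abs_def] Phi_rule_def Let_def)

lemma Phi_rule_balanced:
  assumes "i + j = n + 1" "1 \<le> i" "0 \<le> j"
  shows "balanced_map R (Md (trunc1 S) i) (Md Y j) (star_Md R X Y n) (Phi_rule n (i, j))"
proof -
  consider "0 < j" | "j = 0" "i = 1" | "j = 0" "i \<noteq> 1" using assms by linarith
  then show ?thesis
  proof cases
    case 1
    have n: "1 \<le> n" using 1 assms by simp
    have id: "(\<lambda>y. y) \<in> module_hom R (Md Y j) (Md (trunc1 Y) j)" using 1 module_hom_id by (simp add: trunc1_Md)
    have "balanced_map R (Md (trunc1 S) i) (Md Y j) (XY.Tot (n + 1)) (\<lambda>\<alpha> \<beta>. homog_tensor R (trunc1 X) (trunc1 Y) (i, j) (\<phi> i \<alpha>) \<beta>)"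
      by (rule balanced_map_pre[OF homog_tensor_balanced[OF tXm tYm] trunc1_hom(1)[OF assms(2)] id]) (use assms(1) in simp)
    from balanced_map_sign[OF this XY.Tot_module, of "i + j"] show ?thesis
      using 1 n assms(2) by (simp add: Phi_rule_def star_Md_pos star_elem_pos)
  next
    case 2
    then have n: "n = 0" using assms(1) by simp
    have "balanced_map R (Md S 1) (Md Y 0) (star_Md R X Y 0) (\<lambda>\<alpha> \<beta>. homog_tensor R X Y (0, 0) (e1 (bd S 1 \<alpha>)) \<beta>)"
      unfolding star_Md_0 by (rule balanced_map_pre[OF homog_tensor_balanced[OF Xm Ym] e1_bd_hom module_hom_id]) simp
    then show ?thesis using 2 n by (simp add: Phi_rule_def star_elem_0 trunc1_1)
  next
    case 3
    then show ?thesis using balanced_map_zero[OF star_module] by (simp add: Phi_rule_def)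
  qed
qed

lemma Phi_hom: "Phi R S X Y \<phi> e1 n \<in> module_hom R (tensor_cplx_Md R (trunc1 S) Y (n + 1)) (star_Md R X Y n)"
  unfolding Phi_eq tensor_cplx_Md_def SY_Tot
  by (rule bitensor_lift_hom[OF tSm Ym star_module]) (use Phi_rule_balanced in auto)

lemma Phi_0:
  assumes "u \<in> carrier (SY.Tot 1)"
  shows "Phi R S X Y \<phi> e1 0 u = dsum_inj B (0, 0) (tensor_map R (Md X 0) (Md Y 0) (\<lambda>a. e1 (bd S 1 a)) (\<lambda>y. y) (u (1, 0)))"
proof -
  have K: "{(i, j). i + j = 1 \<and> 1 \<le> i \<and> 0 \<le> j} = {(1, 0 :: int)}" for i :: int by auto
  have "u \<in> carrier (dsum_module {(1, 0)} (bigraded_tensor R (trunc1 S) Y))"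
    using assms unfolding SY_Tot K .
  moreover have "(\<lambda>a. e1 (bd S 1 a)) \<in> module_hom R (Md (trunc1 S) 1) (Md X 0)" using e1_bd_hom trunc1_1 by simp
  moreover have "Phi_rule 0 (1, 0) x y = homog_tensor R X Y (0, 0) (e1 (bd S 1 x)) y" for x y
    by (simp add: Phi_rule_def star_elem_0)
  ultimately show ?thesis unfolding Phi_eq
    by (intro lift_to_degree_0(1)[OF tSm Ym _ module_hom_id])
qed

lemmas Phi_factors = trunc1_chain_map[OF S X \<phi>] truncation_chain_map[OF Y]

text \<open>In bidegrees (i, 0) with \<open>i \<ge> 2\<close> the map \<open>\<Phi>\<close> vanishes by definition, and the other side does
  because the truncation cuts off \<open>Y\<^sub>0\<close>.\<close>

lemma Phi_pos:
  assumes n: "1 \<le> n" and u: "u \<in> carrier (tensor_cplx_Md R (trunc1 S) Y (n + 1))"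
  shows "Phi R S X Y \<phi> e1 n u = sign_smult (star_Md R X Y n) (n + 1)
    (tensor_chain_map R (trunc1 X) (trunc1 Y) (trunc1_map X \<phi>) (trunc1_map Y (\<lambda>_ x. x)) u)"
proof -
  let ?K = "{(i, j). i + j = n + 1 \<and> 1 \<le> i \<and> 0 \<le> j}"
  let ?h = "tensor_chain_map R (trunc1 X) (trunc1 Y) (trunc1_map X \<phi>) (trunc1_map Y (\<lambda>_ x. x))"
  have u': "u \<in> carrier (dsum_module ?K (bigraded_tensor R (trunc1 S) Y))"
    using u by (simp only: tensor_cplx_Md_def SY_Tot)
  have PhiK: "Phi R S X Y \<phi> e1 n \<in> module_hom R (dsum_module ?K (bigraded_tensor R (trunc1 S) Y)) (star_Md R X Y n)"
    using Phi_hom[of n] by (simp only: tensor_cplx_Md_def SY_Tot)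
  have hK: "?h \<in> module_hom R (dsum_module ?K (bigraded_tensor R (trunc1 S) Y)) (star_Md R X Y n)"
    using tensor_chain_map_hom[OF tS Y tX tY Phi_factors, of "{(i, j). i + j = n + 1}"] n
    by (simp only: star_Md_pos SY_Tot)
  show ?thesis
  proof (rule bitensor_hom_eq[OF tSm Ym star_module PhiK module_hom_sign[OF hK star_module] _ u'])
    fix i j \<alpha> \<beta> assume ij: "(i, j) \<in> ?K" and \<alpha>: "\<alpha> \<in> carrier (Md (trunc1 S) i)" and \<beta>: "\<beta> \<in> carrier (Md Y j)"
    have "Phi R S X Y \<phi> e1 n (homog_tensor R (trunc1 S) Y (i, j) \<alpha> \<beta>) = Phi_rule n (i, j) \<alpha> \<beta>"
      unfolding Phi_eq
      by (rule bitensor_lift_homog[where K = ?K, OF tSm Ym star_module _ ij \<alpha> \<beta>]) (use Phi_rule_balanced in auto)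
    also have "\<dots> = sign_smult (star_Md R X Y n) (n + 1) (?h (homog_tensor R (trunc1 S) Y (i, j) \<alpha> \<beta>))"
    proof (cases "0 < j")
      case True
      then show ?thesis
        using ij n tensor_chain_map_homog[OF tS Y tX tY Phi_factors \<alpha> \<beta>]
        by (simp add: Phi_rule_def star_elem_pos trunc1_map_def)
    next
      case False
      then have j: "j = 0" "i = n + 1" using ij by auto
      have "\<phi> i \<alpha> \<in> carrier (Md (trunc1 X) i)" using module_hom_closed[OF trunc1_hom(1) \<alpha>] ij by auto
      then have bal: "(\<lambda>y. homog_tensor R (trunc1 X) (trunc1 Y) (i, j) (\<phi> i \<alpha>) y) \<in> module_hom R (Md (trunc1 Y) j) (XY.Tot (n + 1))"
        using ij by (intro balanced_map_right[OF homog_tensor_balanced[OF tXm tYm]]) auto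
      have "?h (homog_tensor R (trunc1 S) Y (i, j) \<alpha> \<beta>) = homog_tensor R (trunc1 X) (trunc1 Y) (i, j) (\<phi> i \<alpha>) \<zero>\<^bsub>Md (trunc1 Y) j\<^esub>"
        using tensor_chain_map_homog[OF tS Y tX tY Phi_factors \<alpha> \<beta>] j ij by (simp add: trunc1_map_def trunc1_zero)
      also have "\<dots> = \<zero>\<^bsub>star_Md R X Y n\<^esub>"
        using module_hom_zero[OF bal tYm XY.Tot_module] n by (simp add: star_Md_pos)
      finally show ?thesis
        using j n sign_smult_zero[OF star_module, of n "n + 1"] by (simp add: Phi_rule_def)
    qed
    finally show "Phi R S X Y \<phi> e1 n (homog_tensor R (trunc1 S) Y (i, j) \<alpha> \<beta>) =
       sign_smult (star_Md R X Y n) (n + 1) (?h (homog_tensor R (trunc1 S) Y (i, j) \<alpha> \<beta>))" .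
  qed
qed

lemma tensor_Md: "Md (tensor_cplx R P Q) n = tensor_cplx_Md R P Q n"
  by (simp add: tensor_cplx_def)

lemma SY_component: "u \<in> carrier (SY.Tot n) \<Longrightarrow> u (i, j) \<in> carrier (tensor_module R (Md (trunc1 S) i) (Md Y j))"
  by (drule dsum_closed[where k = "(i, j)"]) simp

lemma XT_component: "u \<in> carrier (XT.Tot n) \<Longrightarrow> u (i, j) \<in> carrier (tensor_module R (Md X i) (Md (trunc1 T) j))"
  by (drule dsum_closed[where k = "(i, j)"]) simp

text \<open>Going either way, only the component of \<open>u\<close> in bidegree (1, 1) contributes: the one in bidegree
  (2, 0) is mapped to zero by \<open>\<Phi>\<close>, and its boundary is killed because \<open>\<partial>\<^sub>1 \<partial>\<^sub>2 = 0\<close>.  The sign of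
  the shift cancels that of the vertical differential in odd horizontal degree.\<close>

lemma Phi_comm_1:
  assumes u: "u \<in> carrier (SY.Tot 2)"
  shows "bd (star_product R X Y) 1 (Phi R S X Y \<phi> e1 1 u) =
    Phi R S X Y \<phi> e1 0 (sign_smult (SY.Tot 1) (- 1) (SY.tot u))"
proof -
  let ?h = "tensor_chain_map R (trunc1 X) (trunc1 Y) (trunc1_map X \<phi>) (trunc1_map Y (\<lambda>_ x. x))"
  note T = module_tensor[OF Xm Ym]
  let ?T = "tensor_module R (Md X 0) (Md Y 0)"
  have \<phi>1: "\<phi> 1 \<in> module_hom R (Md S 1) (Md X 1)" by (rule chain_map_hom[OF \<phi>])
  have S2: "bd S 2 \<in> module_hom R (Md S 2) (Md S 1)" using chain_complex_hom[OF S, of 2] by simp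
  have u11: "u (1, 1) \<in> carrier (tensor_module R (Md S 1) (Md Y 1))"
    using SY_component[OF u, of 1 1] by (simp add: trunc1_1)
  have u20: "u (2, 0) \<in> carrier (tensor_module R (Md S 2) (Md Y 0))"
    using SY_component[OF u, of 2 0] by (simp add: trunc1_Md)
  let ?v = "tensor_map R (Md X 0) (Md Y 0) (\<lambda>a. e1 (bd S 1 a)) (\<lambda>y. bd Y 1 y) (u (1, 1))"
  have v: "?v \<in> carrier ?T"
    by (rule module_hom_closed[OF tensor_map_hom[OF Sm Ym Xm Ym e1_bd_hom bd1(2)] u11])
  have hu: "?h u \<in> carrier (XY.Tot 2)"
    by (rule module_hom_closed[OF tensor_chain_map_hom[OF tS Y tX tY Phi_factors] u])
  have "Phi R S X Y \<phi> e1 1 u = ?h u"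
    using Phi_pos[of 1 u] u by (simp add: tensor_cplx_Md_def sign_smult_def)
  then have "bd (star_product R X Y) 1 (Phi R S X Y \<phi> e1 1 u) =
      dsum_inj B (0, 0) (tensor_map R (Md X 0) (Md Y 0) (bd X 1) (bd Y 1) (?h u (1, 1)))"
    using star_bd_1[OF hu] by simp
  also have "?h u (1, 1) = tensor_map R (Md X 1) (Md Y 1) (\<phi> 1) (\<lambda>y. y) (u (1, 1))"
    by (simp add: tensor_chain_map_def trunc1_1 trunc1_map_def)
  also have "tensor_map R (Md X 0) (Md Y 0) (bd X 1) (bd Y 1) \<dots> =
      tensor_map R (Md X 0) (Md Y 0) (\<lambda>a. bd X 1 (\<phi> 1 a)) (\<lambda>y. bd Y 1 y) (u (1, 1))"
    by (rule tensor_map_comp[OF Sm Ym Xm Ym Xm Ym \<phi>1 module_hom_id bd1(1,2) u11])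
  also have "\<dots> = ?v"
    by (rule tensor_map_cong[OF Sm Ym Xm Ym module_hom_comp[OF \<phi>1 bd1(1)] bd1(2) _ _ u11]) (simp_all add: e1_bd)
  finally have L: "bd (star_product R X Y) 1 (Phi R S X Y \<phi> e1 1 u) = dsum_inj B (0, 0) ?v" .
  let ?g = "tensor_map R (Md X 0) (Md Y 0) (\<lambda>a. e1 (bd S 1 a)) (\<lambda>y. y)"
  have g: "?g \<in> module_hom R (tensor_module R (Md S 1) (Md Y 0)) ?T"
    by (rule tensor_map_hom[OF Sm Ym Xm Ym e1_bd_hom module_hom_id])
  let ?a = "tensor_map R (Md S 1) (Md Y 0) (bd S 2) (\<lambda>y. y) (u (2, 0))"
  let ?b = "tensor_map R (Md S 1) (Md Y 0) (\<lambda>x. x) (bd Y 1) (u (1, 1))"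
  note TS = module_tensor[OF Sm Ym]
  have a: "?a \<in> carrier (tensor_module R (Md S 1) (Md Y 0))"
    by (rule module_hom_closed[OF tensor_map_hom[OF Sm Ym Sm Ym S2 module_hom_id] u20])
  have b: "?b \<in> carrier (tensor_module R (Md S 1) (Md Y 0))"
    by (rule module_hom_closed[OF tensor_map_hom[OF Sm Ym Sm Ym module_hom_id bd1(2)] u11])
  have "SY.tot u (1, 0) = ?a \<oplus>\<^bsub>tensor_module R (Md S 1) (Md Y 0)\<^esub> sign_smult (tensor_module R (Md S 1) (Md Y 0)) 1 ?b"
    by (simp add: SY.tot_apply tensor_D1_def tensor_D2_def trunc1_Md trunc1_bd)
  moreover have "?g ?a = \<zero>\<^bsub>?T\<^esub>"
    using tensor_map_comp[OF Sm Ym Sm Ym Xm Ym S2 module_hom_id e1_bd_hom module_hom_id u20]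
      tensor_map_zero[OF Sm Ym Xm Ym module_hom_comp[OF S2 e1_bd_hom] module_hom_comp[OF module_hom_id module_hom_id] _ u20]
      chain_complex_bd_bd[OF S, of _ 2] e1[of "\<zero>\<^bsub>Md S 0\<^esub>"] module_hom_zero[OF chain_map_hom[OF \<phi>] Sm Xm]
      abelian_monoid.zero_closed[OF abelian_group.axioms(1)[OF module_abelian_group[OF Sm]], of 0] by simp
  moreover have "?g ?b = ?v"
    by (rule tensor_map_comp[OF Sm Ym Sm Ym Xm Ym module_hom_id bd1(2) e1_bd_hom module_hom_id u11])
  ultimately have "?g (SY.tot u (1, 0)) = sign_smult ?T 1 ?v"
    using module_hom_add[OF g a sign_smult_closed[OF TS b, of 1]] module_hom_sign_smult[OF g TS T b, of 1]
      sign_smult_closed[OF T v, of 1] abelian_monoid.l_zero[OF abelian_group.axioms(1)[OF module_abelian_group[OF T]]] by simp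
  moreover have tu: "SY.tot u \<in> carrier (SY.Tot 1)" using SY.tot_closed[OF u] by simp
  moreover have pr: "(\<lambda>u. u (1, 0)) \<in> module_hom R (SY.Tot 1) (tensor_module R (Md S 1) (Md Y 0))"
    using dsum_proj_hom[of "(1, 0)" R "{(i, j). i + j = 1}" "bigraded_tensor R (trunc1 S) Y"] by (simp add: trunc1_1)
  moreover have "SY.tot u (1, 0) \<in> carrier (tensor_module R (Md S 1) (Md Y 0))"
    by (rule module_hom_closed[OF pr tu])
  ultimately have "?g (sign_smult (SY.Tot 1) (- 1) (SY.tot u) (1, 0)) = ?v"
    using module_hom_sign_smult[OF pr SY.Tot_module TS tu, of "- 1"]
      module_hom_sign_smult[OF g TS T, of "SY.tot u (1, 0)" "- 1"] sign_smult_pred[OF T sign_smult_closed[OF T v, of 1], of 0]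
      sign_smult_sign_smult[OF T v, of 1]
    by (simp add: sign_smult_def)
  then show ?thesis
    using L Phi_0[OF sign_smult_closed[OF SY.Tot_module tu, of "- 1"]] by simp
qed

lemma Phi_comm:
  assumes u: "u \<in> carrier (tensor_cplx_Md R (trunc1 S) Y (n + 1))"
  shows "bd (star_product R X Y) n (Phi R S X Y \<phi> e1 n u) =
    Phi R S X Y \<phi> e1 (n - 1) (sign_smult (tensor_cplx_Md R (trunc1 S) Y n) (- 1) (bd (tensor_cplx R (trunc1 S) Y) (n + 1) u))"
proof (cases "n = 1")
  case True
  then have "u \<in> carrier (SY.Tot 2)" using u by (simp add: tensor_cplx_Md_def)
  then show ?thesis using True Phi_comm_1 tensor_cplx_bd[OF tS Y, of u 2] by (simp add: tensor_cplx_Md_def)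
next
  case False
  show ?thesis by (rule star_map_comm[OF tS Y Phi_factors Phi_hom Phi_pos False u])
qed

subsection \<open>The map \<Psi>\<close>

definition Psi_rule :: "int \<Rightarrow> int \<times> int \<Rightarrow> 'x \<Rightarrow> 't \<Rightarrow> ('x, 'y) bitensor" where
  "Psi_rule n = (\<lambda>(i, j) \<alpha> \<beta>.
       if i > 0 then sign_smult (star_Md R X Y n) (i + j - 1) (star_elem R X Y (i, j) \<alpha> (\<psi> j \<beta>))
       else if i = 0 \<and> j = 1 then star_elem R X Y (0, 0) \<alpha> (e2 (bd T 1 \<beta>))
       else \<zero>\<^bsub>star_Md R X Y n\<^esub>)"

lemma Psi_eq: "Psi R T X Y \<psi> e2 n = bitensor_lift R X (trunc1 T) (star_Md R X Y n) (Psi_rule n)"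
  by (simp add: Psi_def[abs_def] Psi_rule_def Let_def)

lemma Psi_rule_balanced:
  assumes "i + j = n + 1" "0 \<le> i" "1 \<le> j"
  shows "balanced_map R (Md X i) (Md (trunc1 T) j) (star_Md R X Y n) (Psi_rule n (i, j))"
proof -
  consider "0 < i" | "i = 0" "j = 1" | "i = 0" "j \<noteq> 1" using assms by linarith
  then show ?thesis
  proof cases
    case 1
    have n: "1 \<le> n" using 1 assms by simp
    have id: "(\<lambda>y. y) \<in> module_hom R (Md X i) (Md (trunc1 X) i)" using 1 module_hom_id by (simp add: trunc1_Md)
    have "balanced_map R (Md X i) (Md (trunc1 T) j) (XY.Tot (n + 1)) (\<lambda>\<alpha> \<beta>. homog_tensor R (trunc1 X) (trunc1 Y) (i, j) \<alpha> (\<psi> j \<beta>))"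
      by (rule balanced_map_pre[OF homog_tensor_balanced[OF tXm tYm] id trunc1_hom(2)[OF assms(3)]]) (use assms(1) in simp)
    from balanced_map_sign[OF this XY.Tot_module, of "i + j - 1"] show ?thesis
      using 1 n by (simp add: Psi_rule_def star_Md_pos star_elem_pos)
  next
    case 2
    then have n: "n = 0" using assms(1) by simp
    have "balanced_map R (Md X 0) (Md T 1) (star_Md R X Y 0) (\<lambda>\<alpha> \<beta>. homog_tensor R X Y (0, 0) \<alpha> (e2 (bd T 1 \<beta>)))"
      unfolding star_Md_0 by (rule balanced_map_pre[OF homog_tensor_balanced[OF Xm Ym] module_hom_id e2_bd_hom]) simp
    then show ?thesis using 2 n by (simp add: Psi_rule_def star_elem_0 trunc1_1)
  next
    case 3
    then show ?thesis using balanced_map_zero[OF star_module] by (simp add: Psi_rule_def)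
  qed
qed

lemma Psi_hom: "Psi R T X Y \<psi> e2 n \<in> module_hom R (tensor_cplx_Md R X (trunc1 T) (n + 1)) (star_Md R X Y n)"
  unfolding Psi_eq tensor_cplx_Md_def XT_Tot
  by (rule bitensor_lift_hom[OF Xm tTm star_module]) (use Psi_rule_balanced in auto)

lemma Psi_0:
  assumes "v \<in> carrier (XT.Tot 1)"
  shows "Psi R T X Y \<psi> e2 0 v = dsum_inj B (0, 0) (tensor_map R (Md X 0) (Md Y 0) (\<lambda>x. x) (\<lambda>b. e2 (bd T 1 b)) (v (0, 1)))"
proof -
  have K: "{(i, j). i + j = 1 \<and> 0 \<le> i \<and> 1 \<le> j} = {(0 :: int, 1)}" for i :: int by auto
  have "v \<in> carrier (dsum_module {(0, 1)} (bigraded_tensor R X (trunc1 T)))"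
    using assms unfolding XT_Tot K .
  moreover have "(\<lambda>b. e2 (bd T 1 b)) \<in> module_hom R (Md (trunc1 T) 1) (Md Y 0)" using e2_bd_hom trunc1_1 by simp
  moreover have "Psi_rule 0 (0, 1) x y = homog_tensor R X Y (0, 0) x (e2 (bd T 1 y))" for x y
    by (simp add: Psi_rule_def star_elem_0)
  ultimately show ?thesis unfolding Psi_eq
    by (intro lift_to_degree_0(1)[OF Xm tTm module_hom_id])
qed

lemmas Psi_factors = truncation_chain_map[OF X] trunc1_chain_map[OF T Y \<psi>]

lemma Psi_pos:
  assumes n: "1 \<le> n" and u: "u \<in> carrier (tensor_cplx_Md R X (trunc1 T) (n + 1))"
  shows "Psi R T X Y \<psi> e2 n u = sign_smult (star_Md R X Y n) (n + 0)
    (tensor_chain_map R (trunc1 X) (trunc1 Y) (trunc1_map X (\<lambda>_ x. x)) (trunc1_map Y \<psi>) u)"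
proof -
  let ?K = "{(i, j). i + j = n + 1 \<and> 0 \<le> i \<and> 1 \<le> j}"
  let ?h = "tensor_chain_map R (trunc1 X) (trunc1 Y) (trunc1_map X (\<lambda>_ x. x)) (trunc1_map Y \<psi>)"
  have u': "u \<in> carrier (dsum_module ?K (bigraded_tensor R X (trunc1 T)))"
    using u by (simp only: tensor_cplx_Md_def XT_Tot)
  have PsiK: "Psi R T X Y \<psi> e2 n \<in> module_hom R (dsum_module ?K (bigraded_tensor R X (trunc1 T))) (star_Md R X Y n)"
    using Psi_hom[of n] by (simp only: tensor_cplx_Md_def XT_Tot)
  have hK: "?h \<in> module_hom R (dsum_module ?K (bigraded_tensor R X (trunc1 T))) (star_Md R X Y n)"
    using tensor_chain_map_hom[OF X tT tX tY Psi_factors, of "{(i, j). i + j = n + 1}"] n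
    by (simp only: star_Md_pos XT_Tot)
  show ?thesis
  proof (rule bitensor_hom_eq[OF Xm tTm star_module PsiK module_hom_sign[OF hK star_module] _ u'])
    fix i j \<alpha> \<beta> assume ij: "(i, j) \<in> ?K" and \<alpha>: "\<alpha> \<in> carrier (Md X i)" and \<beta>: "\<beta> \<in> carrier (Md (trunc1 T) j)"
    have "Psi R T X Y \<psi> e2 n (homog_tensor R X (trunc1 T) (i, j) \<alpha> \<beta>) = Psi_rule n (i, j) \<alpha> \<beta>"
      unfolding Psi_eq
      by (rule bitensor_lift_homog[where K = ?K, OF Xm tTm star_module _ ij \<alpha> \<beta>]) (use Psi_rule_balanced in auto)
    also have "\<dots> = sign_smult (star_Md R X Y n) (n + 0) (?h (homog_tensor R X (trunc1 T) (i, j) \<alpha> \<beta>))"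
    proof (cases "0 < i")
      case True
      then show ?thesis
        using ij n tensor_chain_map_homog[OF X tT tX tY Psi_factors \<alpha> \<beta>]
        by (simp add: Psi_rule_def star_elem_pos trunc1_map_def)
    next
      case False
      then have j: "i = 0" "j = n + 1" using ij by auto
      have "\<psi> j \<beta> \<in> carrier (Md (trunc1 Y) j)" using module_hom_closed[OF trunc1_hom(2) \<beta>] ij by auto
      then have bal: "(\<lambda>x. homog_tensor R (trunc1 X) (trunc1 Y) (i, j) x (\<psi> j \<beta>)) \<in> module_hom R (Md (trunc1 X) i) (XY.Tot (n + 1))"
        using ij by (intro balanced_map_left[OF homog_tensor_balanced[OF tXm tYm]]) auto
      have "?h (homog_tensor R X (trunc1 T) (i, j) \<alpha> \<beta>) = homog_tensor R (trunc1 X) (trunc1 Y) (i, j) \<zero>\<^bsub>Md (trunc1 X) i\<^esub> (\<psi> j \<beta>)"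
        using tensor_chain_map_homog[OF X tT tX tY Psi_factors \<alpha> \<beta>] j ij by (simp add: trunc1_map_def trunc1_zero)
      also have "\<dots> = \<zero>\<^bsub>star_Md R X Y n\<^esub>"
        using module_hom_zero[OF bal tXm XY.Tot_module] n by (simp add: star_Md_pos)
      finally show ?thesis
        using j n sign_smult_zero[OF star_module, of n n] by (simp add: Psi_rule_def)
    qed
    finally show "Psi R T X Y \<psi> e2 n (homog_tensor R X (trunc1 T) (i, j) \<alpha> \<beta>) =
       sign_smult (star_Md R X Y n) (n + 0) (?h (homog_tensor R X (trunc1 T) (i, j) \<alpha> \<beta>))" .
  qed
qed

text \<open>As for \<open>\<Phi>\<close>, only the component in bidegree (1, 1) contributes.  Here the sign of the shift is
  compensated by the sign in \<open>\<Psi>\<close>.\<close>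

lemma Psi_comm_1:
  assumes u: "u \<in> carrier (XT.Tot 2)"
  shows "bd (star_product R X Y) 1 (Psi R T X Y \<psi> e2 1 u) =
    Psi R T X Y \<psi> e2 0 (sign_smult (XT.Tot 1) (- 1) (XT.tot u))"
proof -
  let ?h = "tensor_chain_map R (trunc1 X) (trunc1 Y) (trunc1_map X (\<lambda>_ x. x)) (trunc1_map Y \<psi>)"
  note T = module_tensor[OF Xm Ym]
  let ?T = "tensor_module R (Md X 0) (Md Y 0)"
  have \<psi>1: "\<psi> 1 \<in> module_hom R (Md T 1) (Md Y 1)" by (rule chain_map_hom[OF \<psi>])
  have T2: "bd T 2 \<in> module_hom R (Md T 2) (Md T 1)" using chain_complex_hom[OF T_chain, of 2] by simp
  have u11: "u (1, 1) \<in> carrier (tensor_module R (Md X 1) (Md T 1))"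
    using XT_component[OF u, of 1 1] by (simp add: trunc1_1)
  have u02: "u (0, 2) \<in> carrier (tensor_module R (Md X 0) (Md T 2))"
    using XT_component[OF u, of 0 2] by (simp add: trunc1_Md)
  let ?v = "tensor_map R (Md X 0) (Md Y 0) (\<lambda>x. bd X 1 x) (\<lambda>b. e2 (bd T 1 b)) (u (1, 1))"
  have v: "?v \<in> carrier ?T"
    by (rule module_hom_closed[OF tensor_map_hom[OF Xm Tm Xm Ym bd1(1) e2_bd_hom] u11])
  have hu: "?h u \<in> carrier (XY.Tot 2)"
    by (rule module_hom_closed[OF tensor_chain_map_hom[OF X tT tX tY Psi_factors] u])
  have star1: "star_Md R X Y 1 = XY.Tot 2" using star_Md_pos[of 1] by simp
  have bh: "bd (star_product R X Y) 1 \<in> module_hom R (XY.Tot 2) (star_Md R X Y 0)"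
    using chain_complex_hom[OF star_chain_complex, of 1] by (simp add: star_Md_product star1)
  have "bd (star_product R X Y) 1 (Psi R T X Y \<psi> e2 1 u) = sign_smult (star_Md R X Y 0) 1 (bd (star_product R X Y) 1 (?h u))"
    using Psi_pos[of 1 u] u module_hom_sign_smult[OF bh XY.Tot_module star_module hu, of 1] star1 by (simp add: tensor_cplx_Md_def)
  also have "bd (star_product R X Y) 1 (?h u) =
      dsum_inj B (0, 0) (tensor_map R (Md X 0) (Md Y 0) (bd X 1) (bd Y 1) (?h u (1, 1)))"
    using star_bd_1[OF hu] by simp
  also have "?h u (1, 1) = tensor_map R (Md X 1) (Md Y 1) (\<lambda>x. x) (\<psi> 1) (u (1, 1))"
    by (simp add: tensor_chain_map_def trunc1_1 trunc1_map_def)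
  also have "tensor_map R (Md X 0) (Md Y 0) (bd X 1) (bd Y 1) \<dots> =
      tensor_map R (Md X 0) (Md Y 0) (\<lambda>x. bd X 1 x) (\<lambda>b. bd Y 1 (\<psi> 1 b)) (u (1, 1))"
    by (rule tensor_map_comp[OF Xm Tm Xm Ym Xm Ym module_hom_id \<psi>1 bd1(1,2) u11])
  also have "\<dots> = ?v"
    by (rule tensor_map_cong[OF Xm Tm Xm Ym bd1(1) module_hom_comp[OF \<psi>1 bd1(2)] _ _ u11]) (simp_all add: e2_bd)
  also have "sign_smult (star_Md R X Y 0) 1 (dsum_inj B (0, 0) ?v) = dsum_inj B (0, 0) (sign_smult ?T 1 ?v)"
    using module_hom_sign_smult[OF B0_hom T star_module v, of 1] by simp
  finally have L: "bd (star_product R X Y) 1 (Psi R T X Y \<psi> e2 1 u) = dsum_inj B (0, 0) (sign_smult ?T 1 ?v)" .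
  let ?g = "tensor_map R (Md X 0) (Md Y 0) (\<lambda>x. x) (\<lambda>b. e2 (bd T 1 b))"
  have g: "?g \<in> module_hom R (tensor_module R (Md X 0) (Md T 1)) ?T"
    by (rule tensor_map_hom[OF Xm Tm Xm Ym module_hom_id e2_bd_hom])
  let ?a = "tensor_map R (Md X 0) (Md T 1) (bd X 1) (\<lambda>y. y) (u (1, 1))"
  let ?b = "tensor_map R (Md X 0) (Md T 1) (\<lambda>x. x) (bd T 2) (u (0, 2))"
  note TT = module_tensor[OF Xm Tm]
  have a: "?a \<in> carrier (tensor_module R (Md X 0) (Md T 1))"
    by (rule module_hom_closed[OF tensor_map_hom[OF Xm Tm Xm Tm bd1(1) module_hom_id] u11])
  have b: "?b \<in> carrier (tensor_module R (Md X 0) (Md T 1))"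
    by (rule module_hom_closed[OF tensor_map_hom[OF Xm Tm Xm Tm module_hom_id T2] u02])
  have "XT.tot u (0, 1) = ?a \<oplus>\<^bsub>tensor_module R (Md X 0) (Md T 1)\<^esub> ?b"
    by (simp add: XT.tot_apply tensor_D1_def tensor_D2_def trunc1_Md trunc1_bd sign_smult_def)
  moreover have "?g ?b = \<zero>\<^bsub>?T\<^esub>"
    using tensor_map_comp[OF Xm Tm Xm Tm Xm Ym module_hom_id T2 module_hom_id e2_bd_hom u02]
      tensor_map_zero[OF Xm Tm Xm Ym module_hom_comp[OF module_hom_id module_hom_id] module_hom_comp[OF T2 e2_bd_hom] _ u02]
      chain_complex_bd_bd[OF T_chain, of _ 2] e2[of "\<zero>\<^bsub>Md T 0\<^esub>"] module_hom_zero[OF chain_map_hom[OF \<psi>] Tm Ym]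
      abelian_monoid.zero_closed[OF abelian_group.axioms(1)[OF module_abelian_group[OF Tm]], of 0] by simp
  moreover have "?g ?a = ?v"
    by (rule tensor_map_comp[OF Xm Tm Xm Tm Xm Ym bd1(1) module_hom_id module_hom_id e2_bd_hom u11])
  ultimately have "?g (XT.tot u (0, 1)) = ?v"
    using module_hom_add[OF g a b] v abelian_monoid.r_zero[OF abelian_group.axioms(1)[OF module_abelian_group[OF T]]] by simp
  moreover have tu: "XT.tot u \<in> carrier (XT.Tot 1)" using XT.tot_closed[OF u] by simp
  moreover have pr: "(\<lambda>u. u (0, 1)) \<in> module_hom R (XT.Tot 1) (tensor_module R (Md X 0) (Md T 1))"
    using dsum_proj_hom[of "(0, 1)" R "{(i, j). i + j = 1}" "bigraded_tensor R X (trunc1 T)"] by (simp add: trunc1_1)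
  moreover have "XT.tot u (0, 1) \<in> carrier (tensor_module R (Md X 0) (Md T 1))"
    by (rule module_hom_closed[OF pr tu])
  ultimately have "?g (sign_smult (XT.Tot 1) (- 1) (XT.tot u) (0, 1)) = sign_smult ?T 1 ?v"
    using module_hom_sign_smult[OF pr XT.Tot_module TT tu, of "- 1"]
      module_hom_sign_smult[OF g TT T, of "XT.tot u (0, 1)" "- 1"]
    by (simp add: sign_smult_def)
  then show ?thesis
    using L Psi_0[OF sign_smult_closed[OF XT.Tot_module tu, of "- 1"]] by simp
qed

lemma Psi_comm:
  assumes u: "u \<in> carrier (tensor_cplx_Md R X (trunc1 T) (n + 1))"
  shows "bd (star_product R X Y) n (Psi R T X Y \<psi> e2 n u) =
    Psi R T X Y \<psi> e2 (n - 1) (sign_smult (tensor_cplx_Md R X (trunc1 T) n) (- 1) (bd (tensor_cplx R X (trunc1 T)) (n + 1) u))"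
proof (cases "n = 1")
  case True
  then have "u \<in> carrier (XT.Tot 2)" using u by (simp add: tensor_cplx_Md_def)
  then show ?thesis using True Psi_comm_1 tensor_cplx_bd[OF X tT, of u 2] by (simp add: tensor_cplx_Md_def)
next
  case False
  show ?thesis by (rule star_map_comm[OF X tT Psi_factors Psi_hom Psi_pos False u])
qed

subsection \<open>The map \<Omega>\<close>

abbreviation \<Omega> where "\<Omega> \<equiv> Omega R X Y (Phi R S X Y \<phi> e1) (Psi R T X Y \<psi> e2)"

abbreviation source where "source \<equiv> Omega_source R S T X Y"

lemma source_chain_complex: "chain_complex R source"
  unfolding Omega_source_def
  by (intro dsum_cplx_chain_complex shift_chain_complex tensor_cplx_chain_complex tS Y X tT)

lemma source_Md: "Md source n = prod_module (SY.Tot (n + 1)) (XT.Tot (n + 1))"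
  by (simp add: Omega_source_def dsum_cplx_def shift_simps tensor_Md tensor_cplx_Md_def)

lemma source_bd: "u \<in> carrier (SY.Tot (n + 1)) \<Longrightarrow> v \<in> carrier (XT.Tot (n + 1)) \<Longrightarrow>
    bd source n (u, v) = (sign_smult (SY.Tot n) (- 1) (SY.tot u), sign_smult (XT.Tot n) (- 1) (XT.tot v))"
  using tensor_cplx_bd[OF tS Y, of u "n + 1"] tensor_cplx_bd[OF X tT, of v "n + 1"]
  by (simp add: Omega_source_def dsum_cplx_def shift_simps tensor_Md tensor_cplx_Md_def)

lemma Omega_chain_map: "chain_map R source (star_product R X Y) \<Omega>"
  unfolding chain_map_def star_Md_product
proof (intro allI conjI ballI)
  fix n
  have F: "Phi R S X Y \<phi> e1 n \<in> module_hom R (SY.Tot (n + 1)) (star_Md R X Y n)"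
    using Phi_hom[of n] by (simp add: tensor_cplx_Md_def)
  have G: "Psi R T X Y \<psi> e2 n \<in> module_hom R (XT.Tot (n + 1)) (star_Md R X Y n)"
    using Psi_hom[of n] by (simp add: tensor_cplx_Md_def)
  have "(\<lambda>z. Phi R S X Y \<phi> e1 n (fst z) \<oplus>\<^bsub>star_Md R X Y n\<^esub> Psi R T X Y \<psi> e2 n (snd z))
      \<in> module_hom R (Md source n) (star_Md R X Y n)"
  proof (rule module_hom_plus[OF module_hom_comp[OF _ F] module_hom_comp[OF _ G] star_module])
    show "fst \<in> module_hom R (Md source n) (SY.Tot (n + 1))" unfolding source_Md by (rule module_homI) auto
    show "snd \<in> module_hom R (Md source n) (XT.Tot (n + 1))" unfolding source_Md by (rule module_homI) auto
  qed
  then show "\<Omega> n \<in> module_hom R (Md source n) (star_Md R X Y n)"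
    by (simp add: Omega_def case_prod_beta')
  fix z assume "z \<in> carrier (Md source n)"
  then obtain u v where z: "z = (u, v)" and u: "u \<in> carrier (SY.Tot (n + 1))" and v: "v \<in> carrier (XT.Tot (n + 1))"
    by (auto simp: source_Md)
  have bh: "bd (star_product R X Y) n \<in> module_hom R (star_Md R X Y n) (star_Md R X Y (n - 1))"
    using chain_complex_hom[OF star_chain_complex, of n] by (simp add: star_Md_product)
  show "bd (star_product R X Y) n (\<Omega> n z) = \<Omega> (n - 1) (bd source n z)"
    using Phi_comm[of u n] Psi_comm[of v n] u v tensor_cplx_bd[OF tS Y u] tensor_cplx_bd[OF X tT v]
      module_hom_add[OF bh module_hom_closed[OF F u] module_hom_closed[OF G v]]
    by (simp add: z source_bd Omega_def tensor_cplx_Md_def)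
qed

end

section \<open>Exactness of the cone\<close>

text \<open>The maps \<open>\<phi>'\<close> and \<open>\<psi>'\<close> invert \<open>\<phi>\<close> and \<open>\<psi>\<close> in degree zero.  The three edge conditions are
  the form in which the Tor-independence of the pairs \<open>{I, J}\<close>, \<open>{I', J}\<close> and \<open>{I, J'}\<close> is used.\<close>

locale star_exact = star_setup R X Y S T \<phi> \<psi> e1 e2
  for R :: "('a, 'r) ring_scheme" and X :: "('a, 'x) cplx" and Y :: "('a, 'y) cplx"
    and S :: "('a, 's) cplx" and T :: "('a, 't) cplx" and \<phi> \<psi> e1 e2 +
  fixes \<phi>' :: "'x \<Rightarrow> 's" and \<psi>' :: "'y \<Rightarrow> 't"
  assumes X_free: "\<And>n. free_module R (Md X n)" and Y_free: "\<And>n. free_module R (Md Y n)"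
    and S_free: "\<And>n. free_module R (Md S n)" and T_free: "\<And>n. free_module R (Md T n)"
    and X_exact: "\<And>n. 1 \<le> n \<Longrightarrow> cycles X n = boundaries X n"
    and Y_exact: "\<And>n. 1 \<le> n \<Longrightarrow> cycles Y n = boundaries Y n"
    and \<phi>0: "\<phi>' \<in> module_hom R (Md X 0) (Md S 0)" "\<And>a. a \<in> carrier (Md S 0) \<Longrightarrow> \<phi>' (\<phi> 0 a) = a"
    and \<psi>0: "\<psi>' \<in> module_hom R (Md Y 0) (Md T 0)" "\<And>a. a \<in> carrier (Md T 0) \<Longrightarrow> \<psi>' (\<psi> 0 a) = a"
    and XY_edge: "\<And>n z w. 1 \<le> n \<Longrightarrow> z \<in> carrier (tensor_module R (Md X n) (Md Y 0)) \<Longrightarrow>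
       w \<in> carrier (tensor_module R (Md X (n - 1)) (Md Y 1)) \<Longrightarrow> tensor_D1 R X Y n 0 z = tensor_D2 R X Y (n - 1) 1 w \<Longrightarrow>
       \<exists>u\<in>carrier (tensor_module R (Md X (n + 1)) (Md Y 0)). \<exists>v\<in>carrier (tensor_module R (Md X n) (Md Y 1)).
         z = tensor_D1 R X Y (n + 1) 0 u \<oplus>\<^bsub>tensor_module R (Md X n) (Md Y 0)\<^esub> tensor_D2 R X Y n 1 v"
    and SY_edge: "\<And>n z w. 1 \<le> n \<Longrightarrow> z \<in> carrier (tensor_module R (Md S n) (Md Y 0)) \<Longrightarrow>
       w \<in> carrier (tensor_module R (Md S (n - 1)) (Md Y 1)) \<Longrightarrow> tensor_D1 R S Y n 0 z = tensor_D2 R S Y (n - 1) 1 w \<Longrightarrow>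
       \<exists>u\<in>carrier (tensor_module R (Md S (n + 1)) (Md Y 0)). \<exists>v\<in>carrier (tensor_module R (Md S n) (Md Y 1)).
         z = tensor_D1 R S Y (n + 1) 0 u \<oplus>\<^bsub>tensor_module R (Md S n) (Md Y 0)\<^esub> tensor_D2 R S Y n 1 v"
    and XT_edge: "\<And>n z w. 1 \<le> n \<Longrightarrow> z \<in> carrier (tensor_module R (Md X 0) (Md T n)) \<Longrightarrow>
       w \<in> carrier (tensor_module R (Md X 1) (Md T (n - 1))) \<Longrightarrow> tensor_D2 R X T 0 n z = tensor_D1 R X T 1 (n - 1) w \<Longrightarrow>
       \<exists>u\<in>carrier (tensor_module R (Md X 1) (Md T n)). \<exists>v\<in>carrier (tensor_module R (Md X 0) (Md T (n + 1))).
         z = tensor_D1 R X T 1 n u \<oplus>\<^bsub>tensor_module R (Md X 0) (Md T n)\<^esub> tensor_D2 R X T 0 (n + 1) v"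
begin

sublocale XY0: double_complex R B "tensor_D1 R X Y" "tensor_D2 R X Y"
  by (rule tensor_double_complex[OF X Y])

text \<open>The edge condition of \<open>X \<otimes> Y\<close> along its bottom row, moved up to the bottom row of the truncated
  double complex.\<close>

lemma XY_corner:
  assumes i: "1 \<le> i" and z: "z \<in> carrier (tensor_module R (Md X i) (Md Y 1))"
    and 0: "tensor_D1 R X Y i 0 (tensor_D2 R X Y i 1 z) = \<zero>\<^bsub>tensor_module R (Md X (i - 1)) (Md Y 0)\<^esub>"
  shows "\<exists>u\<in>carrier (tensor_module R (Md X (i + 1)) (Md Y 1)). \<exists>v\<in>carrier (tensor_module R (Md X i) (Md Y 2)).
     z = tensor_D1 R X Y (i + 1) 1 u \<oplus>\<^bsub>tensor_module R (Md X i) (Md Y 1)\<^esub> tensor_D2 R X Y i 2 v"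
proof -
  have "\<exists>u\<in>carrier (B (i + 1, 0 + 1)). \<exists>v\<in>carrier (B (i, 0 + 1 + 1)).
     z = tensor_D1 R X Y (i + 1) (0 + 1) u \<oplus>\<^bsub>B (i, 0 + 1)\<^esub> tensor_D2 R X Y i (0 + 1 + 1) v"
  proof (rule XY0.corner_chase)
    show "\<exists>y\<in>carrier (B (i + 1, 0)). x = tensor_D1 R X Y (i + 1) 0 y"
      if "x \<in> carrier (B (i, 0))" "tensor_D1 R X Y i 0 x = \<zero>\<^bsub>B (i - 1, 0)\<^esub>" for x
      using tensor_row_exact[OF X Y Y_free X_exact[OF i]] that by simp
    show "\<exists>y\<in>carrier (B (i, 0 + 1 + 1)). x = tensor_D2 R X Y i (0 + 1 + 1) y"
      if "x \<in> carrier (B (i, 0 + 1))" "tensor_D2 R X Y i (0 + 1) x = \<zero>\<^bsub>B (i, 0)\<^esub>" for x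
      using tensor_column_exact[OF X Y X_free Y_exact, of 1 x i] that by simp
    show "\<exists>u\<in>carrier (B (i + 1 + 1, 0)). \<exists>v\<in>carrier (B (i + 1, 0 + 1)).
       x = tensor_D1 R X Y (i + 1 + 1) 0 u \<oplus>\<^bsub>B (i + 1, 0)\<^esub> tensor_D2 R X Y (i + 1) (0 + 1) v"
      if "x \<in> carrier (B (i + 1, 0))" "w \<in> carrier (B (i, 0 + 1))" "tensor_D1 R X Y (i + 1) 0 x = tensor_D2 R X Y i (0 + 1) w" for x w
      using XY_edge[of "i + 1" x w] i that by simp
  qed (use z 0 in simp_all)
  then show ?thesis by simp
qed

lemma tensor_D1_D2:
  assumes "z \<in> carrier (tensor_module R (Md X i) (Md Y 1))"
  shows "tensor_D1 R X Y i 0 (tensor_D2 R X Y i 1 z) =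
    sign_smult (tensor_module R (Md X (i - 1)) (Md Y 0)) i (tensor_map R (Md X (i - 1)) (Md Y 0) (bd X i) (bd Y 1) z)"
proof -
  have v: "tensor_map R (Md X i) (Md Y 0) (\<lambda>x. x) (bd Y 1) z \<in> carrier (tensor_module R (Md X i) (Md Y 0))"
    by (rule module_hom_closed[OF tensor_map_hom[OF Xm Ym Xm Ym module_hom_id bd1(2)] assms])
  show ?thesis
    using module_hom_sign_smult[OF tensor_D1_hom[OF X Y] module_tensor[OF Xm Ym] module_tensor[OF Xm Ym] v, of i]
      tensor_map_comp[OF Xm Ym Xm Ym Xm Ym module_hom_id bd1(2) chain_complex_hom[OF X] module_hom_id assms]
    by (simp add: tensor_D2_def tensor_D1_def)
qed

lemma tensor_truncated:
  "1 < i \<Longrightarrow> 1 \<le> j \<Longrightarrow> tensor_D1 R (trunc1 X) (trunc1 Y) i j = tensor_D1 R X Y i j"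
  "1 \<le> i \<Longrightarrow> 1 < j \<Longrightarrow> tensor_D2 R (trunc1 X) (trunc1 Y) i j = tensor_D2 R X Y i j"
  "1 < i \<Longrightarrow> tensor_D1 R (trunc1 S) Y i j = tensor_D1 R S Y i j"
  "1 \<le> i \<Longrightarrow> tensor_D2 R (trunc1 S) Y i j = tensor_D2 R S Y i j"
  "1 \<le> j \<Longrightarrow> tensor_D1 R X (trunc1 T) i j = tensor_D1 R X T i j"
  "1 < j \<Longrightarrow> tensor_D2 R X (trunc1 T) i j = tensor_D2 R X T i j"
  by (simp_all add: tensor_D1_def tensor_D2_def trunc1_Md trunc1_bd)

lemma XY_boundary:
  assumes n: "3 \<le> n" and f: "f \<in> carrier (XY.Tot n)" and tf: "XY.tot f = (\<lambda>k. \<zero>\<^bsub>bigraded_tensor R (trunc1 X) (trunc1 Y) k\<^esub>)"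
  shows "XY.boundary n f"
proof (rule XY.columns_exact_imp_boundary[of 1 1, OF _ _ _ _ f tf])
  fix i j :: int assume "i < 1"
  then show "carrier (bigraded_tensor R (trunc1 X) (trunc1 Y) (i, j)) = {\<zero>\<^bsub>bigraded_tensor R (trunc1 X) (trunc1 Y) (i, j)\<^esub>}"
    by (intro XY_trivial) simp
next
  fix i j :: int assume "j < 1"
  then show "carrier (bigraded_tensor R (trunc1 X) (trunc1 Y) (i, j)) = {\<zero>\<^bsub>bigraded_tensor R (trunc1 X) (trunc1 Y) (i, j)\<^esub>}"
    by (intro XY_trivial) simp
next
  fix i j x assume "i + j = n" "1 < j" and x: "x \<in> carrier (bigraded_tensor R (trunc1 X) (trunc1 Y) (i, j))"
    "tensor_D2 R (trunc1 X) (trunc1 Y) i j x = \<zero>\<^bsub>bigraded_tensor R (trunc1 X) (trunc1 Y) (i, j - 1)\<^esub>"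
  then have "cycles (trunc1 Y) j = boundaries (trunc1 Y) j" by (intro trunc1_exact Y_exact) simp_all
  then show "\<exists>y\<in>carrier (bigraded_tensor R (trunc1 X) (trunc1 Y) (i, j + 1)). x = tensor_D2 R (trunc1 X) (trunc1 Y) i (j + 1) y"
    using tensor_column_exact[OF tX tY trunc1_free[OF X_free]] x by simp
next
  fix i x w
  assume i: "i + 1 = n" and x: "x \<in> carrier (bigraded_tensor R (trunc1 X) (trunc1 Y) (i, 1))"
    and w: "w \<in> carrier (bigraded_tensor R (trunc1 X) (trunc1 Y) (i - 1, 1 + 1))"
    and eq: "tensor_D1 R (trunc1 X) (trunc1 Y) i 1 x = tensor_D2 R (trunc1 X) (trunc1 Y) (i - 1) (1 + 1) w"
  have i2: "2 \<le> i" using i n by simp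
  have x': "x \<in> carrier (B (i, 1))" using x i2 by (simp add: trunc1_Md)
  have w': "w \<in> carrier (B (i - 1, 2))" using w i2 by (simp add: trunc1_Md)
  have eq': "tensor_D1 R X Y i 1 x = tensor_D2 R X Y (i - 1) 2 w"
    using eq i2 by (simp add: tensor_truncated)
  have "tensor_D1 R X Y i 0 (tensor_D2 R X Y i 1 x) \<oplus>\<^bsub>B (i - 1, 0)\<^esub> tensor_D2 R X Y (i - 1) 1 (tensor_D1 R X Y i 1 x) = \<zero>\<^bsub>B (i - 1, 0)\<^esub>"
    using XY0.D1_D2[OF x'] by simp
  moreover have "tensor_D2 R X Y (i - 1) 1 (tensor_D1 R X Y i 1 x) = \<zero>\<^bsub>B (i - 1, 0)\<^esub>"
    unfolding eq' using XY0.D2_D2[OF w'] by simp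
  moreover have "tensor_D1 R X Y i 0 (tensor_D2 R X Y i 1 x) \<in> carrier (B (i - 1, 0))"
    using XY0.D1_closed[of "tensor_D2 R X Y i 1 x" i 0] XY0.D2_closed[OF x'] by simp
  ultimately have "tensor_D1 R X Y i 0 (tensor_D2 R X Y i 1 x) = \<zero>\<^bsub>tensor_module R (Md X (i - 1)) (Md Y 0)\<^esub>"
    using XY0.A_rzero[where k = "(i - 1, 0)"] by simp
  from XY_corner[OF _ _ this] x' i2
  show "\<exists>u\<in>carrier (bigraded_tensor R (trunc1 X) (trunc1 Y) (i + 1, 1)). \<exists>v\<in>carrier (bigraded_tensor R (trunc1 X) (trunc1 Y) (i, 1 + 1)).
     x = tensor_D1 R (trunc1 X) (trunc1 Y) (i + 1) 1 u \<oplus>\<^bsub>bigraded_tensor R (trunc1 X) (trunc1 Y) (i, 1)\<^esub> tensor_D2 R (trunc1 X) (trunc1 Y) i (1 + 1) v"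
    by (simp add: tensor_truncated trunc1_Md)
qed

text \<open>In bidegree (1, 1) the corner chase applies because \<open>\<partial>\<^sub>1 \<otimes> \<partial>\<^sub>1\<close> is, up to sign, the composite of
  the two differentials out of the corner of the untruncated double complex.\<close>

lemma XY_boundary_2:
  assumes f: "f \<in> carrier (XY.Tot 2)"
    and z: "tensor_map R (Md X 0) (Md Y 0) (bd X 1) (bd Y 1) (f (1, 1)) = \<zero>\<^bsub>tensor_module R (Md X 0) (Md Y 0)\<^esub>"
  shows "XY.boundary 2 f"
proof -
  have f11: "f (1, 1) \<in> carrier (tensor_module R (Md X 1) (Md Y 1))"
    using XY_component[OF f, of 1 1] by (simp add: trunc1_1)
  have "tensor_D1 R X Y 1 0 (tensor_D2 R X Y 1 1 (f (1, 1))) = \<zero>\<^bsub>tensor_module R (Md X (1 - 1)) (Md Y 0)\<^esub>"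
    using tensor_D1_D2[OF f11] z sign_smult_zero[OF module_tensor[OF Xm Ym]] by simp
  from XY_corner[OF _ f11 this] obtain u v where
    uv: "u \<in> carrier (tensor_module R (Md X 2) (Md Y 1))" "v \<in> carrier (tensor_module R (Md X 1) (Md Y 2))"
    "f (1, 1) = tensor_D1 R X Y 2 1 u \<oplus>\<^bsub>tensor_module R (Md X 1) (Md Y 1)\<^esub> tensor_D2 R X Y 1 2 v" by auto
  show ?thesis
  proof (rule XY.boundary_of_component[OF f, of 1 1 u v])
    fix a b :: int assume "a + b = 2" "a \<noteq> 1"
    then show "carrier (bigraded_tensor R (trunc1 X) (trunc1 Y) (a, b)) = {\<zero>\<^bsub>bigraded_tensor R (trunc1 X) (trunc1 Y) (a, b)\<^esub>}"
      by (intro XY_trivial) linarith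
  qed (use uv in \<open>simp_all add: trunc1_Md tensor_truncated\<close>)
qed

lemma B0_zeroD:
  assumes "dsum_inj B (0, 0) t = \<zero>\<^bsub>star_Md R X Y 0\<^esub>"
  shows "t = \<zero>\<^bsub>tensor_module R (Md X 0) (Md Y 0)\<^esub>"
  using fun_cong[OF assms, of "(0, 0)"] by (simp add: star_Md_0)

lemma star_exact:
  assumes "1 \<le> n"
  shows "cycles (star_product R X Y) n = boundaries (star_product R X Y) n"
proof
  show "boundaries (star_product R X Y) n \<subseteq> cycles (star_product R X Y) n"
    using module_hom_closed[OF chain_complex_hom_up[OF star_chain_complex, of n]]
      chain_complex_bd_bd[OF star_chain_complex, of _ "n + 1"]
    by (auto simp: boundaries_def cycles_def)
  show "cycles (star_product R X Y) n \<subseteq> boundaries (star_product R X Y) n"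
  proof
    fix f assume c: "f \<in> cycles (star_product R X Y) n"
    then have f: "f \<in> carrier (XY.Tot (n + 1))" using assms by (simp add: cycles_def star_Md_product star_Md_pos)
    have "XY.boundary (n + 1) f"
    proof (cases "n = 1")
      case True
      have f2: "f \<in> carrier (XY.Tot 2)" using f True by simp
      show ?thesis
        using XY_boundary_2[OF f2 B0_zeroD] c star_bd_1[OF f2] True by (simp add: cycles_def star_Md_product)
    next
      case False
      then show ?thesis
        using XY_boundary[OF _ f] c assms star_bd_pos[OF _ f] by (simp add: cycles_def star_Md_product star_Md_pos)
    qed
    then obtain g where "g \<in> carrier (XY.Tot (n + 1 + 1))" "XY.tot g = f" by (auto simp: XY.boundary_def)
    then show "f \<in> boundaries (star_product R X Y) n"
      using star_bd_pos[of "n + 1" g] assms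
      by (auto simp: boundaries_def star_Md_product star_Md_pos intro!: image_eqI[of _ _ g])
  qed
qed

text \<open>For total degree at least two the bottom row contributes only in bidegrees (i, 0) with \<open>i \<ge> 2\<close>,
  where the truncation of \<open>S\<close> is not felt and the edge condition applies.\<close>

lemma SY_boundary:
  assumes n: "2 \<le> n" and f: "f \<in> carrier (SY.Tot n)" and tf: "SY.tot f = (\<lambda>k. \<zero>\<^bsub>bigraded_tensor R (trunc1 S) Y k\<^esub>)"
  shows "SY.boundary n f"
proof (rule SY.columns_exact_imp_boundary[of 1 0, OF _ _ _ _ f tf])
  fix i j :: int assume "i < 1"
  then show "carrier (bigraded_tensor R (trunc1 S) Y (i, j)) = {\<zero>\<^bsub>bigraded_tensor R (trunc1 S) Y (i, j)\<^esub>}"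
    by (intro SY_trivial) simp
next
  fix i j :: int assume "j < 0"
  then show "carrier (bigraded_tensor R (trunc1 S) Y (i, j)) = {\<zero>\<^bsub>bigraded_tensor R (trunc1 S) Y (i, j)\<^esub>}"
    by (intro SY_trivial) simp
next
  fix i j x assume "i + j = n" "0 < j" and x: "x \<in> carrier (bigraded_tensor R (trunc1 S) Y (i, j))"
    "tensor_D2 R (trunc1 S) Y i j x = \<zero>\<^bsub>bigraded_tensor R (trunc1 S) Y (i, j - 1)\<^esub>"
  then show "\<exists>y\<in>carrier (bigraded_tensor R (trunc1 S) Y (i, j + 1)). x = tensor_D2 R (trunc1 S) Y i (j + 1) y"
    using tensor_column_exact[OF tS Y trunc1_free[OF S_free] Y_exact, of j x i] by simp
next
  fix i x w
  assume i: "i + 0 = n" and x: "x \<in> carrier (bigraded_tensor R (trunc1 S) Y (i, 0))"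
    and w: "w \<in> carrier (bigraded_tensor R (trunc1 S) Y (i - 1, 0 + 1))"
    and eq: "tensor_D1 R (trunc1 S) Y i 0 x = tensor_D2 R (trunc1 S) Y (i - 1) (0 + 1) w"
  have i2: "2 \<le> i" using i n by simp
  show "\<exists>u\<in>carrier (bigraded_tensor R (trunc1 S) Y (i + 1, 0)). \<exists>v\<in>carrier (bigraded_tensor R (trunc1 S) Y (i, 0 + 1)).
     x = tensor_D1 R (trunc1 S) Y (i + 1) 0 u \<oplus>\<^bsub>bigraded_tensor R (trunc1 S) Y (i, 0)\<^esub> tensor_D2 R (trunc1 S) Y i (0 + 1) v"
    using SY_edge[of i x w] i2 x w eq by (simp add: tensor_truncated trunc1_Md)
qed

lemma XT_boundary:
  assumes n: "2 \<le> n" and f: "f \<in> carrier (XT.Tot n)" and tf: "XT.tot f = (\<lambda>k. \<zero>\<^bsub>bigraded_tensor R X (trunc1 T) k\<^esub>)"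
  shows "XT.boundary n f"
proof (rule XT.rows_exact_imp_boundary[of 0 1, OF _ _ _ _ f tf])
  fix i j :: int assume "i < 0"
  then show "carrier (bigraded_tensor R X (trunc1 T) (i, j)) = {\<zero>\<^bsub>bigraded_tensor R X (trunc1 T) (i, j)\<^esub>}"
    by (intro XT_trivial) simp
next
  fix i j :: int assume "j < 1"
  then show "carrier (bigraded_tensor R X (trunc1 T) (i, j)) = {\<zero>\<^bsub>bigraded_tensor R X (trunc1 T) (i, j)\<^esub>}"
    by (intro XT_trivial) simp
next
  fix i j x assume "i + j = n" "0 < i" and x: "x \<in> carrier (bigraded_tensor R X (trunc1 T) (i, j))"
    "tensor_D1 R X (trunc1 T) i j x = \<zero>\<^bsub>bigraded_tensor R X (trunc1 T) (i - 1, j)\<^esub>"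
  then show "\<exists>y\<in>carrier (bigraded_tensor R X (trunc1 T) (i + 1, j)). x = tensor_D1 R X (trunc1 T) (i + 1) j y"
    using tensor_row_exact[OF X tT trunc1_free[OF T_free] X_exact, of i x j] by simp
next
  fix j x w
  assume j: "0 + j = n" and x: "x \<in> carrier (bigraded_tensor R X (trunc1 T) (0, j))"
    and w: "w \<in> carrier (bigraded_tensor R X (trunc1 T) (0 + 1, j - 1))"
    and eq: "tensor_D2 R X (trunc1 T) 0 j x = tensor_D1 R X (trunc1 T) (0 + 1) (j - 1) w"
  have j2: "2 \<le> j" using j n by simp
  show "\<exists>u\<in>carrier (bigraded_tensor R X (trunc1 T) (0 + 1, j)). \<exists>v\<in>carrier (bigraded_tensor R X (trunc1 T) (0, j + 1)).
     x = tensor_D1 R X (trunc1 T) (0 + 1) j u \<oplus>\<^bsub>bigraded_tensor R X (trunc1 T) (0, j)\<^esub> tensor_D2 R X (trunc1 T) 0 (j + 1) v"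
    using XT_edge[of j x w] j2 x w eq by (simp add: tensor_truncated trunc1_Md)
qed

text \<open>A cycle of the cone in degree one gives \<open>a \<in> I'\<close> and \<open>b \<in> J'\<close> with \<open>a + b \<in> IJ\<close>.  Then \<open>a \<in> J\<close> and
  \<open>b \<in> I\<close>, and the edge conditions in degree one say that \<open>I' \<inter> J = I'J\<close> and \<open>I \<inter> J' = IJ'\<close>.\<close>

lemma degree_1_boundaries:
  assumes d: "d \<in> carrier (XY.Tot 2)" and u: "u \<in> carrier (SY.Tot 1)" and v: "v \<in> carrier (XT.Tot 1)"
    and eq: "bd (star_product R X Y) 1 d \<oplus>\<^bsub>star_Md R X Y 0\<^esub>
       (Phi R S X Y \<phi> e1 0 u \<oplus>\<^bsub>star_Md R X Y 0\<^esub> Psi R T X Y \<psi> e2 0 v) = \<zero>\<^bsub>star_Md R X Y 0\<^esub>"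
  shows "SY.boundary 1 u" "XT.boundary 1 v"
proof -
  let ?T = "tensor_module R (Md X 0) (Md Y 0)"
  note Th = module_tensor[OF Xm Ym]
  interpret T0: module R ?T by (rule Th)
  have d11: "d (1, 1) \<in> carrier (tensor_module R (Md X 1) (Md Y 1))" using XY_component[OF d, of 1 1] by (simp add: trunc1_1)
  have u10: "u (1, 0) \<in> carrier (tensor_module R (Md S 1) (Md Y 0))" using SY_component[OF u, of 1 0] by (simp add: trunc1_1)
  have v01: "v (0, 1) \<in> carrier (tensor_module R (Md X 0) (Md T 1))" using XT_component[OF v, of 0 1] by (simp add: trunc1_1)
  have \<phi>1: "\<phi> 1 \<in> module_hom R (Md S 1) (Md X 1)" and \<psi>1: "\<psi> 1 \<in> module_hom R (Md T 1) (Md Y 1)"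
    by (rule chain_map_hom[OF \<phi>] chain_map_hom[OF \<psi>])+
  let ?\<alpha> = "tensor_map R (Md X 0) (Md Y 0) (\<lambda>x. bd X 1 x) (\<lambda>y. bd Y 1 y) (d (1, 1))"
  let ?\<beta> = "tensor_map R (Md X 0) (Md Y 0) (\<lambda>a. e1 (bd S 1 a)) (\<lambda>y. y) (u (1, 0))"
  let ?\<gamma> = "tensor_map R (Md X 0) (Md Y 0) (\<lambda>x. x) (\<lambda>b. e2 (bd T 1 b)) (v (0, 1))"
  have \<alpha>: "?\<alpha> \<in> carrier ?T" by (rule module_hom_closed[OF tensor_map_hom[OF Xm Ym Xm Ym bd1(1,2)] d11])
  have \<beta>: "?\<beta> \<in> carrier ?T" by (rule module_hom_closed[OF tensor_map_hom[OF Sm Ym Xm Ym e1_bd_hom module_hom_id] u10])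
  have \<gamma>: "?\<gamma> \<in> carrier ?T" by (rule module_hom_closed[OF tensor_map_hom[OF Xm Tm Xm Ym module_hom_id e2_bd_hom] v01])
  have "dsum_inj B (0, 0) (?\<alpha> \<oplus>\<^bsub>?T\<^esub> (?\<beta> \<oplus>\<^bsub>?T\<^esub> ?\<gamma>)) = \<zero>\<^bsub>star_Md R X Y 0\<^esub>"
    using eq star_bd_1[OF d] Phi_0[OF u] Psi_0[OF v] module_hom_add[OF B0_hom \<alpha> T0.M.a_closed[OF \<beta> \<gamma>]]
      module_hom_add[OF B0_hom \<beta> \<gamma>] by simp
  then have sum: "?\<alpha> \<oplus>\<^bsub>?T\<^esub> (?\<beta> \<oplus>\<^bsub>?T\<^esub> ?\<gamma>) = \<zero>\<^bsub>?T\<^esub>" by (rule B0_zeroD)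
  have "?\<beta> \<oplus>\<^bsub>?T\<^esub> (?\<alpha> \<oplus>\<^bsub>?T\<^esub> ?\<gamma>) = \<zero>\<^bsub>?T\<^esub>" using sum T0.M.a_lcomm[OF \<beta> \<alpha> \<gamma>] by simp
  then have \<beta>eq: "?\<beta> = \<ominus>\<^bsub>?T\<^esub> (?\<alpha> \<oplus>\<^bsub>?T\<^esub> ?\<gamma>)"
    by (rule module_add_eq_zeroD[OF Th \<beta> T0.M.a_closed[OF \<alpha> \<gamma>]])
  have "?\<gamma> \<oplus>\<^bsub>?T\<^esub> (?\<alpha> \<oplus>\<^bsub>?T\<^esub> ?\<beta>) = \<zero>\<^bsub>?T\<^esub>" using sum \<alpha> \<beta> \<gamma> by (simp add: T0.M.a_ac)
  then have \<gamma>eq: "?\<gamma> = \<ominus>\<^bsub>?T\<^esub> (?\<alpha> \<oplus>\<^bsub>?T\<^esub> ?\<beta>)"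
    by (rule module_add_eq_zeroD[OF Th \<gamma> T0.M.a_closed[OF \<alpha> \<beta>]])
  show "SY.boundary 1 u"
  proof -
    let ?V = "tensor_map R (Md X 0) (Md Y 0) (\<lambda>x. x) (bd Y 1)"
    let ?a = "tensor_map R (Md X 0) (Md Y 1) (bd X 1) (\<lambda>y. y) (d (1, 1))"
    let ?c = "tensor_map R (Md X 0) (Md Y 1) (\<lambda>x. x) (\<psi> 1) (v (0, 1))"
    let ?T1 = "tensor_module R (Md X 0) (Md Y 1)"
    note T1 = module_tensor[OF Xm Ym]
    interpret T1: module R ?T1 by (rule T1)
    have V: "?V \<in> module_hom R ?T1 ?T" by (rule tensor_map_hom[OF Xm Ym Xm Ym module_hom_id bd1(2)])
    have a: "?a \<in> carrier ?T1" by (rule module_hom_closed[OF tensor_map_hom[OF Xm Ym Xm Ym bd1(1) module_hom_id] d11])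
    have c: "?c \<in> carrier ?T1" by (rule module_hom_closed[OF tensor_map_hom[OF Xm Tm Xm Ym module_hom_id \<psi>1] v01])
    have Va: "?V ?a = ?\<alpha>"
      using tensor_map_comp[OF Xm Ym Xm Ym Xm Ym bd1(1) module_hom_id module_hom_id bd1(2) d11] .
    have Vc: "?V ?c = ?\<gamma>"
      using tensor_map_comp[OF Xm Tm Xm Ym Xm Ym module_hom_id \<psi>1 module_hom_id bd1(2) v01]
        tensor_map_cong[OF Xm Tm Xm Ym module_hom_id e2_bd_hom _ _ v01, of "\<lambda>x. x" "\<lambda>b. bd Y 1 (\<psi> 1 b)"] e2_bd by simp
    \<comment> \<open>The image of \<open>u\<close> in \<open>X\<^sub>0 \<otimes> Y\<^sub>0\<close> comes from \<open>X\<^sub>0 \<otimes> Y\<^sub>1\<close>, that is, it lies in \<open>J\<close>.\<close>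
    let ?w = "\<ominus>\<^bsub>?T1\<^esub> (?a \<oplus>\<^bsub>?T1\<^esub> ?c)"
    have w: "?w \<in> carrier ?T1" using a c by simp
    have Vw: "?V ?w = ?\<beta>"
      using module_hom_minus[OF V T1 Th T1.M.a_closed[OF a c]] module_hom_add[OF V a c] Va Vc \<beta>eq by simp
    let ?p = "tensor_map R (Md S 0) (Md Y 0) \<phi>' (\<lambda>y. y)"
    have "?p ?\<beta> = tensor_map R (Md S 0) (Md Y 0) (\<lambda>a. \<phi>' (e1 (bd S 1 a))) (\<lambda>y. y) (u (1, 0))"
      by (rule tensor_map_comp[OF Sm Ym Xm Ym Sm Ym e1_bd_hom module_hom_id \<phi>0(1) module_hom_id u10])
    also have "\<dots> = tensor_map R (Md S 0) (Md Y 0) (bd S 1) (\<lambda>y. y) (u (1, 0))"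
      by (rule tensor_map_cong[OF Sm Ym Sm Ym module_hom_comp[OF e1_bd_hom \<phi>0(1)] module_hom_id _ _ u10])
        (use e1 \<phi>0(2) module_hom_closed[OF bd1(3)] in auto)
    finally have 1: "tensor_D1 R S Y 1 0 (u (1, 0)) = ?p (?V ?w)" using Vw by (simp add: tensor_D1_def)
    let ?w' = "tensor_map R (Md S 0) (Md Y 1) \<phi>' (\<lambda>y. y) ?w"
    have w': "?w' \<in> carrier (tensor_module R (Md S 0) (Md Y 1))"
      by (rule module_hom_closed[OF tensor_map_hom[OF Xm Ym Sm Ym \<phi>0(1) module_hom_id] w])
    have "?p (?V ?w) = tensor_D2 R S Y 0 1 ?w'"
      using tensor_map_comp[OF Xm Ym Xm Ym Sm Ym module_hom_id bd1(2) \<phi>0(1) module_hom_id w]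
        tensor_map_comp[OF Xm Ym Sm Ym Sm Ym \<phi>0(1) module_hom_id module_hom_id bd1(2) w]
      by (simp add: tensor_D2_def sign_smult_def)
    then obtain p q where pq: "p \<in> carrier (tensor_module R (Md S 2) (Md Y 0))" "q \<in> carrier (tensor_module R (Md S 1) (Md Y 1))"
      "u (1, 0) = tensor_D1 R S Y 2 0 p \<oplus>\<^bsub>tensor_module R (Md S 1) (Md Y 0)\<^esub> tensor_D2 R S Y 1 1 q"
      using SY_edge[of 1 "u (1, 0)" ?w'] u10 w' 1 by auto
    show ?thesis
    proof (rule SY.boundary_of_component[OF u, of 1 0 p q])
      fix a b :: int assume "a + b = 1" "a \<noteq> 1"
      then show "carrier (bigraded_tensor R (trunc1 S) Y (a, b)) = {\<zero>\<^bsub>bigraded_tensor R (trunc1 S) Y (a, b)\<^esub>}"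
        by (intro SY_trivial) linarith
    qed (use pq in \<open>simp_all add: trunc1_Md tensor_truncated\<close>)
  qed
  show "XT.boundary 1 v"
  proof -
    let ?H = "tensor_map R (Md X 0) (Md Y 0) (bd X 1) (\<lambda>y. y)"
    let ?a = "tensor_map R (Md X 1) (Md Y 0) (\<lambda>x. x) (bd Y 1) (d (1, 1))"
    let ?c = "tensor_map R (Md X 1) (Md Y 0) (\<phi> 1) (\<lambda>y. y) (u (1, 0))"
    let ?T1 = "tensor_module R (Md X 1) (Md Y 0)"
    note T1 = module_tensor[OF Xm Ym]
    interpret T1: module R ?T1 by (rule T1)
    have H: "?H \<in> module_hom R ?T1 ?T" by (rule tensor_map_hom[OF Xm Ym Xm Ym bd1(1) module_hom_id])
    have a: "?a \<in> carrier ?T1" by (rule module_hom_closed[OF tensor_map_hom[OF Xm Ym Xm Ym module_hom_id bd1(2)] d11])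
    have c: "?c \<in> carrier ?T1" by (rule module_hom_closed[OF tensor_map_hom[OF Sm Ym Xm Ym \<phi>1 module_hom_id] u10])
    have Ha: "?H ?a = ?\<alpha>"
      using tensor_map_comp[OF Xm Ym Xm Ym Xm Ym module_hom_id bd1(2) bd1(1) module_hom_id d11] .
    have Hc: "?H ?c = ?\<beta>"
      using tensor_map_comp[OF Sm Ym Xm Ym Xm Ym \<phi>1 module_hom_id bd1(1) module_hom_id u10]
        tensor_map_cong[OF Sm Ym Xm Ym e1_bd_hom module_hom_id _ _ u10, of "\<lambda>a. bd X 1 (\<phi> 1 a)" "\<lambda>y. y"] e1_bd by simp
    \<comment> \<open>The image of \<open>v\<close> in \<open>X\<^sub>0 \<otimes> Y\<^sub>0\<close> comes from \<open>X\<^sub>1 \<otimes> Y\<^sub>0\<close>, that is, it lies in \<open>I\<close>.\<close>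
    let ?w = "\<ominus>\<^bsub>?T1\<^esub> (?a \<oplus>\<^bsub>?T1\<^esub> ?c)"
    have w: "?w \<in> carrier ?T1" using a c by simp
    have Hw: "?H ?w = ?\<gamma>"
      using module_hom_minus[OF H T1 Th T1.M.a_closed[OF a c]] module_hom_add[OF H a c] Ha Hc \<gamma>eq by simp
    let ?p = "tensor_map R (Md X 0) (Md T 0) (\<lambda>x. x) \<psi>'"
    have "?p ?\<gamma> = tensor_map R (Md X 0) (Md T 0) (\<lambda>x. x) (\<lambda>b. \<psi>' (e2 (bd T 1 b))) (v (0, 1))"
      by (rule tensor_map_comp[OF Xm Tm Xm Ym Xm Tm module_hom_id e2_bd_hom module_hom_id \<psi>0(1) v01])
    also have "\<dots> = tensor_map R (Md X 0) (Md T 0) (\<lambda>x. x) (bd T 1) (v (0, 1))"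
      by (rule tensor_map_cong[OF Xm Tm Xm Tm module_hom_id module_hom_comp[OF e2_bd_hom \<psi>0(1)] _ _ v01])
        (use e2 \<psi>0(2) module_hom_closed[OF bd1(4)] in auto)
    finally have 1: "tensor_D2 R X T 0 1 (v (0, 1)) = ?p (?H ?w)" using Hw by (simp add: tensor_D2_def sign_smult_def)
    let ?w' = "tensor_map R (Md X 1) (Md T 0) (\<lambda>x. x) \<psi>' ?w"
    have w': "?w' \<in> carrier (tensor_module R (Md X 1) (Md T 0))"
      by (rule module_hom_closed[OF tensor_map_hom[OF Xm Ym Xm Tm module_hom_id \<psi>0(1)] w])
    have "?p (?H ?w) = tensor_D1 R X T 1 0 ?w'"
      using tensor_map_comp[OF Xm Ym Xm Ym Xm Tm bd1(1) module_hom_id module_hom_id \<psi>0(1) w]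
        tensor_map_comp[OF Xm Ym Xm Tm Xm Tm module_hom_id \<psi>0(1) bd1(1) module_hom_id w]
      by (simp add: tensor_D1_def)
    then obtain p q where pq: "p \<in> carrier (tensor_module R (Md X 1) (Md T 1))" "q \<in> carrier (tensor_module R (Md X 0) (Md T 2))"
      "v (0, 1) = tensor_D1 R X T 1 1 p \<oplus>\<^bsub>tensor_module R (Md X 0) (Md T 1)\<^esub> tensor_D2 R X T 0 2 q"
      using XT_edge[of 1 "v (0, 1)" ?w'] v01 w' 1 by auto
    show ?thesis
    proof (rule XT.boundary_of_component[OF v, of 0 1 p q])
      fix a b :: int assume "a + b = 1" "a \<noteq> 0"
      then show "carrier (bigraded_tensor R X (trunc1 T) (a, b)) = {\<zero>\<^bsub>bigraded_tensor R X (trunc1 T) (a, b)\<^esub>}"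
        by (intro XT_trivial) linarith
    qed (use pq in \<open>simp_all add: trunc1_Md tensor_truncated\<close>)
  qed
qed

lemma sign_minus_one_zeroD:
  assumes "module R M" "x \<in> carrier M" "sign_smult M (- 1) x = \<zero>\<^bsub>M\<^esub>"
  shows "x = \<zero>\<^bsub>M\<^esub>"
  using sign_smult_sign_smult[OF assms(1,2), of "- 1"] assms(3) sign_smult_zero[OF assms(1)] by simp

lemma source_boundaryI:
  assumes u: "SY.boundary n u" and v: "XT.boundary n v"
  shows "(u, v) \<in> boundaries source (n - 1)"
proof -
  obtain a where a: "a \<in> carrier (SY.Tot (n + 1))" "SY.tot a = u" using u by (auto simp: SY.boundary_def)
  obtain b where b: "b \<in> carrier (XT.Tot (n + 1))" "XT.tot b = v" using v by (auto simp: XT.boundary_def)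
  let ?a = "sign_smult (SY.Tot (n + 1)) (- 1) a" and ?b = "sign_smult (XT.Tot (n + 1)) (- 1) b"
  have ac: "?a \<in> carrier (SY.Tot (n + 1))" by (rule sign_smult_closed[OF SY.Tot_module a(1)])
  have bc: "?b \<in> carrier (XT.Tot (n + 1))" by (rule sign_smult_closed[OF XT.Tot_module b(1)])
  have "SY.tot a \<in> carrier (SY.Tot n)" "XT.tot b \<in> carrier (XT.Tot n)"
    using SY.tot_closed[OF a(1)] XT.tot_closed[OF b(1)] by simp_all
  then have "bd source n (?a, ?b) = (u, v)"
    using source_bd[OF ac bc] module_hom_sign_smult[OF SY.tot_hom SY.Tot_module SY.Tot_module a(1), of "- 1"]
      module_hom_sign_smult[OF XT.tot_hom XT.Tot_module XT.Tot_module b(1), of "- 1"]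
      sign_smult_sign_smult[OF SY.Tot_module, of u n "- 1"] sign_smult_sign_smult[OF XT.Tot_module, of v n "- 1"] a(2) b(2)
    by (simp del: dsum_module_simps)
  moreover have "(?a, ?b) \<in> carrier (Md source n)" using ac bc by (simp add: source_Md)
  ultimately show ?thesis by (auto simp: boundaries_def intro!: image_eqI[of _ _ "(?a, ?b)"])
qed

text \<open>Every cycle of the cone has a boundary of the source as its second component: in degree one by
  \<open>degree_1_boundaries\<close>, and in higher degrees because the source is exact there.\<close>

lemma cone_exact:
  assumes n: "1 \<le> n"
  shows "cycles (mapping_cone source (star_product R X Y) \<Omega>) n = boundaries (mapping_cone source (star_product R X Y) \<Omega>) n"
proof (rule mapping_cone_exact[OF source_chain_complex star_chain_complex Omega_chain_map star_exact[OF n]])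
  fix d c assume d: "d \<in> carrier (Md (star_product R X Y) n)" and c: "c \<in> cycles source (n - 1)"
    and eq: "bd (star_product R X Y) n d \<oplus>\<^bsub>Md (star_product R X Y) (n - 1)\<^esub> \<Omega> (n - 1) c = \<zero>\<^bsub>Md (star_product R X Y) (n - 1)\<^esub>"
  obtain u v where uv: "c = (u, v)" "u \<in> carrier (SY.Tot n)" "v \<in> carrier (XT.Tot n)"
    using c by (auto simp: cycles_def source_Md)
  show "c \<in> boundaries source (n - 1)"
    unfolding uv(1)
  proof (cases "n = 1")
    case True
    show "(u, v) \<in> boundaries source (n - 1)"
      by (rule source_boundaryI; unfold True; rule degree_1_boundaries[of d])
        (use d uv eq True in \<open>simp_all add: star_Md_product star_Md_pos Omega_def del: dsum_module_simps\<close>)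
  next
    case False
    then have n2: "2 \<le> n" using n by simp
    have tu: "SY.tot u \<in> carrier (SY.Tot (n - 1))" and tv: "XT.tot v \<in> carrier (XT.Tot (n - 1))"
      by (rule SY.tot_closed[OF uv(2)] XT.tot_closed[OF uv(3)])+
    have "bd source (n - 1) (u, v) = \<zero>\<^bsub>Md source (n - 2)\<^esub>"
      using c by (simp add: cycles_def uv(1))
    moreover have "Md source (n - 2) = prod_module (SY.Tot (n - 1)) (XT.Tot (n - 1))"
      using source_Md[of "n - 2"] by simp
    ultimately have "sign_smult (SY.Tot (n - 1)) (- 1) (SY.tot u) = \<zero>\<^bsub>SY.Tot (n - 1)\<^esub>"
      "sign_smult (XT.Tot (n - 1)) (- 1) (XT.tot v) = \<zero>\<^bsub>XT.Tot (n - 1)\<^esub>"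
      using source_bd[of u "n - 1" v] uv(2,3) by (simp_all del: dsum_module_simps)
    then have "SY.tot u = \<zero>\<^bsub>SY.Tot (n - 1)\<^esub>" "XT.tot v = \<zero>\<^bsub>XT.Tot (n - 1)\<^esub>"
      using sign_minus_one_zeroD[OF SY.Tot_module tu] sign_minus_one_zeroD[OF XT.Tot_module tv] by blast+
    then show "(u, v) \<in> boundaries source (n - 1)"
      using SY_boundary[OF n2 uv(2)] XT_boundary[OF n2 uv(3)] by (intro source_boundaryI) simp_all
  qed
qed

lemma cone_Md: "Md (mapping_cone source (star_product R X Y) \<Omega>) n =
    prod_module (star_Md R X Y n) (prod_module (SY.Tot n) (XT.Tot n))"
  using source_Md[of "n - 1"] by (simp add: mapping_cone_def star_Md_product)

lemma cone_free: "free_module R (Md (mapping_cone source (star_product R X Y) \<Omega>) n)"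
proof -
  have f: "free_module R (dsum_module K (bigraded_tensor R P Q))"
    if "\<And>i. free_module R (Md P i)" "\<And>j. free_module R (Md Q j)"
    for K and P :: "('a, 'p) cplx" and Q :: "('a, 'q) cplx"
  proof (rule free_module_dsum[OF XY.cring])
    show "free_module R (bigraded_tensor R P Q k)" for k
      using free_module_tensor[OF that] by (cases k) simp
  qed
  have "free_module R (star_Md R X Y n)"
    using f[OF trunc1_free[OF X_free] trunc1_free[OF Y_free]] f[OF X_free Y_free]
    by (simp add: star_Md_def tensor_cplx_def tensor_cplx_Md_def)
  then show ?thesis
    unfolding cone_Md
    using f[OF trunc1_free[OF S_free] Y_free] f[OF X_free trunc1_free[OF T_free]]
    by (intro free_module_prod)
qed

lemma Tot_trivial_nonpos:
  assumes "n \<le> 0"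
  shows "carrier (SY.Tot n) = {\<zero>\<^bsub>SY.Tot n\<^esub>}" "carrier (XT.Tot n) = {\<zero>\<^bsub>XT.Tot n\<^esub>}"
proof -
  have e: "carrier (dsum_module {} M) = {\<zero>\<^bsub>dsum_module {} M\<^esub>}" if "\<And>k. module R (M k)" for M :: "int \<times> int \<Rightarrow> ('a, 'z) module"
    using abelian_monoid.zero_closed[OF abelian_group.axioms(1)[OF module_abelian_group[OF that]]]
    by (auto simp: dsum_carrier_iff)
  have k: "{(i, j). i + j = n \<and> 1 \<le> i \<and> 0 \<le> j} = {}" "{(i, j). i + j = n \<and> 0 \<le> i \<and> 1 \<le> j} = {}" using assms by auto
  show "carrier (SY.Tot n) = {\<zero>\<^bsub>SY.Tot n\<^esub>}"
    unfolding SY_Tot k by (rule e[of "bigraded_tensor R (trunc1 S) Y", OF SY.A_module])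
  show "carrier (XT.Tot n) = {\<zero>\<^bsub>XT.Tot n\<^esub>}"
    unfolding XT_Tot k by (rule e[of "bigraded_tensor R X (trunc1 T)", OF XT.A_module])
qed

lemma cone_neg:
  assumes "n < 0"
  shows "carrier (Md (mapping_cone source (star_product R X Y) \<Omega>) n) =
    {\<zero>\<^bsub>Md (mapping_cone source (star_product R X Y) \<Omega>) n\<^esub>}"
proof -
  have "\<zero>\<^bsub>star_Md R X Y n\<^esub> \<in> carrier (star_Md R X Y n)"
    by (rule abelian_monoid.zero_closed[OF abelian_group.axioms(1)[OF module_abelian_group[OF star_module]]])
  then have "carrier (star_Md R X Y n) = {\<zero>\<^bsub>star_Md R X Y n\<^esub>}"
    by (intro equalityI subsetI) (drule star_neg_trivial[OF assms], simp, simp)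
  then show ?thesis
    using Tot_trivial_nonpos[of n] assms unfolding cone_Md prod_module_simps by simp
qed

lemmas cone_chain_complex = mapping_cone_chain_complex[OF source_chain_complex star_chain_complex Omega_chain_map]

lemma cone_bd_1:
  assumes "d \<in> carrier (XY.Tot 2)" "u \<in> carrier (SY.Tot 1)" "v \<in> carrier (XT.Tot 1)"
  shows "bd (mapping_cone source (star_product R X Y) \<Omega>) 1 (d, (u, v)) = (dsum_inj B (0, 0)
      (tensor_map R (Md X 0) (Md Y 0) (bd X 1) (bd Y 1) (d (1, 1)) \<oplus>\<^bsub>tensor_module R (Md X 0) (Md Y 0)\<^esub>
       (tensor_map R (Md X 0) (Md Y 0) (\<lambda>a. e1 (bd S 1 a)) (\<lambda>y. y) (u (1, 0)) \<oplus>\<^bsub>tensor_module R (Md X 0) (Md Y 0)\<^esub>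
        tensor_map R (Md X 0) (Md Y 0) (\<lambda>x. x) (\<lambda>b. e2 (bd T 1 b)) (v (0, 1)))), (\<zero>\<^bsub>SY.Tot 0\<^esub>, \<zero>\<^bsub>XT.Tot 0\<^esub>))"
proof -
  note d = assms(1) and u = assms(2) and v = assms(3)
  interpret T0: module R "tensor_module R (Md X 0) (Md Y 0)" by (rule module_tensor[OF Xm Ym])
  have "d (1, 1) \<in> carrier (tensor_module R (Md X 1) (Md Y 1))" using XY_component[OF d, of 1 1] by (simp add: trunc1_1)
  note \<alpha> = module_hom_closed[OF tensor_map_hom[OF Xm Ym Xm Ym bd1(1,2)] this]
  have "u (1, 0) \<in> carrier (tensor_module R (Md S 1) (Md Y 0))" using SY_component[OF u, of 1 0] by (simp add: trunc1_1)
  note \<beta> = module_hom_closed[OF tensor_map_hom[OF Sm Ym Xm Ym e1_bd_hom module_hom_id] this]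
  have "v (0, 1) \<in> carrier (tensor_module R (Md X 0) (Md T 1))" using XT_component[OF v, of 0 1] by (simp add: trunc1_1)
  note \<gamma> = module_hom_closed[OF tensor_map_hom[OF Xm Tm Xm Ym module_hom_id e2_bd_hom] this]
  let ?K = "mapping_cone source (star_product R X Y) \<Omega>"
  have "(d, (u, v)) \<in> carrier (Md ?K 1)" using d u v by (simp add: cone_Md star_Md_pos)
  from module_hom_closed[OF chain_complex_hom[OF cone_chain_complex, of 1] this]
  have "snd (bd ?K 1 (d, (u, v))) \<in> carrier (SY.Tot 0) \<times> carrier (XT.Tot 0)"
    by (auto simp: cone_Md)
  then have s: "snd (bd ?K 1 (d, (u, v))) = (\<zero>\<^bsub>SY.Tot 0\<^esub>, \<zero>\<^bsub>XT.Tot 0\<^esub>)"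
    using Tot_trivial_nonpos[of 0] by auto
  have "fst (bd ?K 1 (d, (u, v))) = bd (star_product R X Y) 1 d \<oplus>\<^bsub>star_Md R X Y 0\<^esub>
       (Phi R S X Y \<phi> e1 0 u \<oplus>\<^bsub>star_Md R X Y 0\<^esub> Psi R T X Y \<psi> e2 0 v)"
    by (simp add: mapping_cone_def star_Md_product Omega_def)
  also have "\<dots> = dsum_inj B (0, 0)
      (tensor_map R (Md X 0) (Md Y 0) (bd X 1) (bd Y 1) (d (1, 1)) \<oplus>\<^bsub>tensor_module R (Md X 0) (Md Y 0)\<^esub>
       (tensor_map R (Md X 0) (Md Y 0) (\<lambda>a. e1 (bd S 1 a)) (\<lambda>y. y) (u (1, 0)) \<oplus>\<^bsub>tensor_module R (Md X 0) (Md Y 0)\<^esub>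
        tensor_map R (Md X 0) (Md Y 0) (\<lambda>x. x) (\<lambda>b. e2 (bd T 1 b)) (v (0, 1))))"
    using star_bd_1[OF d] Phi_0[OF u] Psi_0[OF v] module_hom_add[OF B0_hom \<alpha> T0.M.a_closed[OF \<beta> \<gamma>]]
      module_hom_add[OF B0_hom \<beta> \<gamma>] by simp
  finally show ?thesis using s by (simp add: prod_eq_iff)
qed

end

section \<open>The augmentation of the cone\<close>

text \<open>The map \<open>g\<close> reads off elements of \<open>R\<close> in degree zero.  Through it the image of the first
  differential becomes the ideal \<open>I\<close>.\<close>

lemma cyclic_resolutionD:
  assumes R: "cring R" and I: "ideal I R" and C: "cyclic_resolution R I C e"
  defines "g \<equiv> inv_into (carrier R) e"
  shows "augmented_free_resolution R C (\<lambda>x. I +>\<^bsub>R\<^esub> g x) (cyclic_module R I)"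
    and "e \<in> module_hom R (regular_module R) (Md C 0)"
    and "g \<in> module_hom R (Md C 0) (regular_module R)"
    and "\<And>x. x \<in> carrier (Md C 0) \<Longrightarrow> e (g x) = x"
    and "\<And>r. r \<in> carrier R \<Longrightarrow> g (e r) = r"
    and "\<And>x. x \<in> carrier (Md C 1) \<Longrightarrow> g (bd C 1 x) \<in> I"
    and "\<And>a. a \<in> I \<Longrightarrow> \<exists>x\<in>carrier (Md C 1). g (bd C 1 x) = a"
proof -
  interpret cring R by fact
  have e: "e \<in> module_hom R (regular_module R) (Md C 0)" and bij: "bij_betw e (carrier R) (carrier (Md C 0))"
    using C by (simp_all add: cyclic_resolution_def module_iso_def)
  show afr: "augmented_free_resolution R C (\<lambda>x. I +>\<^bsub>R\<^esub> g x) (cyclic_module R I)"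
    using C by (simp add: cyclic_resolution_def g_def)
  note Cm = chain_complex_module[OF afr_chain[OF afr]]
  show "e \<in> module_hom R (regular_module R) (Md C 0)" by fact
  show eg: "e (g x) = x" if "x \<in> carrier (Md C 0)" for x
    using that bij by (simp add: g_def bij_betw_inv_into_right)
  show ge: "g (e r) = r" if "r \<in> carrier R" for r
    using that bij by (simp add: g_def bij_betw_inv_into_left)
  have gc: "g x \<in> carrier R" if "x \<in> carrier (Md C 0)" for x
    using that bij by (simp add: g_def bij_betw_def inv_into_into)
  show "g \<in> module_hom R (Md C 0) (regular_module R)"
  proof (rule module_homI)
    fix x assume x: "x \<in> carrier (Md C 0)"
    then show "g x \<in> carrier (regular_module R)" using gc by simp
    show "g (x \<oplus>\<^bsub>Md C 0\<^esub> y) = g x \<oplus>\<^bsub>regular_module R\<^esub> g y" if y: "y \<in> carrier (Md C 0)" for y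
      using ge[of "g x \<oplus>\<^bsub>R\<^esub> g y"] module_hom_add[OF e, of "g x" "g y"] gc[OF x] gc[OF y] eg[OF x] eg[OF y] by simp
    show "g (r \<odot>\<^bsub>Md C 0\<^esub> x) = r \<odot>\<^bsub>regular_module R\<^esub> g x" if "r \<in> carrier R" for r
      using ge[of "r \<otimes>\<^bsub>R\<^esub> g x"] module_hom_smult[OF e that, of "g x"] gc[OF x] eg[OF x] that by simp
  qed
  have bh: "bd C 1 \<in> module_hom R (Md C 1) (Md C 0)"
    using chain_complex_hom[OF afr_chain[OF afr], of 1] by simp
  show "g (bd C 1 x) \<in> I" if "x \<in> carrier (Md C 1)" for x
    using afr_aug_bd[OF afr that] cyclic_coset_eq_zero[OF R I gc[OF module_hom_closed[OF bh that]]] cyclic_zero[OF R I] by simp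
  show "\<exists>x\<in>carrier (Md C 1). g (bd C 1 x) = a" if a: "a \<in> I" for a
  proof -
    have aR: "a \<in> carrier R" by (rule ideal.Icarr[OF I a])
    have ea: "e a \<in> carrier (Md C 0)" using module_hom_closed[OF e] aR by simp
    have "I +>\<^bsub>R\<^esub> g (e a) = \<zero>\<^bsub>cyclic_module R I\<^esub>"
      using cyclic_coset_eq_zero[OF R I aR] a ge[OF aR] cyclic_zero[OF R I] by simp
    then have "e a \<in> bd C 1 ` carrier (Md C 1)" using afr_kernel[OF afr ea] by simp
    then obtain x where "x \<in> carrier (Md C 1)" "e a = bd C 1 x" by auto
    then show ?thesis using ge[OF aR] by (metis)
  qed
qed

context star_exact
begin

abbreviation cone where "cone \<equiv> mapping_cone source (star_product R X Y) \<Omega>"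

text \<open>The map \<open>\<rho>'\<close> below identifies degree zero of the cone, which is \<open>X\<^sub>0 \<otimes> Y\<^sub>0\<close>, with \<open>R\<close>.  The
  three summands in degree one are mapped to \<open>IJ\<close>, \<open>I'\<close> and \<open>J'\<close>, so the boundaries correspond to
  the ideal \<open>K\<close> generated by these.\<close>

lemma cone_augmentation:
  assumes I: "ideal I R" and J: "ideal J R" and I': "ideal I' R" and J': "ideal J' R"
    and gX: "gX \<in> module_hom R (Md X 0) (regular_module R)" and gY: "gY \<in> module_hom R (Md Y 0) (regular_module R)"
    and eX: "eX \<in> module_hom R (regular_module R) (Md X 0)" and eY: "eY \<in> module_hom R (regular_module R) (Md Y 0)"
    and egX: "\<And>x. x \<in> carrier (Md X 0) \<Longrightarrow> eX (gX x) = x" and egY: "\<And>y. y \<in> carrier (Md Y 0) \<Longrightarrow> eY (gY y) = y"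
    and geX: "\<And>r. r \<in> carrier R \<Longrightarrow> gX (eX r) = r" and geY: "\<And>r. r \<in> carrier R \<Longrightarrow> gY (eY r) = r"
    and IX: "\<And>x. x \<in> carrier (Md X 1) \<Longrightarrow> gX (bd X 1 x) \<in> I" "\<And>a. a \<in> I \<Longrightarrow> \<exists>x\<in>carrier (Md X 1). gX (bd X 1 x) = a"
    and JY: "\<And>y. y \<in> carrier (Md Y 1) \<Longrightarrow> gY (bd Y 1 y) \<in> J" "\<And>a. a \<in> J \<Longrightarrow> \<exists>y\<in>carrier (Md Y 1). gY (bd Y 1 y) = a"
    and IS: "\<And>s. s \<in> carrier (Md S 1) \<Longrightarrow> gX (e1 (bd S 1 s)) \<in> I'" "\<And>a. a \<in> I' \<Longrightarrow> \<exists>s\<in>carrier (Md S 1). gX (e1 (bd S 1 s)) = a"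
    and JT: "\<And>t. t \<in> carrier (Md T 1) \<Longrightarrow> gY (e2 (bd T 1 t)) \<in> J'" "\<And>a. a \<in> J' \<Longrightarrow> \<exists>t\<in>carrier (Md T 1). gY (e2 (bd T 1 t)) = a"
  defines "K \<equiv> genideal R (I' \<union> (ideal_prod R I J) \<union> J')"
  shows "\<exists>\<epsilon>. augmented_free_resolution R cone \<epsilon> (cyclic_module R K)"
proof -
  interpret cring R by (rule XY.cring)
  note RR = module_regular[OF XY.cring]
  interpret RR: module R "regular_module R" by (rule RR)
  note T0m = module_tensor[OF Xm Ym]
  let ?T0 = "tensor_module R (Md X 0) (Md Y 0)"
  interpret T0: module R ?T0 by (rule T0m)
  have gXc: "x \<in> carrier (Md X 0) \<Longrightarrow> gX x \<in> carrier R" for x using module_hom_closed[OF gX] by simp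
  have gYc: "x \<in> carrier (Md Y 0) \<Longrightarrow> gY x \<in> carrier R" for x using module_hom_closed[OF gY] by simp
  have sub: "I' \<subseteq> carrier R" "J' \<subseteq> carrier R" "ideal_prod R I J \<subseteq> carrier R"
    using ideal.Icarr[OF I'] ideal.Icarr[OF J'] ideal_prod_in_carrier[OF I J] by blast+
  have KI: "ideal K R" unfolding K_def by (rule genideal_ideal) (use sub in auto)
  have Ksup: "I' \<subseteq> K" "J' \<subseteq> K" "ideal_prod R I J \<subseteq> K"
    using genideal_self[of "I' \<union> (ideal_prod R I J) \<union> J'"] sub unfolding K_def by auto
  note KS = ideal_submodule[OF XY.cring KI]
  define \<rho> where "\<rho> = tensor_lift (regular_module R) (\<lambda>x y. gX x \<otimes>\<^bsub>R\<^esub> gY y)"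
  have bal: "balanced_map R (Md X 0) (Md Y 0) (regular_module R) (\<lambda>x y. gX x \<otimes>\<^bsub>R\<^esub> gY y)"
    by (rule balanced_mapI; rule module_homI)
      (auto simp: gXc gYc module_hom_add[OF gX] module_hom_add[OF gY] module_hom_smult[OF gX] module_hom_smult[OF gY]
        r_distr l_distr m_ac)
  have \<rho>: "\<rho> \<in> module_hom R ?T0 (regular_module R)"
    unfolding \<rho>_def by (rule tensor_lift_module_hom[OF Xm Ym RR bal])
  have \<rho>p: "\<rho> (pure_tensor R (Md X 0) (Md Y 0) x y) = gX x \<otimes>\<^bsub>R\<^esub> gY y"
    if "x \<in> carrier (Md X 0)" "y \<in> carrier (Md Y 0)" for x y
    unfolding \<rho>_def by (rule tensor_lift_pure_tensor[OF Xm Ym RR bal that])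
  have eY1: "eY \<one>\<^bsub>R\<^esub> \<in> carrier (Md Y 0)" and eX1: "eX \<one>\<^bsub>R\<^esub> \<in> carrier (Md X 0)"
    using module_hom_closed[OF eY] module_hom_closed[OF eX] by simp_all
  have \<sigma>: "pure_tensor R (Md X 0) (Md Y 0) (eX (\<rho> t)) (eY \<one>\<^bsub>R\<^esub>) = t" if t: "t \<in> carrier ?T0" for t
  proof (rule tensor_module_hom_eq[OF Xm Ym T0m
        module_hom_comp[OF module_hom_comp[OF \<rho> eX] pure_tensor_hom_left[OF Xm Ym eY1]] module_hom_id _ t])
    fix x y assume x: "x \<in> carrier (Md X 0)" and y: "y \<in> carrier (Md Y 0)"
    have "eX (gX x \<otimes>\<^bsub>R\<^esub> gY y) = gY y \<odot>\<^bsub>Md X 0\<^esub> x"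
      using module_hom_smult[OF eX gYc[OF y], of "gX x"] gXc[OF x] gYc[OF y] egX[OF x] by (simp add: m_comm)
    moreover have "gY y \<odot>\<^bsub>Md Y 0\<^esub> eY \<one>\<^bsub>R\<^esub> = y"
      using module_hom_smult[OF eY gYc[OF y], of "\<one>\<^bsub>R\<^esub>"] gYc[OF y] egY[OF y] by simp
    ultimately show "pure_tensor R (Md X 0) (Md Y 0) (eX (\<rho> (pure_tensor R (Md X 0) (Md Y 0) x y))) (eY \<one>\<^bsub>R\<^esub>)
        = pure_tensor R (Md X 0) (Md Y 0) x y"
      using \<rho>p[OF x y] module_hom_smult[OF pure_tensor_hom_left[OF Xm Ym eY1] gYc[OF y] x]
        module_hom_smult[OF pure_tensor_hom_right[OF Xm Ym x] gYc[OF y] eY1] by simp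
  qed
  have C0: "carrier (Md cone 0) = carrier (star_Md R X Y 0) \<times> ({\<zero>\<^bsub>SY.Tot 0\<^esub>} \<times> {\<zero>\<^bsub>XT.Tot 0\<^esub>})"
    unfolding cone_Md prod_module_simps using Tot_trivial_nonpos[of 0] by simp
  note Cm = chain_complex_module[OF cone_chain_complex]
  define \<rho>' where "\<rho>' = (\<lambda>z :: ('x, 'y) bitensor \<times> ('s, 'y) bitensor \<times> ('x, 't) bitensor. \<rho> (fst z (0, 0)))"
  have fsth: "fst \<in> module_hom R (Md cone 0) (star_Md R X Y 0)"
    unfolding cone_Md by (rule module_homI) auto
  have pr: "(\<lambda>d. d (0, 0)) \<in> module_hom R (star_Md R X Y 0) ?T0"
    using dsum_proj_hom[of "(0, 0)" R "{(0, 0)}" B] by (simp add: star_Md_0)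
  have \<rho>': "\<rho>' \<in> module_hom R (Md cone 0) (regular_module R)"
    unfolding \<rho>'_def by (rule module_hom_comp[OF module_hom_comp[OF fsth pr] \<rho>])
  have \<rho>'_inj: "z = z'" if z: "z \<in> carrier (Md cone 0)" "z' \<in> carrier (Md cone 0)" and eq: "\<rho>' z = \<rho>' z'" for z z'
  proof -
    have c: "fst z \<in> carrier (star_Md R X Y 0)" "fst z' \<in> carrier (star_Md R X Y 0)" "snd z = snd z'"
      using z unfolding C0 by auto
    have "fst z (0, 0) = fst z' (0, 0)"
      using \<sigma>[OF module_hom_closed[OF pr c(1)], symmetric] \<sigma>[OF module_hom_closed[OF pr c(2)]] eq
      by (simp only: \<rho>'_def)
    moreover have "fst z k = fst z' k" if "k \<noteq> (0, 0)" for k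
      using dsum_outside[OF c(1)[unfolded star_Md_0], of k] dsum_outside[OF c(2)[unfolded star_Md_0], of k] that by simp
    ultimately have "fst z = fst z'" by (intro ext) metis
    then show ?thesis using c(3) by (simp add: prod_eq_iff)
  qed
  have \<rho>'_surj: "\<exists>z\<in>carrier (Md cone 0). \<rho>' z = r" if r: "r \<in> carrier R" for r
  proof -
    have er: "eX r \<in> carrier (Md X 0)" using module_hom_closed[OF eX] r by simp
    let ?z = "(dsum_inj B (0, 0) (pure_tensor R (Md X 0) (Md Y 0) (eX r) (eY \<one>\<^bsub>R\<^esub>)), (\<zero>\<^bsub>SY.Tot 0\<^esub>, \<zero>\<^bsub>XT.Tot 0\<^esub>))"
    have "?z \<in> carrier (Md cone 0)"
      unfolding C0 using module_hom_closed[OF B0_hom pure_tensor_closed[OF Xm Ym er eY1]] by simp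
    moreover have "\<rho>' ?z = r" using \<rho>p[OF er eY1] geX[OF r] geY r by (simp add: \<rho>'_def)
    ultimately show ?thesis by blast
  qed
  let ?h\<alpha> = "\<lambda>t. \<rho> (tensor_map R (Md X 0) (Md Y 0) (bd X 1) (bd Y 1) t)"
  let ?h\<beta> = "\<lambda>t. \<rho> (tensor_map R (Md X 0) (Md Y 0) (\<lambda>a. e1 (bd S 1 a)) (\<lambda>y. y) t)"
  let ?h\<gamma> = "\<lambda>t. \<rho> (tensor_map R (Md X 0) (Md Y 0) (\<lambda>x. x) (\<lambda>b. e2 (bd T 1 b)) t)"
  note t\<alpha> = tensor_map_hom[OF Xm Ym Xm Ym bd1(1,2)]
    and t\<beta> = tensor_map_hom[OF Sm Ym Xm Ym e1_bd_hom module_hom_id]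
    and t\<gamma> = tensor_map_hom[OF Xm Tm Xm Ym module_hom_id e2_bd_hom]
  note h\<alpha> = module_hom_comp[OF t\<alpha> \<rho>] and h\<beta> = module_hom_comp[OF t\<beta> \<rho>] and h\<gamma> = module_hom_comp[OF t\<gamma> \<rho>]
  have p\<alpha>: "?h\<alpha> (pure_tensor R (Md X 1) (Md Y 1) x y) = gX (bd X 1 x) \<otimes>\<^bsub>R\<^esub> gY (bd Y 1 y)"
    if "x \<in> carrier (Md X 1)" "y \<in> carrier (Md Y 1)" for x y
    using that tensor_map_pure[OF Xm Ym Xm Ym bd1(1,2) that] \<rho>p module_hom_closed[OF bd1(1)] module_hom_closed[OF bd1(2)] by simp
  have p\<beta>: "?h\<beta> (pure_tensor R (Md S 1) (Md Y 0) s y) = gX (e1 (bd S 1 s)) \<otimes>\<^bsub>R\<^esub> gY y"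
    if "s \<in> carrier (Md S 1)" "y \<in> carrier (Md Y 0)" for s y
    using that tensor_map_pure[OF Sm Ym Xm Ym e1_bd_hom module_hom_id that] \<rho>p module_hom_closed[OF e1_bd_hom] by simp
  have p\<gamma>: "?h\<gamma> (pure_tensor R (Md X 0) (Md T 1) x t) = gX x \<otimes>\<^bsub>R\<^esub> gY (e2 (bd T 1 t))"
    if "x \<in> carrier (Md X 0)" "t \<in> carrier (Md T 1)" for x t
    using that tensor_map_pure[OF Xm Tm Xm Ym module_hom_id e2_bd_hom that] \<rho>p module_hom_closed[OF e2_bd_hom] by simp
  have K\<alpha>: "?h\<alpha> t \<in> K" if "t \<in> carrier (tensor_module R (Md X 1) (Md Y 1))" for t
  proof (rule spans_image_subset[OF tensor_spans[OF Xm Ym] module_tensor[OF Xm Ym] RR h\<alpha> KS _ that])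
    fix z assume "z \<in> {pure_tensor R (Md X 1) (Md Y 1) x y |x y. x \<in> carrier (Md X 1) \<and> y \<in> carrier (Md Y 1)}"
    then obtain x y where "z = pure_tensor R (Md X 1) (Md Y 1) x y" "x \<in> carrier (Md X 1)" "y \<in> carrier (Md Y 1)" by blast
    then show "?h\<alpha> z \<in> K" using p\<alpha> Ksup(3) ideal_prod.prod[OF IX(1) JY(1), of x y R] by auto
  qed
  have K\<beta>: "?h\<beta> t \<in> K" if "t \<in> carrier (tensor_module R (Md S 1) (Md Y 0))" for t
  proof (rule spans_image_subset[OF tensor_spans[OF Sm Ym] module_tensor[OF Sm Ym] RR h\<beta> KS _ that])
    fix z assume "z \<in> {pure_tensor R (Md S 1) (Md Y 0) x y |x y. x \<in> carrier (Md S 1) \<and> y \<in> carrier (Md Y 0)}"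
    then obtain x y where "z = pure_tensor R (Md S 1) (Md Y 0) x y" "x \<in> carrier (Md S 1)" "y \<in> carrier (Md Y 0)" by blast
    then show "?h\<beta> z \<in> K" using p\<beta> Ksup(1) ideal.I_r_closed[OF KI subsetD[OF Ksup(1) IS(1)] gYc, of x y] by simp
  qed
  have K\<gamma>: "?h\<gamma> t \<in> K" if "t \<in> carrier (tensor_module R (Md X 0) (Md T 1))" for t
  proof (rule spans_image_subset[OF tensor_spans[OF Xm Tm] module_tensor[OF Xm Tm] RR h\<gamma> KS _ that])
    fix z assume "z \<in> {pure_tensor R (Md X 0) (Md T 1) x y |x y. x \<in> carrier (Md X 0) \<and> y \<in> carrier (Md T 1)}"
    then obtain x y where "z = pure_tensor R (Md X 0) (Md T 1) x y" "x \<in> carrier (Md X 0)" "y \<in> carrier (Md T 1)" by blast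
    then show "?h\<gamma> z \<in> K" using p\<gamma> ideal.I_l_closed[OF KI subsetD[OF Ksup(2) JT(1)] gXc, of y x] by simp
  qed
  have bdv: "\<rho>' (bd cone 1 (d, (u, v))) = ?h\<alpha> (d (1, 1)) \<oplus>\<^bsub>R\<^esub> (?h\<beta> (u (1, 0)) \<oplus>\<^bsub>R\<^esub> ?h\<gamma> (v (0, 1)))"
    and mems: "d (1, 1) \<in> carrier (tensor_module R (Md X 1) (Md Y 1))"
      "u (1, 0) \<in> carrier (tensor_module R (Md S 1) (Md Y 0))" "v (0, 1) \<in> carrier (tensor_module R (Md X 0) (Md T 1))"
    if d: "d \<in> carrier (XY.Tot 2)" and u: "u \<in> carrier (SY.Tot 1)" and v: "v \<in> carrier (XT.Tot 1)" for d u v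
  proof -
    show m: "d (1, 1) \<in> carrier (tensor_module R (Md X 1) (Md Y 1))"
      "u (1, 0) \<in> carrier (tensor_module R (Md S 1) (Md Y 0))" "v (0, 1) \<in> carrier (tensor_module R (Md X 0) (Md T 1))"
      using XY_component[OF d, of 1 1] SY_component[OF u, of 1 0] XT_component[OF v, of 0 1] by (simp_all add: trunc1_1)
    show "\<rho>' (bd cone 1 (d, (u, v))) = ?h\<alpha> (d (1, 1)) \<oplus>\<^bsub>R\<^esub> (?h\<beta> (u (1, 0)) \<oplus>\<^bsub>R\<^esub> ?h\<gamma> (v (0, 1)))"
      using cone_bd_1[OF d u v] module_hom_closed[OF t\<alpha> m(1)] module_hom_closed[OF t\<beta> m(2)] module_hom_closed[OF t\<gamma> m(3)]
      by (simp add: \<rho>'_def module_hom_add[OF \<rho>])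
  qed
  have C1: "carrier (Md cone 1) = carrier (XY.Tot 2) \<times> (carrier (SY.Tot 1) \<times> carrier (XT.Tot 1))"
    unfolding cone_Md by (simp add: star_Md_pos)
  have bh: "bd cone 1 \<in> module_hom R (Md cone 1) (Md cone 0)" using chain_complex_hom[OF cone_chain_complex, of 1] by simp
  have B_eq: "boundaries cone 0 = bd cone 1 ` carrier (Md cone 1)" by (simp add: boundaries_def)
  \<comment> \<open>The ideal of \<open>R\<close> that corresponds to the boundaries in degree zero; it turns out to be \<open>K\<close>.\<close>
  let ?Q = "\<rho>' ` boundaries cone 0"
  have BS: "submodule (boundaries cone 0) R (Md cone 0)"
    unfolding B_eq by (rule submodule_image[OF bh Cm Cm submodule_carrier[OF Cm]])
  have QI: "ideal ?Q R"
    by (rule submodule_ideal[OF XY.cring submodule_image[OF \<rho>' Cm RR BS]])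
  have Qmem: "?h\<alpha> a \<oplus>\<^bsub>R\<^esub> (?h\<beta> b \<oplus>\<^bsub>R\<^esub> ?h\<gamma> c) \<in> ?Q"
    if a: "a \<in> carrier (tensor_module R (Md X 1) (Md Y 1))" and b: "b \<in> carrier (tensor_module R (Md S 1) (Md Y 0))"
      and c: "c \<in> carrier (tensor_module R (Md X 0) (Md T 1))" for a b c
  proof -
    let ?d = "dsum_inj (bigraded_tensor R (trunc1 X) (trunc1 Y)) (1, 1) a"
    let ?u = "dsum_inj (bigraded_tensor R (trunc1 S) Y) (1, 0) b"
    let ?v = "dsum_inj (bigraded_tensor R X (trunc1 T)) (0, 1) c"
    have d: "?d \<in> carrier (XY.Tot 2)" by (rule XY.inj_closed) (use a in \<open>simp_all add: trunc1_1\<close>)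
    have u: "?u \<in> carrier (SY.Tot 1)" by (rule SY.inj_closed) (use b in \<open>simp_all add: trunc1_1\<close>)
    have v: "?v \<in> carrier (XT.Tot 1)" by (rule XT.inj_closed) (use c in \<open>simp_all add: trunc1_1\<close>)
    have "(?d, (?u, ?v)) \<in> carrier (Md cone 1)" unfolding C1 using d u v by blast
    then have "\<rho>' (bd cone 1 (?d, (?u, ?v))) \<in> ?Q" unfolding B_eq by blast
    then show ?thesis using bdv[OF d u v] by simp
  qed
  have Th: "module R (tensor_module R (Md X 1) (Md Y 1))" "module R (tensor_module R (Md S 1) (Md Y 0))"
    "module R (tensor_module R (Md X 0) (Md T 1))"
    by (rule module_tensor[OF Xm Ym] module_tensor[OF Sm Ym] module_tensor[OF Xm Tm])+
  have zc: "\<zero>\<^bsub>tensor_module R (Md X 1) (Md Y 1)\<^esub> \<in> carrier (tensor_module R (Md X 1) (Md Y 1))"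
    "\<zero>\<^bsub>tensor_module R (Md S 1) (Md Y 0)\<^esub> \<in> carrier (tensor_module R (Md S 1) (Md Y 0))"
    "\<zero>\<^bsub>tensor_module R (Md X 0) (Md T 1)\<^esub> \<in> carrier (tensor_module R (Md X 0) (Md T 1))"
    using submodule_zero[OF submodule_carrier] Th by blast+
  have hz: "?h\<alpha> \<zero>\<^bsub>tensor_module R (Md X 1) (Md Y 1)\<^esub> = \<zero>\<^bsub>R\<^esub>" "?h\<beta> \<zero>\<^bsub>tensor_module R (Md S 1) (Md Y 0)\<^esub> = \<zero>\<^bsub>R\<^esub>"
    "?h\<gamma> \<zero>\<^bsub>tensor_module R (Md X 0) (Md T 1)\<^esub> = \<zero>\<^bsub>R\<^esub>"
    using module_hom_zero[OF h\<alpha> Th(1) RR] module_hom_zero[OF h\<beta> Th(2) RR] module_hom_zero[OF h\<gamma> Th(3) RR] by simp_all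
  have "I' \<subseteq> ?Q"
  proof
    fix a assume a: "a \<in> I'"
    then obtain s where s: "s \<in> carrier (Md S 1)" "gX (e1 (bd S 1 s)) = a" using IS(2) by auto
    have "?h\<beta> (pure_tensor R (Md S 1) (Md Y 0) s (eY \<one>\<^bsub>R\<^esub>)) = a"
      using p\<beta>[OF s(1) eY1] s(2) geY a sub(1) by auto
    then show "a \<in> ?Q"
      using Qmem[OF zc(1) pure_tensor_closed[OF Sm Ym s(1) eY1] zc(3)] hz a sub(1) by auto
  qed
  moreover have "J' \<subseteq> ?Q"
  proof
    fix a assume a: "a \<in> J'"
    then obtain t where t: "t \<in> carrier (Md T 1)" "gY (e2 (bd T 1 t)) = a" using JT(2) by auto
    have "?h\<gamma> (pure_tensor R (Md X 0) (Md T 1) (eX \<one>\<^bsub>R\<^esub>) t) = a"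
      using p\<gamma>[OF eX1 t(1)] t(2) geX a sub(2) by auto
    then show "a \<in> ?Q"
      using Qmem[OF zc(1,2) pure_tensor_closed[OF Xm Tm eX1 t(1)]] hz a sub(2) by auto
  qed
  moreover have "ideal_prod R I J \<subseteq> ?Q"
  proof
    fix r assume "r \<in> ideal_prod R I J"
    then show "r \<in> ?Q"
    proof (induction r rule: ideal_prod.induct)
      case (prod a b)
      obtain x where x: "x \<in> carrier (Md X 1)" "gX (bd X 1 x) = a" using IX(2)[OF prod(1)] by auto
      obtain y where y: "y \<in> carrier (Md Y 1)" "gY (bd Y 1 y) = b" using JY(2)[OF prod(2)] by auto
      have "a \<otimes>\<^bsub>R\<^esub> b \<in> carrier R" using sub(3) ideal_prod.prod[OF prod, of R] by blast
      then show ?case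
        using Qmem[OF pure_tensor_closed[OF Xm Ym x(1) y(1)] zc(2,3)] hz p\<alpha>[OF x(1) y(1)] x(2) y(2) by simp
    next
      case (sum s t)
      show ?case by (rule additive_subgroup.a_closed[OF ideal.axioms(1)[OF QI] sum.IH])
    qed
  qed
  ultimately have KQ: "K \<subseteq> ?Q"
    unfolding K_def by (intro genideal_minimal[OF QI]) auto
  have QK: "?Q \<subseteq> K"
  proof
    fix r assume "r \<in> ?Q"
    then obtain d u v where d: "d \<in> carrier (XY.Tot 2)" and u: "u \<in> carrier (SY.Tot 1)" and v: "v \<in> carrier (XT.Tot 1)"
      and r: "r = \<rho>' (bd cone 1 (d, (u, v)))"
      unfolding B_eq C1 by blast
    show "r \<in> K"
      unfolding r bdv[OF d u v]
      by (intro additive_subgroup.a_closed[OF ideal.axioms(1)[OF KI]] K\<alpha> K\<beta> K\<gamma> mems[OF d u v])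
  qed
  let ?\<epsilon> = "\<lambda>z. K +>\<^bsub>R\<^esub> \<rho>' z"
  have \<rho>'c: "\<rho>' z \<in> carrier R" if "z \<in> carrier (Md cone 0)" for z
    using module_hom_closed[OF \<rho>' that] by simp
  have "augmented_free_resolution R cone ?\<epsilon> (cyclic_module R K)"
    unfolding augmented_free_resolution_def
  proof (intro conjI allI impI)
    show "chain_complex R cone" by (rule cone_chain_complex)
    show "free_module R (Md cone n)" for n by (rule cone_free)
    show "carrier (Md cone n) = {\<zero>\<^bsub>Md cone n\<^esub>}" if "n < 0" for n by (rule cone_neg[OF that])
    show "cycles cone n = boundaries cone n" if "1 \<le> n" for n by (rule cone_exact[OF that])
    show "?\<epsilon> \<in> module_hom R (Md cone 0) (cyclic_module R K)"
      by (rule module_hom_comp[OF \<rho>' cyclic_proj_hom[OF XY.cring KI]])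
    have "\<rho>' ` carrier (Md cone 0) = carrier R" using \<rho>'c \<rho>'_surj by (auto simp: image_iff) metis
    then show "?\<epsilon> ` carrier (Md cone 0) = carrier (cyclic_module R K)"
      unfolding cyclic_carrier[OF XY.cring KI] by (metis image_image)
    have "?\<epsilon> z = \<zero>\<^bsub>cyclic_module R K\<^esub> \<longleftrightarrow> z \<in> boundaries cone 0" if z: "z \<in> carrier (Md cone 0)" for z
    proof -
      have "?\<epsilon> z = \<zero>\<^bsub>cyclic_module R K\<^esub> \<longleftrightarrow> \<rho>' z \<in> K"
        unfolding cyclic_zero[OF XY.cring KI] by (rule cyclic_coset_eq_zero[OF XY.cring KI \<rho>'c[OF z]])
      also have "\<dots> \<longleftrightarrow> \<rho>' z \<in> ?Q" using KQ QK by blast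
      also have "\<dots> \<longleftrightarrow> z \<in> boundaries cone 0"
        using \<rho>'_inj[OF z submodule_subset[OF BS]] by blast
      finally show ?thesis .
    qed
    then show "{z \<in> carrier (Md cone 0). ?\<epsilon> z = \<zero>\<^bsub>cyclic_module R K\<^esub>} = boundaries cone 0"
      using submodule_subset[OF BS] by blast
  qed
  then show ?thesis by blast
qed

end

theorem theorem4p8:
  fixes R :: "('a, 'r) ring_scheme"
    and X :: "('a, 'x) cplx" and Y :: "('a, 'y) cplx"
    and S :: "('a, 's) cplx" and T :: "('a, 't) cplx"
    and e\<^sub>X :: "'a \<Rightarrow> 'x" and e\<^sub>Y :: "'a \<Rightarrow> 'y"
    and e\<^sub>S :: "'a \<Rightarrow> 's" and e\<^sub>T :: "'a \<Rightarrow> 't"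
    and \<phi> :: "int \<Rightarrow> 's \<Rightarrow> 'x" and \<psi> :: "int \<Rightarrow> 't \<Rightarrow> 'y"
  assumes "cring R" and "noetherian_ring R"
    and "local_ring R \<or> standard_graded R"
    and "ideal I R" and "ideal J R" and "ideal I' R" and "ideal J' R"
    and "I' \<subseteq> I" and "J' \<subseteq> J"
    and "Tor_independent R I J" and "Tor_independent R I' J" and "Tor_independent R I J'"
    and "cyclic_resolution R I X e\<^sub>X" and "cyclic_resolution R J Y e\<^sub>Y"
    and "cyclic_resolution R I' S e\<^sub>S" and "cyclic_resolution R J' T e\<^sub>T"
    and "chain_map R S X \<phi>" and "\<forall>r\<in>carrier R. \<phi> 0 (e\<^sub>S r) = e\<^sub>X r"
    and "chain_map R T Y \<psi>" and "\<forall>r\<in>carrier R. \<psi> 0 (e\<^sub>T r) = e\<^sub>Y r"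
  defines "\<Phi> \<equiv> Phi R S X Y \<phi> (e\<^sub>X \<circ> inv_into (carrier R) e\<^sub>S)"
    and "\<Psi> \<equiv> Psi R T X Y \<psi> (e\<^sub>Y \<circ> inv_into (carrier R) e\<^sub>T)"
  defines "\<Omega> \<equiv> Omega R X Y \<Phi> \<Psi>"
  shows "free_resolution R (mapping_cone (Omega_source R S T X Y) (star_product R X Y) \<Omega>)
           (cyclic_module R (genideal R (I' \<union> (ideal_prod R I J) \<union> J')))"
proof -
  note R = \<open>cring R\<close> and N = \<open>noetherian_ring R\<close>
  note I = \<open>ideal I R\<close> and J = \<open>ideal J R\<close> and I' = \<open>ideal I' R\<close> and J' = \<open>ideal J' R\<close>
  note X = cyclic_resolutionD[OF R I \<open>cyclic_resolution R I X e\<^sub>X\<close>]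
    and Y = cyclic_resolutionD[OF R J \<open>cyclic_resolution R J Y e\<^sub>Y\<close>]
    and S = cyclic_resolutionD[OF R I' \<open>cyclic_resolution R I' S e\<^sub>S\<close>]
    and T = cyclic_resolutionD[OF R J' \<open>cyclic_resolution R J' T e\<^sub>T\<close>]
  let ?e1 = "e\<^sub>X \<circ> inv_into (carrier R) e\<^sub>S" and ?e2 = "e\<^sub>Y \<circ> inv_into (carrier R) e\<^sub>T"
  let ?\<phi>' = "\<lambda>x. e\<^sub>S (inv_into (carrier R) e\<^sub>X x)" and ?\<psi>' = "\<lambda>y. e\<^sub>T (inv_into (carrier R) e\<^sub>Y y)"
  have gS: "a \<in> carrier (Md S 0) \<Longrightarrow> inv_into (carrier R) e\<^sub>S a \<in> carrier R" for a
    using module_hom_closed[OF S(3)] by simp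
  have gT: "a \<in> carrier (Md T 0) \<Longrightarrow> inv_into (carrier R) e\<^sub>T a \<in> carrier R" for a
    using module_hom_closed[OF T(3)] by simp
  have e1: "?e1 a = \<phi> 0 a" if "a \<in> carrier (Md S 0)" for a
    using \<open>\<forall>r\<in>carrier R. \<phi> 0 (e\<^sub>S r) = e\<^sub>X r\<close> gS[OF that] S(4)[OF that] by (metis comp_apply)
  have e2: "?e2 a = \<psi> 0 a" if "a \<in> carrier (Md T 0)" for a
    using \<open>\<forall>r\<in>carrier R. \<psi> 0 (e\<^sub>T r) = e\<^sub>Y r\<close> gT[OF that] T(4)[OF that] by (metis comp_apply)
  note CI = module_cyclic[OF R I] and CJ = module_cyclic[OF R J] and CJ' = module_cyclic[OF R J']
  have bS: "bd S 1 s \<in> carrier (Md S 0)" if "s \<in> carrier (Md S 1)" for s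
    using module_hom_closed[OF chain_complex_hom[OF afr_chain[OF S(1)]] that] by simp
  have bT: "bd T 1 t \<in> carrier (Md T 0)" if "t \<in> carrier (Md T 1)" for t
    using module_hom_closed[OF chain_complex_hom[OF afr_chain[OF T(1)]] that] by simp
  have IS: "inv_into (carrier R) e\<^sub>X (?e1 (bd S 1 s)) = inv_into (carrier R) e\<^sub>S (bd S 1 s)"
    if "s \<in> carrier (Md S 1)" for s
    using X(5)[OF gS[OF bS[OF that]]] by simp
  have JT: "inv_into (carrier R) e\<^sub>Y (?e2 (bd T 1 t)) = inv_into (carrier R) e\<^sub>T (bd T 1 t)"
    if "t \<in> carrier (Md T 1)" for t
    using Y(5)[OF gT[OF bT[OF that]]] by simp
  have "star_setup R X Y S T \<phi> \<psi> ?e1 ?e2"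
    by (intro star_setup.intro afr_chain[OF X(1)] afr_chain[OF Y(1)] afr_chain[OF S(1)] afr_chain[OF T(1)]
        afr_neg[OF X(1)] afr_neg[OF Y(1)] e1 e2 \<open>chain_map R S X \<phi>\<close> \<open>chain_map R T Y \<psi>\<close>)
  moreover have "star_exact_axioms R X Y S T \<phi> \<psi> ?\<phi>' ?\<psi>'"
  proof (intro star_exact_axioms.intro afr_free[OF X(1)] afr_free[OF Y(1)] afr_free[OF S(1)] afr_free[OF T(1)]
      afr_exact[OF X(1)] afr_exact[OF Y(1)] module_hom_comp[OF X(3) S(2)] module_hom_comp[OF Y(3) T(2)])
    show "?\<phi>' (\<phi> 0 a) = a" if "a \<in> carrier (Md S 0)" for a
      using e1[OF that, symmetric] X(5)[OF gS[OF that]] S(4)[OF that] by simp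
    show "?\<psi>' (\<psi> 0 a) = a" if "a \<in> carrier (Md T 0)" for a
      using e2[OF that, symmetric] Y(5)[OF gT[OF that]] T(4)[OF that] by simp
  qed (assumption | (rule tensor_acyclic_edge[OF afr_chain[OF X(1)] afr_free[OF X(1)] Y(1) CJ
          Tor_independent_imp_tensor_acyclic[OF R N I J \<open>Tor_independent R I J\<close> X(1) Y(1)]]
        tensor_acyclic_edge[OF afr_chain[OF S(1)] afr_free[OF S(1)] Y(1) CJ
          Tor_independent_imp_tensor_acyclic[OF R N I' J \<open>Tor_independent R I' J\<close> S(1) Y(1)]]
        tensor_acyclic_left_edge[OF X(1) T(1) CJ'
          Tor_independent_imp_tensor_acyclic[OF R N I J' \<open>Tor_independent R I J'\<close> X(1) T(1)]]; assumption))+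
  ultimately interpret Q: star_exact R X Y S T \<phi> \<psi> ?e1 ?e2 ?\<phi>' ?\<psi>'
    by (rule star_exact.intro)
  have "\<exists>\<epsilon>. augmented_free_resolution R Q.cone \<epsilon> (cyclic_module R (genideal R (I' \<union> (ideal_prod R I J) \<union> J')))"
  proof (rule Q.cone_augmentation[OF I J I' J' X(3) Y(3) X(2) Y(2) X(4) Y(4) X(5) Y(5) X(6,7) Y(6,7)])
    show "inv_into (carrier R) e\<^sub>X (?e1 (bd S 1 s)) \<in> I'" if "s \<in> carrier (Md S 1)" for s
      using IS[OF that] S(6)[OF that] by simp
    show "\<exists>s\<in>carrier (Md S 1). inv_into (carrier R) e\<^sub>X (?e1 (bd S 1 s)) = a" if "a \<in> I'" for a
      using S(7)[OF that] IS by auto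
    show "inv_into (carrier R) e\<^sub>Y (?e2 (bd T 1 t)) \<in> J'" if "t \<in> carrier (Md T 1)" for t
      using JT[OF that] T(6)[OF that] by simp
    show "\<exists>t\<in>carrier (Md T 1). inv_into (carrier R) e\<^sub>Y (?e2 (bd T 1 t)) = a" if "a \<in> J'" for a
      using T(7)[OF that] JT by auto
  qed
  then show ?thesis unfolding free_resolution_def \<Omega>_def \<Phi>_def \<Psi>_def .
qed

end
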